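(* Let $p_0$ be supported in $\{|x|_\infty\le1\}$ and let $w$ be measurable with $0<w\le\bar B<\infty$ on $\mathrm{supp}(p_0)$ and $\mathbb E_{p_0}[w^{-\mathrm s}]<\infty$ for some $\mathrm s\in(0,\infty]$ ($\mathrm s=\infty$ meaning $w\ge B>0$ on $\mathrm{supp}(p_0)$). Let $\mathcal H_N$ be a class of functions on $I\times\mathbb R^d$ and $\Psi_N\subset\mathcal V$ a class carrying a symmetric, positively homogeneous scale $\|\cdot\|_\bullet$, such that: (S1) $\psi\in\Psi_N$ implies $-\psi\in\Psi_N$ and $r\psi\in\Psi_N$ for all $r\ge0$; (S2) $\omega\cdot(\mathcal H_N-\mathcal H_N)\subseteq\Psi_N$; every $h\in\mathcal H_N$ is $C^{1,2}$ on $I\times\mathbb R^d$ with $|h|\le3\bar B$ and bounded $\partial_th,\nabla h,\nabla^2h$; and $\|\omega(h-h')\|_\bullet\le C_0$ for all $h,h'\in\mathcal H_N$. Suppose $h_N\in\mathcal H_N$ and $e_N>0$ satisfy $$\|h_N-h^*\|_{L^4(\nu\otimes\rho)}+\sup_{t\in I}\|h_N(t,\cdot)-h^*(t,\cdot)\|_{L^2(\rho_t)}+\||\nabla(h_N-h^* )|\|_{L^4(\nu\otimes\rho)}+\|\partial_t(h_N-h^* )\|_{L^2(\nu\otimes\rho)}\le e_N .$$ Then for every $h\in\mathcal H_N$, $\tau\ge0$ and $\delta\in(0,1)$, with $\varphi:=h-h^*$ and $I_\delta:=[t_0,t_1-\delta\ell]$, $$\int_{I_\delta}\|\nabla\varphi\|^2_{L^2(\rho_t)}\,\nu(dt)\le\frac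 C\delta\Big(\frac{1+\ell}{\ell}\,\mathcal D(h)+\mathcal N_{\Psi_N,\tau}(h)^2+C_0^2\tau^2+(1+\Lambda_*^2+\ell^{-2})\,e_N^2\Big),$$ where $C$ is an absolute constant. Moreover, for the concrete network classes $\mathcal H_N,\Psi_N$ (with cone scale $\|\cdot\|_\bullet$) described in the context, every $h\in\mathcal H_N$ is $C^{1,2}$ on $I\times\mathbb R^d$ with $|h|\le3\bar B$ and bounded $\partial_th,\nabla h,\nabla^2h$, and $\|\omega(h-h')\|_\bullet\le C_0$ holds for all $h,h'\in\mathcal H_N$ with $C_0=1$.
   Context: **Setting.** $d\ge1$, $T>0$. $p_0$ is a probability distribution on $\mathbb R^d$; $dX_\tau=-X_\tau d\tau+\sqrt2\,dB_\tau$, $X_0\sim p_0$, so $X_\tau\mid X_0=x_0\sim\mathcal N(\mu_\tau x_0,\sigma_\tau^2I_d)$ with $\mu_\tau=e^{-\tau}$, $\sigma_\tau^2=1-e^{-2\tau}$; $p_\tau$ is the law/density of $X_\tau$; $\rho_t:=p_{T-t}$; $s(t,x):=\nabla\log p_{T-t}(x)$; $h^*(t,x):=\mathbb E[w(X_0)\mid X_{T-t}=x]$. Window: $I=[t_0,t_1]\subset(0,T)$, $\ell=t_1-t_0\le1$, $\sigma_*:=\sigma_{T-t_1}>0$, $\nu$ normalized Lebesgue measure on $I$, $\omega(t):=(t_1-t)/\ell$. $\|f\|^p_{L^p(\nu\otimes\rho)}=\int_I\int|f|^p\rho_t\,dx\,\nu(dt)$. $\mathcal V:=L^2_\nu(I;H^1(\rho_t))$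 with $\|\psi\|^2_{\mathcal V}=\int_I(\|\psi\|^2_{L^2(\rho_t)}+\|\nabla\psi\|^2_{L^2(\rho_t)})\nu(dt)$. **Functionals.** $\mathcal D(h):=\int_I\|h(t,\cdot)-h^*(t,\cdot)\|^2_{L^2(\rho_t)}\nu(dt)$; $$a_t(h,\psi):=\int_{\mathbb R^d}\big[\partial_th\,\psi+((x+s)\cdot\nabla h)\psi-\nabla h\cdot\nabla\psi\big]\rho_t\,dx,\qquad A(h,\psi):=\int_Ia_t(h,\psi(t,\cdot))\,\nu(dt);$$ $$\|\psi\|^2_{\mathcal V,\tau}:=\|\psi\|^2_{\mathcal V}+\tau^2\|\psi\|_\bullet^2,\qquad \mathcal N_{\Psi,\tau}(h):=\sup_{0\ne\psi\in\Psi}\frac{A(h,\psi)}{\|\psi\|_{\mathcal V,\tau}};$$ $$\Lambda_*:=\sup_{t\in I}\big(\||x+s|\|_{L^4(\rho_t)}+\|d+\nabla\cdot s\|_{L^4(\rho_t)}+\||x+s||s|\|_{L^4(\rho_t)}+\|\partial_t\log\rho_t\|_{L^4(\rho_t)}\big).$$ **Concrete network classes (last sentence of the claim).** $\varrho(u)=(u\vee0)^3$; $Q_R=\{|x|_\infty\le R\}$, $R>1$; $Z=I\times Q_R$. $\mathcal{NN}_\varrho(W,L,\Lambda,P_0,\mathcal A)$ is the set of $f_\vartheta(z)=A_Lx^{(L)}(z)+b_L$ with $x^{(0)}(z)=z=(t,x)$, $x^{(j+1)}(z)=\varrho(A_jx^{(j)}(z)+b_j)$ ($0\le j\le L-1$),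 with hidden widths at most $W$, parameters bounded in modulus by $\Lambda$, at most $P_0$ of them nonzero, and $\sup_{z\in Z}\|x^{(j)}(z)\|_\infty\le\mathcal A$ for every hidden layer. $\mathcal{NN}_{\varrho,\Theta}$ is the same class with $\Theta$ as activation of the last hidden layer. $\Theta\in C^\infty(\mathbb R,[-2\bar B,3\bar B])$ is a fixed 1-Lipschitz map, the identity on $[-\bar B,2\bar B]$, with bounded second derivative. $\chi_R:\mathbb R^d\to\mathbb R^d$ is a fixed smooth coordinatewise clip, in each coordinate the identity on $[-(R-1),R-1]$, of modulus at most $R$, derivative at most $1$ in modulus, bounded second derivative; $f^\chi(t,x):=f(t,\chi_R(x))$. $G:=4\sqrt d\,\bar B\sigma_*^{-2}$, $G_t:=C_td\bar B(R+1)\sigma_*^{-4}$ ($C_t$ an absolute constant), $\Gamma:=6\bar B+2G+2G_t+6\bar B/\ell$. For a resolution $N$, a time degree $K$, width $W_N\asymp KN^d$, $W_N\ge d+1$, and budgets $L,\Lambda,P_0,\mathcal A$ ($\Lambda,\mathcal A\ge1$), $$\mathcal H_N:=\{h=(\Theta\circ g)^\chi:\ g\in\mathcal{NN}_\varrho(W_N,L,\Lambda,P_0,\mathcal A),\ \sup_{I\times\mathbb R^d}|\nabla h|\le G,\ \sup_{I\times\mathbb R^d}|\partial_th|\le G_t\},$$ $$\Psi_N:=\{c\,\omega\,\phi^\chi:\ c\in\mathbb R,\ \phi\in\mathcal{NN}_{\varrho,\Theta}(2W_N,L+1,\Lambda,2P_0+2,\mathcal A\vee3\bar B),\ \sup_{I\times\mathbb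 R^d}(|\phi^\chi|+|\nabla\phi^\chi|+|\partial_t\phi^\chi|)\le\Gamma\},$$ $\|\psi\|_\bullet:=\inf\{|c|:\psi=c\,\omega\,\phi^\chi\text{ as in the definition of }\Psi_N\}$. *)

theory Defs
  imports "HOL-Probability.Probability"
begin

text \<open>
  The constant of the theorem is absolute, in particular independent of the dimension \<open>d\<close>, so \<open>d\<close>
  has to be quantified inside the formula.  Therefore \<open>\<real>\<^sup>d\<close> is not a Euclidean type but the carrier of
  the product measure space over the index set \<open>{..<d}\<close>.  Functions on \<open>I \<times> \<real>\<^sup>d\<close> are curried total
  functions, and only their values on \<open>I \<times> \<real>\<^sup>d\<close> are ever constrained.
\<close>

type_synonym pt = "nat \<Rightarrow> real"
type_synonym tfun = "real \<Rightarrow> pt \<Rightarrow> real"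

section \<open>Calculus on \<open>\<real>\<^sup>d\<close>\<close>

definition Rd :: "nat \<Rightarrow> pt set" where
  "Rd d = PiE {..<d} (\<lambda>_. UNIV)"

definition leb :: "nat \<Rightarrow> pt measure" where
  "leb d = Pi\<^sub>M {..<d} (\<lambda>_. lborel)"

definition enorm :: "nat \<Rightarrow> pt \<Rightarrow> real" where
  "enorm d x = L2_set x {..<d}"

definition pd :: "nat \<Rightarrow> (pt \<Rightarrow> real) \<Rightarrow> pt \<Rightarrow> real" where
  "pd i f x = deriv (\<lambda>y. f (x(i := y))) (x i)"

definition grad :: "(pt \<Rightarrow> real) \<Rightarrow> pt \<Rightarrow> pt" where
  "grad f x = (\<lambda>i. pd i f x)"

definition pd_exists :: "nat \<Rightarrow> (pt \<Rightarrow> real) \<Rightarrow> pt \<Rightarrow> bool" where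
  "pd_exists i f x \<longleftrightarrow> (\<lambda>y. f (x(i := y))) differentiable (at (x i))"

text \<open>The time derivative is one-sided at the two end points of the window \<open>I\<close>.\<close>

definition dt :: "real set \<Rightarrow> tfun \<Rightarrow> tfun" where
  "dt I f t x = vector_derivative (\<lambda>r. f r x) (at t within I)"

definition C12 :: "nat \<Rightarrow> real set \<Rightarrow> tfun \<Rightarrow> bool" where
  "C12 d I f \<longleftrightarrow>
     continuous_on (I \<times> Rd d) (\<lambda>(t, x). f t x) \<and>
     (\<forall>t\<in>I. \<forall>x\<in>Rd d. (\<lambda>r. f r x) differentiable (at t within I)) \<and>
     continuous_on (I \<times> Rd d) (\<lambda>(t, x). dt I f t x) \<and>
     (\<forall>i<d. (\<forall>t\<in>I. \<forall>x\<in>Rd d. pd_exists i (f t) x) \<and>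
            continuous_on (I \<times> Rd d) (\<lambda>(t, x). pd i (f t) x)) \<and>
     (\<forall>i<d. \<forall>j<d. (\<forall>t\<in>I. \<forall>x\<in>Rd d. pd_exists i (pd j (f t)) x) \<and>
            continuous_on (I \<times> Rd d) (\<lambda>(t, x). pd i (pd j (f t)) x))"

definition bounded_C12 :: "nat \<Rightarrow> real set \<Rightarrow> real \<Rightarrow> tfun \<Rightarrow> bool" where
  "bounded_C12 d I b f \<longleftrightarrow>
     C12 d I f \<and>
     (\<forall>t\<in>I. \<forall>x\<in>Rd d. \<bar>f t x\<bar> \<le> b) \<and>
     (\<exists>M. \<forall>t\<in>I. \<forall>x\<in>Rd d. \<bar>dt I f t x\<bar> \<le> M) \<and>
     (\<exists>M. \<forall>t\<in>I. \<forall>x\<in>Rd d. enorm d (grad (f t) x) \<le> M) \<and>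
     (\<exists>M. \<forall>t\<in>I. \<forall>x\<in>Rd d. \<forall>i<d. \<forall>j<d. \<bar>pd i (pd j (f t)) x\<bar> \<le> M)"

text \<open>\<open>C\<^sub>c\<^sup>\<infinity>(\<real>\<^sup>d)\<close> and weak gradients.\<close>

definition test_fun :: "nat \<Rightarrow> (pt \<Rightarrow> real) \<Rightarrow> bool" where
  "test_fun d \<eta> \<longleftrightarrow>
     (\<forall>is. set is \<subseteq> {..<d} \<longrightarrow>
        continuous_on (Rd d) (foldr pd is \<eta>) \<and>
        (\<forall>i<d. \<forall>x\<in>Rd d. pd_exists i (foldr pd is \<eta>) x)) \<and>
     (\<exists>M. \<forall>x\<in>Rd d. \<eta> x \<noteq> 0 \<longrightarrow> (\<forall>i<d. \<bar>x i\<bar> \<le> M))"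

definition weak_grad :: "nat \<Rightarrow> (pt \<Rightarrow> real) \<Rightarrow> (pt \<Rightarrow> pt) \<Rightarrow> bool" where
  "weak_grad d f g \<longleftrightarrow>
     (\<forall>\<eta> i. test_fun d \<eta> \<longrightarrow> i < d \<longrightarrow>
        integrable (leb d) (\<lambda>x. f x * pd i \<eta> x) \<and>
        integrable (leb d) (\<lambda>x. g x i * \<eta> x) \<and>
        (\<integral>x. f x * pd i \<eta> x \<partial>leb d) = - (\<integral>x. g x i * \<eta> x \<partial>leb d))"

text \<open>\<open>L\<^sup>p\<close> norms take values in \<open>[0,\<infinity>]\<close>, so that an infinite norm is not confused with a small one.\<close>

definition eroot :: "nat \<Rightarrow> ennreal \<Rightarrow> ennreal" where
  "eroot p a = (if a = \<infinity> then \<infinity> else ennreal (root p (enn2real a)))"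

definition Lnorm :: "nat \<Rightarrow> 'a measure \<Rightarrow> ('a \<Rightarrow> real) \<Rightarrow> ennreal" where
  "Lnorm p M f = eroot p (\<integral>\<^sup>+x. ennreal (\<bar>f x\<bar> ^ p) \<partial>M)"

section \<open>The Ornstein-Uhlenbeck flow\<close>

definition msupp :: "nat \<Rightarrow> pt measure \<Rightarrow> pt set" where
  "msupp d p0 = {x \<in> Rd d. \<forall>r>0. emeasure p0 {y \<in> Rd d. enorm d (\<lambda>i. y i - x i) < r} > 0}"

definition neg_moment :: "nat \<Rightarrow> pt measure \<Rightarrow> (pt \<Rightarrow> real) \<Rightarrow> ereal \<Rightarrow> bool" where
  "neg_moment d p0 w s \<longleftrightarrow>
     (if s = \<infinity> then \<exists>B>0. \<forall>x\<in>msupp d p0. B \<le> w x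
      else (\<integral>\<^sup>+x. ennreal (w x powr (- real_of_ereal s)) \<partial>p0) < \<infinity>)"

definition mu_ou :: "real \<Rightarrow> real" where "mu_ou \<tau> = exp (- \<tau>)"
definition sigma_ou :: "real \<Rightarrow> real" where "sigma_ou \<tau> = sqrt (1 - exp (- 2 * \<tau>))"

text \<open>The Lebesgue density of \<open>N(\<mu>\<^sub>\<tau> x\<^sub>0, \<sigma>\<^sub>\<tau>\<^sup>2 I\<^sub>d)\<close>, i.e. of the law of \<open>X\<^sub>\<tau>\<close> given \<open>X\<^sub>0 = x\<^sub>0\<close>.\<close>

definition ou_kernel :: "nat \<Rightarrow> real \<Rightarrow> pt \<Rightarrow> pt \<Rightarrow> real" where
  "ou_kernel d \<tau> x0 x = (\<Prod>i<d. normal_density (mu_ou \<tau> * x0 i) (sigma_ou \<tau>) (x i))"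

definition ou_joint :: "nat \<Rightarrow> pt measure \<Rightarrow> real \<Rightarrow> (pt \<times> pt) measure" where
  "ou_joint d p0 \<tau> = density (p0 \<Otimes>\<^sub>M leb d) (\<lambda>(x0, x). ennreal (ou_kernel d \<tau> x0 x))"

definition ou_dens :: "nat \<Rightarrow> pt measure \<Rightarrow> real \<Rightarrow> pt \<Rightarrow> real" where
  "ou_dens d p0 \<tau> x = (\<integral>x0. ou_kernel d \<tau> x0 x \<partial>p0)"

definition rho_dens :: "nat \<Rightarrow> pt measure \<Rightarrow> real \<Rightarrow> tfun" where
  "rho_dens d p0 T t x = ou_dens d p0 (T - t) x"

definition rho :: "nat \<Rightarrow> pt measure \<Rightarrow> real \<Rightarrow> real \<Rightarrow> pt measure" where
  "rho d p0 T t = density (leb d) (\<lambda>x. ennreal (rho_dens d p0 T t x))"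

definition score :: "nat \<Rightarrow> pt measure \<Rightarrow> real \<Rightarrow> real \<Rightarrow> pt \<Rightarrow> pt" where
  "score d p0 T t = grad (\<lambda>x. ln (rho_dens d p0 T t x))"

text \<open>
  The regular version of \<open>E[w(X\<^sub>0) | X\<^sub>\<tau> = x]\<close>: the integral of \<open>w\<close> against the posterior of \<open>X\<^sub>0\<close>.
  It is needed at every \<open>x\<close> because it gets differentiated; \<open>post_mean_cond_exp\<close> below
  identifies it with the conditional expectation.
\<close>

definition post_mean :: "nat \<Rightarrow> pt measure \<Rightarrow> (pt \<Rightarrow> real) \<Rightarrow> real \<Rightarrow> pt \<Rightarrow> real" where
  "post_mean d p0 w \<tau> x = (\<integral>x0. w x0 * ou_kernel d \<tau> x0 x \<partial>p0) / ou_dens d p0 \<tau> x"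

definition hstar :: "nat \<Rightarrow> pt measure \<Rightarrow> (pt \<Rightarrow> real) \<Rightarrow> real \<Rightarrow> tfun" where
  "hstar d p0 w T t x = post_mean d p0 w (T - t) x"

definition setting ::
  "nat \<Rightarrow> real \<Rightarrow> pt measure \<Rightarrow> (pt \<Rightarrow> real) \<Rightarrow> real \<Rightarrow> ereal \<Rightarrow> real \<Rightarrow> real \<Rightarrow> bool" where
  "setting d T p0 w Bbar s t0 t1 \<longleftrightarrow>
     1 \<le> d \<and> 0 < T \<and> 0 < t0 \<and> t0 < t1 \<and> t1 < T \<and> t1 - t0 \<le> 1 \<and>
     prob_space p0 \<and> sets p0 = sets (leb d) \<and>
     (\<forall>x\<in>msupp d p0. \<forall>i<d. \<bar>x i\<bar> \<le> 1) \<and>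
     w \<in> borel_measurable (leb d) \<and> (\<forall>x\<in>msupp d p0. 0 < w x \<and> w x \<le> Bbar) \<and>
     0 < s \<and> neg_moment d p0 w s"

section \<open>Functionals\<close>

definition nu :: "real \<Rightarrow> real \<Rightarrow> real measure" where
  "nu t0 t1 = uniform_measure (restrict_space lborel {t0..t1}) {t0..t1}"

definition omega :: "real \<Rightarrow> real \<Rightarrow> real \<Rightarrow> real" where
  "omega t0 t1 t = (t1 - t) / (t1 - t0)"

definition LnormI ::
  "nat \<Rightarrow> nat \<Rightarrow> pt measure \<Rightarrow> real \<Rightarrow> real \<Rightarrow> real \<Rightarrow> tfun \<Rightarrow> ennreal" where
  "LnormI p d p0 T t0 t1 f =
     eroot p (\<integral>\<^sup>+t. (\<integral>\<^sup>+x. ennreal (\<bar>f t x\<bar> ^ p) \<partial>rho d p0 T t) \<partial>nu t0 t1)"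

text \<open>
  \<open>\<V> = L\<^sup>2\<^sub>\<nu>(I; H\<^sup>1(\<rho>\<^sub>t))\<close>: \<open>G\<close> is a jointly measurable spatial weak gradient of \<open>\<psi>\<close>, unique up to null sets.
\<close>

definition is_V_grad ::
  "nat \<Rightarrow> pt measure \<Rightarrow> real \<Rightarrow> real \<Rightarrow> real \<Rightarrow> tfun \<Rightarrow> (real \<Rightarrow> pt \<Rightarrow> pt) \<Rightarrow> bool" where
  "is_V_grad d p0 T t0 t1 \<psi> G \<longleftrightarrow>
     (\<lambda>(t, x). \<psi> t x) \<in> borel_measurable (nu t0 t1 \<Otimes>\<^sub>M leb d) \<and>
     (\<forall>i<d. (\<lambda>(t, x). G t x i) \<in> borel_measurable (nu t0 t1 \<Otimes>\<^sub>M leb d)) \<and>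
     (AE t in nu t0 t1. weak_grad d (\<psi> t) (G t)) \<and>
     (\<integral>\<^sup>+t. (\<integral>\<^sup>+x. ennreal ((\<psi> t x)\<^sup>2) \<partial>rho d p0 T t)
          + (\<integral>\<^sup>+x. ennreal ((enorm d (G t x))\<^sup>2) \<partial>rho d p0 T t) \<partial>nu t0 t1) < \<infinity>"

definition V_space :: "nat \<Rightarrow> pt measure \<Rightarrow> real \<Rightarrow> real \<Rightarrow> real \<Rightarrow> tfun set" where
  "V_space d p0 T t0 t1 = {\<psi>. \<exists>G. is_V_grad d p0 T t0 t1 \<psi> G}"

definition V_grad ::
  "nat \<Rightarrow> pt measure \<Rightarrow> real \<Rightarrow> real \<Rightarrow> real \<Rightarrow> tfun \<Rightarrow> real \<Rightarrow> pt \<Rightarrow> pt" where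
  "V_grad d p0 T t0 t1 \<psi> = (SOME G. is_V_grad d p0 T t0 t1 \<psi> G)"

definition V_norm_sq :: "nat \<Rightarrow> pt measure \<Rightarrow> real \<Rightarrow> real \<Rightarrow> real \<Rightarrow> tfun \<Rightarrow> real" where
  "V_norm_sq d p0 T t0 t1 \<psi> =
     enn2real (\<integral>\<^sup>+t. (\<integral>\<^sup>+x. ennreal ((\<psi> t x)\<^sup>2) \<partial>rho d p0 T t)
       + (\<integral>\<^sup>+x. ennreal ((enorm d (V_grad d p0 T t0 t1 \<psi> t x))\<^sup>2) \<partial>rho d p0 T t) \<partial>nu t0 t1)"

definition D_fun ::
  "nat \<Rightarrow> pt measure \<Rightarrow> (pt \<Rightarrow> real) \<Rightarrow> real \<Rightarrow> real \<Rightarrow> real \<Rightarrow> tfun \<Rightarrow> ennreal" where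
  "D_fun d p0 w T t0 t1 h =
     (\<integral>\<^sup>+t. (\<integral>\<^sup>+x. ennreal ((h t x - hstar d p0 w T t x)\<^sup>2) \<partial>rho d p0 T t) \<partial>nu t0 t1)"

definition a_form ::
  "nat \<Rightarrow> pt measure \<Rightarrow> real \<Rightarrow> real \<Rightarrow> real \<Rightarrow> tfun \<Rightarrow> tfun \<Rightarrow> real \<Rightarrow> real" where
  "a_form d p0 T t0 t1 h \<psi> t =
     (\<integral>x. dt {t0..t1} h t x * \<psi> t x
          + (\<Sum>i<d. (x i + score d p0 T t x i) * grad (h t) x i) * \<psi> t x
          - (\<Sum>i<d. grad (h t) x i * V_grad d p0 T t0 t1 \<psi> t x i) \<partial>rho d p0 T t)"

definition A_form ::
  "nat \<Rightarrow> pt measure \<Rightarrow> real \<Rightarrow> real \<Rightarrow> real \<Rightarrow> tfun \<Rightarrow> tfun \<Rightarrow> real" where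
  "A_form d p0 T t0 t1 h \<psi> = (\<integral>t. a_form d p0 T t0 t1 h \<psi> t \<partial>nu t0 t1)"

text \<open>
  The supremum is taken in \<open>[0,\<infinity>]\<close>.  For classes closed under negation, the only ones considered,
  this truncation of negative quotients does not change it, and it is \<open>0\<close> if \<open>\<Psi>\<close> contains only \<open>0\<close>.
\<close>

definition N_fun ::
  "nat \<Rightarrow> pt measure \<Rightarrow> real \<Rightarrow> real \<Rightarrow> real \<Rightarrow> tfun set \<Rightarrow> (tfun \<Rightarrow> real) \<Rightarrow> real \<Rightarrow> tfun \<Rightarrow> ennreal"
  where
  "N_fun d p0 T t0 t1 \<Psi> scl \<tau> h =
     (SUP \<psi>\<in>{\<psi>\<in>\<Psi>. \<exists>t\<in>{t0..t1}. \<exists>x\<in>Rd d. \<psi> t x \<noteq> 0}.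
        ennreal (A_form d p0 T t0 t1 h \<psi> / sqrt (V_norm_sq d p0 T t0 t1 \<psi> + \<tau>\<^sup>2 * (scl \<psi>)\<^sup>2)))"

definition Lambda_star :: "nat \<Rightarrow> pt measure \<Rightarrow> real \<Rightarrow> real \<Rightarrow> real \<Rightarrow> ennreal" where
  "Lambda_star d p0 T t0 t1 =
     (SUP t\<in>{t0..t1}.
        Lnorm 4 (rho d p0 T t) (\<lambda>x. enorm d (\<lambda>i. x i + score d p0 T t x i))
      + Lnorm 4 (rho d p0 T t) (\<lambda>x. real d + (\<Sum>i<d. pd i (\<lambda>y. score d p0 T t y i) x))
      + Lnorm 4 (rho d p0 T t)
          (\<lambda>x. enorm d (\<lambda>i. x i + score d p0 T t x i) * enorm d (score d p0 T t x))
      + Lnorm 4 (rho d p0 T t) (\<lambda>x. dt {t0..t1} (\<lambda>t x. ln (rho_dens d p0 T t x)) t x))"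

text \<open>
  \<open>\<Psi>\<close> is a subset of \<open>\<V>\<close> carrying the symmetric, positively homogeneous scale \<open>scl\<close>, with (S1).
\<close>

definition scaled_class ::
  "nat \<Rightarrow> pt measure \<Rightarrow> real \<Rightarrow> real \<Rightarrow> real \<Rightarrow> tfun set \<Rightarrow> (tfun \<Rightarrow> real) \<Rightarrow> bool" where
  "scaled_class d p0 T t0 t1 \<Psi> scl \<longleftrightarrow>
     \<Psi> \<subseteq> V_space d p0 T t0 t1 \<and>
     (\<forall>\<psi>\<in>\<Psi>. (\<lambda>t x. - \<psi> t x) \<in> \<Psi> \<and> (\<forall>r\<ge>0. (\<lambda>t x. r * \<psi> t x) \<in> \<Psi>)) \<and>
     (\<forall>\<psi>\<in>\<Psi>. 0 \<le> scl \<psi> \<and> scl (\<lambda>t x. - \<psi> t x) = scl \<psi> \<and>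
              (\<forall>r\<ge>0. scl (\<lambda>t x. r * \<psi> t x) = r * scl \<psi>))"

definition wdiff :: "real \<Rightarrow> real \<Rightarrow> tfun \<Rightarrow> tfun \<Rightarrow> tfun" where
  "wdiff t0 t1 h h' = (\<lambda>t x. omega t0 t1 t * (h t x - h' t x))"

definition approx_err ::
  "nat \<Rightarrow> pt measure \<Rightarrow> (pt \<Rightarrow> real) \<Rightarrow> real \<Rightarrow> real \<Rightarrow> real \<Rightarrow> tfun \<Rightarrow> ennreal" where
  "approx_err d p0 w T t0 t1 h =
     (let \<eta> = (\<lambda>t x. h t x - hstar d p0 w T t x) in
        LnormI 4 d p0 T t0 t1 \<eta>
      + (SUP t\<in>{t0..t1}. Lnorm 2 (rho d p0 T t) (\<eta> t))
      + LnormI 4 d p0 T t0 t1 (\<lambda>t x. enorm d (grad (\<eta> t) x))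
      + LnormI 2 d p0 T t0 t1 (dt {t0..t1} \<eta>))"

section \<open>Network classes\<close>

text \<open>
  A network with \<open>L\<close> hidden layers: \<open>n j\<close> is the width of layer \<open>j\<close> (\<open>n 0 = d + 1\<close> inputs,
  \<open>n (L + 1) = 1\<close> output), \<open>A j i k\<close> and \<open>b j i\<close> are the parameters of the affine map from layer \<open>j\<close>
  to layer \<open>j + 1\<close>, and \<open>act j\<close> is the activation of hidden layer \<open>j\<close>.
\<close>

fun layer ::
  "(nat \<Rightarrow> real \<Rightarrow> real) \<Rightarrow> (nat \<Rightarrow> nat) \<Rightarrow> (nat \<Rightarrow> nat \<Rightarrow> nat \<Rightarrow> real) \<Rightarrow> (nat \<Rightarrow> nat \<Rightarrow> real)
     \<Rightarrow> nat \<Rightarrow> pt \<Rightarrow> pt" where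
  "layer act n A b 0 z = z"
| "layer act n A b (Suc j) z =
     (\<lambda>i. act (Suc j) ((\<Sum>k<n j. A j i k * layer act n A b j z k) + b j i))"

definition net_out ::
  "(nat \<Rightarrow> real \<Rightarrow> real) \<Rightarrow> (nat \<Rightarrow> nat) \<Rightarrow> (nat \<Rightarrow> nat \<Rightarrow> nat \<Rightarrow> real) \<Rightarrow> (nat \<Rightarrow> nat \<Rightarrow> real)
     \<Rightarrow> nat \<Rightarrow> pt \<Rightarrow> real" where
  "net_out act n A b L z = (\<Sum>k<n L. A L 0 k * layer act n A b L z k) + b L 0"

text \<open>The input \<open>z = (t, x)\<close> is the vector with \<open>z 0 = t\<close> and \<open>z (i + 1) = x i\<close>.\<close>

definition net_input :: "real \<Rightarrow> pt \<Rightarrow> pt" where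
  "net_input t x = case_nat t x"

definition NN ::
  "nat \<Rightarrow> real \<Rightarrow> real \<Rightarrow> real \<Rightarrow> (nat \<Rightarrow> real \<Rightarrow> real)
     \<Rightarrow> nat \<Rightarrow> nat \<Rightarrow> real \<Rightarrow> nat \<Rightarrow> real \<Rightarrow> tfun set" where
  "NN d t0 t1 R act W L Lam P0 Aa =
     {f. \<exists>n A b.
        n 0 = d + 1 \<and> n (L + 1) = 1 \<and> (\<forall>j\<in>{1..L}. 1 \<le> n j \<and> n j \<le> W) \<and>
        (\<forall>j\<le>L. \<forall>i<n (j + 1). \<bar>b j i\<bar> \<le> Lam \<and> (\<forall>k<n j. \<bar>A j i k\<bar> \<le> Lam)) \<and>
        card {(j, i, k). j \<le> L \<and> i < n (j + 1) \<and> k < n j \<and> A j i k \<noteq> 0}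
          + card {(j, i). j \<le> L \<and> i < n (j + 1) \<and> b j i \<noteq> 0} \<le> P0 \<and>
        (\<forall>t\<in>{t0..t1}. \<forall>x\<in>Rd d. (\<forall>i<d. \<bar>x i\<bar> \<le> R) \<longrightarrow>
           (\<forall>j\<in>{1..L}. \<forall>i<n j. \<bar>layer act n A b j (net_input t x) i\<bar> \<le> Aa)) \<and>
        f = (\<lambda>t x. net_out act n A b L (net_input t x))}"

definition cubed_relu :: "real \<Rightarrow> real" where
  "cubed_relu u = (max u 0) ^ 3"

definition NN_cubed ::
  "nat \<Rightarrow> real \<Rightarrow> real \<Rightarrow> real \<Rightarrow> nat \<Rightarrow> nat \<Rightarrow> real \<Rightarrow> nat \<Rightarrow> real \<Rightarrow> tfun set" where
  "NN_cubed d t0 t1 R = NN d t0 t1 R (\<lambda>_. cubed_relu)"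

definition NN_cubed_last ::
  "nat \<Rightarrow> real \<Rightarrow> real \<Rightarrow> real \<Rightarrow> (real \<Rightarrow> real)
     \<Rightarrow> nat \<Rightarrow> nat \<Rightarrow> real \<Rightarrow> nat \<Rightarrow> real \<Rightarrow> tfun set" where
  "NN_cubed_last d t0 t1 R \<Theta> W L =
     NN d t0 t1 R (\<lambda>j. if j = L then \<Theta> else cubed_relu) W L"

definition smooth_real :: "(real \<Rightarrow> real) \<Rightarrow> bool" where
  "smooth_real f \<longleftrightarrow> (\<forall>n x. (deriv ^^ n) f differentiable (at x))"

definition is_Theta :: "real \<Rightarrow> (real \<Rightarrow> real) \<Rightarrow> bool" where
  "is_Theta Bbar \<Theta> \<longleftrightarrow>
     smooth_real \<Theta> \<and> range \<Theta> \<subseteq> {- 2 * Bbar .. 3 * Bbar} \<and> 1-lipschitz_on UNIV \<Theta> \<and>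
     (\<forall>u\<in>{- Bbar .. 2 * Bbar}. \<Theta> u = u) \<and> (\<exists>M. \<forall>u. \<bar>deriv (deriv \<Theta>) u\<bar> \<le> M)"

text \<open>\<open>\<kappa> i\<close> is the one-dimensional clip acting on coordinate \<open>i\<close>.\<close>

definition is_clip :: "nat \<Rightarrow> real \<Rightarrow> (nat \<Rightarrow> real \<Rightarrow> real) \<Rightarrow> bool" where
  "is_clip d R \<kappa> \<longleftrightarrow>
     (\<forall>i<d. smooth_real (\<kappa> i) \<and> (\<forall>u\<in>{- (R - 1) .. R - 1}. \<kappa> i u = u) \<and>
        (\<forall>u. \<bar>\<kappa> i u\<bar> \<le> R) \<and> (\<forall>u. \<bar>deriv (\<kappa> i) u\<bar> \<le> 1) \<and>
        (\<exists>M. \<forall>u. \<bar>deriv (deriv (\<kappa> i)) u\<bar> \<le> M))"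

definition clip :: "nat \<Rightarrow> (nat \<Rightarrow> real \<Rightarrow> real) \<Rightarrow> pt \<Rightarrow> pt" where
  "clip d \<kappa> x = (\<lambda>i\<in>{..<d}. \<kappa> i (x i))"

definition clipped :: "nat \<Rightarrow> (nat \<Rightarrow> real \<Rightarrow> real) \<Rightarrow> tfun \<Rightarrow> tfun" where
  "clipped d \<kappa> f = (\<lambda>t x. f t (clip d \<kappa> x))"

definition sigma_star :: "real \<Rightarrow> real \<Rightarrow> real" where
  "sigma_star T t1 = sigma_ou (T - t1)"

definition G_bd :: "nat \<Rightarrow> real \<Rightarrow> real \<Rightarrow> real \<Rightarrow> real" where
  "G_bd d T Bbar t1 = 4 * sqrt (real d) * Bbar / (sigma_star T t1)\<^sup>2"

definition Gt_bd :: "nat \<Rightarrow> real \<Rightarrow> real \<Rightarrow> real \<Rightarrow> real \<Rightarrow> real \<Rightarrow> real" where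
  "Gt_bd d T Bbar t1 R Ct = Ct * real d * Bbar * (R + 1) / (sigma_star T t1) ^ 4"

definition Gamma_bd :: "nat \<Rightarrow> real \<Rightarrow> real \<Rightarrow> real \<Rightarrow> real \<Rightarrow> real \<Rightarrow> real \<Rightarrow> real" where
  "Gamma_bd d T Bbar t0 t1 R Ct =
     6 * Bbar + 2 * G_bd d T Bbar t1 + 2 * Gt_bd d T Bbar t1 R Ct + 6 * Bbar / (t1 - t0)"

definition agree :: "nat \<Rightarrow> real \<Rightarrow> real \<Rightarrow> tfun \<Rightarrow> tfun \<Rightarrow> bool" where
  "agree d t0 t1 f g \<longleftrightarrow> (\<forall>t\<in>{t0..t1}. \<forall>x\<in>Rd d. f t x = g t x)"

definition H_net ::
  "nat \<Rightarrow> real \<Rightarrow> real \<Rightarrow> real \<Rightarrow> real \<Rightarrow> real \<Rightarrow> (real \<Rightarrow> real) \<Rightarrow> (nat \<Rightarrow> real \<Rightarrow> real) \<Rightarrow> real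
     \<Rightarrow> nat \<Rightarrow> nat \<Rightarrow> real \<Rightarrow> nat \<Rightarrow> real \<Rightarrow> tfun set" where
  "H_net d T Bbar t0 t1 R \<Theta> \<kappa> Ct W L Lam P0 Aa =
     {h. (\<exists>g\<in>NN_cubed d t0 t1 R W L Lam P0 Aa.
            agree d t0 t1 h (clipped d \<kappa> (\<lambda>t x. \<Theta> (g t x)))) \<and>
         (\<forall>t\<in>{t0..t1}. \<forall>x\<in>Rd d.
            enorm d (grad (h t) x) \<le> G_bd d T Bbar t1 \<and>
            \<bar>dt {t0..t1} h t x\<bar> \<le> Gt_bd d T Bbar t1 R Ct)}"

text \<open>The representations \<open>\<psi> = c \<omega> \<phi>\<^sup>\<chi>\<close> admitted in the cone class \<open>\<Psi>\<^sub>N\<close> and in its scale.\<close>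

definition cone_rep ::
  "nat \<Rightarrow> real \<Rightarrow> real \<Rightarrow> real \<Rightarrow> real \<Rightarrow> real \<Rightarrow> (real \<Rightarrow> real) \<Rightarrow> (nat \<Rightarrow> real \<Rightarrow> real) \<Rightarrow> real
     \<Rightarrow> nat \<Rightarrow> nat \<Rightarrow> real \<Rightarrow> nat \<Rightarrow> real \<Rightarrow> real \<Rightarrow> tfun \<Rightarrow> bool" where
  "cone_rep d T Bbar t0 t1 R \<Theta> \<kappa> Ct W L Lam P0 Aa c \<psi> \<longleftrightarrow>
     (\<exists>\<phi>\<in>NN_cubed_last d t0 t1 R \<Theta> (2 * W) (L + 1) Lam (2 * P0 + 2) (max Aa (3 * Bbar)).
        (\<forall>t\<in>{t0..t1}. \<forall>x\<in>Rd d.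
           \<bar>clipped d \<kappa> \<phi> t x\<bar> + enorm d (grad (clipped d \<kappa> \<phi> t) x)
             + \<bar>dt {t0..t1} (clipped d \<kappa> \<phi>) t x\<bar> \<le> Gamma_bd d T Bbar t0 t1 R Ct) \<and>
        agree d t0 t1 \<psi> (\<lambda>t x. c * omega t0 t1 t * clipped d \<kappa> \<phi> t x))"

definition Psi_net ::
  "nat \<Rightarrow> real \<Rightarrow> real \<Rightarrow> real \<Rightarrow> real \<Rightarrow> real \<Rightarrow> (real \<Rightarrow> real) \<Rightarrow> (nat \<Rightarrow> real \<Rightarrow> real) \<Rightarrow> real
     \<Rightarrow> nat \<Rightarrow> nat \<Rightarrow> real \<Rightarrow> nat \<Rightarrow> real \<Rightarrow> tfun set" where
  "Psi_net d T Bbar t0 t1 R \<Theta> \<kappa> Ct W L Lam P0 Aa =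
     {\<psi>. \<exists>c. cone_rep d T Bbar t0 t1 R \<Theta> \<kappa> Ct W L Lam P0 Aa c \<psi>}"

definition cone_scale ::
  "nat \<Rightarrow> real \<Rightarrow> real \<Rightarrow> real \<Rightarrow> real \<Rightarrow> real \<Rightarrow> (real \<Rightarrow> real) \<Rightarrow> (nat \<Rightarrow> real \<Rightarrow> real) \<Rightarrow> real
     \<Rightarrow> nat \<Rightarrow> nat \<Rightarrow> real \<Rightarrow> nat \<Rightarrow> real \<Rightarrow> tfun \<Rightarrow> real" where
  "cone_scale d T Bbar t0 t1 R \<Theta> \<kappa> Ct W L Lam P0 Aa \<psi> =
     Inf {\<bar>c\<bar> | c. cone_rep d T Bbar t0 t1 R \<Theta> \<kappa> Ct W L Lam P0 Aa c \<psi>}"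

section \<open>Identification of the law of \<open>(X\<^sub>0, X\<^sub>\<tau>)\<close> and of the conditional expectation\<close>

lemma sets_pair_leb:
  assumes "sets p0 = sets (leb d)"
  shows "sets (p0 \<Otimes>\<^sub>M leb d) = sets (leb d \<Otimes>\<^sub>M leb d)"
  using assms by (intro sets_pair_measure_cong) auto

lemma sigma_finite_leb: "sigma_finite_measure (leb d)"
proof -
  interpret finite_product_sigma_finite "\<lambda>_::nat. lborel :: real measure" "{..<d}"
    by standard auto
  show ?thesis unfolding leb_def by (rule sigma_finite_measure_axioms)
qed

lemma ou_kernel_nonneg: "0 \<le> ou_kernel d \<tau> x0 x"
  by (auto simp: ou_kernel_def intro!: prod_nonneg)

lemma sigma_ou_pos: "0 < \<tau> \<Longrightarrow> 0 < sigma_ou \<tau>"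
  by (simp add: sigma_ou_def)

lemma ou_kernel_pos: "0 < \<tau> \<Longrightarrow> 0 < ou_kernel d \<tau> x0 x"
  by (auto simp: ou_kernel_def sigma_ou_pos intro!: prod_pos normal_density_pos)

lemma ou_kernel_le: "ou_kernel d \<tau> x0 x \<le> (1 / sqrt (2 * pi * (sigma_ou \<tau>)\<^sup>2)) ^ d"
proof -
  have "normal_density m s y \<le> 1 / sqrt (2 * pi * s\<^sup>2)" for m s y :: real
    by (auto simp: normal_density_def intro!: divide_right_mono)
  then have "ou_kernel d \<tau> x0 x \<le> (\<Prod>i<d. 1 / sqrt (2 * pi * (sigma_ou \<tau>)\<^sup>2))"
    unfolding ou_kernel_def by (intro prod_mono) auto
  then show ?thesis by simp
qed

lemma ou_kernel_measurable:
  "(\<lambda>(x0, x). ou_kernel d \<tau> x0 x) \<in> borel_measurable (leb d \<Otimes>\<^sub>M leb d)"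
proof -
  have [measurable]: "(\<lambda>p. fst p i) \<in> borel_measurable (leb d \<Otimes>\<^sub>M leb d)" if "i < d" for i
    using measurable_compose[OF measurable_fst, of "\<lambda>x. x i" "leb d" borel "leb d"] that
    by (simp add: leb_def)
  have [measurable]: "(\<lambda>p. snd p i) \<in> borel_measurable (leb d \<Otimes>\<^sub>M leb d)" if "i < d" for i
    using measurable_compose[OF measurable_snd, of "\<lambda>x. x i" "leb d" borel "leb d"] that
    by (simp add: leb_def)
  show ?thesis
    unfolding ou_kernel_def case_prod_beta normal_density_def
    by (intro borel_measurable_prod) simp
qed

lemma ou_kernel_nn_integral:
  assumes "0 < \<tau>"
  shows "(\<integral>\<^sup>+x. ennreal (ou_kernel d \<tau> x0 x) \<partial>leb d) = 1"
proof -
  interpret product_sigma_finite "\<lambda>_::nat. lborel :: real measure" by standard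
  have 1: "(\<integral>\<^sup>+y. ennreal (normal_density m (sigma_ou \<tau>) y) \<partial>lborel) = 1" for m
    using sigma_ou_pos[OF assms] by (subst nn_integral_eq_integral) auto
  have "(\<integral>\<^sup>+x. ennreal (ou_kernel d \<tau> x0 x) \<partial>leb d) =
     (\<integral>\<^sup>+x. (\<Prod>i<d. ennreal (normal_density (mu_ou \<tau> * x0 i) (sigma_ou \<tau>) (x i))) \<partial>leb d)"
    by (simp add: ou_kernel_def prod_ennreal)
  also have "\<dots> = (\<Prod>i<d. \<integral>\<^sup>+y. ennreal (normal_density (mu_ou \<tau> * x0 i) (sigma_ou \<tau>) y) \<partial>lborel)"
    unfolding leb_def by (rule product_nn_integral_prod) auto
  also have "\<dots> = 1" by (simp add: 1)
  finally show ?thesis .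
qed

lemma ou_joint_marginals:
  assumes p0: "prob_space p0" "sets p0 = sets (leb d)" and \<tau>: "0 < \<tau>"
  shows "distr (ou_joint d p0 \<tau>) p0 fst = p0"
    and "distr (ou_joint d p0 \<tau>) (leb d) snd = density (leb d) (\<lambda>x. ennreal (ou_dens d p0 \<tau> x))"
proof -
  interpret P: prob_space p0 by fact
  interpret L: sigma_finite_measure "leb d" by (rule sigma_finite_leb)
  interpret PL: pair_sigma_finite p0 "leb d" ..
  let ?J = "p0 \<Otimes>\<^sub>M leb d"
  have km[measurable]: "(\<lambda>p. ou_kernel d \<tau> (fst p) (snd p)) \<in> borel_measurable ?J"
    using ou_kernel_measurable[of d \<tau>]
    by (simp add: case_prod_beta' measurable_cong_sets[OF sets_pair_leb[OF p0(2)] refl])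
  have sets_J: "sets (ou_joint d p0 \<tau>) = sets ?J" "space (ou_joint d p0 \<tau>) = space ?J"
    by (simp_all add: ou_joint_def)
  have em: "emeasure (ou_joint d p0 \<tau>) E =
      (\<integral>\<^sup>+p. ennreal (ou_kernel d \<tau> (fst p) (snd p)) * indicator E p \<partial>?J)"
    if "E \<in> sets ?J" for E
    using that unfolding ou_joint_def case_prod_beta' by (subst emeasure_density) auto
  show "distr (ou_joint d p0 \<tau>) p0 fst = p0"
  proof (rule measure_eqI)
    fix A assume "A \<in> sets (distr (ou_joint d p0 \<tau>) p0 fst)"
    then have A[measurable]: "A \<in> sets p0" by simp
    have "emeasure (distr (ou_joint d p0 \<tau>) p0 fst) A
        = emeasure (ou_joint d p0 \<tau>) (fst -` A \<inter> space ?J)"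
      by (subst emeasure_distr) (auto simp: sets_J measurable_cong_sets[OF sets_J(1) refl])
    also have "\<dots> = (\<integral>\<^sup>+p. ennreal (ou_kernel d \<tau> (fst p) (snd p)) * indicator A (fst p) \<partial>?J)"
      by (subst em) (auto intro!: nn_integral_cong simp: indicator_def)
    also have "\<dots> = (\<integral>\<^sup>+x0. (\<integral>\<^sup>+x. ennreal (ou_kernel d \<tau> x0 x) * indicator A x0 \<partial>leb d) \<partial>p0)"
      by (subst L.nn_integral_fst[symmetric]) auto
    also have "\<dots> = (\<integral>\<^sup>+x0. indicator A x0 \<partial>p0)"
    proof (rule nn_integral_cong)
      fix x0
      show "(\<integral>\<^sup>+x. ennreal (ou_kernel d \<tau> x0 x) * indicator A x0 \<partial>leb d) = indicator A x0"
        using ou_kernel_nn_integral[OF \<tau>, of d x0] by (cases "x0 \<in> A") auto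
    qed
    also have "\<dots> = emeasure p0 A" by simp
    finally show "emeasure (distr (ou_joint d p0 \<tau>) p0 fst) A = emeasure p0 A" .
  qed simp
  show "distr (ou_joint d p0 \<tau>) (leb d) snd = density (leb d) (\<lambda>x. ennreal (ou_dens d p0 \<tau> x))"
  proof (rule measure_eqI)
    fix A assume "A \<in> sets (distr (ou_joint d p0 \<tau>) (leb d) snd)"
    then have A[measurable]: "A \<in> sets (leb d)" by simp
    have km2: "(\<lambda>(x, x0). ou_kernel d \<tau> x0 x) \<in> borel_measurable (leb d \<Otimes>\<^sub>M p0)"
      using measurable_pair_swap[OF km] by (simp add: case_prod_beta')
    have dens_m[measurable]: "ou_dens d p0 \<tau> \<in> borel_measurable (leb d)"
      unfolding ou_dens_def using P.borel_measurable_lebesgue_integral[OF km2] by simp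
    have km3: "(\<lambda>x0. ou_kernel d \<tau> x0 x) \<in> borel_measurable p0" if "x \<in> space (leb d)" for x
      using measurable_Pair2[OF km2[unfolded case_prod_beta'] that] by simp
    have dens: "(\<integral>\<^sup>+x0. ennreal (ou_kernel d \<tau> x0 x) \<partial>p0) = ennreal (ou_dens d p0 \<tau> x)"
      if "x \<in> space (leb d)" for x
      unfolding ou_dens_def
      by (rule nn_integral_eq_integral)
         (auto simp: ou_kernel_nonneg km3[OF that] intro!: P.integrable_const_bound ou_kernel_le)
    have "emeasure (distr (ou_joint d p0 \<tau>) (leb d) snd) A
        = emeasure (ou_joint d p0 \<tau>) (snd -` A \<inter> space ?J)"
      by (subst emeasure_distr) (auto simp: sets_J measurable_cong_sets[OF sets_J(1) refl])
    also have "\<dots> = (\<integral>\<^sup>+p. ennreal (ou_kernel d \<tau> (fst p) (snd p)) * indicator A (snd p) \<partial>?J)"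
      by (subst em) (auto intro!: nn_integral_cong simp: indicator_def)
    also have "\<dots> = (\<integral>\<^sup>+x. (\<integral>\<^sup>+x0. ennreal (ou_kernel d \<tau> x0 x) * indicator A x \<partial>p0) \<partial>leb d)"
      by (subst PL.nn_integral_snd[symmetric]) auto
    also have "\<dots> = (\<integral>\<^sup>+x. ennreal (ou_dens d p0 \<tau> x) * indicator A x \<partial>leb d)"
      using dens km3 by (intro nn_integral_cong) (simp add: nn_integral_multc)
    also have "\<dots> = emeasure (density (leb d) (\<lambda>x. ennreal (ou_dens d p0 \<tau> x))) A"
      by (subst emeasure_density) auto
    finally show "emeasure (distr (ou_joint d p0 \<tau>) (leb d) snd) A
      = emeasure (density (leb d) (\<lambda>x. ennreal (ou_dens d p0 \<tau> x))) A" .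
  qed simp
qed

lemma post_mean_cond_exp:
  fixes X0 X :: "'w \<Rightarrow> pt"
  assumes M: "prob_space M" and p0: "prob_space p0" "sets p0 = sets (leb d)" and \<tau>: "0 < \<tau>"
    and X: "(\<lambda>\<omega>. (X0 \<omega>, X \<omega>)) \<in> measurable M (p0 \<Otimes>\<^sub>M leb d)"
    and law: "distr M (p0 \<Otimes>\<^sub>M leb d) (\<lambda>\<omega>. (X0 \<omega>, X \<omega>)) = ou_joint d p0 \<tau>"
    and w: "w \<in> borel_measurable (leb d)" and B: "AE x in p0. \<bar>w x\<bar> \<le> B"
  shows "AE \<omega> in M. real_cond_exp M (vimage_algebra (space M) X (leb d)) (\<lambda>\<omega>. w (X0 \<omega>)) \<omega>
           = post_mean d p0 w \<tau> (X \<omega>)"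
proof -
  interpret M: prob_space M by fact
  interpret P: prob_space p0 by fact
  interpret L: sigma_finite_measure "leb d" by (rule sigma_finite_leb)
  interpret PL: pair_sigma_finite p0 "leb d" ..
  let ?k = "\<lambda>p. ou_kernel d \<tau> (fst p) (snd p)"
  let ?J = "p0 \<Otimes>\<^sub>M leb d"
  define g where "g = post_mean d p0 w \<tau>"
  have wm[measurable]: "w \<in> borel_measurable p0"
    using w p0(2) by (simp cong: measurable_cong_sets)
  have km[measurable]: "?k \<in> borel_measurable ?J"
    using ou_kernel_measurable[of d \<tau>]
    by (simp add: case_prod_beta' measurable_cong_sets[OF sets_pair_leb[OF p0(2)] refl])
  have km2: "(\<lambda>(x, x0). ou_kernel d \<tau> x0 x) \<in> borel_measurable (leb d \<Otimes>\<^sub>M p0)"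
    using measurable_pair_swap[OF km] by (simp add: case_prod_beta')
  have X0m[measurable]: "X0 \<in> measurable M p0" and Xm[measurable]: "X \<in> measurable M (leb d)"
    using measurable_compose[OF X measurable_fst] measurable_compose[OF X measurable_snd] by simp_all
  have km3: "(\<lambda>x0. ou_kernel d \<tau> x0 x) \<in> borel_measurable p0" if "x \<in> space (leb d)" for x
    using measurable_Pair2[OF km2[unfolded case_prod_beta'] that] by simp
  have dens_m[measurable]: "ou_dens d p0 \<tau> \<in> borel_measurable (leb d)"
    unfolding ou_dens_def using P.borel_measurable_lebesgue_integral[OF km2] by simp
  have num_m: "(\<lambda>x. \<integral>x0. w x0 * ou_kernel d \<tau> x0 x \<partial>p0) \<in> borel_measurable (leb d)"
    by (rule P.borel_measurable_lebesgue_integral) (use km2 in measurable)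
  have gm[measurable]: "g \<in> borel_measurable (leb d)"
    unfolding g_def post_mean_def[abs_def] using num_m by measurable
  have kint: "integrable p0 (\<lambda>x0. ou_kernel d \<tau> x0 x)" if "x \<in> space (leb d)" for x
    by (rule P.integrable_const_bound[where B="(1 / sqrt (2 * pi * (sigma_ou \<tau>)\<^sup>2)) ^ d"])
       (use ou_kernel_le ou_kernel_nonneg km3[OF that] in auto)
  have wkint: "integrable p0 (\<lambda>x0. w x0 * ou_kernel d \<tau> x0 x)" if "x \<in> space (leb d)" for x
  proof (rule Bochner_Integration.integrable_bound)
    show "integrable p0 (\<lambda>x0. B * ou_kernel d \<tau> x0 x)" using kint[OF that] by simp
    show "(\<lambda>x0. w x0 * ou_kernel d \<tau> x0 x) \<in> borel_measurable p0" using km3[OF that] by simp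
    show "AE x0 in p0. norm (w x0 * ou_kernel d \<tau> x0 x) \<le> norm (B * ou_kernel d \<tau> x0 x)"
      using B by eventually_elim (auto simp: abs_mult intro!: mult_right_mono)
  qed
  have dens_pos: "0 < ou_dens d p0 \<tau> x" if "x \<in> space (leb d)" for x
  proof -
    have "ou_dens d p0 \<tau> x \<noteq> 0"
    proof
      assume "ou_dens d p0 \<tau> x = 0"
      then have "AE x0 in p0. ou_kernel d \<tau> x0 x = 0"
        unfolding ou_dens_def using integral_nonneg_eq_0_iff_AE[OF kint[OF that]] ou_kernel_nonneg
        by auto
      then have "AE x0 in p0. False"
        by eventually_elim (use ou_kernel_pos[OF \<tau>, of d _ x] in \<open>metis less_irrefl\<close>)
      then show False by simp
    qed
    moreover have "0 \<le> ou_dens d p0 \<tau> x"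
      unfolding ou_dens_def by (intro integral_nonneg_AE) (simp add: ou_kernel_nonneg)
    ultimately show ?thesis by simp
  qed
  have g_eq: "g x * ou_dens d p0 \<tau> x = (\<integral>x0. w x0 * ou_kernel d \<tau> x0 x \<partial>p0)"
    if "x \<in> space (leb d)" for x
    using dens_pos[OF that] by (simp add: g_def post_mean_def)
  have g_le: "\<bar>g x\<bar> \<le> B" if "x \<in> space (leb d)" for x
  proof -
    have "\<bar>\<integral>x0. w x0 * ou_kernel d \<tau> x0 x \<partial>p0\<bar> \<le> (\<integral>x0. \<bar>w x0 * ou_kernel d \<tau> x0 x\<bar> \<partial>p0)"
      by (rule integral_abs_bound)
    also have "\<dots> \<le> (\<integral>x0. B * ou_kernel d \<tau> x0 x \<partial>p0)"
    proof (rule integral_mono_AE)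
      show "AE x0 in p0. \<bar>w x0 * ou_kernel d \<tau> x0 x\<bar> \<le> B * ou_kernel d \<tau> x0 x"
        using B by eventually_elim
          (auto simp: abs_mult ou_kernel_nonneg intro!: mult_right_mono)
    qed (use wkint[OF that] kint[OF that] in auto)
    finally show ?thesis
      using dens_pos[OF that] unfolding g_def post_mean_def
      by (simp add: ou_dens_def[symmetric] field_simps abs_if split: if_splits)
  qed
  have kJ: "integrable ?J ?k"
  proof (rule integrableI_nonneg)
    have "(\<integral>\<^sup>+p. ennreal (?k p) \<partial>?J) = (\<integral>\<^sup>+x0. (\<integral>\<^sup>+x. ennreal (ou_kernel d \<tau> x0 x) \<partial>leb d) \<partial>p0)"
      by (subst L.nn_integral_fst[symmetric]) auto
    then show "(\<integral>\<^sup>+p. ennreal (?k p) \<partial>?J) < \<infinity>"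
      by (simp add: ou_kernel_nn_integral[OF \<tau>] P.emeasure_space_1)
  qed (auto simp: ou_kernel_nonneg)
  have BJ: "AE p in ?J. \<bar>w (fst p)\<bar> \<le> B"
    by (rule PL.AE_pair_measure) (use B in auto)
  have wkJ: "integrable ?J (\<lambda>p. indicator A (snd p) * (w (fst p) * ?k p))"
    if [measurable]: "A \<in> sets (leb d)" for A
  proof (rule Bochner_Integration.integrable_bound)
    show "integrable ?J (\<lambda>p. B * ?k p)" using kJ by simp
    show "AE p in ?J. norm (indicator A (snd p) * (w (fst p) * ?k p)) \<le> norm (B * ?k p)"
      using BJ by eventually_elim
        (auto simp: abs_mult indicator_def intro!: mult_right_mono)
  qed measurable
  have gkJ: "integrable ?J (\<lambda>p. indicator A (snd p) * (g (snd p) * ?k p))"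
    if [measurable]: "A \<in> sets (leb d)" for A
  proof (rule Bochner_Integration.integrable_bound)
    show "integrable ?J (\<lambda>p. B * ?k p)" using kJ by simp
    have "AE p in ?J. \<bar>g (snd p)\<bar> \<le> B"
      by (rule AE_I2) (auto simp: space_pair_measure intro!: g_le)
    then show "AE p in ?J. norm (indicator A (snd p) * (g (snd p) * ?k p)) \<le> norm (B * ?k p)"
      by eventually_elim (auto simp: abs_mult indicator_def intro!: mult_right_mono)
  qed measurable
  have push: "(\<integral>\<omega>. f (X0 \<omega>, X \<omega>) \<partial>M) = (\<integral>p. ?k p * f p \<partial>?J)"
    if [measurable]: "f \<in> borel_measurable ?J" for f :: "pt \<times> pt \<Rightarrow> real"
  proof -
    have "(\<integral>\<omega>. f (X0 \<omega>, X \<omega>) \<partial>M) = integral\<^sup>L (ou_joint d p0 \<tau>) f"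
      unfolding law[symmetric] by (rule integral_distr[symmetric, OF X that])
    also have "\<dots> = (\<integral>p. ?k p * f p \<partial>?J)"
      unfolding ou_joint_def case_prod_beta'
      by (subst integral_density) (auto simp: ou_kernel_nonneg)
    finally show ?thesis .
  qed
  have pushi: "integrable M (\<lambda>\<omega>. f (X0 \<omega>, X \<omega>))"
    if [measurable]: "f \<in> borel_measurable ?J" and "integrable ?J (\<lambda>p. ?k p * f p)"
    for f :: "pt \<times> pt \<Rightarrow> real"
  proof -
    have "integrable (ou_joint d p0 \<tau>) f"
      unfolding ou_joint_def case_prod_beta'
      using that by (subst integrable_density) (auto simp: ou_kernel_nonneg)
    then show ?thesis unfolding law[symmetric] by (simp add: integrable_distr_eq[OF X])
  qed
  have Xs: "X \<in> space M \<rightarrow> space (leb d)" using measurable_space[OF Xm] by auto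
  have "subalgebra M (vimage_algebra (space M) X (leb d))"
    unfolding subalgebra_def sets_vimage_algebra2[OF Xs] by (auto intro: measurable_sets[OF Xm])
  then interpret S: finite_measure_subalgebra M "vimage_algebra (space M) X (leb d)"
    by unfold_locales
  show ?thesis unfolding g_def[symmetric]
  proof (rule S.real_cond_exp_charact)
    fix A assume "A \<in> sets (vimage_algebra (space M) X (leb d))"
    then obtain E where E[measurable]: "E \<in> sets (leb d)" and A: "A = X -` E \<inter> space M"
      by (auto simp: sets_vimage_algebra2[OF Xs])
    have "(\<integral>\<omega>\<in>A. w (X0 \<omega>) \<partial>M) = (\<integral>\<omega>. (\<lambda>p. indicator E (snd p) * w (fst p)) (X0 \<omega>, X \<omega>) \<partial>M)"
      unfolding set_lebesgue_integral_def
      by (intro Bochner_Integration.integral_cong) (auto simp: A indicator_def)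
    also have "\<dots> = (\<integral>p. ?k p * (indicator E (snd p) * w (fst p)) \<partial>?J)"
      by (rule push) measurable
    also have "\<dots> = (\<integral>p. indicator E (snd p) * (w (fst p) * ?k p) \<partial>?J)"
      by (simp add: ac_simps)
    also have "\<dots> = (\<integral>x. (\<integral>x0. indicator E x * (w x0 * ou_kernel d \<tau> x0 x) \<partial>p0) \<partial>leb d)"
      using PL.integral_snd[of "\<lambda>x0 x. indicator E x * (w x0 * ou_kernel d \<tau> x0 x)"] wkJ[OF E]
      by (simp add: case_prod_beta')
    also have "\<dots> = (\<integral>x. (\<integral>x0. indicator E x * (g x * ou_kernel d \<tau> x0 x) \<partial>p0) \<partial>leb d)"
      by (rule Bochner_Integration.integral_cong[OF refl]) (simp add: g_eq[symmetric] ou_dens_def)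
    also have "\<dots> = (\<integral>p. indicator E (snd p) * (g (snd p) * ?k p) \<partial>?J)"
      using PL.integral_snd[of "\<lambda>x0 x. indicator E x * (g x * ou_kernel d \<tau> x0 x)"] gkJ[OF E]
      by (simp add: case_prod_beta')
    also have "\<dots> = (\<integral>p. ?k p * (indicator E (snd p) * g (snd p)) \<partial>?J)"
      by (simp add: ac_simps)
    also have "\<dots> = (\<integral>\<omega>. (\<lambda>p. indicator E (snd p) * g (snd p)) (X0 \<omega>, X \<omega>) \<partial>M)"
      by (rule push[symmetric]) measurable
    also have "\<dots> = (\<integral>\<omega>\<in>A. g (X \<omega>) \<partial>M)"
      unfolding set_lebesgue_integral_def
      by (intro Bochner_Integration.integral_cong) (auto simp: A indicator_def)
    finally show "(\<integral>\<omega>\<in>A. w (X0 \<omega>) \<partial>M) = (\<integral>\<omega>\<in>A. g (X \<omega>) \<partial>M)" .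
  next
    have "integrable ?J (\<lambda>p. ?k p * w (fst p))"
      using wkJ[OF sets.top] by (subst (asm) Bochner_Integration.integrable_cong[OF refl])
        (auto simp: space_pair_measure ac_simps)
    then show "integrable M (\<lambda>\<omega>. w (X0 \<omega>))"
      using pushi[of "\<lambda>p. w (fst p)"] by simp
    show "integrable M (\<lambda>\<omega>. g (X \<omega>))"
      by (rule M.integrable_const_bound[where B=B])
         (use measurable_space[OF Xm] g_le in auto)
    show "(\<lambda>\<omega>. g (X \<omega>)) \<in> borel_measurable (vimage_algebra (space M) X (leb d))"
      by (rule measurable_compose[OF measurable_vimage_algebra1 gm])
         (use measurable_space[OF Xm] in auto)
  qed
qed

end

theory Submission
  imports Defs "HOL-Computational_Algebra.Polynomial"
begin

text \<open>Put \<open>u = h\<^sub>N - h\<close>, \<open>\<eta> = h\<^sub>N - h\<^sup>*\<close> and test with \<open>\<psi> = \<omega> u\<close>, which lies in \<open>\<Psi>\<^sub>N\<close>. The posterior mean solves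
  the backward Kolmogorov equation, so \<open>a\<^sub>t(h\<^sup>*, \<psi>) = 0\<close> and \<open>A(h, \<psi>) = A(\<eta>, \<psi>) - A(u, \<psi>)\<close>. The
  Fokker-Planck equation \<open>\<partial>\<^sub>t \<rho> = - div ((x + s) \<rho>)\<close> gives
  \<open>a\<^sub>t(u, u) = \<partial>\<^sub>t \<parallel>u\<parallel>\<^sup>2 / 2 - \<parallel>\<nabla>u\<parallel>\<^sup>2\<close>. Integrating against \<open>\<omega>\<close>, which vanishes at \<open>t\<^sub>1\<close> and has slope
  \<open>-1 / \<ell>\<close>, bounds \<open>\<integral> \<omega> \<parallel>\<nabla>u\<parallel>\<^sup>2\<close> by \<open>A(h, \<psi>) - A(\<eta>, \<psi>) + \<integral> \<parallel>u\<parallel>\<^sup>2 / (2 \<ell>)\<close>. Here \<open>A(h, \<psi>)\<close> is at most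
  \<open>N(h) \<parallel>\<psi>\<parallel>\<close>, and Young's inequality absorbs the gradients. Finally \<open>\<omega> \<ge> \<delta>\<close> on \<open>I\<^sub>\<delta>\<close> and
  \<open>h - h\<^sup>* = \<eta> - u\<close>. For networks, the difference of two members of \<open>H\<^sub>N\<close> is computed by running both in
  parallel, with scale 1.\<close>

section \<open>Smooth bumps\<close>

text \<open>The constant has to be independent of dimension, window and laws, while the derivatives
  of the posterior mean are controlled only through kernel bounds that depend on all of these. Two
  kinds of bounds are therefore kept apart. The initial law lives in the unit cube and T - t1 > 0,
  so every kernel derivative is at most a multiple of one Gaussian envelope, uniformly on the
  window; such crude bounds only serve to differentiate under integrals and to exchange them. Sizes
  are measured by the norms of the statement alone. The obstacle is the drift: x + s and the
  gradient of the posterior mean are only known to grow at most linearly, so the product of drift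
  and error gradient is split into two L^4 norms. Young's inequality puts the weight 1/4 on the
  gradients of u twice, once for A(h, \<psi>) and once for A(\<eta>, \<psi>), so that half of the
  gradient energy stays on the left. The norm of V refers to some weak gradient. Comparing it with
  the classical one takes smooth functions of compact support, which are built from
  exp(-1/u).\<close>

definition flat :: "nat \<Rightarrow> real \<Rightarrow> real" where
  "flat k u = (if u \<le> 0 then 0 else (1 / u) ^ k * exp (- (1 / u)))"

lemma flat_tendsto_0: "(flat k \<longlongrightarrow> 0) (at 0)"
proof -
  have "((\<lambda>u. (inverse u) ^ k / exp (inverse u :: real)) \<longlongrightarrow> 0) (at_right 0)"
    by (rule filterlim_compose[OF tendsto_power_div_exp_0 filterlim_inverse_at_top_right])
  then have "(flat k \<longlongrightarrow> 0) (at_right 0)"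
    by (rule Lim_transform_eventually)
       (auto simp: eventually_at_filter flat_def exp_minus field_simps)
  moreover have "(flat k \<longlongrightarrow> 0) (at_left 0)"
    by (rule tendsto_eventually) (auto simp: eventually_at_filter flat_def)
  ultimately show ?thesis by (simp add: filterlim_split_at)
qed

lemma flat_DERIV: "(flat k has_real_derivative - real k * flat (Suc k) u + flat (k + 2) u) (at u)"
proof (cases u "0 :: real" rule: linorder_cases)
  case less
  have "((\<lambda>_. 0) has_real_derivative 0) (at u)" by simp
  then have "(flat k has_real_derivative 0) (at u)"
    by (rule DERIV_cong_ev[THEN iffD1, rotated -1])
       (use less eventually_nhds_in_open[of "{..<0}" u] in \<open>auto simp: flat_def elim: eventually_mono\<close>)
  then show ?thesis using less by (simp add: flat_def)
next
  case equal
  \<comment> \<open>The difference quotient of \<open>flat k\<close> at 0 is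
    \<open>flat (Suc k)\<close> itself, so differentiability there is the limit
    \<open>flat_tendsto_0\<close> with the next index.\<close>
  have "((\<lambda>h. (flat k (0 + h) - flat k 0) / h) \<longlongrightarrow> 0) (at 0)"
    by (rule Lim_transform_eventually[OF flat_tendsto_0[of "Suc k"]])
       (auto simp: eventually_at_filter flat_def)
  then show ?thesis using equal by (simp add: DERIV_def flat_def)
next
  case greater
  have "((\<lambda>u. (1 / u) ^ k * exp (- (1 / u))) has_real_derivative
      - real k * flat (Suc k) u + flat (k + 2) u) (at u)"
    using greater
    by (auto intro!: derivative_eq_intros simp: flat_def divide_simps power2_eq_square)
       (cases k; auto simp: field_simps power2_eq_square)
  then show ?thesis
    by (rule DERIV_cong_ev[THEN iffD1, rotated -1])
       (use greater eventually_nhds_in_open[of "{0<..}" u] in \<open>auto simp: flat_def elim: eventually_mono\<close>)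
qed

text \<open>Differentiating exp(-1/u) only produces negative powers of u, which are the index of
  \<open>flat\<close>. With polynomial coefficients the span is closed under differentiation, so
  derivatives of every order exist without any formula for them, and membership alone forces a
  function to vanish where q is not positive.\<close>

inductive flat_span :: "real poly \<Rightarrow> (real \<Rightarrow> real) \<Rightarrow> bool" for q where
  base: "flat_span q (\<lambda>x. poly p x * flat k (poly q x))"
| add: "flat_span q f \<Longrightarrow> flat_span q g \<Longrightarrow> flat_span q (\<lambda>x. f x + g x)"

lemma flat_span_DERIV:
  assumes "flat_span q f"
  shows "\<exists>f'. flat_span q f' \<and> (\<forall>x. (f has_real_derivative f' x) (at x))"
  using assms
proof induction
  case (base p k)
  let ?f' = "\<lambda>x. poly (pderiv p) x * flat k (poly q x) +
    (poly (smult (- real k) (p * pderiv q)) x * flat (Suc k) (poly q x)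
      + poly (p * pderiv q) x * flat (k + 2) (poly q x))"
  have "flat_span q ?f'" by (intro flat_span.intros)
  moreover have "((\<lambda>x. poly p x * flat k (poly q x)) has_real_derivative ?f' x) (at x)" for x
    by (rule derivative_eq_intros DERIV_chain2[OF flat_DERIV] poly_DERIV refl)+
       (simp add: algebra_simps)
  ultimately show ?case by blast
next
  case (add f g)
  then obtain f' g' where "flat_span q f'" "flat_span q g'"
    "\<forall>x. (f has_real_derivative f' x) (at x)" "\<forall>x. (g has_real_derivative g' x) (at x)" by blast
  then show ?case by (intro exI[of _ "\<lambda>x. f' x + g' x"]) (auto intro: flat_span.intros DERIV_add)
qed

lemma flat_span_deriv: "flat_span q f \<Longrightarrow> flat_span q (deriv f)"
  using flat_span_DERIV[of q f] by (metis DERIV_imp_deriv ext)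

lemma flat_span_has_deriv: "flat_span q f \<Longrightarrow> (f has_real_derivative deriv f x) (at x)"
  using flat_span_DERIV[of q f] by (metis DERIV_imp_deriv)

lemma flat_span_zero: "flat_span q f \<Longrightarrow> poly q x \<le> 0 \<Longrightarrow> f x = 0"
  by (induction rule: flat_span.induct) (auto simp: flat_def)

definition bump_poly :: "real \<Rightarrow> real \<Rightarrow> real \<Rightarrow> real poly" where
  "bump_poly n a c = smult n ([:- a, 1:] * [:c, - 1:])"

text \<open>The parameter n sharpens the bump: exp(-1 / (n (x - a)(c - x))) tends to the indicator
  of the open interval as n grows, while the support stays in [a, c] and the values below 1.\<close>

definition bump :: "real \<Rightarrow> real \<Rightarrow> real \<Rightarrow> real \<Rightarrow> real" where
  "bump n a c x = flat 0 (n * ((x - a) * (c - x)))"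

lemma poly_bump_poly: "poly (bump_poly n a c) x = n * ((x - a) * (c - x))"
  by (simp add: bump_poly_def algebra_simps)

lemma bump_span: "flat_span (bump_poly n a c) (bump n a c)"
  using flat_span.base[of "bump_poly n a c" 1 0]
  by (simp add: bump_def[abs_def] poly_bump_poly)

lemma bump_nonneg: "0 \<le> bump n a c x"
  by (simp add: bump_def flat_def)

lemma bump_le_1: "bump n a c x \<le> 1"
  by (simp add: bump_def flat_def)

lemma bump_poly_nonpos:
  assumes "0 \<le> n" "a < c" "\<not> (a < x \<and> x < c)"
  shows "poly (bump_poly n a c) x \<le> 0"
proof -
  have "(x - a) * (c - x) \<le> 0" using assms by (auto simp: mult_le_0_iff)
  then show ?thesis unfolding poly_bump_poly using assms(1) by (rule mult_nonneg_nonpos[rotated])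
qed

lemma bump_zero: "0 \<le> n \<Longrightarrow> a < c \<Longrightarrow> \<not> (a < x \<and> x < c) \<Longrightarrow> bump n a c x = 0"
  using flat_span_zero[OF bump_span bump_poly_nonpos] by blast

lemma bump_tendsto:
  assumes "a < c"
  shows "(\<lambda>n. bump (real (Suc n)) a c x) \<longlonglongrightarrow> indicator {a<..<c} x"
proof (cases "a < x \<and> x < c")
  case True
  have "(\<lambda>n. exp (- (1 / ((x - a) * (c - x)) * inverse (real (Suc n))))) \<longlonglongrightarrow> exp (- (1 / ((x - a) * (c - x)) * 0))"
    by (intro tendsto_intros LIMSEQ_inverse_real_of_nat)
  moreover have "bump (real (Suc n)) a c x = exp (- (1 / ((x - a) * (c - x)) * inverse (real (Suc n))))" for n
  proof -
    have "0 < real (Suc n) * ((x - a) * (c - x))" using True by (intro mult_pos_pos) auto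
    then show ?thesis unfolding bump_def flat_def by (simp add: divide_simps)
  qed
  ultimately show ?thesis using True by simp
next
  case False
  then show ?thesis using assms by (subst bump_zero) (auto simp: indicator_def)
qed

text \<open>On the original interval the quadratic belonging to the interval enlarged by 1 on either
  side is at least 1. Multiplied over the coordinates, this lower bound turns integrability against
  test functions into integrability on cubes.\<close>

lemma bump_ge: 
  assumes "a < x" "x < c" 
  shows "exp (- 1) \<le> bump 1 (a - 1) (c + 1) x"
proof -
  have *: "1 * 1 \<le> (x - (a - 1)) * (c + 1 - x)" using assms by (intro mult_mono) auto
  moreover have "- 1 \<le> - (1 / ((x - (a - 1)) * (c + 1 - x)))"
    using * by (simp add: divide_simps)
  ultimately show ?thesis
    unfolding bump_def flat_def by simp
qed

section \<open>Product test functions\<close>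

lemma DERIV_prod_coord:
  fixes d i :: nat
  assumes "i < d" "(f i has_real_derivative D) (at y)"
  shows "((\<lambda>y. \<Prod>j<d. f j ((x(i := y)) j)) has_real_derivative
    D * (\<Prod>j\<in>{..<d} - {i}. f j (x j))) (at y)"
proof -
  have *: "(\<lambda>y. \<Prod>j<d. f j ((x(i := y)) j)) = (\<lambda>y. f i y * (\<Prod>j\<in>{..<d} - {i}. f j (x j)))"
  proof
    fix y
    have "(\<Prod>j\<in>{..<d} - {i}. f j ((x(i := y)) j)) = (\<Prod>j\<in>{..<d} - {i}. f j (x j))"
      by (rule prod.cong) auto
    then show "(\<Prod>j<d. f j ((x(i := y)) j)) = f i y * (\<Prod>j\<in>{..<d} - {i}. f j (x j))"
      using prod.remove[of "{..<d}" i "\<lambda>j. f j ((x(i := y)) j)"] assms(1) by simp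
  qed
  show ?thesis unfolding * by (intro DERIV_cmult_right assms(2))
qed

lemma pd_prod:
  assumes "i < d" "\<And>y. (f i has_real_derivative deriv (f i) y) (at y)"
  shows "pd i (\<lambda>x. \<Prod>j<d. f j (x j)) = (\<lambda>x. \<Prod>j<d. (f(i := deriv (f i))) j (x j))"
proof
  fix x
  have "pd i (\<lambda>x. \<Prod>j<d. f j (x j)) x = deriv (f i) (x i) * (\<Prod>j\<in>{..<d} - {i}. f j (x j))"
    unfolding pd_def by (rule DERIV_imp_deriv[OF DERIV_prod_coord[where f=f, OF assms(1) assms(2)]])
  also have "\<dots> = (\<Prod>j<d. (f(i := deriv (f i))) j (x j))"
    using prod.remove[of "{..<d}" i "\<lambda>j. (f(i := deriv (f i))) j (x j)"] assms(1) by simp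
  finally show "pd i (\<lambda>x. \<Prod>j<d. f j (x j)) x = (\<Prod>j<d. (f(i := deriv (f i))) j (x j))" .
qed

text \<open>A partial derivative of a product of one-variable functions is again such a product,
  with one factor differentiated. Iterated partial derivatives thus stay in one family, for which
  continuity and differentiability are checked once.\<close>

lemma test_fun_prod:
  assumes f: "\<And>j. j < d \<Longrightarrow> flat_span (q j) (f j)"
    and M: "\<And>j x. j < d \<Longrightarrow> f j x \<noteq> 0 \<Longrightarrow> \<bar>x\<bar> \<le> M"
  shows "test_fun d (\<lambda>x. \<Prod>j<d. f j (x j))"
proof -
  have *: "\<exists>g. (\<forall>j<d. flat_span (q j) (g j)) \<and> foldr pd is (\<lambda>x. \<Prod>j<d. f j (x j)) = (\<lambda>x. \<Prod>j<d. g j (x j))"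
    if "set is \<subseteq> {..<d}" for "is"
    using that
  proof (induction "is")
    case Nil
    then show ?case using f by auto
  next
    case (Cons i "is")
    then obtain g where g: "\<And>j. j < d \<Longrightarrow> flat_span (q j) (g j)"
      "foldr pd is (\<lambda>x. \<Prod>j<d. f j (x j)) = (\<lambda>x. \<Prod>j<d. g j (x j))" by auto
    have i: "i < d" using Cons.prems by auto
    show ?case
    proof (intro exI[of _ "g(i := deriv (g i))"] conjI allI impI)
      show "foldr pd (i # is) (\<lambda>x. \<Prod>j<d. f j (x j)) = (\<lambda>x. \<Prod>j<d. (g(i := deriv (g i))) j (x j))"
        using pd_prod[where f=g, OF i flat_span_has_deriv[OF g(1)[OF i]]] g(2) by simp
    qed (use g(1) in \<open>auto intro: flat_span_deriv\<close>)
  qed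
  have c: "continuous_on (Rd d) (\<lambda>x. \<Prod>j<d. g j (x j))" if "\<forall>j<d. flat_span (q j) (g j)" for g
  proof (intro continuous_on_prod)
    fix j assume j: "j \<in> {..<d}"
    have "continuous_on UNIV (g j)"
      by (rule DERIV_continuous_on[where D="deriv (g j)"]) (use flat_span_has_deriv that j in blast)
    moreover have "continuous_on (Rd d) (\<lambda>x::pt. x j)"
      by (rule continuous_on_subset[OF continuous_on_product_coordinates]) auto
    ultimately show "continuous_on (Rd d) (\<lambda>x. g j (x j))"
      by (rule continuous_on_compose2) auto
  qed
  have e: "pd_exists i (\<lambda>x. \<Prod>j<d. g j (x j)) x"
    if "\<forall>j<d. flat_span (q j) (g j)" "i < d" for g i x
  proof -
    have "(g i has_real_derivative deriv (g i) (x i)) (at (x i))"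
      by (rule flat_span_has_deriv) (use that in blast)
    from DERIV_prod_coord[where f=g, OF that(2) this] show ?thesis
      unfolding pd_exists_def real_differentiable_def by blast
  qed
  have b: "\<bar>x i\<bar> \<le> M" if "(\<Prod>j<d. f j (x j)) \<noteq> 0" "i < d" for x i
    using that M by (auto simp: prod_zero_iff)
  show ?thesis
    unfolding test_fun_def
  proof (intro conjI allI impI ballI exI[of _ M])
    fix "is" :: "nat list" assume "set is \<subseteq> {..<d}"
    from *[OF this] obtain g where g: "\<forall>j<d. flat_span (q j) (g j)"
      "foldr pd is (\<lambda>x. \<Prod>j<d. f j (x j)) = (\<lambda>x. \<Prod>j<d. g j (x j))" by blast
    show "continuous_on (Rd d) (foldr pd is (\<lambda>x. \<Prod>j<d. f j (x j)))" unfolding g(2) by (rule c[OF g(1)])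
    show "pd_exists i (foldr pd is (\<lambda>x. \<Prod>j<d. f j (x j))) x" if "i < d" for i x
      unfolding g(2) by (rule e[OF g(1) that])
  qed (use b in auto)
qed

section \<open>Integration on \<open>\<real>\<^sup>d\<close>\<close>

lemma space_leb[simp]: "space (leb d) = Rd d"
  by (simp add: leb_def space_PiM Rd_def)

lemma measurable_coord[measurable]: "i < d \<Longrightarrow> (\<lambda>x. x i) \<in> borel_measurable (leb d)"
  unfolding leb_def using measurable_component_singleton[of i "{..<d}" "\<lambda>_. lborel"] by simp

lemma Rd_upd[simp]: "x \<in> Rd d \<Longrightarrow> i < d \<Longrightarrow> x(i := y) \<in> Rd d"
  by (auto simp: Rd_def PiE_def extensional_def)

text \<open>Continuity on \<open>Rd d\<close> refers to the product topology over all indices,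
  \<open>leb d\<close> to the product \<sigma>-algebra over the first d. Measurability of the
  identity connects them; the coordinates from d on are the constant
  \<open>undefined\<close>.\<close>

lemma measurable_leb_borel: "(\<lambda>x. x) \<in> borel_measurable (leb d)"
proof (rule measurable_coordinatewise_then_product)
  fix i
  show "(\<lambda>x. x i) \<in> borel_measurable (leb d)"
  proof (cases "i < d")
    case False
    have "(\<lambda>x. x i) \<in> borel_measurable (leb d) \<longleftrightarrow> (\<lambda>x. undefined :: real) \<in> borel_measurable (leb d)"
      by (rule measurable_cong) (use False in \<open>auto simp: Rd_def PiE_def extensional_def\<close>)
    then show ?thesis by simp
  qed simp
qed

lemma measurable_pair_continuous_on:
  assumes "continuous_on (I \<times> Rd d) (\<lambda>(t, x). f t x)"
    and "sets M = sets (restrict_space lborel I)"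
  shows "(\<lambda>(t, x). f t x) \<in> borel_measurable (M \<Otimes>\<^sub>M leb d)"
proof -
  have M: "space M = I" using sets_eq_imp_space_eq[OF assms(2)] by (simp add: space_restrict_space)
  have "(\<lambda>t. t) \<in> borel_measurable (restrict_space lborel I)"
    by (rule measurable_restrict_space1) simp
  then have [measurable]: "(\<lambda>t. t) \<in> borel_measurable M"
    using measurable_cong_sets[OF assms(2) refl] by blast
  have [measurable]: "fst \<in> borel_measurable (M \<Otimes>\<^sub>M leb d)"
    by (rule measurable_compose[OF measurable_fst \<open>(\<lambda>t. t) \<in> borel_measurable M\<close>])
  have [measurable]: "snd \<in> borel_measurable (M \<Otimes>\<^sub>M leb d)"
    by (rule measurable_compose[OF measurable_snd measurable_leb_borel])
  have "(\<lambda>p. (fst p, snd p)) \<in> borel_measurable (M \<Otimes>\<^sub>M leb d)"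
    by (intro borel_measurable_Pair) simp_all
  then have "(\<lambda>p. p) \<in> borel_measurable (M \<Otimes>\<^sub>M leb d)" by simp
  then have "(\<lambda>p. p) \<in> measurable (M \<Otimes>\<^sub>M leb d) (restrict_space borel (I \<times> Rd d))"
    by (intro measurable_restrict_space2) (auto simp: space_pair_measure M)
  from measurable_compose[OF this borel_measurable_continuous_on_restrict[OF assms(1)]]
  show ?thesis by simp
qed

lemma measurable_leb_continuous_on:
  assumes "continuous_on (Rd d) f"
  shows "f \<in> borel_measurable (leb d)"
proof -
  have "(\<lambda>x. x) \<in> measurable (leb d) (restrict_space borel (Rd d))"
    by (intro measurable_restrict_space2 measurable_leb_borel) auto
  from measurable_compose[OF this borel_measurable_continuous_on_restrict[OF assms]] show ?thesis
    by simp
qed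

lemma integral_lborel_deriv_eq_0:
  fixes F f :: "real \<Rightarrow> real"
  assumes F: "\<And>y. (F has_real_derivative f y) (at y)"
    and lim: "(F \<longlongrightarrow> 0) at_top" "(F \<longlongrightarrow> 0) at_bot"
  shows "integral\<^sup>L lborel f = 0"
proof (cases "integrable lborel f")
  case int: True
  have eq: "(\<integral>y. indicator {- real n..real n} y *\<^sub>R f y \<partial>lborel) = F (real n) - F (- real n)" for n
  proof -
    have "set_integrable lborel {- real n..real n} f"
      unfolding set_integrable_def by (intro integrable_mult_indicator int) auto
    from set_borel_integral_eq_integral(2)[OF this]
    have "(\<integral>y. indicator {- real n..real n} y *\<^sub>R f y \<partial>lborel) = integral {- real n..real n} f"
      by (simp add: set_lebesgue_integral_def)
    moreover have "(f has_integral F (real n) - F (- real n)) {- real n..real n}"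
      by (rule fundamental_theorem_of_calculus)
         (simp_all add: has_real_derivative_iff_has_vector_derivative[symmetric] DERIV_subset[OF F])
    ultimately show ?thesis by (simp add: integral_unique)
  qed
  have "(\<lambda>n. \<integral>y. indicator {- real n..real n} y *\<^sub>R f y \<partial>lborel) \<longlonglongrightarrow> integral\<^sup>L lborel f"
  proof (rule integral_dominated_convergence[where w="\<lambda>y. norm (f y)"])
    show "AE y in lborel. (\<lambda>n. indicator {- real n..real n} y *\<^sub>R f y) \<longlonglongrightarrow> f y"
    proof (rule AE_I2)
      fix y :: real
      obtain N where N: "\<bar>y\<bar> < real N" using reals_Archimedean2 by blast
      have "\<forall>\<^sub>F n in sequentially. indicator {- real n..real n} y *\<^sub>R f y = f y"
        using eventually_ge_at_top[of N]
      proof eventually_elim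
        case (elim n)
        then have "\<bar>y\<bar> \<le> real n" using N of_nat_mono[OF elim, where 'a=real] by linarith
        then show ?case by (simp add: abs_le_iff)
      qed
      then show "(\<lambda>n. indicator {- real n..real n} y *\<^sub>R f y) \<longlonglongrightarrow> f y" by (rule tendsto_eventually)
    qed
  qed (use int in \<open>auto simp: indicator_def\<close>)
  moreover have "(\<lambda>n. F (real n) - F (- real n)) \<longlonglongrightarrow> 0 - 0"
    by (intro tendsto_diff filterlim_compose[OF lim(1) filterlim_real_sequentially]
        filterlim_compose[OF lim(2) filterlim_compose[OF filterlim_uminus_at_bot_at_top filterlim_real_sequentially]])
  ultimately show ?thesis unfolding eq using LIMSEQ_unique by fastforce
next
  \<comment> \<open>A function that is not integrable has Bochner integral 0 by convention. In the
    product case this spares a proof of integrability along every single line.\<close>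
  case False
  then show ?thesis by (rule not_integrable_integral_eq)
qed

lemma integral_leb_partial_eq_0:
  assumes i: "i < d" and int: "integrable (leb d) f"
    and F: "\<And>x y. x \<in> Rd d \<Longrightarrow> ((\<lambda>y. F (x(i := y))) has_real_derivative f (x(i := y))) (at y)"
    and lim: "\<And>x. x \<in> Rd d \<Longrightarrow> ((\<lambda>y. F (x(i := y))) \<longlongrightarrow> 0) at_top"
      "\<And>x. x \<in> Rd d \<Longrightarrow> ((\<lambda>y. F (x(i := y))) \<longlongrightarrow> 0) at_bot"
  shows "integral\<^sup>L (leb d) f = 0"
proof -
  interpret product_sigma_finite "\<lambda>_::nat. lborel :: real measure" by standard
  let ?I = "{..<d} - {i}"
  have ins: "insert i ?I = {..<d}" using i by auto
  have "integral\<^sup>L (Pi\<^sub>M (insert i ?I) (\<lambda>_. lborel)) f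
      = (\<integral>x. (\<integral>y. f (x(i := y)) \<partial>lborel) \<partial>Pi\<^sub>M ?I (\<lambda>_. lborel :: real measure))"
    by (rule product_integral_insert) (use int in \<open>auto simp: leb_def insert_absorb i\<close>)
  also have "\<dots> = (\<integral>x. 0 \<partial>Pi\<^sub>M ?I (\<lambda>_. lborel :: real measure))"
  proof (rule Bochner_Integration.integral_cong[OF refl])
    fix x :: pt assume "x \<in> space (Pi\<^sub>M ?I (\<lambda>_. lborel :: real measure))"
    \<comment> \<open>A point of the reduced product has no i-th coordinate. Putting 0 there gives a
      point of \<open>Rd d\<close> with the same lines x(i := y).\<close>
    then have x: "x(i := 0) \<in> Rd d"
      using i by (auto simp: space_PiM Rd_def PiE_def extensional_def)
    show "(\<integral>y. f (x(i := y)) \<partial>lborel) = 0"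
      by (rule integral_lborel_deriv_eq_0[where F="\<lambda>y. F (x(i := y))"])
         (use F[OF x] lim[OF x] in auto)
  qed
  finally show ?thesis unfolding ins by (simp add: leb_def)
qed

text \<open>The mean value inequality bounds the difference quotients by g, and dominated
  convergence along sequences gives the limit. Derivatives within a convex S cover both the closed
  time window, one-sided at its end points, and a full coordinate line.\<close>

lemma has_real_derivative_integral:
  fixes f f' :: "real \<Rightarrow> 'a \<Rightarrow> real"
  assumes S: "convex S" "r0 \<in> S" and int: "\<And>r. r \<in> S \<Longrightarrow> integrable M (f r)"
    and f': "f' r0 \<in> borel_measurable M" and g: "integrable M g"
    and deriv: "AE y in M. \<forall>r\<in>S. ((\<lambda>r. f r y) has_real_derivative f' r y) (at r within S) \<and> \<bar>f' r y\<bar> \<le> g y"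
  shows "((\<lambda>r. \<integral>y. f r y \<partial>M) has_real_derivative (\<integral>y. f' r0 y \<partial>M)) (at r0 within S)"
  unfolding has_field_derivative_iff tendsto_at_iff_sequentially comp_def
proof (intro allI impI)
  fix X :: "nat \<Rightarrow> real" assume X: "\<forall>i. X i \<in> S - {r0}" "X \<longlonglongrightarrow> r0"
  have eq: "((\<integral>y. f (X n) y \<partial>M) - (\<integral>y. f r0 y \<partial>M)) / (X n - r0)
      = (\<integral>y. (f (X n) y - f r0 y) / (X n - r0) \<partial>M)" for n
    using X(1) S(2) int by (simp add: Bochner_Integration.integral_diff)
  show "(\<lambda>n. ((\<integral>y. f (X n) y \<partial>M) - (\<integral>y. f r0 y \<partial>M)) / (X n - r0)) \<longlonglongrightarrow> (\<integral>y. f' r0 y \<partial>M)"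
    unfolding eq
  proof (rule integral_dominated_convergence[OF f' _ g])
    show "(\<lambda>y. (f (X n) y - f r0 y) / (X n - r0)) \<in> borel_measurable M" for n
      using int[of "X n"] int[OF S(2)] X(1) by (intro borel_measurable_divide borel_measurable_diff) auto
    show "AE y in M. (\<lambda>n. (f (X n) y - f r0 y) / (X n - r0)) \<longlonglongrightarrow> f' r0 y"
      using deriv
    proof eventually_elim
      case (elim y)
      then have "((\<lambda>r. f r y) has_real_derivative f' r0 y) (at r0 within S)" using S(2) by auto
      then show ?case
        using X unfolding has_field_derivative_iff tendsto_at_iff_sequentially comp_def by blast
    qed
    show "AE y in M. norm ((f (X n) y - f r0 y) / (X n - r0)) \<le> g y" for n
      using deriv
    proof eventually_elim
      case (elim y)
      have "norm (f (X n) y - f r0 y) \<le> g y * norm (X n - r0)"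
        by (rule field_differentiable_bound[OF S(1), where f'="\<lambda>r. f' r y"]) (use elim X(1) S(2) in auto)
      then show ?case using X(1) by (auto simp: divide_simps)
    qed
  qed
qed

section \<open>Uniqueness of weak gradients\<close>

lemma cube_I: "x \<in> Rd d \<Longrightarrow> (\<And>j. j < d \<Longrightarrow> \<bar>x j\<bar> < m) \<Longrightarrow> x \<in> Pi\<^sub>E {..<d} (\<lambda>j. {- m<..<m})"
  by (rule PiE_I) (force simp: abs_less_iff Rd_def PiE_def extensional_def)+

text \<open>Open boxes are wanted as the generator because they are stable under intersection and
  because products of bumps converge to exactly their indicators.\<close>

lemma sets_leb_boxes:
  "sets (leb d) = sigma_sets (Rd d) {Pi\<^sub>E {..<d} (\<lambda>j. {a j<..<c j}) | a c. True}"
proof -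
  let ?E = "range (\<lambda>(a::real, b). {a<..<b})"
  have "sets (leb d) = sets (Pi\<^sub>M {..<d} (\<lambda>_. sigma UNIV ?E))"
    unfolding leb_def
  proof (intro sets_PiM_cong refl)
    show "sets lborel = sets (sigma UNIV ?E)"
      using arg_cong[OF borel_eq_box[where 'a=real], of sets] unfolding box_real sets_lborel .
  qed
  also have "\<dots> = sets (sigma (Pi\<^sub>E {..<d} (\<lambda>_. UNIV))
      {{f \<in> (\<Pi>\<^sub>E i\<in>{..<d}. UNIV). \<forall>i\<in>j. f i \<in> A i} |A j. j \<in> {{..<d}} \<and> A \<in> (\<Pi> i\<in>j. ?E)})"
  proof (rule sets_PiM_sigma)
    fix i
    have "UNIV = (\<Union>n. {- real n <..< real n})"
    proof (intro equalityI subsetI)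
      fix x :: real
      obtain n where "\<bar>x\<bar> < real n" using reals_Archimedean2 by blast
      then have "x \<in> {- real n <..< real n}" by (simp add: abs_less_iff)
      then show "x \<in> (\<Union>n. {- real n <..< real n})" by blast
    qed simp
    then show "\<exists>S\<subseteq>?E. countable S \<and> UNIV = \<Union> S"
      by (intro exI[of _ "range (\<lambda>n. {- real n <..< real n})"]) auto
  qed auto
  also have "\<dots> = sigma_sets (Rd d) {{f \<in> (\<Pi>\<^sub>E i\<in>{..<d}. UNIV). \<forall>i\<in>j. f i \<in> A i} |A j. j \<in> {{..<d}} \<and> A \<in> (\<Pi> i\<in>j. ?E)}"
    by (subst sets_measure_of) (auto simp: Rd_def)
  also have "{{f \<in> (\<Pi>\<^sub>E i\<in>{..<d}. UNIV). \<forall>i\<in>j. f i \<in> A i} |A j. j \<in> {{..<d}} \<and> A \<in> (\<Pi> i\<in>j. ?E)}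
     = {Pi\<^sub>E {..<d} (\<lambda>j. {a j<..<c j}) | a c. True}"
  proof (intro equalityI subsetI)
    fix X :: "pt set" assume "X \<in> {{f \<in> (\<Pi>\<^sub>E i\<in>{..<d}. UNIV). \<forall>i\<in>j. f i \<in> A i} |A j. j \<in> {{..<d}} \<and> A \<in> (\<Pi> i\<in>j. ?E)}"
    then obtain A j where "X = {f \<in> (\<Pi>\<^sub>E i\<in>{..<d}. UNIV). \<forall>i\<in>j. f i \<in> A i}" "j = {..<d}" "A \<in> (\<Pi> i\<in>j. ?E)"
      by (elim CollectE exE conjE singletonE)
    then have A: "X = {f \<in> (\<Pi>\<^sub>E i\<in>{..<d}. UNIV). \<forall>i\<in>{..<d}. f i \<in> A i}" "A \<in> (\<Pi> i\<in>{..<d}. ?E)"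
      by simp_all
    have "\<forall>i\<in>{..<d}. \<exists>a c. A i = {a<..<c}"
    proof
      fix i assume "i \<in> {..<d}"
      with A(2) have "A i \<in> ?E" by (rule Pi_mem)
      then show "\<exists>a c. A i = {a<..<c}" by (rule imageE) (simp add: case_prod_beta, blast)
    qed
    then obtain a c where "\<forall>i\<in>{..<d}. A i = {a i<..<c i}" by metis
    then have "X = Pi\<^sub>E {..<d} (\<lambda>j. {a j<..<c j})" unfolding A(1) by (auto simp: PiE_def Pi_def)
    then show "X \<in> {Pi\<^sub>E {..<d} (\<lambda>j. {a j<..<c j}) | a c. True}" by blast
  next
    fix X :: "pt set" assume "X \<in> {Pi\<^sub>E {..<d} (\<lambda>j. {a j<..<c j}) | a c. True}"
    then obtain a c :: pt where X: "X = Pi\<^sub>E {..<d} (\<lambda>j. {a j<..<c j})" by blast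
    show "X \<in> {{f \<in> (\<Pi>\<^sub>E i\<in>{..<d}. UNIV). \<forall>i\<in>j. f i \<in> A i} |A j. j \<in> {{..<d}} \<and> A \<in> (\<Pi> i\<in>j. ?E)}"
      unfolding X
      by (rule CollectI, rule exI[of _ "\<lambda>j. {a j<..<c j}"], rule exI[of _ "{..<d}"])
         (auto simp: PiE_def Pi_def)
  qed
  finally show ?thesis .
qed

lemma sets_box[measurable]: "Pi\<^sub>E {..<d} (\<lambda>j. {a j<..<c j :: real}) \<in> sets (leb d)"
  unfolding leb_def by (rule sets_PiM_I_finite) auto

text \<open>Dynkin's argument: the sets over which f integrates to 0 are closed under disjoint
  unions, and under complements because the integral over the whole space is the limit of the
  integrals over growing cubes. Afterwards the sets {f > 0} and {f < 0} may be taken.\<close>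

lemma AE_eq_0_of_boxes:
  fixes f :: "pt \<Rightarrow> real"
  assumes int: "integrable (leb d) f"
    and box: "\<And>a c. (\<And>j. j < d \<Longrightarrow> a j < c j) \<Longrightarrow> (LINT x:Pi\<^sub>E {..<d} (\<lambda>j. {a j<..<c j})|leb d. f x) = 0"
  shows "AE x in leb d. f x = 0"
proof -
  have [measurable]: "f \<in> borel_measurable (leb d)" using int by auto
  have si: "set_integrable (leb d) A f" if "A \<in> sets (leb d)" for A
    unfolding set_integrable_def by (intro integrable_mult_indicator int that)
  have all: "(LINT x:A|leb d. f x) = 0" if "A \<in> sets (leb d)" for A
  proof -
    have "Int_stable {Pi\<^sub>E {..<d} (\<lambda>j. {a j<..<c j :: real}) | a c. True}"
    proof (rule Int_stableI)
      fix X Y assume "X \<in> {Pi\<^sub>E {..<d} (\<lambda>j. {a j<..<c j :: real}) | a c. True}"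
        and "Y \<in> {Pi\<^sub>E {..<d} (\<lambda>j. {a j<..<c j :: real}) | a c. True}"
      then obtain a c a' c' :: pt where XY: "X = Pi\<^sub>E {..<d} (\<lambda>j. {a j<..<c j})" "Y = Pi\<^sub>E {..<d} (\<lambda>j. {a' j<..<c' j})"
        by blast
      have "X \<inter> Y = Pi\<^sub>E {..<d} (\<lambda>j. {max (a j) (a' j)<..<min (c j) (c' j)})"
        unfolding XY PiE_Int by (rule PiE_cong) auto
      then show "X \<inter> Y \<in> {Pi\<^sub>E {..<d} (\<lambda>j. {a j<..<c j :: real}) | a c. True}"
        by (intro CollectI exI[of _ "\<lambda>j. max (a j) (a' j)"] exI[of _ "\<lambda>j. min (c j) (c' j)"] conjI TrueI)
    qed
    moreover have "{Pi\<^sub>E {..<d} (\<lambda>j. {a j<..<c j :: real}) | a c. True} \<subseteq> Pow (Rd d)"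
      by (auto simp: Rd_def PiE_def)
    moreover have "A \<in> sigma_sets (Rd d) {Pi\<^sub>E {..<d} (\<lambda>j. {a j<..<c j}) | a c. True}"
      using that by (simp add: sets_leb_boxes)
    ultimately show ?thesis
    proof (induction rule: sigma_sets_induct_disjoint)
      case (basic A)
      then obtain a c :: pt where A: "A = Pi\<^sub>E {..<d} (\<lambda>j. {a j<..<c j})" by blast
      show ?case
      proof (cases "\<forall>j<d. a j < c j")
        case True then show ?thesis using box A by simp
      next
        case False
        then obtain j where "j < d" "c j \<le> a j" by (auto simp: not_less)
        then have "A = {}" unfolding A PiE_eq_empty_iff by force
        then show ?thesis by (simp add: set_lebesgue_integral_def)
      qed
    next
      case empty show ?case by (simp add: set_lebesgue_integral_def)
    next
      case (compl A)
      then have A: "A \<in> sets (leb d)" by (simp add: sets_leb_boxes)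
      have "(\<lambda>n. LINT x:Pi\<^sub>E {..<d} (\<lambda>j. {- real (Suc n)<..<real (Suc n)})|leb d. f x) \<longlonglongrightarrow> integral\<^sup>L (leb d) f"
        unfolding set_lebesgue_integral_def
      proof (rule integral_dominated_convergence[where w="\<lambda>x. norm (f x)"])
        show "AE x in leb d. (\<lambda>n. indicator (Pi\<^sub>E {..<d} (\<lambda>j. {- real (Suc n)<..<real (Suc n)})) x *\<^sub>R f x) \<longlonglongrightarrow> f x"
        proof (rule AE_I2)
          fix x assume x: "x \<in> space (leb d)"
          have "finite ((\<lambda>j. \<bar>x j\<bar>) ` {..<d})" by simp
          obtain N where N: "(\<Sum>j<d. \<bar>x j\<bar>) < real N" using reals_Archimedean2 by blast
          have "\<forall>\<^sub>F n in sequentially. indicator (Pi\<^sub>E {..<d} (\<lambda>j. {- real (Suc n)<..<real (Suc n)})) x *\<^sub>R f x = f x"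
            using eventually_ge_at_top[of N]
          proof eventually_elim
            case (elim n)
            have "\<bar>x j\<bar> < real (Suc n)" if "j < d" for j
            proof -
              have "\<bar>x j\<bar> \<le> (\<Sum>j<d. \<bar>x j\<bar>)" by (rule member_le_sum) (use that in auto)
              then show ?thesis using N of_nat_mono[OF elim, where 'a=real] by simp
            qed
            then have "x \<in> Pi\<^sub>E {..<d} (\<lambda>j. {- real (Suc n)<..<real (Suc n)})"
              using x by (intro cube_I) auto
            then show ?case by simp
          qed
          then show "(\<lambda>n. indicator (Pi\<^sub>E {..<d} (\<lambda>j. {- real (Suc n)<..<real (Suc n)})) x *\<^sub>R f x) \<longlonglongrightarrow> f x"
            by (rule tendsto_eventually)
        qed
      qed (use int in \<open>auto simp: indicator_def\<close>)
      moreover have "(LINT x:Pi\<^sub>E {..<d} (\<lambda>j. {- real (Suc n)<..<real (Suc n)})|leb d. f x) = 0" for n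
        by (rule box) simp
      ultimately have "integral\<^sup>L (leb d) f = 0" by (simp only: LIMSEQ_const_iff)
      moreover have "(LINT x:Rd d - A|leb d. f x) = (\<integral>x. f x - indicator A x *\<^sub>R f x \<partial>leb d)"
        unfolding set_lebesgue_integral_def
        by (rule Bochner_Integration.integral_cong) (auto simp: indicator_def)
      moreover have "\<dots> = integral\<^sup>L (leb d) f - (LINT x:A|leb d. f x)"
        unfolding set_lebesgue_integral_def
        by (rule Bochner_Integration.integral_diff[OF int si[OF A, unfolded set_integrable_def]])
      ultimately show ?case using compl by simp
    next
      case (union A)
      then have A: "A i \<in> sets (leb d)" for i by (auto simp: sets_leb_boxes)
      then have "(LINT x:(\<Union>i. A i)|leb d. f x) = (\<Sum>i. LINT x:A i|leb d. f x)"
        using union(1) by (intro lebesgue_integral_countable_add si) (auto simp: disjoint_family_on_def)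
      then show ?case using union by simp
    qed
  qed
  have pos: "AE x in leb d. f x \<le> 0" if "\<And>A. A \<in> sets (leb d) \<Longrightarrow> (LINT x:A|leb d. f x) = 0"
    "integrable (leb d) f" for f :: "pt \<Rightarrow> real"
  proof -
    have [measurable]: "f \<in> borel_measurable (leb d)" using that(2) by auto
    let ?A = "{x \<in> space (leb d). 0 < f x}"
    have "?A \<in> sets (leb d)" by measurable
    from that(1)[OF this] have "(\<integral>x. indicator ?A x * f x \<partial>leb d) = 0"
      by (simp add: set_lebesgue_integral_def)
    moreover have "integrable (leb d) (\<lambda>x. indicator ?A x * f x)"
      using integrable_mult_indicator[OF \<open>?A \<in> sets (leb d)\<close> that(2)] by simp
    moreover have "AE x in leb d. 0 \<le> indicator ?A x * f x" by (auto simp: indicator_def)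
    ultimately have "AE x in leb d. indicator ?A x * f x = 0"
      using integral_nonneg_eq_0_iff_AE by blast
    then show ?thesis using AE_space by eventually_elim (auto simp: indicator_def split: if_splits)
  qed
  have "AE x in leb d. f x \<le> 0" by (rule pos[OF all int])
  moreover have "AE x in leb d. - f x \<le> 0"
    by (rule pos) (use all int in \<open>auto simp: set_lebesgue_integral_def\<close>)
  ultimately show ?thesis by eventually_elim auto
qed

lemma flat_span_integrable:
  assumes "flat_span q f" "\<And>x. x \<notin> {a..c} \<Longrightarrow> f x = 0"
  shows "integrable lborel f"
proof -
  have "continuous_on {a..c} f"
    by (rule DERIV_continuous_on[where D="deriv f"])
       (use flat_span_has_deriv[OF assms(1)] has_field_derivative_at_within in blast)
  then have "integrable lborel (\<lambda>x. indicator {a..c} x *\<^sub>R f x)"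
    by (intro borel_integrable_compact) auto
  moreover have "(\<lambda>x. indicator {a..c} x *\<^sub>R f x) = f"
    using assms(2) by (fastforce simp: indicator_def)
  ultimately show ?thesis by simp
qed

lemma bump_outside:
  assumes "a < c" "0 \<le> n" "x \<notin> {a..c}"
  shows "bump n a c x = 0" "deriv (bump n a c) x = 0"
  using assms flat_span_zero[OF bump_span bump_poly_nonpos, of n a c x]
    flat_span_zero[OF flat_span_deriv[OF bump_span] bump_poly_nonpos, of n a c x] by auto

lemma integrable_leb_prod:
  assumes "\<And>j. j < d \<Longrightarrow> integrable lborel (f j)"
  shows "integrable (leb d) (\<lambda>x. \<Prod>j<d. f j (x j) :: real)"
proof -
  interpret product_sigma_finite "\<lambda>_::nat. lborel :: real measure" by standard
  show ?thesis unfolding leb_def by (rule product_integrable_prod) (use assms in auto)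
qed

text \<open>The norm of \<open>V\<close> refers to a chosen weak gradient; for differentiable \<open>\<psi>\<close> it must be identified with
  the classical one.\<close>

lemma weak_grad_unique:
  assumes i: "i < d"
    and f: "continuous_on (Rd d) f" "\<And>x. x \<in> Rd d \<Longrightarrow> \<bar>f x\<bar> \<le> B"
    and g: "continuous_on (Rd d) g" "\<And>x. x \<in> Rd d \<Longrightarrow> \<bar>g x\<bar> \<le> B"
    and fg: "\<And>x. x \<in> Rd d \<Longrightarrow> ((\<lambda>y. f (x(i := y))) has_real_derivative g x) (at (x i))"
    and G: "weak_grad d f G" "(\<lambda>x. G x i) \<in> borel_measurable (leb d)"
  shows "AE x in leb d. G x i = g x"
proof -
  note [measurable] = G(2) measurable_leb_continuous_on[OF f(1)] measurable_leb_continuous_on[OF g(1)]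
  let ?box = "\<lambda>a c. Pi\<^sub>E {..<d} (\<lambda>j. {a j<..<c j :: real})"
  let ?eta = "\<lambda>n a c x. \<Prod>j<d. bump n (a j) (c j) (x j)"
  define D where "D x = G x i - g x" for x
  have [measurable]: "D \<in> borel_measurable (leb d)" unfolding D_def by measurable
  have fin: "finite {..<d}" by simp
  have tf: "test_fun d (?eta n a c)" if ac: "\<And>j. j < d \<Longrightarrow> a j < c j" and n: "0 \<le> n" for a c n
  proof (rule test_fun_prod)
    fix j x assume j: "j < d" and nz: "bump n (a j) (c j) x \<noteq> 0"
    then have "a j \<le> x \<and> x \<le> c j" using bump_outside(1)[OF ac[OF j] n, of x] by force
    moreover have "\<bar>a j\<bar> + \<bar>c j\<bar> \<le> (\<Sum>j<d. \<bar>a j\<bar> + \<bar>c j\<bar>)"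
      using j by (intro member_le_sum[where f="\<lambda>j. \<bar>a j\<bar> + \<bar>c j\<bar>"]) auto
    ultimately show "\<bar>x\<bar> \<le> (\<Sum>j<d. \<bar>a j\<bar> + \<bar>c j\<bar>)" by linarith
  qed (rule bump_span)
  have bm: "bump n a c \<in> borel_measurable borel" for n a c
    by (intro borel_measurable_continuous_onI DERIV_continuous_on[where D="deriv (bump n a c)"])
       (use flat_span_has_deriv[OF bump_span] has_field_derivative_at_within in blast)
  have em[measurable]: "?eta n a c \<in> borel_measurable (leb d)" for n a c
    by (intro borel_measurable_prod measurable_compose[OF measurable_coord bm]) auto
  have prod01: "0 \<le> ?eta n a c x" "?eta n a c x \<le> 1" for n a c x
    by (auto intro!: prod_nonneg prod_le_1 bump_nonneg bump_le_1)
  have eta0: "?eta n a c x = 0" if ac: "\<And>j. j < d \<Longrightarrow> a j < c j" and n: "0 \<le> n" and x: "x \<in> Rd d" "x \<notin> ?box a c" for n a c x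
  proof -
    have "\<exists>j<d. \<not> (a j < x j \<and> x j < c j)" using x by (auto simp: Rd_def PiE_def Pi_def)
    then obtain j where "j < d" "bump n (a j) (c j) (x j) = 0" using bump_zero[OF n ac] by blast
    then show ?thesis by (simp add: prod_zero_iff) blast
  qed
  have key: "(\<integral>x. D x * ?eta n a c x \<partial>leb d) = 0"
    and keyi: "integrable (leb d) (\<lambda>x. G x i * ?eta n a c x)"
    if ac: "\<And>j. j < d \<Longrightarrow> a j < c j" and n: "0 \<le> n" for a c n
  proof -
    let ?e = "?eta n a c"
    let ?b = "(\<lambda>j. bump n (a j) (c j))"
    let ?p = "\<lambda>x. \<Prod>j<d. (?b(i := deriv (?b i))) j (x j)"
    have pd: "pd i ?e = ?p"
      by (rule pd_prod[where f="?b", OF i flat_span_has_deriv[OF bump_span]])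
    have tff: "test_fun d ?e" by (rule tf) (use ac n in auto)
    have w: "integrable (leb d) (\<lambda>x. f x * ?p x)" "integrable (leb d) (\<lambda>x. G x i * ?e x)"
      "(\<integral>x. f x * ?p x \<partial>leb d) = - (\<integral>x. G x i * ?e x \<partial>leb d)"
      using G(1)[unfolded weak_grad_def, rule_format, OF tff i] unfolding pd by auto
    show "integrable (leb d) (\<lambda>x. G x i * ?e x)" by (rule w(2))
    have ei: "integrable (leb d) ?e"
    proof (rule integrable_leb_prod)
      fix j assume "j < d"
      then show "integrable lborel (bump n (a j) (c j))"
        using bump_outside(1)[OF ac n] by (intro flat_span_integrable[OF bump_span]) blast
    qed
    have gi: "integrable (leb d) (\<lambda>x. g x * ?e x)"
    proof (rule Bochner_Integration.integrable_bound)
      show "integrable (leb d) (\<lambda>x. B * ?e x)" using ei by simp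
      show "AE x in leb d. norm (g x * ?e x) \<le> norm (B * ?e x)"
        using g(2) prod01 by (intro AE_I2) (force simp: abs_mult intro!: mult_right_mono)
    qed measurable
    \<comment> \<open>The integrand is the i-th partial derivative of f times the bump, and the bump
      cuts off the boundary terms. Comparison with the weak identity shows that G and g integrate
      equally against every product of bumps.\<close>
    have "(\<integral>x. g x * ?e x + f x * ?p x \<partial>leb d) = 0"
    proof (rule integral_leb_partial_eq_0[OF i, where F="\<lambda>x. f x * ?e x"])
      show "integrable (leb d) (\<lambda>x. g x * ?e x + f x * ?p x)" using gi w(1) by simp
      fix x assume x: "x \<in> Rd d"
      have ev: "f (x(i := y)) * ?e (x(i := y)) = 0" if "y \<notin> {a i..c i}" for y
        using bump_outside(1)[OF ac[OF i] n that] i by (auto simp: prod_zero_iff intro!: bexI[of _ i])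
      show "((\<lambda>y. f (x(i := y)) * ?e (x(i := y))) \<longlongrightarrow> 0) at_top"
        by (rule tendsto_eventually)
           (use eventually_gt_at_top[of "c i"] in eventually_elim, use ev in auto)
      show "((\<lambda>y. f (x(i := y)) * ?e (x(i := y))) \<longlongrightarrow> 0) at_bot"
        by (rule tendsto_eventually)
           (use eventually_gt_at_bot[of "a i"] in eventually_elim, use ev in auto)
      fix y
      have "((\<lambda>y. f (x(i := y))) has_real_derivative g (x(i := y))) (at y)"
        using fg[OF Rd_upd[OF x i, of y]] by simp
      moreover have "((\<lambda>y. ?e (x(i := y))) has_real_derivative ?p (x(i := y))) (at y)"
      proof -
        have "((\<lambda>y. ?e (x(i := y))) has_real_derivative deriv (?b i) y * (\<Prod>j\<in>{..<d} - {i}. ?b j (x j))) (at y)"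
          by (rule DERIV_prod_coord[where f="?b", OF i flat_span_has_deriv[OF bump_span]])
        moreover have "?p (x(i := y)) = deriv (?b i) y * (\<Prod>j\<in>{..<d} - {i}. ?b j (x j))"
          using prod.remove[OF fin, of i "\<lambda>j. (?b(i := deriv (?b i))) j ((x(i := y)) j)"] i
          by (auto intro!: prod.cong)
        ultimately show ?thesis by simp
      qed
      ultimately show "((\<lambda>y. f (x(i := y)) * ?e (x(i := y))) has_real_derivative
          g (x(i := y)) * ?e (x(i := y)) + f (x(i := y)) * ?p (x(i := y))) (at y)"
        using DERIV_mult by (fastforce simp: algebra_simps)
    qed
    then have "(\<integral>x. G x i * ?e x \<partial>leb d) = (\<integral>x. g x * ?e x \<partial>leb d)"
      using gi w by (simp add: Bochner_Integration.integral_add)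
    then show "(\<integral>x. D x * ?e x \<partial>leb d) = 0"
      using gi w(2) by (simp add: D_def left_diff_distrib)
  qed
  let ?Q = "\<lambda>m::nat. ?box (\<lambda>_. - real (Suc m)) (\<lambda>_. real (Suc m))"
  \<comment> \<open>A weak gradient is integrable only against test functions. The bump of the
    enlarged cube is at least exp(-1) per coordinate on the cube, so exp(d) times it dominates the
    indicator.\<close>
  have Qi: "integrable (leb d) (\<lambda>x. indicator (?Q m) x * D x)" for m
  proof (rule Bochner_Integration.integrable_bound)
    let ?e = "?eta 1 (\<lambda>_. - real (Suc m) - 1) (\<lambda>_. real (Suc m) + 1)"
    have ei: "integrable (leb d) ?e"
    proof (rule integrable_leb_prod)
      show "integrable lborel (bump 1 (- real (Suc m) - 1) (real (Suc m) + 1))"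
        using bump_outside(1)[of "- real (Suc m) - 1" "real (Suc m) + 1" 1]
        by (intro flat_span_integrable[OF bump_span]) auto
    qed
    have gi: "integrable (leb d) (\<lambda>x. g x * ?e x)"
    proof (rule Bochner_Integration.integrable_bound)
      show "integrable (leb d) (\<lambda>x. B * ?e x)" using ei by simp
      show "AE x in leb d. norm (g x * ?e x) \<le> norm (B * ?e x)"
        using g(2) prod01 by (intro AE_I2) (force simp: abs_mult intro!: mult_right_mono)
    qed measurable
    have "integrable (leb d) (\<lambda>x. G x i * ?e x)" by (rule keyi) auto
    then have "integrable (leb d) (\<lambda>x. D x * ?e x)" using gi by (simp add: D_def left_diff_distrib)
    then show "integrable (leb d) (\<lambda>x. exp (real d) * (D x * ?e x))" by simp
    show "AE x in leb d. norm (indicator (?Q m) x * D x) \<le> norm (exp (real d) * (D x * ?e x))"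
    proof (rule AE_I2)
      fix x
      show "norm (indicator (?Q m) x * D x) \<le> norm (exp (real d) * (D x * ?e x))"
      proof (cases "x \<in> ?Q m")
        case True
        have "(\<Prod>j<d. exp (- 1)) \<le> ?e x"
          using True by (intro prod_mono conjI bump_ge) (auto simp: PiE_def Pi_def)
        then have "exp (- real d) \<le> ?e x" by (simp add: exp_of_nat_mult[symmetric])
        then have "1 \<le> exp (real d) * ?e x" by (simp add: exp_minus field_simps)
        then have "\<bar>D x\<bar> * 1 \<le> \<bar>D x\<bar> * (exp (real d) * ?e x)" by (intro mult_left_mono) auto
        then show ?thesis using True prod01(1)[of 1] by (simp add: abs_mult mult_ac)
      qed simp
    qed
  qed measurable
  have "AE x in leb d. \<forall>m. indicator (?Q m) x * D x = 0"
  proof (subst AE_all_countable, intro allI)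
    fix m
    show "AE x in leb d. indicator (?Q m) x * D x = 0"
    proof (rule AE_eq_0_of_boxes[OF Qi])
      fix a c :: pt
      \<comment> \<open>Intersecting with the cube keeps the box inside the region where D is known
        to be integrable; if nothing is left, the integral is trivially 0.\<close>
      let ?a = "\<lambda>j. max (a j) (- real (Suc m))" and ?c = "\<lambda>j. min (c j) (real (Suc m))"
      have int: "?box a c \<inter> ?Q m = ?box ?a ?c" by (auto simp: PiE_def Pi_def)
      have eq: "(LINT x:?box a c|leb d. indicator (?Q m) x * D x) = (\<integral>x. indicator (?box ?a ?c) x * D x \<partial>leb d)"
        unfolding set_lebesgue_integral_def int[symmetric]
        by (rule Bochner_Integration.integral_cong) (auto simp: indicator_def)
      show "(LINT x:?box a c|leb d. indicator (?Q m) x * D x) = 0"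
      proof (cases "\<forall>j<d. ?a j < ?c j")
        case True
        \<comment> \<open>Sharpening the bumps replaces them by the indicator of the box; D
          restricted to the cube is the dominating function.\<close>
        have "(\<lambda>n. \<integral>x. D x * ?eta (real (Suc n)) ?a ?c x \<partial>leb d) \<longlonglongrightarrow> (\<integral>x. indicator (?box ?a ?c) x * D x \<partial>leb d)"
        proof (rule integral_dominated_convergence[where w="\<lambda>x. norm (indicator (?Q m) x * D x)"])
          show "AE x in leb d. (\<lambda>n. D x * ?eta (real (Suc n)) ?a ?c x) \<longlonglongrightarrow> indicator (?box ?a ?c) x * D x"
          proof (rule AE_I2)
            fix x assume "x \<in> space (leb d)"
            then have "indicator (?box ?a ?c) x = (\<Prod>j<d. indicator {?a j<..<?c j} (x j) :: real)"
              by (auto simp: indicator_def Rd_def PiE_def Pi_def prod_zero_iff split: if_splits)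
            moreover have "(\<lambda>n. D x * ?eta (real (Suc n)) ?a ?c x) \<longlonglongrightarrow> D x * (\<Prod>j<d. indicator {?a j<..<?c j} (x j) :: real)"
              by (intro tendsto_mult tendsto_const tendsto_prod bump_tendsto) (use True in auto)
            ultimately show "(\<lambda>n. D x * ?eta (real (Suc n)) ?a ?c x) \<longlonglongrightarrow> indicator (?box ?a ?c) x * D x"
              by (simp add: mult.commute)
          qed
          show "AE x in leb d. norm (D x * ?eta (real (Suc n)) ?a ?c x) \<le> norm (indicator (?Q m) x * D x)" for n
          proof (rule AE_I2)
            fix x assume x: "x \<in> space (leb d)"
            show "norm (D x * ?eta (real (Suc n)) ?a ?c x) \<le> norm (indicator (?Q m) x * D x)"
            proof (cases "x \<in> ?box ?a ?c")
              case True
              then have "x \<in> ?Q m" using int by blast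
              then show ?thesis using prod01[of "real (Suc n)" ?a ?c x]
                by (simp add: abs_mult mult_left_le)
            next
              case False
              then have "?eta (real (Suc n)) ?a ?c x = 0" using True x by (intro eta0) auto
              then show ?thesis by (simp only: mult_zero_right norm_zero norm_ge_zero)
            qed
          qed
          show "integrable (leb d) (\<lambda>x. norm (indicator (?Q m) x * D x))" by (intro integrable_norm Qi)
        qed measurable
        moreover have "(\<integral>x. D x * ?eta (real (Suc n)) ?a ?c x \<partial>leb d) = 0" for n
          by (rule key) (use True in auto)
        ultimately show ?thesis unfolding eq by (simp only: LIMSEQ_const_iff)
      next
        case False
        then obtain j where "j < d" "?c j \<le> ?a j" by (meson not_less)
        then have "?box ?a ?c = {}" unfolding PiE_eq_empty_iff by force
        then show ?thesis unfolding eq by simp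
      qed
    qed
  qed
  then show ?thesis using AE_space
  proof eventually_elim
    case (elim x)
    obtain m where m: "(\<Sum>j<d. \<bar>x j\<bar>) < real m" using reals_Archimedean2 by blast
    have "\<bar>x j\<bar> < real (Suc m)" if "j < d" for j
    proof -
      have "\<bar>x j\<bar> \<le> (\<Sum>j<d. \<bar>x j\<bar>)" by (rule member_le_sum) (use that in auto)
      then show ?thesis using m by simp
    qed
    then have "x \<in> ?Q m" using elim(2) by (intro cube_I) auto
    then show ?case using elim(1)[rule_format, of m] by (simp add: D_def)
  qed
qed

section \<open>The Ornstein-Uhlenbeck kernel\<close>

text \<open>For positive times the square of \<open>sigma_ou\<close>, written without a root so that
  it can be differentiated directly.\<close>

definition var_ou :: "real \<Rightarrow> real" where "var_ou \<tau> = 1 - exp (- 2 * \<tau>)"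

text \<open>\<open>ksl\<close> is the logarithmic derivative in \<open>y\<close> of the one-dimensional kernel; \<open>kt\<close>, \<open>kx\<close>, \<open>kj\<close> and \<open>kjx\<close> are
  \<open>\<partial>\<^sub>\<tau> k\<close>, \<open>\<partial>\<^sub>i k\<close>, the flux \<open>x\<^sub>i k + \<partial>\<^sub>i k\<close> and its derivative \<open>\<partial>\<^sub>i (x\<^sub>i k + \<partial>\<^sub>i k)\<close>.\<close>

definition ksl :: "real \<Rightarrow> real \<Rightarrow> real \<Rightarrow> real" where
  "ksl \<tau> a y = - (y - mu_ou \<tau> * a) / var_ou \<tau>"

text \<open>The logarithmic time derivative of the one-dimensional kernel. By the one-dimensional
  Fokker-Planck equation it is also the derivative of the flux divided by the kernel, so one factor
  serves both \<open>kt\<close> and \<open>kjx\<close>.\<close>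

definition kb :: "real \<Rightarrow> real \<Rightarrow> real \<Rightarrow> real" where
  "kb \<tau> a y = - (mu_ou \<tau>)\<^sup>2 / var_ou \<tau> - (y - mu_ou \<tau> * a) * (mu_ou \<tau> * a) / var_ou \<tau>
     + (y - mu_ou \<tau> * a)\<^sup>2 * (mu_ou \<tau>)\<^sup>2 / (var_ou \<tau>)\<^sup>2"

definition kt :: "nat \<Rightarrow> real \<Rightarrow> pt \<Rightarrow> pt \<Rightarrow> real" where
  "kt d \<tau> a x = ou_kernel d \<tau> a x * (\<Sum>i<d. kb \<tau> (a i) (x i))"

definition kx :: "nat \<Rightarrow> nat \<Rightarrow> real \<Rightarrow> pt \<Rightarrow> pt \<Rightarrow> real" where
  "kx d i \<tau> a x = ou_kernel d \<tau> a x * ksl \<tau> (a i) (x i)"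

definition kj :: "nat \<Rightarrow> nat \<Rightarrow> real \<Rightarrow> pt \<Rightarrow> pt \<Rightarrow> real" where
  "kj d i \<tau> a x = ou_kernel d \<tau> a x * (x i + ksl \<tau> (a i) (x i))"

definition kjx :: "nat \<Rightarrow> nat \<Rightarrow> real \<Rightarrow> pt \<Rightarrow> pt \<Rightarrow> real" where
  "kjx d i \<tau> a x = ou_kernel d \<tau> a x * kb \<tau> (a i) (x i)"

definition sq :: "nat \<Rightarrow> pt \<Rightarrow> real" where "sq d x = (\<Sum>i<d. (x i)\<^sup>2)"

text \<open>The exponent 1/8 is what remains of the 1/2 in a Gaussian of variance at most 1 after
  half of it is spent on the shift of the mean and half of the rest on a factor 1 + |x|^2.\<close>

definition gauss_env :: "nat \<Rightarrow> pt \<Rightarrow> real" where "gauss_env d x = exp (- sq d x / 8)"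

text \<open>This is the Fokker-Planck equation of the kernel. It reduces to distributivity because
  both sides are built from \<open>kb\<close>; the analytic content sits in
  \<open>ou_kernel_DERIV_time\<close> and \<open>kj_DERIV\<close>.\<close>

lemma kt_sum: "kt d \<tau> a x = (\<Sum>i<d. kjx d i \<tau> a x)"
  by (simp add: kt_def kjx_def sum_distrib_left)

lemma var_ou_pos: "0 < \<tau> \<Longrightarrow> 0 < var_ou \<tau>"
  by (simp add: var_ou_def)

lemma sigma_ou_sq: "0 < \<tau> \<Longrightarrow> (sigma_ou \<tau>)\<^sup>2 = var_ou \<tau>"
  by (simp add: sigma_ou_def var_ou_def)

lemma mu_ou_sq: "(mu_ou \<tau>)\<^sup>2 = 1 - var_ou \<tau>"
  by (simp add: mu_ou_def var_ou_def power2_eq_square flip: exp_add)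

lemma normal_density_exp:
  assumes "0 < \<tau>"
  shows "normal_density (mu_ou \<tau> * a) (sigma_ou \<tau>) y
    = exp (- ln (2 * pi * var_ou \<tau>) / 2 - (y - mu_ou \<tau> * a)\<^sup>2 / (2 * var_ou \<tau>))"
proof -
  have z: "0 < 2 * pi * var_ou \<tau>" using var_ou_pos[OF assms] by simp
  have "exp (ln (2 * pi * var_ou \<tau>) / 2) = sqrt (2 * pi * var_ou \<tau>)"
    unfolding ln_sqrt[OF less_imp_le[OF z], symmetric] using z by (intro exp_ln) simp
  then have "1 / sqrt (2 * pi * var_ou \<tau>) = exp (- ln (2 * pi * var_ou \<tau>) / 2)"
    by (simp add: exp_minus inverse_eq_divide)
  then show ?thesis
    unfolding normal_density_def sigma_ou_sq[OF assms] diff_conv_add_uminus exp_add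
    by (simp only: minus_divide_left)
qed

lemma ou_kernel_exp:
  assumes "0 < \<tau>"
  shows "ou_kernel d \<tau> a x
    = exp (\<Sum>i<d. - ln (2 * pi * var_ou \<tau>) / 2 - (x i - mu_ou \<tau> * a i)\<^sup>2 / (2 * var_ou \<tau>))"
  unfolding ou_kernel_def normal_density_exp[OF assms] by (simp add: exp_sum)

lemma ou_kernel_DERIV_time:
  assumes "0 < \<tau>"
  shows "((\<lambda>\<tau>. ou_kernel d \<tau> a x) has_real_derivative kt d \<tau> a x) (at \<tau>)"
proof -
  have V: "0 < var_ou \<tau>" by (rule var_ou_pos[OF assms])
  have dV: "(var_ou has_real_derivative 2 * (mu_ou \<tau>)\<^sup>2) (at \<tau>)"
    unfolding var_ou_def[abs_def]
    by (rule derivative_eq_intros refl | simp add: mu_ou_def power2_eq_square flip: exp_add)+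
  have dm: "(mu_ou has_real_derivative - mu_ou \<tau>) (at \<tau>)"
    unfolding mu_ou_def[abs_def] by (auto intro!: derivative_eq_intros)
  have one: "((\<lambda>\<tau>. - ln (2 * pi * var_ou \<tau>) / 2 - (y - mu_ou \<tau> * b)\<^sup>2 / (2 * var_ou \<tau>))
      has_real_derivative kb \<tau> b y) (at \<tau>)" for b y
    apply (rule derivative_eq_intros dV dm refl | use V in simp; fail)+
    using V unfolding kb_def
    apply (simp add: divide_simps)
    apply (simp add: algebra_simps power2_eq_square power3_eq_cube power4_eq_xxxx)
    done
  have "((\<lambda>\<tau>. exp (\<Sum>i<d. - ln (2 * pi * var_ou \<tau>) / 2 - (x i - mu_ou \<tau> * a i)\<^sup>2 / (2 * var_ou \<tau>)))
      has_real_derivative kt d \<tau> a x) (at \<tau>)"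
    unfolding kt_def ou_kernel_exp[OF assms]
    by (intro DERIV_fun_exp DERIV_sum one)
  moreover have "\<forall>\<^sub>F \<sigma> in nhds \<tau>. ou_kernel d \<sigma> a x
      = exp (\<Sum>i<d. - ln (2 * pi * var_ou \<sigma>) / 2 - (x i - mu_ou \<sigma> * a i)\<^sup>2 / (2 * var_ou \<sigma>))"
    using eventually_nhds_in_open[of "{0<..}" \<tau>] assms ou_kernel_exp by (auto elim: eventually_mono)
  ultimately show ?thesis by (subst DERIV_cong_ev[OF refl _ refl])
qed

lemma ou_kernel_DERIV_space:
  assumes "0 < \<tau>" "i < d"
  shows "((\<lambda>y. ou_kernel d \<tau> a (x(i := y))) has_real_derivative kx d i \<tau> a (x(i := y))) (at y)"
proof -
  have V: "0 < var_ou \<tau>" by (rule var_ou_pos[OF assms(1)])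
  let ?f = "\<lambda>j y. normal_density (mu_ou \<tau> * a j) (sigma_ou \<tau>) y"
  have "(?f i has_real_derivative ?f i y * ksl \<tau> (a i) y) (at y)"
    unfolding normal_density_exp[OF assms(1)] ksl_def
    by (rule derivative_eq_intros refl | use V in \<open>simp add: field_simps\<close>; fail)+
  from DERIV_prod_coord[where f="?f", OF assms(2) this]
  have "((\<lambda>y. ou_kernel d \<tau> a (x(i := y))) has_real_derivative
    ?f i y * ksl \<tau> (a i) y * (\<Prod>j\<in>{..<d} - {i}. ?f j (x j))) (at y)"
    by (simp only: ou_kernel_def)
  moreover have "kx d i \<tau> a (x(i := y)) = ?f i y * ksl \<tau> (a i) y * (\<Prod>j\<in>{..<d} - {i}. ?f j (x j))"
    using prod.remove[of "{..<d}" i "\<lambda>j. ?f j ((x(i := y)) j)"] assms(2)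
    by (simp add: kx_def ou_kernel_def)
  ultimately show ?thesis by simp
qed

lemma kj_DERIV:
  assumes "0 < \<tau>" "i < d"
  shows "((\<lambda>y. kj d i \<tau> a (x(i := y))) has_real_derivative kjx d i \<tau> a (x(i := y))) (at y)"
proof -
  have V: "0 < var_ou \<tau>" by (rule var_ou_pos[OF assms(1)])
  let ?k = "ou_kernel d \<tau> a (x(i := y))"
  have "((\<lambda>y. y + ksl \<tau> (a i) y) has_real_derivative 1 - 1 / var_ou \<tau>) (at y)"
    unfolding ksl_def
    by (rule derivative_eq_intros refl | use V in \<open>simp add: field_simps\<close>; fail)+
  from DERIV_mult[OF ou_kernel_DERIV_space[OF assms] this]
  have "((\<lambda>y. ou_kernel d \<tau> a (x(i := y)) * (y + ksl \<tau> (a i) y)) has_real_derivative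
    ?k * (ksl \<tau> (a i) y * (y + ksl \<tau> (a i) y) + (1 - 1 / var_ou \<tau>))) (at y)"
    by (simp add: kx_def algebra_simps)
  \<comment> \<open>The one-dimensional Fokker-Planck identity. It depends on the relation between
    mean factor and variance, \<open>mu_ou_sq\<close>.\<close>
  moreover have "ksl \<tau> (a i) y * (y + ksl \<tau> (a i) y) + (1 - 1 / var_ou \<tau>) = kb \<tau> (a i) y"
    using V unfolding kb_def ksl_def mu_ou_sq
    apply (simp add: divide_simps)
    apply (simp add: algebra_simps power2_eq_square power3_eq_cube)
    done
  ultimately show ?thesis by (simp add: kj_def kjx_def)
qed

lemma sq_nonneg: "0 \<le> sq d x"
  by (simp add: sq_def sum_nonneg)

lemma coord_sq_le: "i < d \<Longrightarrow> (x i)\<^sup>2 \<le> sq d x"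
  unfolding sq_def by (rule member_le_sum) auto

lemma gauss_env_pos: "0 < gauss_env d x"
  by (simp add: gauss_env_def)

lemma gauss_env_le_1: "gauss_env d x \<le> 1"
  using sq_nonneg[of d x] by (simp add: gauss_env_def)

lemma one_plus_coord_sq: "i < d \<Longrightarrow> (1 + \<bar>x i\<bar>) * (1 + \<bar>x i\<bar>) \<le> 2 * (1 + sq d x)"
  using coord_sq_le[of i d x] sum_squares_bound[of 1 "\<bar>x i\<bar>"] by (simp add: power2_eq_square algebra_simps)

lemma one_plus_coord: "i < d \<Longrightarrow> 1 + \<bar>x i\<bar> \<le> 2 * (1 + sq d x)"
proof -
  assume "i < d"
  have "1 + \<bar>x i\<bar> \<le> (1 + \<bar>x i\<bar>) * (1 + \<bar>x i\<bar>)"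
    using mult_right_mono[of 1 "1 + \<bar>x i\<bar>" "1 + \<bar>x i\<bar>"] by simp
  then show ?thesis using one_plus_coord_sq[OF \<open>i < d\<close>, of x] by (rule order_trans)
qed

text \<open>From \<tau>1 on, the variance lies between \<open>var_ou \<tau>1\<close> and 1, and
  starting points in the unit cube have means of modulus at most 1; hence the uniformity.
  Derivatives are compared with the kernel itself times a polynomial, not only with the envelope,
  because this comparison survives mixing and division by the density.\<close>

lemma kernel_bounds:
  assumes \<tau>1: "0 < \<tau>1"
  obtains C where "0 < C"
    and "\<And>\<tau> a x. \<tau>1 \<le> \<tau> \<Longrightarrow> \<forall>i<d. \<bar>a i\<bar> \<le> 1 \<Longrightarrow> (1 + sq d x) * ou_kernel d \<tau> a x \<le> C * gauss_env d x"
    and "\<And>\<tau> a x i. \<tau>1 \<le> \<tau> \<Longrightarrow> \<forall>i<d. \<bar>a i\<bar> \<le> 1 \<Longrightarrow> i < d \<Longrightarrow> \<bar>kx d i \<tau> a x\<bar> \<le> C * ((1 + \<bar>x i\<bar>) * ou_kernel d \<tau> a x)"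
    and "\<And>\<tau> a x i. \<tau>1 \<le> \<tau> \<Longrightarrow> \<forall>i<d. \<bar>a i\<bar> \<le> 1 \<Longrightarrow> i < d \<Longrightarrow> \<bar>kj d i \<tau> a x\<bar> \<le> C * ((1 + \<bar>x i\<bar>) * ou_kernel d \<tau> a x)"
    and "\<And>\<tau> a x i. \<tau>1 \<le> \<tau> \<Longrightarrow> \<forall>i<d. \<bar>a i\<bar> \<le> 1 \<Longrightarrow> i < d \<Longrightarrow> \<bar>kjx d i \<tau> a x\<bar> \<le> C * ((1 + sq d x) * ou_kernel d \<tau> a x)"
    and "\<And>\<tau> a x. \<tau>1 \<le> \<tau> \<Longrightarrow> \<forall>i<d. \<bar>a i\<bar> \<le> 1 \<Longrightarrow> \<bar>kt d \<tau> a x\<bar> \<le> C * ((1 + sq d x) * ou_kernel d \<tau> a x)"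
proof -
  define c where "c = 1 / var_ou \<tau>1"
  define b where "b = exp (1 / 2) / sqrt (2 * pi * var_ou \<tau>1)"
  have V1: "0 < var_ou \<tau>1" "var_ou \<tau>1 \<le> 1" using var_ou_pos[OF \<tau>1] by (auto simp: var_ou_def)
  have c1: "1 \<le> c" using V1 by (simp add: c_def)
  have b0: "0 < b" using V1 by (simp add: b_def)
  \<comment> \<open>The 8 comes from 1 + r \<le> 8 exp(r / 8) with r = |x|^2, the factor exp(1/2) in
    b from the shift of the mean, 6 c^2 from the bound on \<open>kb\<close>, and d + 1 from summing
    it over the coordinates.\<close>
  define C where "C = max (8 * b ^ d) (6 * c\<^sup>2 * (real d + 1))"
  have C: "8 * b ^ d \<le> C" "6 * c\<^sup>2 * (real d + 1) \<le> C" by (auto simp: C_def)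
  have c2: "1 \<le> c\<^sup>2" "c \<le> c\<^sup>2" using c1 by (auto simp: power2_eq_square intro: mult_le_cancel_right1[THEN iffD2] order_trans[OF c1])
  have C6: "6 * c\<^sup>2 \<le> C"
    using C(2) c2 by (smt (verit, ccfv_SIG) mult_le_cancel_left1 of_nat_0_le_iff)
  have C0: "0 < C" using C6 c2 by linarith
  have one: "0 < var_ou \<tau>" "1 / var_ou \<tau> \<le> c" "var_ou \<tau> \<le> 1" "var_ou \<tau>1 \<le> var_ou \<tau>" "0 < mu_ou \<tau>" "mu_ou \<tau> \<le> 1"
    if "\<tau>1 \<le> \<tau>" for \<tau>
  proof -
    show "var_ou \<tau>1 \<le> var_ou \<tau>" using that by (simp add: var_ou_def)
    then show "0 < var_ou \<tau>" "1 / var_ou \<tau> \<le> c" using V1 by (auto simp: c_def intro: divide_left_mono)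
    show "var_ou \<tau> \<le> 1" by (simp add: var_ou_def)
    show "0 < mu_ou \<tau>" "mu_ou \<tau> \<le> 1" using that \<tau>1 by (simp_all add: mu_ou_def)
  qed
  have m1: "\<bar>mu_ou \<tau> * a\<bar> \<le> 1" if "\<tau>1 \<le> \<tau>" "\<bar>a\<bar> \<le> 1" for \<tau> a
    using one[OF that(1)] that(2) by (simp add: abs_mult mult_le_one)
  have sl: "\<bar>ksl \<tau> a y\<bar> \<le> c * (1 + \<bar>y\<bar>)" if "\<tau>1 \<le> \<tau>" "\<bar>a\<bar> \<le> 1" for \<tau> a y
  proof -
    have "\<bar>ksl \<tau> a y\<bar> = (1 / var_ou \<tau>) * \<bar>y - mu_ou \<tau> * a\<bar>"
      using one(1)[OF that(1)] by (simp add: ksl_def abs_divide)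
    also have "\<dots> \<le> c * (1 + \<bar>y\<bar>)"
      using one[OF that(1)] m1[OF that] c1 by (intro mult_mono) auto
    finally show ?thesis .
  qed
  have kb: "\<bar>kb \<tau> a y\<bar> \<le> 6 * c\<^sup>2 * (1 + y\<^sup>2)" if "\<tau>1 \<le> \<tau>" "\<bar>a\<bar> \<le> 1" for \<tau> a y
  proof -
    have mu2: "(mu_ou \<tau>)\<^sup>2 \<le> 1" "0 \<le> (mu_ou \<tau>)\<^sup>2" using one[OF that(1)] by (simp_all add: power_le_one)
    have eq: "kb \<tau> a y = - (mu_ou \<tau>)\<^sup>2 * (1 / var_ou \<tau>) + ksl \<tau> a y * (mu_ou \<tau> * a) + (ksl \<tau> a y)\<^sup>2 * (mu_ou \<tau>)\<^sup>2"
    proof -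
      define u where "u = y - mu_ou \<tau> * a"
      show ?thesis unfolding kb_def ksl_def u_def[symmetric] by (simp add: power_divide)
    qed
    have t1: "\<bar>(mu_ou \<tau>)\<^sup>2 * (1 / var_ou \<tau>)\<bar> \<le> 1 * c"
      unfolding abs_mult using one[OF that(1)] mu2 by (intro mult_mono) auto
    have t2: "\<bar>ksl \<tau> a y * (mu_ou \<tau> * a)\<bar> \<le> (c * (1 + \<bar>y\<bar>)) * 1"
      unfolding abs_mult[of "ksl \<tau> a y"] using sl[OF that] m1[OF that] c1 by (intro mult_mono) auto
    have t3: "\<bar>(ksl \<tau> a y)\<^sup>2 * (mu_ou \<tau>)\<^sup>2\<bar> \<le> (c * (1 + \<bar>y\<bar>))\<^sup>2 * 1"
      unfolding abs_mult power_abs using sl[OF that, of y] mu2 c1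
      by (intro mult_mono power_mono) (auto simp: power_abs)
    have c0: "0 \<le> c" "c \<le> c\<^sup>2" using c1 c2 by auto
    have y1: "1 \<le> (1 + \<bar>y\<bar>)\<^sup>2" "1 + \<bar>y\<bar> \<le> (1 + \<bar>y\<bar>)\<^sup>2" by (auto intro: one_le_power self_le_power)
    have "c * 1 \<le> c\<^sup>2 * (1 + \<bar>y\<bar>)\<^sup>2" "c * (1 + \<bar>y\<bar>) \<le> c\<^sup>2 * (1 + \<bar>y\<bar>)\<^sup>2"
      by (rule mult_mono[OF c0(2) y1(1)]; simp)
         (rule mult_mono[OF c0(2) y1(2)]; simp)
    moreover have "\<bar>- A + B + D\<bar> \<le> \<bar>A\<bar> + \<bar>B\<bar> + \<bar>D\<bar>" for A B D :: real by linarith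
    from this[of "(mu_ou \<tau>)\<^sup>2 * (1 / var_ou \<tau>)" "ksl \<tau> a y * (mu_ou \<tau> * a)" "(ksl \<tau> a y)\<^sup>2 * (mu_ou \<tau>)\<^sup>2"]
    have "\<bar>kb \<tau> a y\<bar> \<le> 1 * c + (c * (1 + \<bar>y\<bar>)) * 1 + (c * (1 + \<bar>y\<bar>))\<^sup>2 * 1"
      unfolding eq using t1 t2 t3 by (simp only: mult_minus_left)
    ultimately have "\<bar>kb \<tau> a y\<bar> \<le> 3 * (c\<^sup>2 * (1 + \<bar>y\<bar>)\<^sup>2)"
      by (simp only: power_mult_distrib mult_1_left mult_1_right)
    moreover have "(1 + \<bar>y\<bar>)\<^sup>2 \<le> 2 * (1 + y\<^sup>2)"
      using sum_squares_bound[of 1 "\<bar>y\<bar>"] by (simp add: power2_eq_square algebra_simps)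
    then have "c\<^sup>2 * (1 + \<bar>y\<bar>)\<^sup>2 \<le> c\<^sup>2 * (2 * (1 + y\<^sup>2))" by (rule mult_left_mono) simp
    ultimately have "\<bar>kb \<tau> a y\<bar> \<le> 3 * (c\<^sup>2 * (2 * (1 + y\<^sup>2)))" by linarith
    then show ?thesis by (simp add: algebra_simps)
  qed
  show ?thesis
  proof (rule that[OF C0])
    fix \<tau> :: real and a x :: pt assume \<tau>: "\<tau>1 \<le> \<tau>" and a: "\<forall>i<d. \<bar>a i\<bar> \<le> 1"
    note k0 = ou_kernel_nonneg[of d \<tau> a x]
    have scale: "\<bar>ou_kernel d \<tau> a x * p\<bar> \<le> C * (q * ou_kernel d \<tau> a x)" if "\<bar>p\<bar> \<le> C * q" for p q
      using mult_left_mono[OF that k0] k0 by (simp add: abs_mult mult_ac)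
    have "normal_density (mu_ou \<tau> * a i) (sigma_ou \<tau>) (x i) \<le> b * exp (- (x i)\<^sup>2 / 4)" if "i < d" for i
    proof -
      let ?m = "mu_ou \<tau> * a i"
      have "?m\<^sup>2 \<le> 1" unfolding abs_square_le_1 by (rule m1[OF \<tau>]) (use a that in blast)
      \<comment> \<open>Expanded, this square says (x - m)^2 \<ge> x^2 / 2 - m^2: half of the
        Gaussian decay survives uniformly in the mean.\<close>
      moreover have "0 \<le> (x i - 2 * ?m)\<^sup>2" by simp
      ultimately have "(x i)\<^sup>2 / 4 - 1 / 2 \<le> (x i - ?m)\<^sup>2 / 2"
        by (simp add: power2_eq_square algebra_simps)
      also have "\<dots> \<le> (x i - ?m)\<^sup>2 / (2 * var_ou \<tau>)"
        using one[OF \<tau>] by (intro divide_left_mono) auto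
      finally have "exp (- (x i - ?m)\<^sup>2 / (2 * var_ou \<tau>)) \<le> exp (1 / 2 + (- (x i)\<^sup>2 / 4))" by simp
      moreover have "1 / sqrt (2 * pi * var_ou \<tau>) \<le> 1 / sqrt (2 * pi * var_ou \<tau>1)"
        using one[OF \<tau>] V1 by (intro divide_left_mono) auto
      moreover have "0 < \<tau>" using \<tau>1 \<tau> by simp
      ultimately have "normal_density ?m (sigma_ou \<tau>) (x i)
          \<le> 1 / sqrt (2 * pi * var_ou \<tau>1) * exp (1 / 2 + (- (x i)\<^sup>2 / 4))"
        unfolding normal_density_def sigma_ou_sq[OF \<open>0 < \<tau>\<close>] using V1 by (intro mult_mono) auto
      then show ?thesis unfolding exp_add by (simp add: b_def mult_ac)
    qed
    then have "ou_kernel d \<tau> a x \<le> (\<Prod>i<d. b * exp (- (x i)\<^sup>2 / 4))"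
      unfolding ou_kernel_def by (intro prod_mono conjI) simp_all
    also have "\<dots> = b ^ d * exp (\<Sum>i<d. - (x i)\<^sup>2 / 4)"
      by (simp add: prod.distrib exp_sum)
    also have "(\<Sum>i<d. - (x i)\<^sup>2 / 4) = - sq d x / 4"
      by (simp add: sq_def sum_negf sum_divide_distrib)
    finally have k: "ou_kernel d \<tau> a x \<le> b ^ d * exp (- sq d x / 4)" .
    have "1 + sq d x / 8 \<le> exp (sq d x / 8)" by (rule exp_ge_add_one_self)
    then have "1 + sq d x \<le> 8 * exp (sq d x / 8)" using sq_nonneg[of d x] by linarith
    then have "(1 + sq d x) * ou_kernel d \<tau> a x \<le> (8 * exp (sq d x / 8)) * (b ^ d * exp (- sq d x / 4))"
      using k k0 sq_nonneg[of d x] by (intro mult_mono) auto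
    also have "\<dots> = (8 * b ^ d) * gauss_env d x"
      by (simp add: gauss_env_def flip: exp_add)
    also have "\<dots> \<le> C * gauss_env d x" using C gauss_env_pos[of d x] by (intro mult_right_mono) auto
    finally show "(1 + sq d x) * ou_kernel d \<tau> a x \<le> C * gauss_env d x" .
    have kbs: "(\<Sum>i<d. \<bar>kb \<tau> (a i) (x i)\<bar>) \<le> C * (1 + sq d x)"
    proof -
      have "(\<Sum>i<d. \<bar>kb \<tau> (a i) (x i)\<bar>) \<le> (\<Sum>i<d. 6 * c\<^sup>2 * (1 + (x i)\<^sup>2))"
        by (intro sum_mono kb[OF \<tau>]) (use a in auto)
      also have "\<dots> = 6 * c\<^sup>2 * (real d + sq d x)"
        by (simp add: sq_def sum.distrib flip: sum_distrib_left)
      also have "\<dots> \<le> 6 * c\<^sup>2 * ((real d + 1) * (1 + sq d x))"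
        using sq_nonneg[of d x] by (intro mult_left_mono) (auto simp: algebra_simps)
      also have "\<dots> \<le> C * (1 + sq d x)"
        using C(2) sq_nonneg[of d x] by (simp add: mult.assoc[symmetric] mult_right_mono)
      finally show ?thesis .
    qed
    then have "\<bar>\<Sum>i<d. kb \<tau> (a i) (x i)\<bar> \<le> C * (1 + sq d x)" by (rule order_trans[OF sum_abs])
    then show "\<bar>kt d \<tau> a x\<bar> \<le> C * ((1 + sq d x) * ou_kernel d \<tau> a x)"
      unfolding kt_def by (rule scale)
    fix i assume i: "i < d"
    have "\<bar>kb \<tau> (a i) (x i)\<bar> \<le> (\<Sum>i<d. \<bar>kb \<tau> (a i) (x i)\<bar>)"
      by (rule member_le_sum[where f="\<lambda>i. \<bar>kb \<tau> (a i) (x i)\<bar>"]) (use i in auto)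
    then have "\<bar>kb \<tau> (a i) (x i)\<bar> \<le> C * (1 + sq d x)" using kbs by linarith
    then show "\<bar>kjx d i \<tau> a x\<bar> \<le> C * ((1 + sq d x) * ou_kernel d \<tau> a x)"
      unfolding kjx_def by (rule scale)
    have s: "\<bar>ksl \<tau> (a i) (x i)\<bar> \<le> c * (1 + \<bar>x i\<bar>)" using sl[OF \<tau>] a i by blast
    have cC: "c + 1 \<le> C" using c1 c2 C6 by linarith
    have "\<bar>ksl \<tau> (a i) (x i)\<bar> \<le> C * (1 + \<bar>x i\<bar>)"
      by (rule order_trans[OF s]) (use cC in \<open>auto intro!: mult_right_mono\<close>)
    then show "\<bar>kx d i \<tau> a x\<bar> \<le> C * ((1 + \<bar>x i\<bar>) * ou_kernel d \<tau> a x)"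
      unfolding kx_def by (rule scale)
    have "\<bar>x i + ksl \<tau> (a i) (x i)\<bar> \<le> (c + 1) * (1 + \<bar>x i\<bar>)" using s by (simp add: algebra_simps)
    also have "\<dots> \<le> C * (1 + \<bar>x i\<bar>)" using cC by (intro mult_right_mono) auto
    finally show "\<bar>kj d i \<tau> a x\<bar> \<le> C * ((1 + \<bar>x i\<bar>) * ou_kernel d \<tau> a x)"
      unfolding kj_def by (rule scale)
  qed
qed

lemma gauss_env_integrable: "integrable (leb d) (gauss_env d)"
proof -
  have "integrable lborel (\<lambda>y. exp (- y\<^sup>2 / 8) :: real)"
  proof -
    have "integrable lborel (\<lambda>y. sqrt (2 * pi * 2\<^sup>2) * normal_density 0 2 y)"
      by (intro integrable_mult_right integrable_normal_density) simp
    moreover have "(\<lambda>y. sqrt (2 * pi * 2\<^sup>2) * normal_density 0 2 y) = (\<lambda>y. exp (- y\<^sup>2 / 8))"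
      by (simp add: normal_density_def)
    ultimately show ?thesis by (simp only:)
  qed
  then have "integrable (leb d) (\<lambda>x. \<Prod>j<d. exp (- (x j)\<^sup>2 / 8))" by (rule integrable_leb_prod)
  then show ?thesis
    by (simp add: gauss_env_def[abs_def] sq_def sum_negf sum_divide_distrib flip: exp_sum)
qed

lemma gauss_env_tendsto:
  assumes "i < d"
  shows "((\<lambda>y. gauss_env d (x(i := y))) \<longlongrightarrow> 0) at_top" "((\<lambda>y. gauss_env d (x(i := y))) \<longlongrightarrow> 0) at_bot"
proof -
  have b: "gauss_env d (x(i := y)) \<le> exp (- y\<^sup>2 / 8)" for y
    using coord_sq_le[OF assms, of "x(i := y)"] by (simp add: gauss_env_def)
  have l: "((\<lambda>y. exp (- y\<^sup>2 / 8) :: real) \<longlongrightarrow> 0) at_top" "((\<lambda>y. exp (- y\<^sup>2 / 8) :: real) \<longlongrightarrow> 0) at_bot"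
  proof -
    have 1: "LIM y at_top. - (y\<^sup>2 / 8) :> (at_bot :: real filter)"
      by (intro filterlim_compose[OF filterlim_uminus_at_bot_at_top] filterlim_at_top_mult_tendsto_pos[OF tendsto_const _ filterlim_pow_at_top[OF _ filterlim_ident], of "1/8" 2, simplified]) 
    have 2: "LIM y at_bot. - (y\<^sup>2 / 8) :> (at_bot :: real filter)"
      by (intro filterlim_compose[OF filterlim_uminus_at_bot_at_top] filterlim_at_top_mult_tendsto_pos[OF tendsto_const _ filterlim_pow_at_bot_even[OF _ filterlim_ident], of "1/8" 2, simplified]) 
    show "((\<lambda>y. exp (- y\<^sup>2 / 8) :: real) \<longlongrightarrow> 0) at_top" "((\<lambda>y. exp (- y\<^sup>2 / 8) :: real) \<longlongrightarrow> 0) at_bot"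
      using filterlim_compose[OF exp_at_bot 1] filterlim_compose[OF exp_at_bot 2] by simp_all
  qed
  show "((\<lambda>y. gauss_env d (x(i := y))) \<longlongrightarrow> 0) at_top"
    by (rule tendsto_sandwich[OF _ _ tendsto_const l(1)]) (intro always_eventually allI b less_imp_le[OF gauss_env_pos])+
  show "((\<lambda>y. gauss_env d (x(i := y))) \<longlongrightarrow> 0) at_bot"
    by (rule tendsto_sandwich[OF _ _ tendsto_const l(2)]) (intro always_eventually allI b less_imp_le[OF gauss_env_pos])+
qed

section \<open>The time window\<close>

lemma sets_nu: "sets (nu t0 t1) = sets (restrict_space lborel {t0..t1})"
  by (simp add: nu_def)

lemma space_nu[simp]: "space (nu t0 t1) = {t0..t1}"
  by (simp add: nu_def space_restrict_space)

lemma nn_integral_nu: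
  assumes "t0 < t1" "f \<in> borel_measurable (nu t0 t1)"
  shows "(\<integral>\<^sup>+t. f t \<partial>nu t0 t1) = (\<integral>\<^sup>+t. f t * indicator {t0..t1} t \<partial>lborel) / ennreal (t1 - t0)"
proof -
  have [measurable]: "f \<in> borel_measurable (restrict_space lborel {t0..t1})"
    using assms(2) by (simp add: nu_def)
  have s: "{t0..t1} \<in> sets (restrict_space lborel {t0..t1})" by (auto simp: sets_restrict_space_iff)
  have e: "emeasure (restrict_space lborel {t0..t1}) {t0..t1} = ennreal (t1 - t0)"
    using assms(1) by (subst emeasure_restrict_space) auto
  have "(\<integral>\<^sup>+t. f t \<partial>nu t0 t1) = (\<integral>\<^sup>+t. f t * indicator {t0..t1} t \<partial>restrict_space lborel {t0..t1}) / ennreal (t1 - t0)"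
    unfolding nu_def by (subst nn_integral_uniform_measure) (use s e in auto)
  also have "(\<integral>\<^sup>+t. f t * indicator {t0..t1} t \<partial>restrict_space lborel {t0..t1}) = (\<integral>\<^sup>+t. f t * indicator {t0..t1} t \<partial>lborel)"
    by (subst nn_integral_restrict_space) (auto intro!: nn_integral_cong simp: indicator_def)
  finally show ?thesis .
qed

lemma prob_space_nu:
  assumes "t0 < t1"
  shows "prob_space (nu t0 t1)"
  unfolding nu_def
proof (rule prob_space_uniform_measure)
  have "emeasure (restrict_space lborel {t0..t1}) {t0..t1} = ennreal (t1 - t0)"
    using assms by (subst emeasure_restrict_space) auto
  then show "emeasure (restrict_space lborel {t0..t1}) {t0..t1} \<noteq> 0"
    "emeasure (restrict_space lborel {t0..t1}) {t0..t1} \<noteq> \<infinity>"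
    using assms by auto
qed

lemma integral_nu:
  fixes f :: "real \<Rightarrow> real"
  assumes "t0 < t1"
  shows "(\<integral>t. f t \<partial>nu t0 t1) = (LINT t:{t0..t1}|lborel. f t) / (t1 - t0)"
proof -
  let ?R = "restrict_space lborel {t0..t1}"
  have s: "{t0..t1} \<in> sets ?R" by (auto simp: sets_restrict_space_iff)
  have e: "emeasure ?R {t0..t1} = ennreal (t1 - t0)"
    using assms by (subst emeasure_restrict_space) auto
  have m: "(\<lambda>x. indicator {t0..t1} x / ennreal (t1 - t0)) = (\<lambda>x. ennreal (indicator {t0..t1} x / (t1 - t0)))"
    using assms by (auto simp: indicator_def divide_ennreal[symmetric])
  show ?thesis
  proof (cases "f \<in> borel_measurable ?R")
    case True
    have "(\<integral>t. f t \<partial>nu t0 t1) = (\<integral>t. (indicator {t0..t1} t / (t1 - t0)) * f t \<partial>?R)"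
      unfolding nu_def uniform_measure_def e m
      by (subst integral_density) (use True s assms in auto)
    also have "\<dots> = (\<integral>t. indicator {t0..t1} t * ((indicator {t0..t1} t / (t1 - t0)) * f t) \<partial>lborel)"
      by (subst integral_restrict_space) auto
    also have "\<dots> = (\<integral>t. (indicator {t0..t1} t * f t) / (t1 - t0) \<partial>lborel)"
      by (rule Bochner_Integration.integral_cong) (auto simp: indicator_def)
    finally show ?thesis by (simp add: set_lebesgue_integral_def)
  next
    \<comment> \<open>Without measurability neither integral exists and both are 0 by convention, so
      the formula needs no assumption on f.\<close>
    case False
    have "\<not> integrable (nu t0 t1) f" using False by (auto simp: nu_def dest: borel_measurable_integrable)
    moreover have "\<not> set_integrable lborel {t0..t1} f"
    proof
      assume "set_integrable lborel {t0..t1} f"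
      then have "f \<in> borel_measurable ?R"
        by (auto simp: set_integrable_def borel_measurable_restrict_space_iff dest!: borel_measurable_integrable)
      then show False using False by simp
    qed
    ultimately show ?thesis
      by (simp add: not_integrable_integral_eq set_lebesgue_integral_def set_integrable_def)
  qed
qed

lemma integral_nu_FTC:
  fixes F f :: "real \<Rightarrow> real"
  assumes t: "t0 < t1" and int: "integrable (nu t0 t1) f"
    and F: "\<And>t. t \<in> {t0..t1} \<Longrightarrow> (F has_real_derivative f t) (at t within {t0..t1})"
  shows "(\<integral>t. f t \<partial>nu t0 t1) = (F t1 - F t0) / (t1 - t0)"
proof -
  have "set_integrable lborel {t0..t1} f"
  proof -
    let ?R = "restrict_space lborel {t0..t1}"
    have "f \<in> borel_measurable ?R" using int by (auto simp: nu_def dest: borel_measurable_integrable)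
    then have m: "(\<lambda>t. indicator {t0..t1} t *\<^sub>R f t) \<in> borel_measurable lborel"
      by (simp add: borel_measurable_restrict_space_iff)
    have "(\<integral>\<^sup>+t. ennreal (norm (f t)) \<partial>nu t0 t1) < \<infinity>" using int by (simp add: integrable_iff_bounded)
    then have "(\<integral>\<^sup>+t. ennreal (norm (f t)) * indicator {t0..t1} t \<partial>lborel) / ennreal (t1 - t0) < \<infinity>"
      by (subst (asm) nn_integral_nu[OF t]) (use int in auto)
    then have "(\<integral>\<^sup>+t. ennreal (norm (f t)) * indicator {t0..t1} t \<partial>lborel) < \<infinity>"
      using t by (simp add: ennreal_divide_eq_top_iff less_top[symmetric])
    moreover have "(\<integral>\<^sup>+t. ennreal (norm (f t)) * indicator {t0..t1} t \<partial>lborel)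
        = (\<integral>\<^sup>+t. ennreal (norm (indicator {t0..t1} t *\<^sub>R f t)) \<partial>lborel)"
      by (rule nn_integral_cong) (auto simp: indicator_def)
    ultimately show ?thesis unfolding set_integrable_def integrable_iff_bounded using m by simp
  qed
  moreover have "(f has_integral F t1 - F t0) {t0..t1}"
    using t F by (intro fundamental_theorem_of_calculus)
      (auto simp: has_real_derivative_iff_has_vector_derivative[symmetric])
  ultimately show ?thesis
    unfolding integral_nu[OF t] by (simp add: set_borel_integral_eq_integral(2) integral_unique)
qed

section \<open>Functions dominated by a Gaussian envelope\<close>

locale ou_window =
  fixes d :: nat and T t0 t1 :: real and p0 :: "pt measure"
  assumes d: "1 \<le> d" and t0: "0 < t0" and t01: "t0 < t1" and t1: "t1 < T"
    and p0: "prob_space p0" and sets_p0: "sets p0 = sets (leb d)"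
    and cube: "AE a in p0. \<forall>i<d. \<bar>a i\<bar> \<le> 1"
begin

abbreviation (input) "N \<equiv> nu t0 t1"
abbreviation (input) "I \<equiv> {t0..t1}"
abbreviation (input) "E \<equiv> gauss_env d"

sublocale P: prob_space p0 by (rule p0)
sublocale L: sigma_finite_measure "leb d" by (rule sigma_finite_leb)
sublocale N: prob_space N by (rule prob_space_nu[OF t01])
sublocale PL: pair_sigma_finite p0 "leb d" ..
sublocale NL: pair_sigma_finite N "leb d" ..

lemma space_p0[simp]: "space p0 = Rd d"
  using sets_eq_imp_space_eq[OF sets_p0] by simp

text \<open>One constant for all kernel bounds on the window. It depends on d and on T - t1, and it
  is used only to establish integrability and to exchange integrals; it does not reach the final
  estimate.\<close>

definition kernel_const :: "real \<Rightarrow> bool" where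
  "kernel_const C \<longleftrightarrow> 0 < C \<and> (\<forall>t\<in>I. \<forall>a x. (\<forall>i<d. \<bar>a i\<bar> \<le> 1) \<longrightarrow>
     (1 + sq d x) * ou_kernel d (T - t) a x \<le> C * E x \<and>
     \<bar>ou_kernel d (T - t) a x\<bar> \<le> C * E x \<and> \<bar>kt d (T - t) a x\<bar> \<le> C * E x \<and>
     (\<forall>i<d. \<bar>kx d i (T - t) a x\<bar> \<le> C * E x \<and> (1 + \<bar>x i\<bar>) * \<bar>kj d i (T - t) a x\<bar> \<le> C * E x \<and>
       \<bar>kj d i (T - t) a x\<bar> \<le> C * E x \<and>
       \<bar>kjx d i (T - t) a x\<bar> \<le> C * E x \<and> \<bar>kx d i (T - t) a x\<bar> \<le> C * ((1 + \<bar>x i\<bar>) * ou_kernel d (T - t) a x)))"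

lemma kernel_const_exists: "\<exists>C. kernel_const C"
proof -
  have "0 < T - t1" using t1 by simp
  from kernel_bounds[OF this, of d] obtain C where C: "0 < C"
    and 1: "\<And>\<tau> a x. T - t1 \<le> \<tau> \<Longrightarrow> \<forall>i<d. \<bar>a i\<bar> \<le> 1 \<Longrightarrow> (1 + sq d x) * ou_kernel d \<tau> a x \<le> C * E x"
    and 2: "\<And>\<tau> a x i. T - t1 \<le> \<tau> \<Longrightarrow> \<forall>i<d. \<bar>a i\<bar> \<le> 1 \<Longrightarrow> i < d \<Longrightarrow> \<bar>kx d i \<tau> a x\<bar> \<le> C * ((1 + \<bar>x i\<bar>) * ou_kernel d \<tau> a x)"
    and 3: "\<And>\<tau> a x i. T - t1 \<le> \<tau> \<Longrightarrow> \<forall>i<d. \<bar>a i\<bar> \<le> 1 \<Longrightarrow> i < d \<Longrightarrow> \<bar>kj d i \<tau> a x\<bar> \<le> C * ((1 + \<bar>x i\<bar>) * ou_kernel d \<tau> a x)"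
    and 4: "\<And>\<tau> a x i. T - t1 \<le> \<tau> \<Longrightarrow> \<forall>i<d. \<bar>a i\<bar> \<le> 1 \<Longrightarrow> i < d \<Longrightarrow> \<bar>kjx d i \<tau> a x\<bar> \<le> C * ((1 + sq d x) * ou_kernel d \<tau> a x)"
    and 5: "\<And>\<tau> a x. T - t1 \<le> \<tau> \<Longrightarrow> \<forall>i<d. \<bar>a i\<bar> \<le> 1 \<Longrightarrow> \<bar>kt d \<tau> a x\<bar> \<le> C * ((1 + sq d x) * ou_kernel d \<tau> a x)"
    by blast
  \<comment> \<open>The product C * C arises because a derivative is at most C times a weighted
    kernel, and this at most C times the envelope; the 2 comes from (1 + |x_i|)^2 \<le> 2 (1 +
    |x|^2).\<close>
  define K where "K = C + 1 + 2 * C * C"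
  have K: "0 < K" "C \<le> K" "C * C \<le> K" "2 * C * C \<le> K" "1 \<le> K" using C mult_pos_pos[OF C C] unfolding K_def by linarith+
  have E0: "0 \<le> E x" for x using gauss_env_pos[of d x] by simp
  have CE: "C * E x \<le> K * E x" "C * (C * E x) \<le> K * E x" "2 * (C * (C * E x)) \<le> K * E x" for x
    using mult_right_mono[OF K(2) E0] mult_right_mono[OF K(3) E0, of x] mult_right_mono[OF K(4) E0, of x]
    by (simp_all add: mult_ac)
  have "kernel_const K"
    unfolding kernel_const_def
  proof (intro conjI ballI allI impI K(1))
    fix t and a x :: pt assume t: "t \<in> I" and a: "\<forall>i<d. \<bar>a i\<bar> \<le> 1"
    have \<tau>: "T - t1 \<le> T - t" using t by simp
    let ?k = "ou_kernel d (T - t) a x"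
    have k0: "0 \<le> ?k" by (rule ou_kernel_nonneg)
    have s: "(1 + sq d x) * ?k \<le> C * E x" by (rule 1[OF \<tau> a])
    then show "(1 + sq d x) * ?k \<le> K * E x" using CE(1)[of x] by linarith
    have "?k \<le> (1 + sq d x) * ?k" using k0 sq_nonneg[of d x] by (simp add: distrib_right)
    then show "\<bar>?k\<bar> \<le> K * E x" using s CE(1)[of x] k0 by linarith
    have Cs: "C * ((1 + sq d x) * ?k) \<le> C * (C * E x)" using s C by (intro mult_left_mono) auto
    show "\<bar>kt d (T - t) a x\<bar> \<le> K * E x" using 5[OF \<tau> a, of x] Cs CE(2)[of x] by linarith
    fix i assume i: "i < d"
    show "\<bar>kjx d i (T - t) a x\<bar> \<le> K * E x" using 4[OF \<tau> a i, of x] Cs CE(2)[of x] by linarith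
    have s1: "(1 + \<bar>x i\<bar>) * ?k \<le> 2 * (C * E x)"
      using mult_right_mono[OF one_plus_coord[OF i, of x] k0] s by linarith
    then have Cs1: "C * ((1 + \<bar>x i\<bar>) * ?k) \<le> C * (2 * (C * E x))" using C by (intro mult_left_mono) auto
    show "\<bar>kx d i (T - t) a x\<bar> \<le> K * E x" using 2[OF \<tau> a i, of x] Cs1 CE(3)[of x] by linarith
    show "\<bar>kj d i (T - t) a x\<bar> \<le> K * E x" using 3[OF \<tau> a i, of x] Cs1 CE(3)[of x] by linarith
    have "C * ((1 + \<bar>x i\<bar>) * ?k) \<le> K * ((1 + \<bar>x i\<bar>) * ?k)" using K k0 by (intro mult_right_mono) auto
    then show "\<bar>kx d i (T - t) a x\<bar> \<le> K * ((1 + \<bar>x i\<bar>) * ?k)" using 2[OF \<tau> a i, of x] by linarith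
    have "(1 + \<bar>x i\<bar>) * \<bar>kj d i (T - t) a x\<bar> \<le> (1 + \<bar>x i\<bar>) * (C * ((1 + \<bar>x i\<bar>) * ?k))"
      by (intro mult_left_mono 3[OF \<tau> a i]) auto
    also have "\<dots> = C * (((1 + \<bar>x i\<bar>) * (1 + \<bar>x i\<bar>)) * ?k)" by (simp only: mult_ac)
    also have "\<dots> \<le> C * ((2 * (1 + sq d x)) * ?k)"
      by (intro mult_left_mono mult_right_mono one_plus_coord_sq[OF i] k0) (use C in auto)
    also have "\<dots> = 2 * (C * ((1 + sq d x) * ?k))" by (simp only: mult_ac)
    also have "\<dots> \<le> K * E x" using Cs CE(3)[of x] by linarith
    finally show "(1 + \<bar>x i\<bar>) * \<bar>kj d i (T - t) a x\<bar> \<le> K * E x" .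
  qed
  then show ?thesis by blast
qed

definition "K = (SOME C. kernel_const C)"

lemma K: "kernel_const K"
  unfolding K_def by (rule someI_ex[OF kernel_const_exists])

lemma K_pos: "0 < K" using K by (simp add: kernel_const_def)

text \<open>The class in which all integrals over position and time exist and commute. The companion
  \<open>bdd\<close> is the class of admissible multipliers, and membership in either is decided by
  algebraic closure rules from here on.\<close>

definition dom :: "tfun \<Rightarrow> bool" where
  "dom f \<longleftrightarrow> (\<lambda>(t, x). f t x) \<in> borel_measurable (N \<Otimes>\<^sub>M leb d) \<and>
     (\<exists>C. \<forall>t\<in>I. \<forall>x\<in>Rd d. \<bar>f t x\<bar> \<le> C * E x)"

definition bdd :: "tfun \<Rightarrow> bool" where
  "bdd f \<longleftrightarrow> (\<lambda>(t, x). f t x) \<in> borel_measurable (N \<Otimes>\<^sub>M leb d) \<and>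
     (\<exists>C. \<forall>t\<in>I. \<forall>x\<in>Rd d. \<bar>f t x\<bar> \<le> C)"

lemma E_meas[measurable]: "E \<in> borel_measurable (leb d)"
  using gauss_env_integrable by auto

lemma section_meas:
  assumes "(\<lambda>(t, x). f t x) \<in> borel_measurable (N \<Otimes>\<^sub>M leb d)" "t \<in> I"
  shows "f t \<in> borel_measurable (leb d)"
  using measurable_Pair2[OF assms(1), of t] assms(2) by simp

lemma dom_integrable: "dom f \<Longrightarrow> t \<in> I \<Longrightarrow> integrable (leb d) (f t)"
proof -
  assume f: "dom f" and t: "t \<in> I"
  then obtain C where C: "\<forall>t\<in>I. \<forall>x\<in>Rd d. \<bar>f t x\<bar> \<le> C * E x" by (auto simp: dom_def)
  show "integrable (leb d) (f t)"
  proof (rule Bochner_Integration.integrable_bound)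
    show "integrable (leb d) (\<lambda>x. C * E x)" using gauss_env_integrable by simp
    show "f t \<in> borel_measurable (leb d)" using f t section_meas by (auto simp: dom_def)
    show "AE x in leb d. norm (f t x) \<le> norm (C * E x)"
      using C t by (intro AE_I2) (fastforce intro: order_trans)
  qed
qed

lemma dom_integrable_pair: "dom f \<Longrightarrow> integrable (N \<Otimes>\<^sub>M leb d) (\<lambda>(t, x). f t x)"
proof -
  assume f: "dom f"
  then obtain C where C: "\<forall>t\<in>I. \<forall>x\<in>Rd d. \<bar>f t x\<bar> \<le> C * E x" by (auto simp: dom_def)
  have [measurable]: "(\<lambda>(t, x). f t x) \<in> borel_measurable (N \<Otimes>\<^sub>M leb d)" using f by (simp add: dom_def)
  show ?thesis
  proof (rule NL.Fubini_integrable)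
    have "(\<lambda>t. \<integral>x. norm (f t x) \<partial>leb d) \<in> borel_measurable N"
      by (rule L.borel_measurable_lebesgue_integral) simp
    then show "integrable N (\<lambda>t. \<integral>x. norm (case (t, x) of (t, x) \<Rightarrow> f t x) \<partial>leb d)"
    proof (intro N.integrable_const_bound[where B="\<integral>x. C * E x \<partial>leb d"] AE_I2)
      fix t assume "t \<in> space N"
      then have "(\<integral>x. norm (f t x) \<partial>leb d) \<le> (\<integral>x. C * E x \<partial>leb d)"
        using dom_integrable[OF f] C by (intro integral_mono) (auto intro: gauss_env_integrable)
      then show "norm (\<integral>x. norm (case (t, x) of (t, x) \<Rightarrow> f t x) \<partial>leb d) \<le> (\<integral>x. C * E x \<partial>leb d)"
        by (simp add: integral_nonneg_AE)
    qed simp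
    show "AE t in N. integrable (leb d) (\<lambda>x. case (t, x) of (t, x) \<Rightarrow> f t x)"
      using dom_integrable[OF f] by (intro AE_I2) auto
  qed simp
qed

lemma dom_integrable_time: "dom f \<Longrightarrow> integrable N (\<lambda>t. \<integral>x. f t x \<partial>leb d)"
  using NL.integrable_fst'[OF dom_integrable_pair] by simp

lemma dom_fubini: "dom f \<Longrightarrow> (\<integral>t. (\<integral>x. f t x \<partial>leb d) \<partial>N) = (\<integral>x. (\<integral>t. f t x \<partial>N) \<partial>leb d)"
  using NL.Fubini_integral[OF dom_integrable_pair] by simp

lemma dom_integrable_section: "dom f \<Longrightarrow> x \<in> Rd d \<Longrightarrow> integrable N (\<lambda>t. f t x)"
proof -
  assume f: "dom f" and x: "x \<in> Rd d"
  then obtain C where C: "\<forall>t\<in>I. \<forall>x\<in>Rd d. \<bar>f t x\<bar> \<le> C * E x" by (auto simp: dom_def)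
  have "(\<lambda>(t, x). f t x) \<in> borel_measurable (N \<Otimes>\<^sub>M leb d)" using f by (simp add: dom_def)
  from measurable_Pair1[OF this, of x] x have "(\<lambda>t. f t x) \<in> borel_measurable N" by simp
  then show "integrable N (\<lambda>t. f t x)"
    using C x by (intro N.integrable_const_bound[where B="C * E x"]) auto
qed

lemma dom_time_integral: "dom f \<Longrightarrow> integrable (leb d) (\<lambda>x. \<integral>t. f t x \<partial>N)"
  using NL.integrable_snd[OF dom_integrable_pair] by simp

lemma dom_mult:
  assumes "bdd g" "dom f" shows "dom (\<lambda>t x. g t x * f t x)"
proof -
  obtain C where C: "\<forall>t\<in>I. \<forall>x\<in>Rd d. \<bar>f t x\<bar> \<le> C * E x" using assms by (auto simp: dom_def)
  obtain D where D: "\<forall>t\<in>I. \<forall>x\<in>Rd d. \<bar>g t x\<bar> \<le> D" using assms by (auto simp: bdd_def)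
  have [measurable]: "(\<lambda>(t, x). f t x) \<in> borel_measurable (N \<Otimes>\<^sub>M leb d)"
    "(\<lambda>(t, x). g t x) \<in> borel_measurable (N \<Otimes>\<^sub>M leb d)"
    using assms by (auto simp: dom_def bdd_def)
  have "\<bar>g t x * f t x\<bar> \<le> (\<bar>D\<bar> * C) * E x" if "t \<in> I" "x \<in> Rd d" for t x
    unfolding abs_mult mult.assoc using C D that by (intro mult_mono) (auto intro: order_trans[OF _ abs_ge_self])
  then show ?thesis unfolding dom_def by (auto intro!: exI[of _ "\<bar>D\<bar> * C"] simp: case_prod_beta')
qed

lemma bdd_mult:
  assumes "bdd g" "bdd f" shows "bdd (\<lambda>t x. g t x * f t x)"
proof -
  obtain C where C: "\<forall>t\<in>I. \<forall>x\<in>Rd d. \<bar>f t x\<bar> \<le> C" using assms by (auto simp: bdd_def)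
  obtain D where D: "\<forall>t\<in>I. \<forall>x\<in>Rd d. \<bar>g t x\<bar> \<le> D" using assms by (auto simp: bdd_def)
  have [measurable]: "(\<lambda>(t, x). f t x) \<in> borel_measurable (N \<Otimes>\<^sub>M leb d)"
    "(\<lambda>(t, x). g t x) \<in> borel_measurable (N \<Otimes>\<^sub>M leb d)"
    using assms by (auto simp: bdd_def)
  have "\<bar>g t x * f t x\<bar> \<le> \<bar>D\<bar> * C" if "t \<in> I" "x \<in> Rd d" for t x
    unfolding abs_mult using C D that by (intro mult_mono) (auto intro: order_trans[OF _ abs_ge_self])
  then show ?thesis unfolding bdd_def by (auto intro!: exI[of _ "\<bar>D\<bar> * C"] simp: case_prod_beta')
qed

lemma dom_add:
  assumes "dom g" "dom f" shows "dom (\<lambda>t x. g t x + f t x)"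
proof -
  obtain C D where C: "\<forall>t\<in>I. \<forall>x\<in>Rd d. \<bar>f t x\<bar> \<le> C * E x" and D: "\<forall>t\<in>I. \<forall>x\<in>Rd d. \<bar>g t x\<bar> \<le> D * E x"
    using assms by (auto simp: dom_def)
  have [measurable]: "(\<lambda>(t, x). f t x) \<in> borel_measurable (N \<Otimes>\<^sub>M leb d)"
    "(\<lambda>(t, x). g t x) \<in> borel_measurable (N \<Otimes>\<^sub>M leb d)"
    using assms by (auto simp: dom_def)
  have "\<bar>g t x + f t x\<bar> \<le> (D + C) * E x" if "t \<in> I" "x \<in> Rd d" for t x
    using C D that abs_triangle_ineq[of "g t x" "f t x"] by (fastforce simp: distrib_right)
  then show ?thesis unfolding dom_def by (auto intro!: exI[of _ "D + C"] simp: case_prod_beta')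
qed

lemma bdd_add:
  assumes "bdd g" "bdd f" shows "bdd (\<lambda>t x. g t x + f t x)"
proof -
  obtain C D where C: "\<forall>t\<in>I. \<forall>x\<in>Rd d. \<bar>f t x\<bar> \<le> C" and D: "\<forall>t\<in>I. \<forall>x\<in>Rd d. \<bar>g t x\<bar> \<le> D"
    using assms by (auto simp: bdd_def)
  have [measurable]: "(\<lambda>(t, x). f t x) \<in> borel_measurable (N \<Otimes>\<^sub>M leb d)"
    "(\<lambda>(t, x). g t x) \<in> borel_measurable (N \<Otimes>\<^sub>M leb d)"
    using assms by (auto simp: bdd_def)
  have "\<bar>g t x + f t x\<bar> \<le> D + C" if "t \<in> I" "x \<in> Rd d" for t x
    using C D that abs_triangle_ineq[of "g t x" "f t x"] by fastforce
  then show ?thesis unfolding bdd_def by (auto intro!: exI[of _ "D + C"] simp: case_prod_beta')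
qed

lemma bdd_const: "bdd (\<lambda>t x. c)"
  unfolding bdd_def by auto

lemma bdd_cmult: "bdd f \<Longrightarrow> bdd (\<lambda>t x. c * f t x)"
  by (rule bdd_mult[OF bdd_const])

lemma bdd_diff: "bdd g \<Longrightarrow> bdd f \<Longrightarrow> bdd (\<lambda>t x. g t x - f t x)"
  using bdd_add[OF _ bdd_cmult[of f "-1"]] by simp

lemma dom_cmult: "dom f \<Longrightarrow> dom (\<lambda>t x. c * f t x)"
  by (rule dom_mult[OF bdd_const])

lemma dom_diff: "dom g \<Longrightarrow> dom f \<Longrightarrow> dom (\<lambda>t x. g t x - f t x)"
  using dom_add[OF _ dom_cmult[of f "-1"]] by simp

lemma dom_zero: "dom (\<lambda>t x. 0)"
  unfolding dom_def by (auto intro: exI[of _ 0])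

lemma dom_sum: "(\<And>i. i < n \<Longrightarrow> dom (f i)) \<Longrightarrow> dom (\<lambda>t x. \<Sum>i<n. f i t x)" for n :: nat
  by (induction n) (auto intro: dom_zero dom_add)

lemma bdd_sum: "(\<And>i. i < n \<Longrightarrow> bdd (f i)) \<Longrightarrow> bdd (\<lambda>t x. \<Sum>i<n. f i t x)" for n :: nat
  by (induction n) (auto intro: bdd_const bdd_add)

section \<open>Mixing kernels over the initial law\<close>

definition wt :: "(pt \<Rightarrow> real) \<Rightarrow> real \<Rightarrow> bool" where
  "wt v B \<longleftrightarrow> v \<in> borel_measurable (leb d) \<and> (AE a in p0. \<bar>v a\<bar> \<le> B)"

text \<open>The arguments are time, starting point and position. Measurability is stated with the
  starting point as the last component, since it is integrated out first; the bound is asked only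
  for starting points in the cube, which carries \<open>p0\<close>.\<close>

definition adm :: "(real \<Rightarrow> pt \<Rightarrow> pt \<Rightarrow> real) \<Rightarrow> bool" where
  "adm F \<longleftrightarrow> (\<lambda>q. F (fst (fst q)) (snd q) (snd (fst q))) \<in> borel_measurable ((N \<Otimes>\<^sub>M leb d) \<Otimes>\<^sub>M p0) \<and>
     (\<exists>C\<ge>0. \<forall>t\<in>I. \<forall>a x. (\<forall>i<d. \<bar>a i\<bar> \<le> 1) \<longrightarrow> \<bar>F t a x\<bar> \<le> C * E x)"

lemma wt_nonneg: "wt v B \<Longrightarrow> 0 \<le> B"
proof -
  assume "wt v B"
  then have "AE a in p0. \<bar>v a\<bar> \<le> B" by (simp add: wt_def)
  then have "AE a in p0. 0 \<le> B" by eventually_elim auto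
  then show "0 \<le> B" by simp
qed

lemma wt_meas: "wt v B \<Longrightarrow> v \<in> borel_measurable p0"
  unfolding wt_def measurable_cong_sets[OF sets_p0 refl] by (rule conjunct1)

lemma p0_coord[measurable]: "i < d \<Longrightarrow> (\<lambda>a. a i) \<in> borel_measurable p0"
  unfolding measurable_cong_sets[OF sets_p0 refl] by (rule measurable_coord)

lemma p0_integral_bound:
  fixes f :: "pt \<Rightarrow> real"
  assumes "AE a in p0. \<bar>f a\<bar> \<le> c" "0 \<le> c"
  shows "\<bar>\<integral>a. f a \<partial>p0\<bar> \<le> c"
proof (cases "integrable p0 f")
  case True
  have "\<bar>\<integral>a. f a \<partial>p0\<bar> \<le> (\<integral>a. \<bar>f a\<bar> \<partial>p0)" by (rule integral_abs_bound)
  also have "\<dots> \<le> (\<integral>a. c \<partial>p0)" by (rule integral_mono_AE) (use True assms in auto)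
  finally show ?thesis using P.prob_space by simp
qed (use assms in \<open>simp add: not_integrable_integral_eq\<close>)

lemma adm_wt_bound:
  assumes "adm F" "wt v B"
  obtains C where "0 \<le> C" "\<And>t. t \<in> I \<Longrightarrow> AE a in p0. \<forall>x. \<bar>v a * F t a x\<bar> \<le> C * E x"
proof -
  obtain C where C: "0 \<le> C" "\<forall>t\<in>I. \<forall>a x. (\<forall>i<d. \<bar>a i\<bar> \<le> 1) \<longrightarrow> \<bar>F t a x\<bar> \<le> C * E x"
    using assms(1) by (auto simp: adm_def)
  have v: "AE a in p0. \<bar>v a\<bar> \<le> B" using assms(2) by (simp add: wt_def)
  have "AE a in p0. \<forall>x. \<bar>v a * F t a x\<bar> \<le> (B * C) * E x" if t: "t \<in> I" for t
    using v cube
  proof eventually_elim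
    case (elim a)
    show ?case
    proof
      fix x
      have "\<bar>v a * F t a x\<bar> \<le> B * (C * E x)"
        unfolding abs_mult using elim C(2) t wt_nonneg[OF assms(2)] by (intro mult_mono) auto
      then show "\<bar>v a * F t a x\<bar> \<le> (B * C) * E x" by (simp add: mult.assoc)
    qed
  qed
  then show ?thesis using C(1) wt_nonneg[OF assms(2)] by (intro that[of "B * C"]) auto
qed

lemma adm_section:
  assumes "adm F" "t \<in> I"
  shows "(\<lambda>q. F t (fst q) (snd q)) \<in> borel_measurable (p0 \<Otimes>\<^sub>M leb d)"
proof -
  have m: "(\<lambda>q. F (fst (fst q)) (snd q) (snd (fst q))) \<in> borel_measurable ((N \<Otimes>\<^sub>M leb d) \<Otimes>\<^sub>M p0)"
    using assms by (simp add: adm_def)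
  have "(\<lambda>q. ((t, snd q), fst q)) \<in> measurable (p0 \<Otimes>\<^sub>M leb d) ((N \<Otimes>\<^sub>M leb d) \<Otimes>\<^sub>M p0)"
    using assms(2) by (intro measurable_Pair measurable_const) auto
  from measurable_compose[OF this m] show ?thesis by simp
qed

lemma adm_section_a:
  assumes "adm F" "t \<in> I" "x \<in> Rd d"
  shows "(\<lambda>a. F t a x) \<in> borel_measurable p0"
  using measurable_Pair1[OF adm_section[OF assms(1,2)], of x] assms(3) by simp

lemma adm_section_x:
  assumes "adm F" "t \<in> I" "a \<in> Rd d"
  shows "F t a \<in> borel_measurable (leb d)"
  using measurable_Pair2[OF adm_section[OF assms(1,2)], of a] assms(3) by simp

lemma adm_integrable:
  assumes "adm F" "wt v B" "t \<in> I" "x \<in> Rd d"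
  shows "integrable p0 (\<lambda>a. v a * F t a x)"
proof -
  obtain C where C: "0 \<le> C" "\<And>t. t \<in> I \<Longrightarrow> AE a in p0. \<forall>x. \<bar>v a * F t a x\<bar> \<le> C * E x"
    by (rule adm_wt_bound[OF assms(1,2)]) blast
  note [measurable] = wt_meas[OF assms(2)] adm_section_a[OF assms(1,3,4)]
  show ?thesis
    by (rule P.integrable_const_bound[where B="C * E x"])
       (use C(2)[OF assms(3)] in \<open>auto elim: eventually_mono\<close>)
qed

lemma adm_dom:
  assumes "adm F" "wt v B"
  shows "dom (\<lambda>t x. \<integral>a. v a * F t a x \<partial>p0)"
proof -
  obtain C where C: "0 \<le> C" "\<And>t. t \<in> I \<Longrightarrow> AE a in p0. \<forall>x. \<bar>v a * F t a x\<bar> \<le> C * E x"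
    by (rule adm_wt_bound[OF assms(1,2)]) blast
  have [measurable]: "(\<lambda>q. F (fst (fst q)) (snd q) (snd (fst q))) \<in> borel_measurable ((N \<Otimes>\<^sub>M leb d) \<Otimes>\<^sub>M p0)"
    "v \<in> borel_measurable p0"
    using assms by (auto simp: adm_def wt_meas)
  have "(\<lambda>p. \<integral>a. v a * F (fst p) a (snd p) \<partial>p0) \<in> borel_measurable (N \<Otimes>\<^sub>M leb d)"
    by (rule P.borel_measurable_lebesgue_integral) (simp add: case_prod_beta')
  moreover have "\<bar>\<integral>a. v a * F t a x \<partial>p0\<bar> \<le> C * E x" if "t \<in> I" for t x
    using C gauss_env_pos[of d x] by (intro p0_integral_bound) (use C(2)[OF that] in \<open>auto elim: eventually_mono\<close>)
  ultimately show ?thesis unfolding dom_def by (auto simp: case_prod_beta' intro!: exI[of _ C])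
qed

text \<open>Fubini between position and starting point, with a bounded multiplier in the position.
  The third claim concerns almost every single starting point, because the integration by parts
  takes place there, before mixing.\<close>

lemma adm_swap:
  assumes F: "adm F" and v: "wt v B" and t: "t \<in> I"
    and g: "g \<in> borel_measurable (leb d)" "\<forall>x\<in>Rd d. \<bar>g x\<bar> \<le> M"
  shows "(\<integral>x. g x * (\<integral>a. v a * F t a x \<partial>p0) \<partial>leb d) = (\<integral>a. v a * (\<integral>x. g x * F t a x \<partial>leb d) \<partial>p0)"
    and "integrable p0 (\<lambda>a. v a * (\<integral>x. g x * F t a x \<partial>leb d))"
    and "AE a in p0. integrable (leb d) (\<lambda>x. g x * F t a x)"
proof -
  obtain C where C: "0 \<le> C" "\<And>t. t \<in> I \<Longrightarrow> AE a in p0. \<forall>x. \<bar>v a * F t a x\<bar> \<le> C * E x"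
    by (rule adm_wt_bound[OF F v]) blast
  \<comment> \<open>The weight v may vanish at some starting points, so integrability of F itself
    has to come from the bound for the weight 1.\<close>
  have w1: "wt (\<lambda>_. 1) 1" by (simp add: wt_def)
  obtain C1 where C1: "0 \<le> C1" "\<And>t. t \<in> I \<Longrightarrow> AE a in p0. \<forall>x. \<bar>1 * F t a x\<bar> \<le> C1 * E x"
    by (rule adm_wt_bound[OF F w1]) blast
  note [measurable] = adm_section[OF F t] wt_meas[OF v] g(1)
  have gi: "integrable (leb d) (\<lambda>x. g x * f x)"
    if "f \<in> borel_measurable (leb d)" "\<forall>x. \<bar>f x\<bar> \<le> D * E x" for f D
  proof (rule Bochner_Integration.integrable_bound)
    show "integrable (leb d) (\<lambda>x. (\<bar>M\<bar> * D) * E x)" using gauss_env_integrable by simp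
    show "(\<lambda>x. g x * f x) \<in> borel_measurable (leb d)" using that(1) by measurable
    show "AE x in leb d. norm (g x * f x) \<le> norm ((\<bar>M\<bar> * D) * E x)"
    proof (rule AE_I2)
      fix x assume "x \<in> space (leb d)"
      then have "\<bar>g x * f x\<bar> \<le> \<bar>M\<bar> * (D * E x)"
        unfolding abs_mult using g(2) that(2) by (intro mult_mono) (auto intro: order_trans[OF _ abs_ge_self])
      then show "norm (g x * f x) \<le> norm ((\<bar>M\<bar> * D) * E x)" by (simp add: mult.assoc)
    qed
  qed
  have sp: "AE a in p0. a \<in> Rd d" using AE_space[of p0] by simp
  show "AE a in p0. integrable (leb d) (\<lambda>x. g x * F t a x)"
    using C1(2)[OF t] sp 
  proof eventually_elim
    case (elim a)
    from elim(1) have "\<forall>x. \<bar>F t a x\<bar> \<le> C1 * E x" by simp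
    then show ?case by (rule gi[OF adm_section_x[OF F t elim(2)]])
  qed
  have gv: "AE a in p0. integrable (leb d) (\<lambda>x. g x * (v a * F t a x)) \<and>
      \<bar>\<integral>x. norm (g x * (v a * F t a x)) \<partial>leb d\<bar> \<le> (\<integral>x. \<bar>M\<bar> * (C * E x) \<partial>leb d)"
    using C(2)[OF t] sp
  proof eventually_elim
    case (elim a)
    have i: "integrable (leb d) (\<lambda>x. g x * (v a * F t a x))"
      by (rule gi[OF borel_measurable_times[OF borel_measurable_const adm_section_x[OF F t elim(2)]] elim(1)])
    have "(\<integral>x. norm (g x * (v a * F t a x)) \<partial>leb d) \<le> (\<integral>x. \<bar>M\<bar> * (C * E x) \<partial>leb d)"
    proof (rule integral_mono)
      fix x assume "x \<in> space (leb d)"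
      then show "norm (g x * (v a * F t a x)) \<le> \<bar>M\<bar> * (C * E x)"
        unfolding real_norm_def abs_mult[of "g x"] using g(2) elim(1)
        by (intro mult_mono) (auto intro: order_trans[OF _ abs_ge_self])
    qed (use i gauss_env_integrable in auto)
    then show ?case using i by (simp add: integral_nonneg_AE)
  qed
  have int: "integrable (p0 \<Otimes>\<^sub>M leb d) (\<lambda>(a, x). g x * (v a * F t a x))"
  proof (rule PL.Fubini_integrable)
    show m: "(\<lambda>(a, x). g x * (v a * F t a x)) \<in> borel_measurable (p0 \<Otimes>\<^sub>M leb d)"
      unfolding case_prod_beta' by measurable
    have "(\<lambda>a. \<integral>x. norm (g x * (v a * F t a x)) \<partial>leb d) \<in> borel_measurable p0"
      by (rule L.borel_measurable_lebesgue_integral) (simp add: case_prod_beta')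
    then show "integrable p0 (\<lambda>a. \<integral>x. norm (case (a, x) of (a, x) \<Rightarrow> g x * (v a * F t a x)) \<partial>leb d)"
      using gv by (intro P.integrable_const_bound[where B="\<integral>x. \<bar>M\<bar> * (C * E x) \<partial>leb d"])
        (auto elim: eventually_mono)
    show "AE a in p0. integrable (leb d) (\<lambda>x. case (a, x) of (a, x) \<Rightarrow> g x * (v a * F t a x))"
      using gv by (auto elim: eventually_mono)
  qed
  have eq: "(\<integral>x. g x * (v a * F t a x) \<partial>leb d) = v a * (\<integral>x. g x * F t a x \<partial>leb d)" for a
    using integral_mult_right_zero[of "leb d" "v a" "\<lambda>x. g x * F t a x"] by (simp add: mult_ac)
  show "integrable p0 (\<lambda>a. v a * (\<integral>x. g x * F t a x \<partial>leb d))"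
    using PL.integrable_fst'[OF int] by (simp add: eq)
  have "(\<integral>x. (\<integral>a. g x * (v a * F t a x) \<partial>p0) \<partial>leb d) = (\<integral>a. (\<integral>x. g x * (v a * F t a x) \<partial>leb d) \<partial>p0)"
    using PL.Fubini_integral[OF int] by simp
  then show "(\<integral>x. g x * (\<integral>a. v a * F t a x \<partial>p0) \<partial>leb d) = (\<integral>a. v a * (\<integral>x. g x * F t a x \<partial>leb d) \<partial>p0)"
    by (simp add: eq)
qed

lemma kernel_K:
  assumes "t \<in> I" "\<forall>i<d. \<bar>a i\<bar> \<le> 1"
  shows K_k: "\<bar>ou_kernel d (T - t) a x\<bar> \<le> K * E x"
    and K_kt: "\<bar>kt d (T - t) a x\<bar> \<le> K * E x"
    and K_kx: "i < d \<Longrightarrow> \<bar>kx d i (T - t) a x\<bar> \<le> K * E x"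
    and K_kj: "i < d \<Longrightarrow> \<bar>kj d i (T - t) a x\<bar> \<le> K * E x"
    and K_kjw: "i < d \<Longrightarrow> \<bar>(1 + \<bar>x i\<bar>) * kj d i (T - t) a x\<bar> \<le> K * E x"
    and K_kjx: "i < d \<Longrightarrow> \<bar>kjx d i (T - t) a x\<bar> \<le> K * E x"
    and K_kx2: "i < d \<Longrightarrow> \<bar>kx d i (T - t) a x\<bar> \<le> K * ((1 + \<bar>x i\<bar>) * ou_kernel d (T - t) a x)"
proof -
  have *: "\<bar>(1 + \<bar>x i\<bar>) * kj d i (T - t) a x\<bar> = (1 + \<bar>x i\<bar>) * \<bar>kj d i (T - t) a x\<bar>"
    by (simp add: abs_mult)
  note KK = K[unfolded kernel_const_def, THEN conjunct2, rule_format, OF assms(1), of a x, OF assms(2)[rule_format]]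
  show "\<bar>ou_kernel d (T - t) a x\<bar> \<le> K * E x" "\<bar>kt d (T - t) a x\<bar> \<le> K * E x"
    using KK by blast+
  show "\<bar>kx d i (T - t) a x\<bar> \<le> K * E x" "\<bar>kj d i (T - t) a x\<bar> \<le> K * E x"
    "\<bar>(1 + \<bar>x i\<bar>) * kj d i (T - t) a x\<bar> \<le> K * E x" "\<bar>kjx d i (T - t) a x\<bar> \<le> K * E x"
    "\<bar>kx d i (T - t) a x\<bar> \<le> K * ((1 + \<bar>x i\<bar>) * ou_kernel d (T - t) a x)" if "i < d"
    unfolding * using KK that by blast+
qed

text \<open>The variant \<open>adm_kjw\<close> with the factor 1 + |x_i| is prepared for pairing the
  flux with functions of linear growth, such as the gradient of the posterior mean.\<close>

lemma adm_kernels: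
  shows adm_k: "adm (\<lambda>t. ou_kernel d (T - t))"
    and adm_kt: "adm (\<lambda>t. kt d (T - t))"
    and adm_kx: "i < d \<Longrightarrow> adm (\<lambda>t. kx d i (T - t))"
    and adm_kj: "i < d \<Longrightarrow> adm (\<lambda>t. kj d i (T - t))"
    and adm_kjx: "i < d \<Longrightarrow> adm (\<lambda>t. kjx d i (T - t))"
    and adm_kjw: "i < d \<Longrightarrow> adm (\<lambda>t a x. (1 + \<bar>x i\<bar>) * kj d i (T - t) a x)"
proof -
  let ?Q = "(N \<Otimes>\<^sub>M leb d) \<Otimes>\<^sub>M p0"
  have "(\<lambda>t. t) \<in> borel_measurable (restrict_space lborel I)"
    by (rule measurable_restrict_space1) simp
  then have tm: "(\<lambda>t. t) \<in> borel_measurable N"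
    using measurable_cong_sets[OF sets_nu refl] by blast
  have [measurable]: "(\<lambda>q. fst (fst q)) \<in> borel_measurable ?Q"
    by (rule measurable_compose[OF measurable_fst measurable_compose[OF measurable_fst tm]])
  have xm[measurable]: "(\<lambda>q. snd (fst q) i) \<in> borel_measurable ?Q" if "i < d" for i
    by (rule measurable_compose[OF measurable_fst measurable_compose[OF measurable_snd measurable_coord[OF that]]])
  have [measurable]: "(\<lambda>q. snd q i) \<in> borel_measurable ?Q" if "i < d" for i
    by (rule measurable_compose[OF measurable_snd p0_coord[OF that]])
  have k[measurable]: "(\<lambda>q. ou_kernel d (T - fst (fst q)) (snd q) (snd (fst q))) \<in> borel_measurable ?Q"
    unfolding ou_kernel_def normal_density_def mu_ou_def sigma_ou_def
    by (intro borel_measurable_prod) simp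
  have sl[measurable]: "(\<lambda>q. ksl (T - fst (fst q)) (snd q i) (snd (fst q) i)) \<in> borel_measurable ?Q" if "i < d" for i
    using that unfolding ksl_def mu_ou_def var_ou_def by simp
  have kb[measurable]: "(\<lambda>q. kb (T - fst (fst q)) (snd q i) (snd (fst q) i)) \<in> borel_measurable ?Q" if "i < d" for i
    using that unfolding kb_def mu_ou_def var_ou_def by simp
  note K0 = less_imp_le[OF K_pos]
  show "adm (\<lambda>t. ou_kernel d (T - t))"
    unfolding adm_def by (intro conjI exI[of _ K] k K0 ballI allI impI) (rule K_k)
  show "adm (\<lambda>t. kt d (T - t))"
    unfolding adm_def
  proof (intro conjI exI[of _ K])
    show "(\<lambda>q. kt d (T - fst (fst q)) (snd q) (snd (fst q))) \<in> borel_measurable ?Q"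
      unfolding kt_def by (intro borel_measurable_times k borel_measurable_sum kb) simp
  qed (rule K0, intro ballI allI impI, rule K_kt)
  show "adm (\<lambda>t. kx d i (T - t))" if "i < d"
    unfolding adm_def
  proof (intro conjI exI[of _ K])
    show "(\<lambda>q. kx d i (T - fst (fst q)) (snd q) (snd (fst q))) \<in> borel_measurable ?Q"
      unfolding kx_def by (intro borel_measurable_times k sl that)
  qed (rule K0, intro ballI allI impI, rule K_kx[OF _ _ that])
  have j: "(\<lambda>q. kj d i (T - fst (fst q)) (snd q) (snd (fst q))) \<in> borel_measurable ?Q" if "i < d" for i
    unfolding kj_def by (intro borel_measurable_times borel_measurable_add xm k sl that)
  show "adm (\<lambda>t. kj d i (T - t))" if "i < d"
    unfolding adm_def
  proof (intro conjI exI[of _ K])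
    show "(\<lambda>q. kj d i (T - fst (fst q)) (snd q) (snd (fst q))) \<in> borel_measurable ?Q" by (rule j[OF that])
  qed (rule K0, intro ballI allI impI, rule K_kj[OF _ _ that])
  show "adm (\<lambda>t. kjx d i (T - t))" if "i < d"
    unfolding adm_def
  proof (intro conjI exI[of _ K])
    show "(\<lambda>q. kjx d i (T - fst (fst q)) (snd q) (snd (fst q))) \<in> borel_measurable ?Q"
      unfolding kjx_def by (intro borel_measurable_times k kb that)
  qed (rule K0, intro ballI allI impI, rule K_kjx[OF _ _ that])
  show "adm (\<lambda>t a x. (1 + \<bar>x i\<bar>) * kj d i (T - t) a x)" if "i < d"
    unfolding adm_def
  proof (intro conjI exI[of _ K])
    show "(\<lambda>q. (1 + \<bar>snd (fst q) i\<bar>) * kj d i (T - fst (fst q)) (snd q) (snd (fst q))) \<in> borel_measurable ?Q"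
      by (intro borel_measurable_times borel_measurable_add borel_measurable_const borel_measurable_abs xm j that)
  qed (rule K0, intro ballI allI impI, rule K_kjw[OF _ _ that])
qed

section \<open>The Fokker-Planck equation\<close>

text \<open>\<open>rw v\<close> is the density of \<open>X\<close> at time \<open>T - t\<close> when the initial law is weighted by \<open>v\<close>, so that
  \<open>h\<^sup>* = rw w / rw 1\<close>; \<open>rt\<close>, \<open>rx\<close> and \<open>rj\<close> are its time derivative, its spatial derivatives and its flux.
  The sign in \<open>rt\<close> comes from reversing time.\<close>

definition rw :: "(pt \<Rightarrow> real) \<Rightarrow> tfun" where
  "rw v t x = (\<integral>a. v a * ou_kernel d (T - t) a x \<partial>p0)"

definition rt :: "(pt \<Rightarrow> real) \<Rightarrow> tfun" where
  "rt v t x = - (\<integral>a. v a * kt d (T - t) a x \<partial>p0)"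

definition rx :: "(pt \<Rightarrow> real) \<Rightarrow> nat \<Rightarrow> tfun" where
  "rx v i t x = (\<integral>a. v a * kx d i (T - t) a x \<partial>p0)"

definition rj :: "(pt \<Rightarrow> real) \<Rightarrow> nat \<Rightarrow> tfun" where
  "rj v i t x = (\<integral>a. v a * kj d i (T - t) a x \<partial>p0)"

lemma dom_rw: "wt v B \<Longrightarrow> dom (rw v)"
  unfolding rw_def[abs_def] by (rule adm_dom[OF adm_k])

lemma dom_rt: "wt v B \<Longrightarrow> dom (rt v)"
  unfolding rt_def[abs_def] using dom_cmult[OF adm_dom[OF adm_kt], of v B "-1"] by simp

lemma dom_rx: "wt v B \<Longrightarrow> i < d \<Longrightarrow> dom (rx v i)"
  unfolding rx_def[abs_def] by (rule adm_dom[OF adm_kx])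

lemma dom_rj: "wt v B \<Longrightarrow> i < d \<Longrightarrow> dom (rj v i)"
  unfolding rj_def[abs_def] by (rule adm_dom[OF adm_kj])

lemma dom_rjw: "wt v B \<Longrightarrow> i < d \<Longrightarrow> dom (\<lambda>t x. (1 + \<bar>x i\<bar>) * rj v i t x)"
proof -
  assume "wt v B" "i < d"
  from adm_dom[OF adm_kjw[OF this(2)] this(1)]
  have "dom (\<lambda>t x. \<integral>a. (1 + \<bar>x i\<bar>) * (v a * kj d i (T - t) a x) \<partial>p0)" by (simp add: mult_ac)
  then show ?thesis unfolding rj_def[abs_def] by simp
qed

lemma rj_eq: "wt v B \<Longrightarrow> i < d \<Longrightarrow> t \<in> I \<Longrightarrow> x \<in> Rd d \<Longrightarrow> rj v i t x = x i * rw v t x + rx v i t x"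
proof -
  assume v: "wt v B" and i: "i < d" and tx: "t \<in> I" "x \<in> Rd d"
  have "rj v i t x = (\<integral>a. x i * (v a * ou_kernel d (T - t) a x) + v a * kx d i (T - t) a x \<partial>p0)"
    unfolding rj_def by (rule Bochner_Integration.integral_cong) (auto simp: kj_def kx_def algebra_simps)
  also have "\<dots> = x i * rw v t x + rx v i t x"
    using adm_integrable[OF adm_k v tx] adm_integrable[OF adm_kx[OF i] v tx]
    by (simp add: rw_def rx_def)
  finally show ?thesis .
qed

lemma rw_DERIV_time:
  assumes v: "wt v B" and t: "t \<in> I" and x: "x \<in> Rd d"
  shows "((\<lambda>t. rw v t x) has_real_derivative rt v t x) (at t within I)"
proof -
  have "((\<lambda>t. \<integral>a. v a * ou_kernel d (T - t) a x \<partial>p0) has_real_derivative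
      (\<integral>a. - (v a * kt d (T - t) a x) \<partial>p0)) (at t within I)"
  proof (rule has_real_derivative_integral[where S=I and M=p0 and f="\<lambda>t a. v a * ou_kernel d (T - t) a x" and g="\<lambda>_. B * (K * E x)" and f'="\<lambda>t a. - (v a * kt d (T - t) a x)"])
    show "integrable p0 (\<lambda>a. v a * ou_kernel d (T - r) a x)" if "r \<in> I" for r
      by (rule adm_integrable[OF adm_k v that x])
    show "(\<lambda>a. - (v a * kt d (T - t) a x)) \<in> borel_measurable p0"
      using adm_integrable[OF adm_kt v t x] by auto
    have "AE a in p0. \<bar>v a\<bar> \<le> B" using v by (simp add: wt_def)
    then show "AE a in p0. \<forall>r\<in>I. ((\<lambda>r. v a * ou_kernel d (T - r) a x) has_real_derivative - (v a * kt d (T - r) a x)) (at r within I)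
        \<and> \<bar>- (v a * kt d (T - r) a x)\<bar> \<le> B * (K * E x)"
      using cube
    proof eventually_elim
      case (elim a)
      show ?case
      proof (intro ballI conjI)
        fix r assume r: "r \<in> I"
        then have "0 < T - r" using t1 by simp
        have "((\<lambda>r. T - r) has_real_derivative - 1) (at r within I)"
          by (auto intro!: derivative_eq_intros)
        from DERIV_chain2[where f="\<lambda>\<tau>. ou_kernel d \<tau> a x" and g="\<lambda>r. T - r", OF ou_kernel_DERIV_time[OF \<open>0 < T - r\<close>] this]
        have "((\<lambda>r. ou_kernel d (T - r) a x) has_real_derivative - kt d (T - r) a x) (at r within I)"
          by simp
        from DERIV_cmult[OF this, of "v a"]
        show "((\<lambda>r. v a * ou_kernel d (T - r) a x) has_real_derivative - (v a * kt d (T - r) a x)) (at r within I)"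
          by simp
        have "\<bar>v a * kt d (T - r) a x\<bar> \<le> B * (K * E x)"
          unfolding abs_mult using elim K_kt[OF r elim(2)] wt_nonneg[OF v] by (intro mult_mono) auto
        then show "\<bar>- (v a * kt d (T - r) a x)\<bar> \<le> B * (K * E x)" by simp
      qed
    qed
  qed (use t in auto)
  then show ?thesis by (simp add: rw_def rt_def)
qed

lemma rw_DERIV_space:
  assumes v: "wt v B" and t: "t \<in> I" and x: "x \<in> Rd d" and i: "i < d"
  shows "((\<lambda>y. rw v t (x(i := y))) has_real_derivative rx v i t (x(i := y))) (at y)"
proof -
  have "((\<lambda>y. \<integral>a. v a * ou_kernel d (T - t) a (x(i := y)) \<partial>p0) has_real_derivative
      (\<integral>a. v a * kx d i (T - t) a (x(i := y)) \<partial>p0)) (at y within UNIV)"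
  proof (rule has_real_derivative_integral[where S=UNIV and M=p0 and f="\<lambda>y a. v a * ou_kernel d (T - t) a (x(i := y))" and g="\<lambda>_. B * (K * 1)" and f'="\<lambda>y a. v a * kx d i (T - t) a (x(i := y))"])
    show "integrable p0 (\<lambda>a. v a * ou_kernel d (T - t) a (x(i := r)))" for r
      by (rule adm_integrable[OF adm_k v t]) (use x i in simp)
    show "(\<lambda>a. v a * kx d i (T - t) a (x(i := y))) \<in> borel_measurable p0"
      using adm_integrable[OF adm_kx[OF i] v t, of "x(i := y)"] x i by auto
    have "AE a in p0. \<bar>v a\<bar> \<le> B" using v by (simp add: wt_def)
    then show "AE a in p0. \<forall>r\<in>UNIV. ((\<lambda>r. v a * ou_kernel d (T - t) a (x(i := r))) has_real_derivative
          v a * kx d i (T - t) a (x(i := r))) (at r within UNIV)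
        \<and> \<bar>v a * kx d i (T - t) a (x(i := r))\<bar> \<le> B * (K * 1)"
      using cube
    proof eventually_elim
      case (elim a)
      show ?case
      proof (intro ballI conjI)
        fix r :: real
        have "0 < T - t" using t1 t by simp
        from DERIV_cmult[OF ou_kernel_DERIV_space[OF this i, of a x r], of "v a"]
        show "((\<lambda>r. v a * ou_kernel d (T - t) a (x(i := r))) has_real_derivative
          v a * kx d i (T - t) a (x(i := r))) (at r within UNIV)" by simp
        have "\<bar>kx d i (T - t) a (x(i := r))\<bar> \<le> K * E (x(i := r))"
          by (rule K_kx[OF t elim(2) i])
        also have "\<dots> \<le> K * 1" using K_pos gauss_env_le_1 by (intro mult_left_mono) auto
        finally show "\<bar>v a * kx d i (T - t) a (x(i := r))\<bar> \<le> B * (K * 1)"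
          unfolding abs_mult using elim wt_nonneg[OF v] by (intro mult_mono) auto
      qed
    qed
  qed auto
  then show ?thesis by (simp add: rw_def rx_def)
qed

text \<open>The kernel satisfies \<open>\<partial>\<^sub>\<tau> k = \<Sum>\<^sub>i \<partial>\<^sub>i (x\<^sub>i k + \<partial>\<^sub>i k)\<close>, which is integrated by parts for each starting point separately.\<close>

lemma weak_fokker_planck:
  assumes v: "wt v B" and t: "t \<in> I"
    and u: "u \<in> borel_measurable (leb d)" "\<And>x. x \<in> Rd d \<Longrightarrow> \<bar>u x\<bar> \<le> M"
    and g: "\<And>i. i < d \<Longrightarrow> g i \<in> borel_measurable (leb d)"
      "\<And>i x. i < d \<Longrightarrow> x \<in> Rd d \<Longrightarrow> \<bar>g i x\<bar> \<le> M * (1 + \<bar>x i\<bar>)"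
    and ug: "\<And>i x. i < d \<Longrightarrow> x \<in> Rd d \<Longrightarrow> ((\<lambda>y. u (x(i := y))) has_real_derivative g i x) (at (x i))"
  shows "(\<integral>x. u x * rt v t x \<partial>leb d) = (\<Sum>i<d. \<integral>x. g i x * rj v i t x \<partial>leb d)"
proof -
  \<comment> \<open>The gradient may grow linearly. Its growth is moved to the flux, so that a
    bounded multiplier meets an admissible kernel and \<open>adm_swap\<close> applies.\<close>
  let ?g = "\<lambda>i x. g i x / (1 + \<bar>x i\<bar>)"
  let ?F = "\<lambda>i t a x. (1 + \<bar>x i\<bar>) * kj d i (T - t) a x"
  have p1: "0 < 1 + \<bar>x i\<bar>" for x :: pt and i by linarith
  have gF: "?g i x * ?F i t a x = g i x * kj d i (T - t) a x" for i a x
    using p1[of x i] by simp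
  have u': "\<forall>x\<in>Rd d. \<bar>u x\<bar> \<le> M" using u(2) by blast
  have g': "?g i \<in> borel_measurable (leb d)" "\<forall>x\<in>Rd d. \<bar>?g i x\<bar> \<le> M" if "i < d" for i
    using g[OF that] measurable_coord[OF that] p1 by (auto simp: abs_divide divide_le_eq)
  have swi: "integrable p0 (\<lambda>a. v a * (\<integral>x. ?g i x * ?F i t a x \<partial>leb d))" if "i < d" for i
    by (rule adm_swap(2)[OF adm_kjw[OF that] v t g'[OF that]])
  have one: "AE a in p0. \<forall>i<d. (\<integral>x. u x * kjx d i (T - t) a x \<partial>leb d) = - (\<integral>x. g i x * kj d i (T - t) a x \<partial>leb d)"
  proof -
    have "AE a in p0. \<forall>i\<in>{..<d}. integrable (leb d) (\<lambda>x. u x * kjx d i (T - t) a x) \<and>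
        integrable (leb d) (\<lambda>x. ?g i x * ?F i t a x)"
    proof (subst AE_ball_countable)
      show "countable {..<d}" by simp
      show "\<forall>i\<in>{..<d}. AE a in p0. integrable (leb d) (\<lambda>x. u x * kjx d i (T - t) a x) \<and>
        integrable (leb d) (\<lambda>x. ?g i x * ?F i t a x)"
      proof
        fix i assume "i \<in> {..<d}"
        then have i: "i < d" by simp
        show "AE a in p0. integrable (leb d) (\<lambda>x. u x * kjx d i (T - t) a x) \<and>
          integrable (leb d) (\<lambda>x. ?g i x * ?F i t a x)"
          using adm_swap(3)[OF adm_kjx[OF i] v t u(1) u'] adm_swap(3)[OF adm_kjw[OF i] v t g'[OF i]]
          by eventually_elim blast
      qed
    qed
    then show ?thesis using cube
    proof eventually_elim
      case (elim a)
      show ?case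
      proof (intro allI impI)
        fix i assume i: "i < d"
        have int: "integrable (leb d) (\<lambda>x. u x * kjx d i (T - t) a x)"
          "integrable (leb d) (\<lambda>x. g i x * kj d i (T - t) a x)"
          using elim(1) i unfolding gF by auto
        have "(\<integral>x. g i x * kj d i (T - t) a x + u x * kjx d i (T - t) a x \<partial>leb d) = 0"
        proof (rule integral_leb_partial_eq_0[OF i, where F="\<lambda>x. u x * kj d i (T - t) a x"])
          show "integrable (leb d) (\<lambda>x. g i x * kj d i (T - t) a x + u x * kjx d i (T - t) a x)"
            using int by simp
          fix x assume x: "x \<in> Rd d"
          \<comment> \<open>Here u is bounded and the flux is dominated by the envelope, so the
            boundary terms vanish at both ends of every coordinate line.\<close>
          have bd: "\<bar>u (x(i := y)) * kj d i (T - t) a (x(i := y))\<bar> \<le> (\<bar>M\<bar> * K) * E (x(i := y))" for y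
          proof -
            have "\<bar>u (x(i := y)) * kj d i (T - t) a (x(i := y))\<bar> \<le> \<bar>M\<bar> * (K * E (x(i := y)))"
              unfolding abs_mult using u(2)[OF Rd_upd[OF x i, of y]] K_kj[OF t elim(2) i]
              by (intro mult_mono) auto
            then show ?thesis by (simp add: mult.assoc)
          qed
          have bd0: "0 \<le> (\<bar>M\<bar> * K) * E (x(i := y))" for y
            using K_pos gauss_env_pos[of d "x(i := y)"] by simp
          show "((\<lambda>y. u (x(i := y)) * kj d i (T - t) a (x(i := y))) \<longlongrightarrow> 0) at_top"
            by (rule Lim_null_comparison[OF _ tendsto_mult_right_zero[OF gauss_env_tendsto(1)[OF i, of x], of "\<bar>M\<bar> * K"]])
               (intro always_eventually allI, unfold real_norm_def, rule bd)
          show "((\<lambda>y. u (x(i := y)) * kj d i (T - t) a (x(i := y))) \<longlongrightarrow> 0) at_bot"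
            by (rule Lim_null_comparison[OF _ tendsto_mult_right_zero[OF gauss_env_tendsto(2)[OF i, of x], of "\<bar>M\<bar> * K"]])
               (intro always_eventually allI, unfold real_norm_def, rule bd)
          fix y
          have "0 < T - t" using t1 t by simp
          have "((\<lambda>y. u (x(i := y))) has_real_derivative g i (x(i := y))) (at y)"
            using ug[OF i Rd_upd[OF x i, of y]] by simp
          from DERIV_mult[OF this kj_DERIV[OF \<open>0 < T - t\<close> i, of a x y]]
          show "((\<lambda>y. u (x(i := y)) * kj d i (T - t) a (x(i := y))) has_real_derivative
            g i (x(i := y)) * kj d i (T - t) a (x(i := y)) + u (x(i := y)) * kjx d i (T - t) a (x(i := y))) (at y)"
            by (simp add: algebra_simps)
        qed
        then show "(\<integral>x. u x * kjx d i (T - t) a x \<partial>leb d) = - (\<integral>x. g i x * kj d i (T - t) a x \<partial>leb d)"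
          using int by simp
      qed
    qed
  qed
  have "(\<integral>x. u x * rt v t x \<partial>leb d) = - (\<integral>a. v a * (\<integral>x. u x * kt d (T - t) a x \<partial>leb d) \<partial>p0)"
    unfolding rt_def using adm_swap(1)[OF adm_kt v t u(1) u'] by simp
  also have "(\<integral>a. v a * (\<integral>x. u x * kt d (T - t) a x \<partial>leb d) \<partial>p0)
      = (\<integral>a. (\<Sum>i<d. - (v a * (\<integral>x. ?g i x * ?F i t a x \<partial>leb d))) \<partial>p0)"
  proof (rule integral_cong_AE)
    show "(\<lambda>a. v a * (\<integral>x. u x * kt d (T - t) a x \<partial>leb d)) \<in> borel_measurable p0"
      using adm_swap(2)[OF adm_kt v t u(1) u'] by auto
    show "(\<lambda>a. \<Sum>i<d. - (v a * (\<integral>x. ?g i x * ?F i t a x \<partial>leb d))) \<in> borel_measurable p0"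
      by (intro borel_measurable_sum borel_measurable_uminus borel_measurable_integrable swi) simp
    have "AE a in p0. \<forall>i\<in>{..<d}. integrable (leb d) (\<lambda>x. u x * kjx d i (T - t) a x)"
      using adm_swap(3)[OF adm_kjx v t u(1) u'] by (subst AE_ball_countable) auto
    then show "AE a in p0. v a * (\<integral>x. u x * kt d (T - t) a x \<partial>leb d) = (\<Sum>i<d. - (v a * (\<integral>x. ?g i x * ?F i t a x \<partial>leb d)))"
      using one
    proof eventually_elim
      case (elim a)
      have "(\<integral>x. u x * kt d (T - t) a x \<partial>leb d) = (\<integral>x. (\<Sum>i<d. u x * kjx d i (T - t) a x) \<partial>leb d)"
        by (simp add: kt_sum sum_distrib_left)
      also have "\<dots> = (\<Sum>i<d. \<integral>x. u x * kjx d i (T - t) a x \<partial>leb d)"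
        using elim(1) by (intro Bochner_Integration.integral_sum) auto
      also have "\<dots> = (\<Sum>i<d. - (\<integral>x. ?g i x * ?F i t a x \<partial>leb d))"
        using elim(2) unfolding gF by (intro sum.cong) auto
      finally show ?case by (simp add: sum_distrib_left)
    qed
  qed
  also have "\<dots> = (\<Sum>i<d. - (\<integral>a. v a * (\<integral>x. ?g i x * ?F i t a x \<partial>leb d) \<partial>p0))"
    unfolding integral_minus[symmetric]
    by (rule Bochner_Integration.integral_sum) (intro Bochner_Integration.integrable_minus swi, simp)
  also have "\<dots> = (\<Sum>i<d. - (\<integral>x. g i x * rj v i t x \<partial>leb d))"
  proof (rule sum.cong[OF refl])
    fix i assume "i \<in> {..<d}"
    then have i: "i < d" by simp
    have "(\<integral>a. v a * (\<integral>x. ?g i x * ?F i t a x \<partial>leb d) \<partial>p0) = (\<integral>x. ?g i x * (\<integral>a. v a * ?F i t a x \<partial>p0) \<partial>leb d)"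
      by (rule adm_swap(1)[OF adm_kjw[OF i] v t g'[OF i], symmetric])
    also have "\<dots> = (\<integral>x. g i x * rj v i t x \<partial>leb d)"
    proof (rule Bochner_Integration.integral_cong[OF refl])
      fix x
      have "(\<integral>a. v a * ?F i t a x \<partial>p0) = (1 + \<bar>x i\<bar>) * rj v i t x"
        unfolding rj_def by (subst integral_mult_right_zero[symmetric]) (simp add: mult_ac)
      then show "?g i x * (\<integral>a. v a * ?F i t a x \<partial>p0) = g i x * rj v i t x"
        using p1[of x i] by simp
    qed
    finally show "- (\<integral>a. v a * (\<integral>x. ?g i x * ?F i t a x \<partial>leb d) \<partial>p0) = - (\<integral>x. g i x * rj v i t x \<partial>leb d)" by simp
  qed
  finally show ?thesis by (simp add: sum_negf)
qed

section \<open>The equation of the posterior mean\<close>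

text \<open>Derivatives are passed along as explicit functions, so that sums, differences and
  products are handled by derivative rules without evaluating \<open>dt\<close> or
  \<open>pd\<close>.\<close>

definition nice :: "tfun \<Rightarrow> tfun \<Rightarrow> (nat \<Rightarrow> tfun) \<Rightarrow> bool" where
  "nice u ut ux \<longleftrightarrow> bdd u \<and> bdd ut \<and> (\<forall>i<d. bdd (ux i)) \<and>
     (\<forall>t\<in>I. \<forall>x\<in>Rd d. ((\<lambda>r. u r x) has_real_derivative ut t x) (at t within I)) \<and>
     (\<forall>i<d. \<forall>t\<in>I. \<forall>x\<in>Rd d. ((\<lambda>y. u t (x(i := y))) has_real_derivative ux i t x) (at (x i)))"

lemma nice_diff:
  assumes "nice u ut ux" "nice v vt vx"
  shows "nice (\<lambda>t x. u t x - v t x) (\<lambda>t x. ut t x - vt t x) (\<lambda>i t x. ux i t x - vx i t x)"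
  using assms unfolding nice_def by (auto intro: bdd_diff DERIV_diff)

abbreviation (input) "\<rho> \<equiv> rw (\<lambda>_. 1)"

lemma wt_1: "wt (\<lambda>_. 1) 1"
  by (simp add: wt_def)

lemma rho_dens_eq: "rho_dens d p0 T t x = \<rho> t x"
  by (simp add: rho_dens_def ou_dens_def rw_def)

lemma rho_pos:
  assumes "t \<in> I" "x \<in> Rd d"
  shows "0 < \<rho> t x"
proof -
  have int: "integrable p0 (\<lambda>a. ou_kernel d (T - t) a x)"
    using adm_integrable[OF adm_k wt_1 assms] by simp
  have "0 < T - t" using assms t1 by simp
  note kp = ou_kernel_pos[OF this]
  have "\<rho> t x \<noteq> 0"
  proof
    assume "\<rho> t x = 0"
    then have "AE a in p0. ou_kernel d (T - t) a x = 0"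
      using integral_nonneg_eq_0_iff_AE[OF int] ou_kernel_nonneg by (auto simp: rw_def)
    then have "AE a in p0. False" by eventually_elim (use kp[of d _ x] in \<open>metis less_irrefl\<close>)
    then show False by simp
  qed
  moreover have "0 \<le> \<rho> t x"
    unfolding rw_def by (intro integral_nonneg_AE) (simp add: ou_kernel_nonneg)
  ultimately show ?thesis by simp
qed

lemma abs_rw_le: "wt v B \<Longrightarrow> t \<in> I \<Longrightarrow> x \<in> Rd d \<Longrightarrow> \<bar>rw v t x\<bar> \<le> B * \<rho> t x"
proof -
  assume v: "wt v B" and t: "t \<in> I" and x: "x \<in> Rd d"
  have "\<bar>rw v t x\<bar> \<le> (\<integral>a. \<bar>v a * ou_kernel d (T - t) a x\<bar> \<partial>p0)"
    unfolding rw_def by (rule integral_abs_bound)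
  also have "\<dots> \<le> (\<integral>a. B * (1 * ou_kernel d (T - t) a x) \<partial>p0)"
  proof (rule integral_mono_AE)
    have "AE a in p0. \<bar>v a\<bar> \<le> B" using v by (simp add: wt_def)
    then show "AE a in p0. \<bar>v a * ou_kernel d (T - t) a x\<bar> \<le> B * (1 * ou_kernel d (T - t) a x)"
      by eventually_elim (simp add: abs_mult ou_kernel_nonneg mult_right_mono)
  qed (use adm_integrable[OF adm_k v t x] adm_integrable[OF adm_k wt_1 t x] in auto)
  finally show ?thesis by (simp add: rw_def)
qed

text \<open>A bound by a multiple of \<open>\<rho>\<close> survives division by it and yields linear
  growth of the score. The envelope would not do, as it decays more slowly than
  \<open>\<rho>\<close>.\<close>

lemma abs_rx_le:
  assumes v: "wt v B" and t: "t \<in> I" and x: "x \<in> Rd d" and i: "i < d"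
  shows "\<bar>rx v i t x\<bar> \<le> B * K * (1 + \<bar>x i\<bar>) * \<rho> t x"
proof -
  have "\<bar>rx v i t x\<bar> \<le> (\<integral>a. \<bar>v a * kx d i (T - t) a x\<bar> \<partial>p0)"
    unfolding rx_def by (rule integral_abs_bound)
  also have "\<dots> \<le> (\<integral>a. (B * K * (1 + \<bar>x i\<bar>)) * (1 * ou_kernel d (T - t) a x) \<partial>p0)"
  proof (rule integral_mono_AE)
    have "AE a in p0. \<bar>v a\<bar> \<le> B" using v by (simp add: wt_def)
    then show "AE a in p0. \<bar>v a * kx d i (T - t) a x\<bar> \<le> (B * K * (1 + \<bar>x i\<bar>)) * (1 * ou_kernel d (T - t) a x)"
      using cube
    proof eventually_elim
      case (elim a)
      have "\<bar>v a * kx d i (T - t) a x\<bar> \<le> B * (K * ((1 + \<bar>x i\<bar>) * ou_kernel d (T - t) a x))"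
        unfolding abs_mult using elim K_kx2[OF t elim(2) i] wt_nonneg[OF v] by (intro mult_mono) auto
      then show ?case by (simp add: mult_ac)
    qed
  qed (use adm_integrable[OF adm_kx[OF i] v t x] adm_integrable[OF adm_k wt_1 t x] in auto)
  finally show ?thesis by (simp add: rw_def)
qed

definition hs :: "(pt \<Rightarrow> real) \<Rightarrow> tfun" where
  "hs w t x = rw w t x / \<rho> t x"

text \<open>The quotient rule for \<open>hs\<close>, arranged so that \<open>hs\<close> itself
  appears in the numerator. Multiplication by \<open>\<rho>\<close> then clears the only
  denominator; \<open>hsx\<close> has the same form.\<close>

definition hst :: "(pt \<Rightarrow> real) \<Rightarrow> tfun" where
  "hst w t x = (rt w t x - hs w t x * rt (\<lambda>_. 1) t x) / \<rho> t x"

definition hsx :: "(pt \<Rightarrow> real) \<Rightarrow> nat \<Rightarrow> tfun" where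
  "hsx w i t x = (rx w i t x - hs w t x * rx (\<lambda>_. 1) i t x) / \<rho> t x"

lemma hstar_eq: "hstar d p0 w T t x = hs w t x"
  by (simp add: hstar_def post_mean_def hs_def rw_def ou_dens_def)

lemma dom_meas: "dom f \<Longrightarrow> (\<lambda>p. f (fst p) (snd p)) \<in> borel_measurable (N \<Otimes>\<^sub>M leb d)"
  by (simp add: dom_def case_prod_beta')

lemma bdd_meas: "bdd f \<Longrightarrow> (\<lambda>p. f (fst p) (snd p)) \<in> borel_measurable (N \<Otimes>\<^sub>M leb d)"
  by (simp add: bdd_def case_prod_beta')

lemma hs_meas:
  assumes "wt w B"
  shows hs_meas0: "(\<lambda>p. hs w (fst p) (snd p)) \<in> borel_measurable (N \<Otimes>\<^sub>M leb d)"
    and "(\<lambda>p. hst w (fst p) (snd p)) \<in> borel_measurable (N \<Otimes>\<^sub>M leb d)"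
    and "i < d \<Longrightarrow> (\<lambda>p. hsx w i (fst p) (snd p)) \<in> borel_measurable (N \<Otimes>\<^sub>M leb d)"
proof -
  note [measurable] = dom_meas[OF dom_rw[OF assms]] dom_meas[OF dom_rw[OF wt_1]]
    dom_meas[OF dom_rt[OF assms]] dom_meas[OF dom_rt[OF wt_1]]
    dom_meas[OF dom_rx[OF assms]] dom_meas[OF dom_rx[OF wt_1]]
  show "(\<lambda>p. hs w (fst p) (snd p)) \<in> borel_measurable (N \<Otimes>\<^sub>M leb d)"
    "(\<lambda>p. hst w (fst p) (snd p)) \<in> borel_measurable (N \<Otimes>\<^sub>M leb d)"
    unfolding hs_def hst_def by measurable
  show "(\<lambda>p. hsx w i (fst p) (snd p)) \<in> borel_measurable (N \<Otimes>\<^sub>M leb d)" if [simp]: "i < d"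
    unfolding hs_def hsx_def by measurable
qed

lemma abs_hs_le: "wt w B \<Longrightarrow> t \<in> I \<Longrightarrow> x \<in> Rd d \<Longrightarrow> \<bar>hs w t x\<bar> \<le> B"
  using abs_rw_le[of w B t x] rho_pos[of t x] by (auto simp: hs_def abs_divide divide_le_eq)

lemma bdd_hs: "wt w B \<Longrightarrow> bdd (hs w)"
  using hs_meas0[of w B] abs_hs_le[of w B] unfolding bdd_def case_prod_beta' by blast

lemma abs_hsx_le:
  assumes w: "wt w B" and t: "t \<in> I" and x: "x \<in> Rd d" and i: "i < d"
  shows "\<bar>hsx w i t x\<bar> \<le> 2 * B * K * (1 + \<bar>x i\<bar>)"
proof -
  have p: "0 < \<rho> t x" by (rule rho_pos[OF t x])
  have "\<bar>hs w t x * rx (\<lambda>_. 1) i t x\<bar> \<le> B * (1 * K * (1 + \<bar>x i\<bar>) * \<rho> t x)"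
    unfolding abs_mult using abs_hs_le[OF w t x] abs_rx_le[OF wt_1 t x i] wt_nonneg[OF w]
    by (intro mult_mono) auto
  then have "\<bar>rx w i t x - hs w t x * rx (\<lambda>_. 1) i t x\<bar> \<le> 2 * B * K * (1 + \<bar>x i\<bar>) * \<rho> t x"
    using abs_rx_le[OF w t x i] by (simp add: algebra_simps)
  then show ?thesis using p by (simp add: hsx_def abs_divide divide_le_eq)
qed

lemma hs_DERIV_time:
  assumes w: "wt w B" and t: "t \<in> I" and x: "x \<in> Rd d"
  shows "((\<lambda>t. hs w t x) has_real_derivative hst w t x) (at t within I)"
proof -
  have p: "\<rho> t x \<noteq> 0" using rho_pos[OF t x] by simp
  from DERIV_divide[OF rw_DERIV_time[OF w t x] rw_DERIV_time[OF wt_1 t x] p]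
  show ?thesis unfolding hs_def hst_def using p by (simp add: field_simps)
qed

lemma hs_DERIV_space:
  assumes w: "wt w B" and t: "t \<in> I" and x: "x \<in> Rd d" and i: "i < d"
  shows "((\<lambda>y. hs w t (x(i := y))) has_real_derivative hsx w i t x) (at (x i))"
proof -
  have p: "\<rho> t x \<noteq> 0" using rho_pos[OF t x] by simp
  from DERIV_divide[OF rw_DERIV_space[OF w t x i, of "x i"] rw_DERIV_space[OF wt_1 t x i, of "x i"]] p
  show ?thesis unfolding hs_def hsx_def by (simp add: field_simps)
qed

lemma score_eq:
  assumes t: "t \<in> I" and x: "x \<in> Rd d" and i: "i < d"
  shows "score d p0 T t x i = rx (\<lambda>_. 1) i t x / \<rho> t x"
proof -
  have p: "0 < \<rho> t (x(i := x i))" using rho_pos[OF t x] by simp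
  from DERIV_chain2[where f=ln and g="\<lambda>y. \<rho> t (x(i := y))", OF DERIV_ln[OF p] rw_DERIV_space[OF wt_1 t x i, of "x i"]]
  show ?thesis
    unfolding score_def grad_def pd_def rho_dens_eq by (intro DERIV_imp_deriv) (simp add: divide_inverse mult.commute)
qed

text \<open>The flux of the density is drift times density. The unbounded drift of the bilinear form
  thereby becomes a mixture with an envelope bound.\<close>

lemma rj_score:
  assumes t: "t \<in> I" and x: "x \<in> Rd d" and i: "i < d"
  shows "rj (\<lambda>_. 1) i t x = (x i + score d p0 T t x i) * \<rho> t x"
  using rj_eq[OF wt_1 i t x] score_eq[OF t x i] rho_pos[OF t x] by (simp add: field_simps)

lemma meas_coord_pair: "i < d \<Longrightarrow> (\<lambda>p. snd p i) \<in> borel_measurable (N \<Otimes>\<^sub>M leb d)"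
  by (rule measurable_compose[OF measurable_snd measurable_coord])

text \<open>\<open>hsx\<close> is only known to grow at most linearly, so it is not a multiplier as
  it stands; the factor 1 + |x_i| is handed to the flux, where \<open>dom_rjw\<close> absorbs
  it.\<close>

lemma dom_hsx_rj:
  assumes w: "wt w B" and i: "i < d"
  shows "dom (\<lambda>t x. hsx w i t x * rj (\<lambda>_. 1) i t x)"
proof -
  have p1: "1 + \<bar>y\<bar> \<noteq> 0" "0 < 1 + \<bar>y\<bar>" for y :: real by linarith+
  note [measurable] = hs_meas(3)[OF w i] meas_coord_pair[OF i]
  have "bdd (\<lambda>t x. hsx w i t x / (1 + \<bar>x i\<bar>))"
    unfolding bdd_def
  proof (intro conjI exI[of _ "2 * B * K"] ballI)
    show "(\<lambda>(t, x). hsx w i t x / (1 + \<bar>x i\<bar>)) \<in> borel_measurable (N \<Otimes>\<^sub>M leb d)"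
      unfolding case_prod_beta' by measurable
    show "\<bar>hsx w i t x / (1 + \<bar>x i\<bar>)\<bar> \<le> 2 * B * K" if "t \<in> I" "x \<in> Rd d" for t x
      using abs_hsx_le[OF w that i] p1(2)[of "x i"] by (simp add: abs_divide divide_le_eq)
  qed
  from dom_mult[OF this dom_rjw[OF wt_1 i]] show ?thesis using p1 by simp
qed

text \<open>The transport parts x_i \<open>\<rho>\<close> of the two fluxes cancel, and the quotient
  rule leaves the gradient of the posterior mean times \<open>\<rho>\<close>. This cancellation
  produces the Dirichlet term of the equation.\<close>

lemma rj_diff:
  assumes w: "wt w B" and t: "t \<in> I" and x: "x \<in> Rd d" and i: "i < d"
  shows "rj w i t x - hs w t x * rj (\<lambda>_. 1) i t x = hsx w i t x * \<rho> t x"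
  using rj_eq[OF w i t x] rj_eq[OF wt_1 i t x] rho_pos[OF t x]
  by (simp add: hsx_def hs_def field_simps)

text \<open>With \<open>q = h\<^sup>* \<rho>\<close>, the equation of \<open>h\<^sup>*\<close> is the difference of the Fokker-Planck equation of \<open>q\<close>
  tested with \<open>\<psi>\<close> and that of \<open>\<rho>\<close> tested with \<open>\<psi> h\<^sup>*\<close>; no second derivative of \<open>h\<^sup>*\<close> is needed.\<close>

lemma hs_weak_equation:
  assumes w: "wt w B" and u: "nice u ut ux" and t: "t \<in> I"
  shows "(\<integral>x. u t x * (hst w t x * \<rho> t x) \<partial>leb d) + (\<Sum>i<d. \<integral>x. u t x * (hsx w i t x * rj (\<lambda>_. 1) i t x) \<partial>leb d)
     - (\<Sum>i<d. \<integral>x. ux i t x * (hsx w i t x * \<rho> t x) \<partial>leb d) = 0"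
    and "dom (\<lambda>t x. u t x * (hst w t x * \<rho> t x))"
    and "i < d \<Longrightarrow> dom (\<lambda>t x. ux i t x * (hsx w i t x * \<rho> t x))"
proof -
  have bu: "bdd u" and bx: "\<And>i. i < d \<Longrightarrow> bdd (ux i)"
    and du: "\<And>i x. i < d \<Longrightarrow> x \<in> Rd d \<Longrightarrow> ((\<lambda>y. u t (x(i := y))) has_real_derivative ux i t x) (at (x i))"
    using u t by (auto simp: nice_def)
  obtain M0 where M0: "\<forall>t\<in>I. \<forall>x\<in>Rd d. \<bar>u t x\<bar> \<le> M0" using bu by (auto simp: bdd_def)
  have "\<forall>i\<in>{..<d}. \<exists>M. \<forall>t\<in>I. \<forall>x\<in>Rd d. \<bar>ux i t x\<bar> \<le> M" using bx by (auto simp: bdd_def)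
  then obtain M1 where M1: "\<forall>i\<in>{..<d}. \<forall>t\<in>I. \<forall>x\<in>Rd d. \<bar>ux i t x\<bar> \<le> M1 i" by metis
  define M where "M = \<bar>M0\<bar> + (\<Sum>i<d. \<bar>M1 i\<bar>)"
  have M: "0 \<le> M" by (simp add: M_def sum_nonneg)
  have uM: "\<bar>u t x\<bar> \<le> M" if "x \<in> Rd d" for x
  proof -
    have "\<bar>u t x\<bar> \<le> M0" using M0 t that by blast
    moreover have "0 \<le> (\<Sum>i<d. \<bar>M1 i\<bar>)" by (simp add: sum_nonneg)
    ultimately show ?thesis unfolding M_def by linarith
  qed
  have uxM: "\<bar>ux i t x\<bar> \<le> M" if "i < d" "x \<in> Rd d" for i x
  proof -
    have "\<bar>ux i t x\<bar> \<le> \<bar>M1 i\<bar>" using M1 t that by (auto intro: order_trans[OF _ abs_ge_self])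
    also have "\<dots> \<le> (\<Sum>i<d. \<bar>M1 i\<bar>)" by (rule member_le_sum[where f="\<lambda>i. \<bar>M1 i\<bar>"]) (use that in auto)
    finally show ?thesis by (simp add: M_def)
  qed
  have sec: "(\<lambda>x. f t x) \<in> borel_measurable (leb d)"
    if "(\<lambda>p. f (fst p) (snd p)) \<in> borel_measurable (N \<Otimes>\<^sub>M leb d)" for f :: tfun
    using section_meas[of f t] that t by (simp add: case_prod_beta')
  note um = sec[OF bdd_meas[OF bu]] and uxm = sec[OF bdd_meas[OF bx]]
  note hm = sec[OF hs_meas(1)[OF w]] and hxm = sec[OF hs_meas(3)[OF w]]
  let ?h = "hs w" and ?r = "rj (\<lambda>_. 1)"
  have B: "0 \<le> B" by (rule wt_nonneg[OF w])
  have y1: "1 \<le> 1 + \<bar>y\<bar>" for y :: real by simp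
  have fp1: "(\<integral>x. u t x * rt w t x \<partial>leb d) = (\<Sum>i<d. \<integral>x. ux i t x * rj w i t x \<partial>leb d)"
  proof (rule weak_fokker_planck[OF w t um uM uxm _ du])
    show "\<bar>ux i t x\<bar> \<le> M * (1 + \<bar>x i\<bar>)" if "i < d" "x \<in> Rd d" for i x
      using uxM[OF that] mult_left_mono[OF y1 M, of "x i"] by simp
  qed
  let ?M = "M * B + M * (1 + 2 * K) * B"
  have fp2: "(\<integral>x. (u t x * ?h t x) * rt (\<lambda>_. 1) t x \<partial>leb d)
      = (\<Sum>i<d. \<integral>x. (ux i t x * ?h t x + u t x * hsx w i t x) * ?r i t x \<partial>leb d)"
  proof (rule weak_fokker_planck[OF wt_1 t, where M="?M"])
    show "(\<lambda>x. u t x * ?h t x) \<in> borel_measurable (leb d)" by (intro borel_measurable_times um hm)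
    show "(\<lambda>x. ux i t x * ?h t x + u t x * hsx w i t x) \<in> borel_measurable (leb d)" if "i < d" for i
      by (intro borel_measurable_add borel_measurable_times um hm hxm uxm that)
    fix x assume x: "x \<in> Rd d"
    have "\<bar>u t x * ?h t x\<bar> \<le> M * B"
      unfolding abs_mult using uM[OF x] abs_hs_le[OF w t x] M by (intro mult_mono) auto
    moreover have "0 \<le> M * (1 + 2 * K) * B" using M B K_pos by simp
    ultimately show "\<bar>u t x * ?h t x\<bar> \<le> ?M" by linarith
    fix i assume i: "i < d"
    have a1: "\<bar>ux i t x * ?h t x\<bar> \<le> M * B"
      unfolding abs_mult using uxM[OF i x] abs_hs_le[OF w t x] M by (intro mult_mono) auto
    have a2: "\<bar>u t x * hsx w i t x\<bar> \<le> M * (2 * B * K * (1 + \<bar>x i\<bar>))"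
      unfolding abs_mult using uM[OF x] abs_hsx_le[OF w t x i] M by (intro mult_mono) auto
    have "\<bar>ux i t x * ?h t x + u t x * hsx w i t x\<bar> \<le> M * B + M * (2 * B * K * (1 + \<bar>x i\<bar>))"
      using a1 a2 by linarith
    also have "\<dots> \<le> (M * B) * (1 + \<bar>x i\<bar>) + (M * (1 + 2 * K) * B) * (1 + \<bar>x i\<bar>)"
    proof -
      have "M * B * 1 \<le> (M * B) * (1 + \<bar>x i\<bar>)" using M B by (intro mult_left_mono) auto
      moreover have "M * (2 * B * K * (1 + \<bar>x i\<bar>)) \<le> (M * (1 + 2 * K) * B) * (1 + \<bar>x i\<bar>)"
        using M B by (simp add: algebra_simps)
      ultimately show ?thesis by linarith
    qed
    finally show "\<bar>ux i t x * ?h t x + u t x * hsx w i t x\<bar> \<le> ?M * (1 + \<bar>x i\<bar>)"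
      by (simp only: distrib_right)
    show "((\<lambda>y. u t (x(i := y)) * ?h t (x(i := y))) has_real_derivative
        ux i t x * ?h t x + u t x * hsx w i t x) (at (x i))"
      using DERIV_mult[OF du[OF i x] hs_DERIV_space[OF w t x i]] by (simp add: mult.commute)
  qed
  have c: "integrable (leb d) (\<lambda>x. f t x)" if "dom f" for f
    using dom_integrable[OF that t] .
  \<comment> \<open>The derivatives of the posterior mean carry no uniform bound here, but their
    products with \<open>\<rho>\<close> are combinations of dominated mixtures with bounded
    coefficients. The domination claims rest on this identity and on \<open>eqx\<close>.\<close>
  have eqt: "u t x * (hst w t x * \<rho> t x) = u t x * rt w t x - (u t x * ?h t x) * rt (\<lambda>_. 1) t x"
    if "t \<in> I" "x \<in> Rd d" for t x
  proof -
    have "hst w t x * \<rho> t x = rt w t x - ?h t x * rt (\<lambda>_. 1) t x"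
      using rho_pos[OF that] by (simp add: hst_def)
    then show ?thesis by (simp only: right_diff_distrib mult.assoc)
  qed
  have eqx: "ux i t x * (hsx w i t x * \<rho> t x) = ux i t x * rj w i t x - (ux i t x * ?h t x) * ?r i t x"
    if "t \<in> I" "x \<in> Rd d" "i < d" for t x i
    unfolding rj_diff[OF w that, symmetric] by (simp only: right_diff_distrib mult.assoc)
  have dcong: "dom f \<Longrightarrow> (\<And>t x. t \<in> I \<Longrightarrow> x \<in> Rd d \<Longrightarrow> g t x = f t x) \<Longrightarrow> dom g" for f g :: tfun
    unfolding dom_def by (subst measurable_cong[where g="\<lambda>(t, x). f t x"]) (auto simp: space_pair_measure)
  note d1 = dom_mult[OF bu dom_rt[OF w]] and d2 = dom_mult[OF bdd_mult[OF bu bdd_hs[OF w]] dom_rt[OF wt_1]]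
  note d3 = dom_mult[OF bx dom_rj[OF w]] and d4 = dom_mult[OF bdd_mult[OF bx bdd_hs[OF w]] dom_rj[OF wt_1]]
  note d5 = dom_mult[OF bu dom_hsx_rj[OF w]]
  show "dom (\<lambda>t x. u t x * (hst w t x * \<rho> t x))"
    by (rule dcong[OF dom_diff[OF d1 d2] eqt])
  show "dom (\<lambda>t x. ux i t x * (hsx w i t x * \<rho> t x))" if "i < d"
    by (rule dcong[OF dom_diff[OF d3[OF that that] d4[OF that that]] eqx[OF _ _ that]])
  have "(\<integral>x. u t x * (hst w t x * \<rho> t x) \<partial>leb d)
      = (\<integral>x. u t x * rt w t x - (u t x * ?h t x) * rt (\<lambda>_. 1) t x \<partial>leb d)"
    by (rule Bochner_Integration.integral_cong) (auto simp: eqt[OF t])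
  also have "\<dots> = (\<integral>x. u t x * rt w t x \<partial>leb d) - (\<integral>x. (u t x * ?h t x) * rt (\<lambda>_. 1) t x \<partial>leb d)"
    by (rule Bochner_Integration.integral_diff[OF c[OF d1] c[OF d2]])
  also have "\<dots> = (\<Sum>i<d. (\<integral>x. ux i t x * rj w i t x \<partial>leb d)
      - (\<integral>x. (ux i t x * ?h t x + u t x * hsx w i t x) * ?r i t x \<partial>leb d))"
    unfolding fp1 fp2 by (simp add: sum_subtractf)
  also have "\<dots> = (\<Sum>i<d. (\<integral>x. ux i t x * (hsx w i t x * \<rho> t x) \<partial>leb d)
      - (\<integral>x. u t x * (hsx w i t x * ?r i t x) \<partial>leb d))"
  proof (rule sum.cong[OF refl])
    fix i assume "i \<in> {..<d}"
    then have i: "i < d" by simp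
    have "(\<integral>x. (ux i t x * ?h t x + u t x * hsx w i t x) * ?r i t x \<partial>leb d)
        = (\<integral>x. (ux i t x * ?h t x) * ?r i t x + u t x * (hsx w i t x * ?r i t x) \<partial>leb d)"
      by (simp add: algebra_simps)
    also have "\<dots> = (\<integral>x. (ux i t x * ?h t x) * ?r i t x \<partial>leb d) + (\<integral>x. u t x * (hsx w i t x * ?r i t x) \<partial>leb d)"
      by (rule Bochner_Integration.integral_add[OF c[OF d4[OF i i]] c[OF d5[OF i]]])
    finally have e: "(\<integral>x. (ux i t x * ?h t x + u t x * hsx w i t x) * ?r i t x \<partial>leb d)
        = (\<integral>x. (ux i t x * ?h t x) * ?r i t x \<partial>leb d) + (\<integral>x. u t x * (hsx w i t x * ?r i t x) \<partial>leb d)" .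
    have "(\<integral>x. ux i t x * (hsx w i t x * \<rho> t x) \<partial>leb d)
        = (\<integral>x. ux i t x * rj w i t x - (ux i t x * ?h t x) * ?r i t x \<partial>leb d)"
      by (rule Bochner_Integration.integral_cong) (auto simp: eqx[OF t _ i])
    also have "\<dots> = (\<integral>x. ux i t x * rj w i t x \<partial>leb d) - (\<integral>x. (ux i t x * ?h t x) * ?r i t x \<partial>leb d)"
      by (rule Bochner_Integration.integral_diff[OF c[OF d3[OF i i]] c[OF d4[OF i i]]])
    finally show "(\<integral>x. ux i t x * rj w i t x \<partial>leb d)
        - (\<integral>x. (ux i t x * ?h t x + u t x * hsx w i t x) * ?r i t x \<partial>leb d)
      = (\<integral>x. ux i t x * (hsx w i t x * \<rho> t x) \<partial>leb d) - (\<integral>x. u t x * (hsx w i t x * ?r i t x) \<partial>leb d)"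
      using e by simp
  qed
  finally show "(\<integral>x. u t x * (hst w t x * \<rho> t x) \<partial>leb d) + (\<Sum>i<d. \<integral>x. u t x * (hsx w i t x * rj (\<lambda>_. 1) i t x) \<partial>leb d)
     - (\<Sum>i<d. \<integral>x. ux i t x * (hsx w i t x * \<rho> t x) \<partial>leb d) = 0"
    by (simp add: sum_subtractf)
qed

lemma bdd_omega: "bdd (\<lambda>t x. omega t0 t1 t)"
proof -
  have "(\<lambda>t. t) \<in> borel_measurable (restrict_space lborel I)"
    by (rule measurable_restrict_space1) simp
  then have "(\<lambda>t. t) \<in> borel_measurable N"
    using measurable_cong_sets[OF sets_nu refl] by blast
  then have [measurable]: "(\<lambda>p. fst p) \<in> borel_measurable (N \<Otimes>\<^sub>M leb d)"
    by (rule measurable_compose[OF measurable_fst])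
  have "\<bar>omega t0 t1 t\<bar> \<le> 1" if "t \<in> I" for t
    using that t01 by (simp add: omega_def divide_le_eq)
  then show ?thesis unfolding bdd_def omega_def by (auto simp: case_prod_beta' intro!: exI[of _ 1])
qed

text \<open>By the Fokker-Planck equation tested with u^2 / 2, the bracket on the left is the space
  integral of the time derivative of u^2 \<open>\<rho>\<close> / 2. After integration by parts in
  time, \<open>omega\<close> removes the term at t1, and the term at t0 is nonpositive and may be
  dropped.\<close>

lemma energy_le:
  assumes u: "nice u ut ux"
  shows "(\<integral>t. omega t0 t1 t * ((\<integral>x. u t x * ut t x * \<rho> t x \<partial>leb d)
      + (\<Sum>i<d. \<integral>x. u t x * ux i t x * rj (\<lambda>_. 1) i t x \<partial>leb d)) \<partial>N)
    \<le> (\<integral>t. (\<integral>x. (u t x)\<^sup>2 * \<rho> t x \<partial>leb d) \<partial>N) / (2 * (t1 - t0))"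
proof -
  let ?l = "t1 - t0"
  let ?r = "rt (\<lambda>_. 1)"
  have l: "0 < ?l" using t01 by simp
  have bu: "bdd u" and but: "bdd ut" and bx: "\<And>i. i < d \<Longrightarrow> bdd (ux i)"
    and dtu: "\<And>t x. t \<in> I \<Longrightarrow> x \<in> Rd d \<Longrightarrow> ((\<lambda>r. u r x) has_real_derivative ut t x) (at t within I)"
    and du: "\<And>i t x. i < d \<Longrightarrow> t \<in> I \<Longrightarrow> x \<in> Rd d \<Longrightarrow> ((\<lambda>y. u t (x(i := y))) has_real_derivative ux i t x) (at (x i))"
    using u by (auto simp: nice_def)
  define f where "f t x = u t x * ut t x * \<rho> t x + (u t x * u t x / 2) * ?r t x" for t x
  have b2: "bdd (\<lambda>t x. u t x * u t x / 2)" using bdd_cmult[OF bdd_mult[OF bu bu], of "1/2"] by simp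
  note dr = dom_rw[OF wt_1]
  note e1 = dom_mult[OF bdd_mult[OF bu but] dr] and e2 = dom_mult[OF b2 dom_rt[OF wt_1]]
  have df: "dom f" unfolding f_def[abs_def] by (rule dom_add[OF e1 e2])
  have fe: "(\<integral>x. u t x * ut t x * \<rho> t x \<partial>leb d) + (\<Sum>i<d. \<integral>x. u t x * ux i t x * rj (\<lambda>_. 1) i t x \<partial>leb d)
     = (\<integral>x. f t x \<partial>leb d)" if t: "t \<in> I" for t
  proof -
    obtain M0 where M0: "\<forall>t\<in>I. \<forall>x\<in>Rd d. \<bar>u t x * u t x / 2\<bar> \<le> M0" using b2 by (auto simp: bdd_def)
    have "\<forall>i\<in>{..<d}. \<exists>M. \<forall>t\<in>I. \<forall>x\<in>Rd d. \<bar>u t x * ux i t x\<bar> \<le> M"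
      using bdd_mult[OF bu bx] by (auto simp: bdd_def)
    then obtain M1 where M1: "\<forall>i\<in>{..<d}. \<forall>t\<in>I. \<forall>x\<in>Rd d. \<bar>u t x * ux i t x\<bar> \<le> M1 i" by metis
    define M where "M = \<bar>M0\<bar> + (\<Sum>i<d. \<bar>M1 i\<bar>)"
    have M: "0 \<le> M" by (simp add: M_def sum_nonneg)
    have "(\<integral>x. (u t x * u t x / 2) * ?r t x \<partial>leb d) = (\<Sum>i<d. \<integral>x. (u t x * ux i t x) * rj (\<lambda>_. 1) i t x \<partial>leb d)"
    proof (rule weak_fokker_planck[OF wt_1 t, where M=M])
      show "(\<lambda>x. u t x * u t x / 2) \<in> borel_measurable (leb d)"
        using b2 section_meas[OF _ t, of "\<lambda>t x. u t x * u t x / 2"] by (simp add: bdd_def)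
      show "(\<lambda>x. u t x * ux i t x) \<in> borel_measurable (leb d)" if "i < d" for i
        using bdd_mult[OF bu bx[OF that]] section_meas[OF _ t, of "\<lambda>t x. u t x * ux i t x"] by (simp add: bdd_def)
      show "\<bar>u t x * u t x / 2\<bar> \<le> M" if "x \<in> Rd d" for x
      proof -
        have "\<bar>u t x * u t x / 2\<bar> \<le> M0" using M0 t that by blast
        moreover have "0 \<le> (\<Sum>i<d. \<bar>M1 i\<bar>)" by (simp add: sum_nonneg)
        ultimately show ?thesis unfolding M_def by linarith
      qed
      show "\<bar>u t x * ux i t x\<bar> \<le> M * (1 + \<bar>x i\<bar>)" if "i < d" "x \<in> Rd d" for i x
      proof -
        have "\<bar>u t x * ux i t x\<bar> \<le> \<bar>M1 i\<bar>" using M1 t that by (auto intro: order_trans[OF _ abs_ge_self])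
        also have "\<dots> \<le> (\<Sum>i<d. \<bar>M1 i\<bar>)" by (rule member_le_sum[where f="\<lambda>i. \<bar>M1 i\<bar>"]) (use that in auto)
        also have "\<dots> \<le> M * 1" by (simp add: M_def)
        also have "\<dots> \<le> M * (1 + \<bar>x i\<bar>)" using M by (intro mult_left_mono) auto
        finally show ?thesis .
      qed
      show "((\<lambda>y. u t (x(i := y)) * u t (x(i := y)) / 2) has_real_derivative u t x * ux i t x) (at (x i))"
        if "i < d" "x \<in> Rd d" for i x
        using DERIV_cdivide[OF DERIV_mult[OF du[OF that(1) t that(2)] du[OF that(1) t that(2)]], of 2] by simp
    qed
    moreover have "(\<integral>x. f t x \<partial>leb d) = (\<integral>x. u t x * ut t x * \<rho> t x \<partial>leb d) + (\<integral>x. (u t x * u t x / 2) * ?r t x \<partial>leb d)"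
      unfolding f_def by (rule Bochner_Integration.integral_add[OF dom_integrable[OF e1 t] dom_integrable[OF e2 t]])
    ultimately show ?thesis by simp
  qed
  have d2: "dom (\<lambda>t x. (u t x)\<^sup>2 * \<rho> t x)" using dom_mult[OF bdd_mult[OF bu bu] dr] by (simp add: power2_eq_square)
  have d3: "dom (\<lambda>t x. (1 / (2 * ?l)) * ((u t x)\<^sup>2 * \<rho> t x))" by (rule dom_cmult[OF d2])
  have d4: "dom (\<lambda>t x. omega t0 t1 t * f t x)" by (rule dom_mult[OF bdd_omega df])
  \<comment> \<open>Time is integrated first, at fixed position, where the fundamental theorem
    applies to a differentiable function. No space integral has to be differentiated in time; Fubini
    gives the order back afterwards.\<close>
  have pt: "(\<integral>t. omega t0 t1 t * f t x \<partial>N) \<le> (\<integral>t. (1 / (2 * ?l)) * ((u t x)\<^sup>2 * \<rho> t x) \<partial>N)" if x: "x \<in> Rd d" for x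
  proof -
    \<comment> \<open>The slope -1 / (t1 - t0) of \<open>omega\<close> contributes precisely the
      term subtracted in the integrand below.\<close>
    let ?F = "\<lambda>t. omega t0 t1 t * ((u t x * u t x / 2) * \<rho> t x)"
    have "(\<integral>t. omega t0 t1 t * f t x - (1 / (2 * ?l)) * ((u t x)\<^sup>2 * \<rho> t x) \<partial>N) = (?F t1 - ?F t0) / ?l"
    proof (rule integral_nu_FTC[OF t01])
      show "integrable N (\<lambda>t. omega t0 t1 t * f t x - (1 / (2 * ?l)) * ((u t x)\<^sup>2 * \<rho> t x))"
        by (rule dom_integrable_section[OF dom_diff[OF d4 d3] x])
      fix t assume t: "t \<in> I"
      have o: "(omega t0 t1 has_real_derivative - 1 / ?l) (at t within I)"
      proof -
        have "((\<lambda>t. t1 - t) has_real_derivative - 1) (at t within I)" by (auto intro!: derivative_eq_intros)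
        from DERIV_cdivide[OF this, of ?l] show ?thesis by (simp add: omega_def[abs_def])
      qed
      have "((\<lambda>t. u t x * u t x / 2) has_real_derivative u t x * ut t x) (at t within I)"
        using DERIV_cdivide[OF DERIV_mult[OF dtu[OF t x] dtu[OF t x]], of 2] by simp
      from DERIV_mult[OF o DERIV_mult[OF this rw_DERIV_time[OF wt_1 t x]]]
      show "(?F has_real_derivative omega t0 t1 t * f t x - (1 / (2 * ?l)) * ((u t x)\<^sup>2 * \<rho> t x)) (at t within I)"
        by (rule DERIV_cong) (use l in \<open>simp add: f_def field_simps power2_eq_square\<close>)
    qed
    also have "\<dots> \<le> 0"
    proof -
      have "0 \<le> ?F t0" using rho_pos[OF _ x, of t0] t01 by (simp add: omega_def)
      moreover have "?F t1 = 0" by (simp add: omega_def)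
      ultimately have "?F t1 - ?F t0 \<le> 0" by linarith
      then show ?thesis using l by (rule divide_nonpos_pos)
    qed
    finally show ?thesis
      using dom_integrable_section[OF d4 x] dom_integrable_section[OF d3 x] by simp
  qed
  have "(\<integral>t. omega t0 t1 t * ((\<integral>x. u t x * ut t x * \<rho> t x \<partial>leb d)
      + (\<Sum>i<d. \<integral>x. u t x * ux i t x * rj (\<lambda>_. 1) i t x \<partial>leb d)) \<partial>N) = (\<integral>t. (\<integral>x. omega t0 t1 t * f t x \<partial>leb d) \<partial>N)"
    by (rule Bochner_Integration.integral_cong) (auto simp: fe)
  also have "\<dots> = (\<integral>x. (\<integral>t. omega t0 t1 t * f t x \<partial>N) \<partial>leb d)" by (rule dom_fubini[OF d4])
  also have "\<dots> \<le> (\<integral>x. (\<integral>t. (1 / (2 * ?l)) * ((u t x)\<^sup>2 * \<rho> t x) \<partial>N) \<partial>leb d)"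
    by (rule integral_mono[OF dom_time_integral[OF d4] dom_time_integral[OF d3]]) (use pt in simp)
  also have "\<dots> = (\<integral>t. (\<integral>x. (1 / (2 * ?l)) * ((u t x)\<^sup>2 * \<rho> t x) \<partial>leb d) \<partial>N)" by (rule dom_fubini[OF d3, symmetric])
  also have "\<dots> = (\<integral>t. (\<integral>x. (u t x)\<^sup>2 * \<rho> t x \<partial>leb d) \<partial>N) / (2 * ?l)" by simp
  finally show ?thesis .
qed

end

section \<open>The functionals in terms of classical derivatives\<close>

lemma enorm_sq: "(enorm d x)\<^sup>2 = sq d x"
  by (simp add: enorm_def L2_set_def sq_def sum_nonneg)

lemma coord_le_enorm: "i < d \<Longrightarrow> \<bar>x i\<bar> \<le> enorm d x"
  using real_sqrt_le_mono[OF coord_sq_le[of i d x]] by (simp add: enorm_def L2_set_def sq_def)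

lemma dt_eqI:
  assumes "t0 < t1" "t \<in> {t0..t1}" "((\<lambda>r. f r x) has_real_derivative D) (at t within {t0..t1})"
  shows "dt {t0..t1} f t x = D"
proof -
  have "((\<lambda>r. f r x) has_vector_derivative D) (at t within cbox t0 t1)"
    using assms(3) by (simp add: has_real_derivative_iff_has_vector_derivative)
  from vector_derivative_within_cbox[OF assms(1) _ this] assms(2) show ?thesis
    by (simp add: dt_def)
qed

lemma pd_eqI: "((\<lambda>y. f (x(i := y))) has_real_derivative D) (at (x i)) \<Longrightarrow> pd i f x = D"
  unfolding pd_def by (rule DERIV_imp_deriv)

context ou_window
begin

text \<open>The continuity clauses are what \<open>weak_grad_unique\<close> asks of a function and
  of its candidate gradient.\<close>

definition nicec :: "tfun \<Rightarrow> tfun \<Rightarrow> (nat \<Rightarrow> tfun) \<Rightarrow> bool" where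
  "nicec u ut ux \<longleftrightarrow> nice u ut ux \<and>
    (\<forall>t\<in>I. continuous_on (Rd d) (u t) \<and> (\<forall>i<d. continuous_on (Rd d) (ux i t)))"

lemma nicec_diff:
  assumes "nicec u ut ux" "nicec v vt vx"
  shows "nicec (\<lambda>t x. u t x - v t x) (\<lambda>t x. ut t x - vt t x) (\<lambda>i t x. ux i t x - vx i t x)"
  using assms nice_diff[of u ut ux v vt vx] unfolding nicec_def by (auto intro: continuous_on_diff)

lemma continuous_on_section:
  assumes "continuous_on (I \<times> Rd d) (\<lambda>(t, x). f t x)" "t \<in> I"
  shows "continuous_on (Rd d) (f t)"
proof -
  have "continuous_on (Rd d) (\<lambda>x. (\<lambda>(t, x). f t x) (t, x))"
    by (rule continuous_on_compose2[OF assms(1)]) (use assms(2) in \<open>auto intro!: continuous_intros\<close>)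
  then show ?thesis by simp
qed

lemma bounded_C12_nicec:
  assumes "bounded_C12 d I b h"
  shows "nicec h (dt I h) (\<lambda>i t x. pd i (h t) x)"
proof -
  note C = assms[unfolded bounded_C12_def C12_def]
  have bd: "bdd f" if "continuous_on (I \<times> Rd d) (\<lambda>(t, x). f t x)" "\<exists>M. \<forall>t\<in>I. \<forall>x\<in>Rd d. \<bar>f t x\<bar> \<le> M" for f
    unfolding bdd_def using measurable_pair_continuous_on[OF that(1) sets_nu] that(2) by simp
  have 1: "bdd h" using C by (intro bd) auto
  have 2: "bdd (dt I h)" using C by (intro bd) auto
  have 3: "bdd (\<lambda>t x. pd i (h t) x)" if i: "i < d" for i
  proof (rule bd)
    show "continuous_on (I \<times> Rd d) (\<lambda>(t, x). pd i (h t) x)" using C i by auto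
    have "\<exists>M. \<forall>t\<in>I. \<forall>x\<in>Rd d. enorm d (grad (h t) x) \<le> M"
      using assms unfolding bounded_C12_def by (elim conjE)
    then obtain M where M: "\<forall>t\<in>I. \<forall>x\<in>Rd d. enorm d (grad (h t) x) \<le> M" ..
    have "\<bar>pd i (h t) x\<bar> \<le> M" if "t \<in> I" "x \<in> Rd d" for t x
    proof -
      have "\<bar>grad (h t) x i\<bar> \<le> enorm d (grad (h t) x)" by (rule coord_le_enorm[OF i])
      also have "\<dots> \<le> M" using M that by blast
      finally show ?thesis by (simp add: grad_def)
    qed
    then show "\<exists>M. \<forall>t\<in>I. \<forall>x\<in>Rd d. \<bar>pd i (h t) x\<bar> \<le> M" by blast
  qed
  have 4: "((\<lambda>r. h r x) has_real_derivative dt I h t x) (at t within I)" if "t \<in> I" "x \<in> Rd d" for t x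
  proof -
    have "(\<lambda>r. h r x) differentiable (at t within I)" using C that by blast
    then show ?thesis
      by (simp add: dt_def has_real_derivative_iff_has_vector_derivative vector_derivative_works[symmetric])
  qed
  have 5: "((\<lambda>y. h t (x(i := y))) has_real_derivative pd i (h t) x) (at (x i))"
    if "t \<in> I" "x \<in> Rd d" "i < d" for t x i
  proof -
    have "pd_exists i (h t) x" using C that by blast
    then show ?thesis unfolding pd_exists_def pd_def by (simp add: DERIV_deriv_iff_real_differentiable)
  qed
  have 6: "continuous_on (Rd d) (h t)" "i < d \<Longrightarrow> continuous_on (Rd d) (\<lambda>x. pd i (h t) x)" if "t \<in> I" for t i
    using continuous_on_section[OF _ that, of h] continuous_on_section[OF _ that, of "\<lambda>t x. pd i (h t) x"] C by blast+
  show ?thesis unfolding nicec_def nice_def using 1 2 3 4 5 6 by blast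
qed

lemma rho_meas[measurable]: "t \<in> I \<Longrightarrow> \<rho> t \<in> borel_measurable (leb d)"
  using dom_integrable[OF dom_rw[OF wt_1]] by auto

lemma rho_eq: "rho d p0 T t = density (leb d) (\<lambda>x. ennreal (\<rho> t x))"
  by (simp add: rho_def rho_dens_eq)

lemma nn_integral_rho:
  assumes t: "t \<in> I" and f: "f \<in> borel_measurable (leb d)" "\<And>x. x \<in> Rd d \<Longrightarrow> 0 \<le> f x"
  shows "(\<integral>\<^sup>+x. ennreal (f x) \<partial>rho d p0 T t) = (\<integral>\<^sup>+x. ennreal (f x * \<rho> t x) \<partial>leb d)"
proof -
  have [measurable]: "\<rho> t \<in> borel_measurable (leb d)" by (rule rho_meas[OF t])
  note [measurable] = f(1)
  have "(\<integral>\<^sup>+x. ennreal (f x) \<partial>rho d p0 T t) = (\<integral>\<^sup>+x. ennreal (\<rho> t x) * ennreal (f x) \<partial>leb d)"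
    unfolding rho_eq by (rule nn_integral_density) auto
  also have "\<dots> = (\<integral>\<^sup>+x. ennreal (f x * \<rho> t x) \<partial>leb d)"
    by (rule nn_integral_cong) (use f(2) rho_pos[OF t] in \<open>auto simp: ennreal_mult'[symmetric] mult.commute less_imp_le\<close>)
  finally show ?thesis .
qed

lemma nn_integral_dom:
  assumes f: "dom f" "\<And>t x. t \<in> I \<Longrightarrow> x \<in> Rd d \<Longrightarrow> 0 \<le> f t x"
  shows "t \<in> I \<Longrightarrow> (\<integral>\<^sup>+x. ennreal (f t x) \<partial>leb d) = ennreal (\<integral>x. f t x \<partial>leb d)"
    and "t \<in> I \<Longrightarrow> 0 \<le> (\<integral>x. f t x \<partial>leb d)"
    and "(\<integral>\<^sup>+t. (\<integral>\<^sup>+x. ennreal (f t x) \<partial>leb d) \<partial>N) = ennreal (\<integral>t. (\<integral>x. f t x \<partial>leb d) \<partial>N)"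
    and "0 \<le> (\<integral>t. (\<integral>x. f t x \<partial>leb d) \<partial>N)"
proof -
  show 1: "(\<integral>\<^sup>+x. ennreal (f t x) \<partial>leb d) = ennreal (\<integral>x. f t x \<partial>leb d)" if "t \<in> I" for t
    by (rule nn_integral_eq_integral[OF dom_integrable[OF f(1) that]]) (use f(2) that in auto)
  show 2: "0 \<le> (\<integral>x. f t x \<partial>leb d)" if "t \<in> I" for t
    by (rule integral_nonneg_AE) (use f(2) that in auto)
  have "(\<integral>\<^sup>+t. (\<integral>\<^sup>+x. ennreal (f t x) \<partial>leb d) \<partial>N) = (\<integral>\<^sup>+t. ennreal (\<integral>x. f t x \<partial>leb d) \<partial>N)"
    by (rule nn_integral_cong) (simp add: 1)
  also have "\<dots> = ennreal (\<integral>t. (\<integral>x. f t x \<partial>leb d) \<partial>N)"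
    by (rule nn_integral_eq_integral[OF dom_integrable_time[OF f(1)]]) (use 2 in auto)
  finally show "(\<integral>\<^sup>+t. (\<integral>\<^sup>+x. ennreal (f t x) \<partial>leb d) \<partial>N) = ennreal (\<integral>t. (\<integral>x. f t x \<partial>leb d) \<partial>N)" .
  show "0 \<le> (\<integral>t. (\<integral>x. f t x \<partial>leb d) \<partial>N)" by (rule integral_nonneg_AE) (use 2 in auto)
qed

lemma V_grad_is_V_grad:
  "\<psi> \<in> V_space d p0 T t0 t1 \<Longrightarrow> is_V_grad d p0 T t0 t1 \<psi> (V_grad d p0 T t0 t1 \<psi>)"
  unfolding V_grad_def V_space_def mem_Collect_eq by (rule someI_ex[of "is_V_grad d p0 T t0 t1 \<psi>"])

lemma V_grad_meas:
  "\<psi> \<in> V_space d p0 T t0 t1 \<Longrightarrow> i < d \<Longrightarrow>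
    (\<lambda>p. V_grad d p0 T t0 t1 \<psi> (fst p) (snd p) i) \<in> borel_measurable (N \<Otimes>\<^sub>M leb d)"
  using V_grad_is_V_grad[of \<psi>] by (simp add: is_V_grad_def case_prod_beta')

text \<open>\<open>V_grad\<close> is an arbitrary choice among the weak gradients. For almost every
  time it agrees almost everywhere in space with the classical gradient, which is enough under the
  integrals defining the form and the norm.\<close>

lemma V_grad_props:
  assumes u: "nicec u ut ux" and V: "(\<lambda>t x. omega t0 t1 t * u t x) \<in> V_space d p0 T t0 t1"
  defines "G \<equiv> V_grad d p0 T t0 t1 (\<lambda>t x. omega t0 t1 t * u t x)"
  shows "AE t in N. t \<in> I \<and> (\<forall>i<d. (\<lambda>x. G t x i) \<in> borel_measurable (leb d) \<and>
           (AE x in leb d. G t x i = omega t0 t1 t * ux i t x))"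
proof -
  let ?\<psi> = "\<lambda>t x. omega t0 t1 t * u t x"
  have G: "is_V_grad d p0 T t0 t1 ?\<psi> G"
    unfolding G_def by (rule V_grad_is_V_grad[OF V])
  have Gm: "(\<lambda>(t, x). G t x i) \<in> borel_measurable (N \<Otimes>\<^sub>M leb d)" if "i < d" for i
    using G that by (simp add: is_V_grad_def)
  have "AE t in N. weak_grad d (?\<psi> t) (G t)" using G by (simp add: is_V_grad_def)
  then show ?thesis using AE_space
  proof eventually_elim
    case (elim t)
    then have t: "t \<in> I" by simp
    show ?case
    proof (intro conjI allI impI t)
      fix i assume i: "i < d"
      show m: "(\<lambda>x. G t x i) \<in> borel_measurable (leb d)" by (rule section_meas[OF Gm[OF i] t])
      have bu: "bdd (\<lambda>t x. omega t0 t1 t * u t x)" "bdd (\<lambda>t x. omega t0 t1 t * ux i t x)"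
        using u i by (auto simp: nicec_def nice_def intro: bdd_mult[OF bdd_omega])
      then obtain M1 M2 where M: "\<forall>t\<in>I. \<forall>x\<in>Rd d. \<bar>omega t0 t1 t * u t x\<bar> \<le> M1"
          "\<forall>t\<in>I. \<forall>x\<in>Rd d. \<bar>omega t0 t1 t * ux i t x\<bar> \<le> M2"
        unfolding bdd_def by blast
      show "AE x in leb d. G t x i = omega t0 t1 t * ux i t x"
      proof (rule weak_grad_unique[where f="?\<psi> t" and B="max M1 M2", OF i _ _ _ _ _ elim(1) m])
        show "continuous_on (Rd d) (?\<psi> t)" "continuous_on (Rd d) (\<lambda>x. omega t0 t1 t * ux i t x)"
          using u t i by (auto simp: nicec_def intro!: continuous_intros)
        fix x assume x: "x \<in> Rd d"
        show "\<bar>?\<psi> t x\<bar> \<le> max M1 M2" "\<bar>omega t0 t1 t * ux i t x\<bar> \<le> max M1 M2"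
          unfolding le_max_iff_disj using M t x by blast+
        have "((\<lambda>y. u t (x(i := y))) has_real_derivative ux i t x) (at (x i))"
          using u t x i by (auto simp: nicec_def nice_def)
        then show "((\<lambda>y. ?\<psi> t (x(i := y))) has_real_derivative omega t0 t1 t * ux i t x) (at (x i))"
          by (rule DERIV_cmult)
      qed
    qed
  qed
qed

text \<open>The integrand of the form a_t against Lebesgue measure, with the drift absorbed into the
  flux \<open>rj\<close>. It sees the first argument only through its derivatives and is linear in
  them, so it accepts h, the approximant, the posterior mean and all differences alike.\<close>

definition bform :: "tfun \<Rightarrow> (nat \<Rightarrow> tfun) \<Rightarrow> tfun \<Rightarrow> (nat \<Rightarrow> tfun) \<Rightarrow> tfun" where
  "bform ht hx u ux t x = u t x * (ht t x * \<rho> t x) + (\<Sum>i<d. u t x * (hx i t x * rj (\<lambda>_. 1) i t x))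
     - (\<Sum>i<d. ux i t x * (hx i t x * \<rho> t x))"

lemma dom_bform:
  assumes "nice h ht hx" "nice u ut ux"
  shows "dom (bform ht hx u ux)"
proof -
  have b: "bdd u" "bdd ht" "\<And>i. i < d \<Longrightarrow> bdd (hx i)" "\<And>i. i < d \<Longrightarrow> bdd (ux i)"
    using assms by (auto simp: nice_def)
  show ?thesis
    unfolding bform_def[abs_def]
    by (intro dom_diff dom_add dom_sum dom_mult[OF b(1)] dom_mult[OF b(2)] dom_mult[OF b(3)] dom_mult[OF b(4)]
        dom_rw[OF wt_1] dom_rj[OF wt_1])
qed

text \<open>\<open>omega\<close> depends on time only and leaves the space integral. The two sides
  differ on null sets, those of the chosen gradient, so measurability of \<open>a_form\<close> in
  time has to be supplied.\<close>

lemma A_form_eq: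
  assumes u: "nicec u ut ux" and V: "(\<lambda>t x. omega t0 t1 t * u t x) \<in> V_space d p0 T t0 t1"
    and h: "nicec h (dt I h) (\<lambda>i t x. pd i (h t) x)"
  shows "A_form d p0 T t0 t1 h (\<lambda>t x. omega t0 t1 t * u t x)
    = (\<integral>t. omega t0 t1 t * (\<integral>x. bform (dt I h) (\<lambda>i t x. pd i (h t) x) u ux t x \<partial>leb d) \<partial>N)"
proof -
  let ?\<psi> = "\<lambda>t x. omega t0 t1 t * u t x"
  let ?b = "bform (dt I h) (\<lambda>i t x. pd i (h t) x) u ux"
  define G where "G = V_grad d p0 T t0 t1 ?\<psi>"
  have db: "dom ?b" by (rule dom_bform) (use h u in \<open>auto simp: nicec_def\<close>)
  have b: "bdd u" "bdd (dt I h)" "\<And>i. i < d \<Longrightarrow> bdd (\<lambda>t x. pd i (h t) x)" "\<And>i. i < d \<Longrightarrow> bdd (ux i)"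
    using h u by (auto simp: nicec_def nice_def)
  let ?f = "\<lambda>t x. dt I h t x * ?\<psi> t x + (\<Sum>i<d. (x i + score d p0 T t x i) * pd i (h t) x) * ?\<psi> t x
      - (\<Sum>i<d. pd i (h t) x * G t x i)"
  have scm: "(\<lambda>p. score d p0 T (fst p) (snd p) i) \<in> borel_measurable (N \<Otimes>\<^sub>M leb d)" if i: "i < d" for i
  proof -
    note [measurable] = dom_meas[OF dom_rx[OF wt_1 i]] dom_meas[OF dom_rw[OF wt_1]]
    have "(\<lambda>p. rx (\<lambda>_. 1) i (fst p) (snd p) / \<rho> (fst p) (snd p)) \<in> borel_measurable (N \<Otimes>\<^sub>M leb d)" by measurable
    then show ?thesis
      by (subst measurable_cong[where g="\<lambda>p. rx (\<lambda>_. 1) i (fst p) (snd p) / \<rho> (fst p) (snd p)"])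
        (auto simp: space_pair_measure score_eq[OF _ _ i])
  qed
  have fm: "(\<lambda>p. ?f (fst p) (snd p)) \<in> borel_measurable (N \<Otimes>\<^sub>M leb d)"
    by (intro borel_measurable_diff borel_measurable_add borel_measurable_times borel_measurable_sum
        bdd_meas[OF b(1)] bdd_meas[OF b(2)] bdd_meas[OF b(3)] bdd_meas[OF bdd_omega] scm meas_coord_pair
        V_grad_meas[OF V, folded G_def]) simp_all
  have fs: "(\<lambda>x. ?f t x) \<in> borel_measurable (leb d)" if "t \<in> I" for t
    using section_meas[of ?f t] fm that by (simp add: case_prod_beta')
  have ae: "a_form d p0 T t0 t1 h ?\<psi> t = (\<integral>x. \<rho> t x * ?f t x \<partial>leb d)" if t: "t \<in> I" for t
  proof -
    have "a_form d p0 T t0 t1 h ?\<psi> t = (\<integral>x. \<rho> t x *\<^sub>R ?f t x \<partial>leb d)"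
      unfolding a_form_def G_def[symmetric] rho_eq grad_def
      by (rule integral_density[OF fs[OF t] rho_meas[OF t] AE_I2[OF less_imp_le[OF rho_pos[OF t]]]]) simp
    then show ?thesis by simp
  qed
  have afm: "a_form d p0 T t0 t1 h ?\<psi> \<in> borel_measurable N"
  proof -
    have "(\<lambda>t. \<integral>x. \<rho> t x * ?f t x \<partial>leb d) \<in> borel_measurable N"
      by (rule L.borel_measurable_lebesgue_integral, unfold case_prod_beta',
          rule borel_measurable_times[OF dom_meas[OF dom_rw[OF wt_1]] fm])
    then show ?thesis by (subst measurable_cong[OF ae]) (simp_all only: space_nu)
  qed
  have "AE t in N. a_form d p0 T t0 t1 h ?\<psi> t = omega t0 t1 t * (\<integral>x. ?b t x \<partial>leb d)"
    using V_grad_props[OF u V, folded G_def]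
  proof eventually_elim
    case (elim t)
    then have t: "t \<in> I" by simp
    have "(\<integral>x. \<rho> t x * ?f t x \<partial>leb d) = (\<integral>x. omega t0 t1 t * ?b t x \<partial>leb d)"
    proof (rule integral_cong_AE)
      show "(\<lambda>x. \<rho> t x * ?f t x) \<in> borel_measurable (leb d)"
        by (rule borel_measurable_times[OF rho_meas[OF t] fs[OF t]])
      show "(\<lambda>x. omega t0 t1 t * ?b t x) \<in> borel_measurable (leb d)"
        using dom_integrable[OF db t] by auto
      have "AE x in leb d. \<forall>i\<in>{..<d}. G t x i = omega t0 t1 t * ux i t x"
        using elim by (subst AE_ball_countable) auto
      then show "AE x in leb d. \<rho> t x * ?f t x = omega t0 t1 t * ?b t x"
        using AE_space
      proof eventually_elim
        case (elim x)
        then have x: "x \<in> Rd d" by simp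
        have 1: "(\<Sum>i<d. pd i (h t) x * G t x i) * \<rho> t x = omega t0 t1 t * (\<Sum>i<d. ux i t x * (pd i (h t) x * \<rho> t x))"
          unfolding sum_distrib_right sum_distrib_left using elim(1)
          by (intro sum.cong) (auto simp: mult_ac)
        have 2: "(\<Sum>i<d. (x i + score d p0 T t x i) * pd i (h t) x) * ?\<psi> t x * \<rho> t x
            = omega t0 t1 t * (\<Sum>i<d. u t x * (pd i (h t) x * rj (\<lambda>_. 1) i t x))"
          unfolding sum_distrib_right sum_distrib_left
          by (intro sum.cong) (auto simp: rj_score[OF t x] mult_ac)
        have "\<rho> t x * ?f t x = omega t0 t1 t * (u t x * (dt I h t x * \<rho> t x))
            + (\<Sum>i<d. (x i + score d p0 T t x i) * pd i (h t) x) * ?\<psi> t x * \<rho> t x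
            - (\<Sum>i<d. pd i (h t) x * G t x i) * \<rho> t x"
          by (simp only: distrib_left right_diff_distrib mult_ac)
        then show ?case unfolding 1 2 bform_def by (simp only: distrib_left right_diff_distrib)
      qed
    qed
    then show ?case unfolding ae[OF t] by simp
  qed
  moreover have "(\<lambda>t. omega t0 t1 t * (\<integral>x. ?b t x \<partial>leb d)) \<in> borel_measurable N"
    using dom_integrable_time[OF dom_mult[OF bdd_omega db]] by auto
  ultimately show ?thesis
    unfolding A_form_def by (intro integral_cong_AE afm)
qed

lemma omega_bounds: "t \<in> I \<Longrightarrow> 0 \<le> omega t0 t1 t \<and> omega t0 t1 t \<le> 1"
  using t01 by (auto simp: omega_def divide_le_eq)

section \<open>The energy inequality\<close>

definition usq :: "tfun \<Rightarrow> tfun" where "usq u t x = (u t x)\<^sup>2 * \<rho> t x"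
definition gsq :: "(nat \<Rightarrow> tfun) \<Rightarrow> tfun" where "gsq ux t x = (\<Sum>i<d. (ux i t x)\<^sup>2) * \<rho> t x"

lemma usq_nonneg: "t \<in> I \<Longrightarrow> x \<in> Rd d \<Longrightarrow> 0 \<le> usq u t x"
  using rho_pos[of t x] by (simp add: usq_def)

lemma gsq_nonneg: "t \<in> I \<Longrightarrow> x \<in> Rd d \<Longrightarrow> 0 \<le> gsq u t x"
  using rho_pos[of t x] by (simp add: gsq_def sum_nonneg)

lemma dom_usq: "bdd u \<Longrightarrow> dom (usq u)"
  unfolding usq_def[abs_def] power2_eq_square by (intro dom_mult[OF bdd_mult] dom_rw[OF wt_1])

lemma dom_gsq: "(\<And>i. i < d \<Longrightarrow> bdd (ux i)) \<Longrightarrow> dom (gsq ux)"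
  unfolding gsq_def[abs_def] power2_eq_square
  by (intro dom_mult[OF bdd_sum[OF bdd_mult]] dom_rw[OF wt_1])

lemma V_norm_sq_eq:
  assumes u: "nicec u ut ux" and V: "(\<lambda>t x. omega t0 t1 t * u t x) \<in> V_space d p0 T t0 t1"
  shows "V_norm_sq d p0 T t0 t1 (\<lambda>t x. omega t0 t1 t * u t x)
    = (\<integral>t. (\<integral>x. (omega t0 t1 t * omega t0 t1 t) * (usq u t x + gsq ux t x) \<partial>leb d) \<partial>N)"
proof -
  let ?\<psi> = "\<lambda>t x. omega t0 t1 t * u t x"
  let ?o = "omega t0 t1"
  define G where "G = V_grad d p0 T t0 t1 ?\<psi>"
  have bu: "bdd u" and bx: "\<And>i. i < d \<Longrightarrow> bdd (ux i)" using u by (auto simp: nicec_def nice_def)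
  note oo = bdd_mult[OF bdd_omega bdd_omega]
  note d1 = dom_mult[OF oo dom_usq[OF bu]] and d2 = dom_mult[OF oo dom_gsq[of ux, OF bx]]
  have d12: "dom (\<lambda>t x. (?o t * ?o t) * (usq u t x + gsq ux t x))"
    by (rule dom_mult[OF oo dom_add[OF dom_usq[OF bu] dom_gsq[of ux, OF bx]]])
  have "(\<integral>\<^sup>+t. (\<integral>\<^sup>+x. ennreal ((?\<psi> t x)\<^sup>2) \<partial>rho d p0 T t) + (\<integral>\<^sup>+x. ennreal ((enorm d (G t x))\<^sup>2) \<partial>rho d p0 T t) \<partial>N)
     = (\<integral>\<^sup>+t. (\<integral>\<^sup>+x. ennreal ((?o t * ?o t) * (usq u t x + gsq ux t x)) \<partial>leb d) \<partial>N)"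
  proof (rule nn_integral_cong_AE)
    show "AE t in N. (\<integral>\<^sup>+x. ennreal ((?\<psi> t x)\<^sup>2) \<partial>rho d p0 T t) + (\<integral>\<^sup>+x. ennreal ((enorm d (G t x))\<^sup>2) \<partial>rho d p0 T t)
      = (\<integral>\<^sup>+x. ennreal ((?o t * ?o t) * (usq u t x + gsq ux t x)) \<partial>leb d)"
      using V_grad_props[OF u V, folded G_def]
    proof eventually_elim
      case (elim t)
      then have t: "t \<in> I" by simp
      have um: "u t \<in> borel_measurable (leb d)" using bu section_meas[OF _ t, of u] by (simp add: bdd_def)
      have "(\<integral>\<^sup>+x. ennreal ((?\<psi> t x)\<^sup>2) \<partial>rho d p0 T t) = (\<integral>\<^sup>+x. ennreal ((?\<psi> t x)\<^sup>2 * \<rho> t x) \<partial>leb d)"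
        by (rule nn_integral_rho[OF t]) (use um in auto)
      also have "\<dots> = (\<integral>\<^sup>+x. ennreal ((?o t * ?o t) * usq u t x) \<partial>leb d)"
        by (simp add: usq_def power2_eq_square mult_ac)
      finally have e1: "(\<integral>\<^sup>+x. ennreal ((?\<psi> t x)\<^sup>2) \<partial>rho d p0 T t) = (\<integral>\<^sup>+x. ennreal ((?o t * ?o t) * usq u t x) \<partial>leb d)" .
      have "(\<integral>\<^sup>+x. ennreal ((enorm d (G t x))\<^sup>2) \<partial>rho d p0 T t) = (\<integral>\<^sup>+x. ennreal ((enorm d (G t x))\<^sup>2 * \<rho> t x) \<partial>leb d)"
        by (rule nn_integral_rho[OF t]) (use elim in \<open>auto simp: enorm_sq sq_def intro!: borel_measurable_sum borel_measurable_power sum_nonneg\<close>)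
      also have "\<dots> = (\<integral>\<^sup>+x. ennreal ((?o t * ?o t) * gsq ux t x) \<partial>leb d)"
      proof (rule nn_integral_cong_AE)
        have "AE x in leb d. \<forall>i\<in>{..<d}. G t x i = ?o t * ux i t x"
          using elim by (subst AE_ball_countable) auto
        then show "AE x in leb d. ennreal ((enorm d (G t x))\<^sup>2 * \<rho> t x) = ennreal ((?o t * ?o t) * gsq ux t x)"
        proof eventually_elim
          case (elim x)
          have "sq d (G t x) = (?o t * ?o t) * (\<Sum>i<d. (ux i t x)\<^sup>2)"
            unfolding sq_def sum_distrib_left using elim by (intro sum.cong) (auto simp: power2_eq_square)
          then show ?case by (simp only: enorm_sq gsq_def mult.assoc)
        qed
      qed
      finally have e2: "(\<integral>\<^sup>+x. ennreal ((enorm d (G t x))\<^sup>2) \<partial>rho d p0 T t) = (\<integral>\<^sup>+x. ennreal ((?o t * ?o t) * gsq ux t x) \<partial>leb d)" .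
      have n: "0 \<le> (?o t * ?o t) * usq u t x" "0 \<le> (?o t * ?o t) * gsq ux t x" if "x \<in> Rd d" for x
        using usq_nonneg[OF t that] gsq_nonneg[OF t that] by auto
      have "(\<integral>\<^sup>+x. ennreal ((?o t * ?o t) * (usq u t x + gsq ux t x)) \<partial>leb d)
          = (\<integral>\<^sup>+x. ennreal ((?o t * ?o t) * usq u t x) + ennreal ((?o t * ?o t) * gsq ux t x) \<partial>leb d)"
        by (rule nn_integral_cong) (use n in \<open>simp add: distrib_left\<close>)
      also have "\<dots> = (\<integral>\<^sup>+x. ennreal ((?o t * ?o t) * usq u t x) \<partial>leb d) + (\<integral>\<^sup>+x. ennreal ((?o t * ?o t) * gsq ux t x) \<partial>leb d)"
        using dom_integrable[OF d1 t] dom_integrable[OF d2 t] by (intro nn_integral_add) auto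
      finally show ?case unfolding e1 e2 by simp
    qed
  qed
  also have "\<dots> = ennreal (\<integral>t. (\<integral>x. (?o t * ?o t) * (usq u t x + gsq ux t x) \<partial>leb d) \<partial>N)"
    by (rule nn_integral_dom(3)[OF d12]) (simp add: usq_nonneg gsq_nonneg)
  moreover have "0 \<le> (\<integral>t. (\<integral>x. (?o t * ?o t) * (usq u t x + gsq ux t x) \<partial>leb d) \<partial>N)"
    by (rule nn_integral_dom(4)[OF d12]) (simp add: usq_nonneg gsq_nonneg)
  ultimately show ?thesis unfolding V_norm_sq_def G_def by simp
qed

section \<open>The error of the approximant in the bilinear form\<close>

definition etat :: "(pt \<Rightarrow> real) \<Rightarrow> tfun \<Rightarrow> tfun" where
  "etat w ht t x = ht t x - hst w t x"
definition etax :: "(pt \<Rightarrow> real) \<Rightarrow> (nat \<Rightarrow> tfun) \<Rightarrow> nat \<Rightarrow> tfun" where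
  "etax w hx i t x = hx i t x - hsx w i t x"
definition drift :: "real \<Rightarrow> pt \<Rightarrow> pt" where
  "drift t x = (\<lambda>i. x i + score d p0 T t x i)"
text \<open>What Young's inequality leaves of A(\<eta>, \<psi>) once the terms in u are split off.
  The error gradient appears once weighted with the squared drift, which is where L^4 norms of both
  become necessary.\<close>

definition zfun :: "(pt \<Rightarrow> real) \<Rightarrow> tfun \<Rightarrow> (nat \<Rightarrow> tfun) \<Rightarrow> tfun" where
  "zfun w ht hx t x = (etat w ht t x)\<^sup>2
     + sq d (drift t x) * (\<Sum>i<d. (etax w hx i t x)\<^sup>2) + (\<Sum>i<d. (etax w hx i t x)\<^sup>2)"

lemma score_meas: "i < d \<Longrightarrow> (\<lambda>p. score d p0 T (fst p) (snd p) i) \<in> borel_measurable (N \<Otimes>\<^sub>M leb d)"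
proof -
  assume i: "i < d"
  note [measurable] = dom_meas[OF dom_rx[OF wt_1 i]] dom_meas[OF dom_rw[OF wt_1]]
  have "(\<lambda>p. rx (\<lambda>_. 1) i (fst p) (snd p) / \<rho> (fst p) (snd p)) \<in> borel_measurable (N \<Otimes>\<^sub>M leb d)" by measurable
  then show ?thesis
    by (subst measurable_cong[where g="\<lambda>p. rx (\<lambda>_. 1) i (fst p) (snd p) / \<rho> (fst p) (snd p)"])
      (auto simp: space_pair_measure score_eq[OF _ _ i])
qed

lemma eta_meas:
  assumes w: "wt w B" and h: "nice h ht hx"
  shows etat_meas: "(\<lambda>p. etat w ht (fst p) (snd p)) \<in> borel_measurable (N \<Otimes>\<^sub>M leb d)"
    and etax_meas: "i < d \<Longrightarrow> (\<lambda>p. etax w hx i (fst p) (snd p)) \<in> borel_measurable (N \<Otimes>\<^sub>M leb d)"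
    and drift_meas: "(\<lambda>p. sq d (drift (fst p) (snd p))) \<in> borel_measurable (N \<Otimes>\<^sub>M leb d)"
    and zfun_meas: "(\<lambda>p. zfun w ht hx (fst p) (snd p)) \<in> borel_measurable (N \<Otimes>\<^sub>M leb d)"
proof -
  have b: "bdd ht" "\<And>i. i < d \<Longrightarrow> bdd (hx i)" using h by (auto simp: nice_def)
  show 1: "(\<lambda>p. etat w ht (fst p) (snd p)) \<in> borel_measurable (N \<Otimes>\<^sub>M leb d)"
    unfolding etat_def by (rule borel_measurable_diff[OF bdd_meas[OF b(1)] hs_meas(2)[OF w]])
  show 2: "(\<lambda>p. etax w hx i (fst p) (snd p)) \<in> borel_measurable (N \<Otimes>\<^sub>M leb d)" if "i < d" for i
    unfolding etax_def by (rule borel_measurable_diff[OF bdd_meas[OF b(2)[OF that]] hs_meas(3)[OF w that]])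
  show 3: "(\<lambda>p. sq d (drift (fst p) (snd p))) \<in> borel_measurable (N \<Otimes>\<^sub>M leb d)"
    unfolding sq_def drift_def
    by (intro borel_measurable_sum borel_measurable_power borel_measurable_add meas_coord_pair score_meas) simp_all
  show "(\<lambda>p. zfun w ht hx (fst p) (snd p)) \<in> borel_measurable (N \<Otimes>\<^sub>M leb d)"
    unfolding zfun_def
    by (intro borel_measurable_add borel_measurable_times borel_measurable_sum borel_measurable_power 1 2 3) simp_all
qed

lemma zfun_nonneg: "0 \<le> zfun w ht hx t x"
  by (simp add: zfun_def sq_nonneg sum_nonneg)

text \<open>The small weight 1/4 goes to the factor that contains u or the norm of the test
  function, so that its gradient part can be absorbed on the left.\<close>

lemma young: "\<bar>a * b :: real\<bar> \<le> a\<^sup>2 / 4 + b\<^sup>2"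
proof -
  have "0 \<le> (\<bar>a\<bar> / 2 - \<bar>b\<bar>)\<^sup>2" by simp
  then show ?thesis by (simp add: power2_diff power_divide abs_mult)
qed

text \<open>Young's inequality for each of the three terms, after Cauchy-Schwarz for the drift.
  \<open>omega\<close> is retained only at the gradient of u, since the energy to be absorbed into
  carries this weight; elsewhere it is estimated by 1. Two terms contain u, which gives 1/2.\<close>

lemma bform_eta_bound:
  assumes t: "t \<in> I" and x: "x \<in> Rd d"
  shows "omega t0 t1 t * \<bar>bform (etat w ht) (etax w hx) u ux t x\<bar>
    \<le> (1 / 2) * usq u t x + (1 / 4) * (omega t0 t1 t * gsq ux t x) + zfun w ht hx t x * \<rho> t x"
proof -
  let ?o = "omega t0 t1 t" and ?e = "\<lambda>i. etax w hx i t x"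
  let ?S = "\<Sum>i<d. drift t x i * ?e i"
  have p: "0 \<le> \<rho> t x" using rho_pos[OF t x] by simp
  have o: "0 \<le> ?o" "?o \<le> 1" using omega_bounds[OF t] by auto
  have eq: "bform (etat w ht) (etax w hx) u ux t x
      = (u t x * etat w ht t x + u t x * ?S - (\<Sum>i<d. ux i t x * ?e i)) * \<rho> t x"
  proof -
    have "(\<Sum>i<d. u t x * (?e i * rj (\<lambda>_. 1) i t x)) = u t x * ?S * \<rho> t x"
      unfolding sum_distrib_left sum_distrib_right
      by (rule sum.cong) (auto simp: rj_score[OF t x] drift_def)
    moreover have "(\<Sum>i<d. ux i t x * (?e i * \<rho> t x)) = (\<Sum>i<d. ux i t x * ?e i) * \<rho> t x"
      unfolding sum_distrib_right by (simp add: mult.assoc)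
    ultimately show ?thesis unfolding bform_def by (simp add: left_diff_distrib distrib_right mult.assoc)
  qed
  have 1: "\<bar>u t x * etat w ht t x\<bar> \<le> (u t x)\<^sup>2 / 4 + (etat w ht t x)\<^sup>2" by (rule young)
  have "?S\<^sup>2 \<le> sq d (drift t x) * (\<Sum>i<d. (?e i)\<^sup>2)"
    unfolding sq_def by (rule Cauchy_Schwarz_ineq_sum)
  then have 2: "\<bar>u t x * ?S\<bar> \<le> (u t x)\<^sup>2 / 4 + sq d (drift t x) * (\<Sum>i<d. (?e i)\<^sup>2)"
    using young[of "u t x" ?S] by linarith
  have "\<bar>\<Sum>i<d. ux i t x * ?e i\<bar> \<le> (\<Sum>i<d. \<bar>ux i t x * ?e i\<bar>)" by (rule sum_abs)
  also have "\<dots> \<le> (\<Sum>i<d. (ux i t x)\<^sup>2 / 4 + (?e i)\<^sup>2)" by (intro sum_mono young)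
  also have "\<dots> = (\<Sum>i<d. (ux i t x)\<^sup>2) / 4 + (\<Sum>i<d. (?e i)\<^sup>2)" by (simp add: sum.distrib sum_divide_distrib)
  finally have 3: "\<bar>\<Sum>i<d. ux i t x * ?e i\<bar> \<le> (\<Sum>i<d. (ux i t x)\<^sup>2) / 4 + (\<Sum>i<d. (?e i)\<^sup>2)" .
  have 4: "\<bar>u t x * etat w ht t x + u t x * ?S - (\<Sum>i<d. ux i t x * ?e i)\<bar>
      \<le> ((u t x)\<^sup>2 / 2 + zfun w ht hx t x) + (\<Sum>i<d. (ux i t x)\<^sup>2) / 4"
    unfolding zfun_def using 1 2 3 by linarith
  have "?o * \<bar>u t x * etat w ht t x + u t x * ?S - (\<Sum>i<d. ux i t x * ?e i)\<bar>
      \<le> ?o * (((u t x)\<^sup>2 / 2 + zfun w ht hx t x) + (\<Sum>i<d. (ux i t x)\<^sup>2) / 4)"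
    by (rule mult_left_mono[OF 4 o(1)])
  also have "\<dots> = ?o * ((u t x)\<^sup>2 / 2 + zfun w ht hx t x) + ?o * ((\<Sum>i<d. (ux i t x)\<^sup>2) / 4)" by (rule distrib_left)
  also have "\<dots> \<le> 1 * ((u t x)\<^sup>2 / 2 + zfun w ht hx t x) + ?o * ((\<Sum>i<d. (ux i t x)\<^sup>2) / 4)"
    using o zfun_nonneg[of w ht hx t x] by (intro add_right_mono mult_right_mono) auto
  finally have "?o * \<bar>u t x * etat w ht t x + u t x * ?S - (\<Sum>i<d. ux i t x * ?e i)\<bar> * \<rho> t x
      \<le> (1 * ((u t x)\<^sup>2 / 2 + zfun w ht hx t x) + ?o * ((\<Sum>i<d. (ux i t x)\<^sup>2) / 4)) * \<rho> t x"
    by (rule mult_right_mono[OF _ p])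
  then show ?thesis
    unfolding eq abs_mult usq_def gsq_def using p by (simp add: algebra_simps)
qed

lemma bform_diff:
  "bform (\<lambda>t x. a t x - b t x) (\<lambda>i t x. ax i t x - bx i t x) u ux t x
    = bform a ax u ux t x - bform b bx u ux t x"
  unfolding bform_def by (simp add: algebra_simps sum_subtractf)

text \<open>X is the weighted gradient energy of the difference u and V the square of its L^2 norm.
  The bound on the error term is assumed as an inequality in [0, \<infinity>]: \<open>zfun\<close>
  contains squares of derivatives of the posterior mean, for which no envelope bound is
  established.\<close>

lemma key_inequality:
  assumes w: "wt w B" and hN: "nice hN hNt hNx" and h: "nice h ht hx"
  defines "u \<equiv> \<lambda>t x. hN t x - h t x" and "ut \<equiv> \<lambda>t x. hNt t x - ht t x"
    and "ux \<equiv> \<lambda>i t x. hNx i t x - hx i t x"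
  defines "X \<equiv> (\<integral>t. (\<integral>x. omega t0 t1 t * gsq ux t x \<partial>leb d) \<partial>N)" and "V \<equiv> (\<integral>t. (\<integral>x. usq u t x \<partial>leb d) \<partial>N)"
  assumes Z: "(\<integral>\<^sup>+t. (\<integral>\<^sup>+x. ennreal (zfun w hNt hNx t x * \<rho> t x) \<partial>leb d) \<partial>N) \<le> ennreal Zr" and Zr: "0 \<le> Zr"
  shows "X \<le> (\<integral>t. omega t0 t1 t * (\<integral>x. bform ht hx u ux t x \<partial>leb d) \<partial>N) + V / (2 * (t1 - t0)) + V / 2 + X / 4 + Zr"
proof -
  let ?o = "omega t0 t1"
  have u: "nice u ut ux" unfolding u_def ut_def ux_def by (rule nice_diff[OF hN h])
  have bu: "bdd u" and but: "bdd ut" and bx: "\<And>i. i < d \<Longrightarrow> bdd (ux i)" using u by (auto simp: nice_def)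
  let ?bN = "bform hNt hNx u ux" and ?bh = "bform ht hx u ux" and ?bu = "bform ut ux u ux"
    and ?bs = "bform (hst w) (hsx w) u ux" and ?q = "bform (etat w hNt) (etax w hNx) u ux"
  have dN: "dom ?bN" and dh: "dom ?bh" and du: "dom ?bu"
    using dom_bform[OF hN u] dom_bform[OF h u] dom_bform[OF u u] by auto
  note hw = hs_weak_equation[OF w u] and hsx = dom_mult[OF bu dom_hsx_rj[OF w]]
  \<comment> \<open>The domination claims of \<open>hs_weak_equation\<close> concern all times at
    once but are stated under a choice of one; t0 serves as that choice.\<close>
  have tI: "t0 \<in> I" using t01 by simp
  have ds: "dom ?bs"
    unfolding bform_def[abs_def] by (intro dom_diff dom_add dom_sum hw(2)[OF tI] hw(3)[OF tI] hsx)
  have bs0: "(\<integral>x. ?bs t x \<partial>leb d) = 0" if t: "t \<in> I" for t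
  proof -
    have i1: "integrable (leb d) (\<lambda>x. u t x * (hst w t x * \<rho> t x))" by (rule dom_integrable[OF hw(2)[OF t] t])
    have i2: "integrable (leb d) (\<lambda>x. u t x * (hsx w i t x * rj (\<lambda>_. 1) i t x))" if "i < d" for i
      by (rule dom_integrable[OF hsx[OF that] t])
    have i3: "integrable (leb d) (\<lambda>x. ux i t x * (hsx w i t x * \<rho> t x))" if "i < d" for i
      by (rule dom_integrable[OF hw(3)[OF t that] t])
    have "(\<integral>x. ?bs t x \<partial>leb d) = (\<integral>x. u t x * (hst w t x * \<rho> t x) \<partial>leb d)
        + (\<Sum>i<d. \<integral>x. u t x * (hsx w i t x * rj (\<lambda>_. 1) i t x) \<partial>leb d)
        - (\<Sum>i<d. \<integral>x. ux i t x * (hsx w i t x * \<rho> t x) \<partial>leb d)"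
    proof -
      have s2: "integrable (leb d) (\<lambda>x. \<Sum>i<d. u t x * (hsx w i t x * rj (\<lambda>_. 1) i t x))"
        "(\<integral>x. (\<Sum>i<d. u t x * (hsx w i t x * rj (\<lambda>_. 1) i t x)) \<partial>leb d) = (\<Sum>i<d. \<integral>x. u t x * (hsx w i t x * rj (\<lambda>_. 1) i t x) \<partial>leb d)"
        by (rule Bochner_Integration.integrable_sum, simp add: i2)
           (rule Bochner_Integration.integral_sum, simp add: i2)
      have s3: "integrable (leb d) (\<lambda>x. \<Sum>i<d. ux i t x * (hsx w i t x * \<rho> t x))"
        "(\<integral>x. (\<Sum>i<d. ux i t x * (hsx w i t x * \<rho> t x)) \<partial>leb d) = (\<Sum>i<d. \<integral>x. ux i t x * (hsx w i t x * \<rho> t x) \<partial>leb d)"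
        by (rule Bochner_Integration.integrable_sum, simp add: i3)
           (rule Bochner_Integration.integral_sum, simp add: i3)
      show ?thesis unfolding bform_def s2(2)[symmetric] s3(2)[symmetric]
        by (simp only: Bochner_Integration.integral_diff[OF Bochner_Integration.integrable_add[OF i1 s2(1)] s3(1)]
            Bochner_Integration.integral_add[OF i1 s2(1)])
    qed
    then show ?thesis using hw(1)[OF t] by simp
  qed
  have qeq: "?q t x = ?bN t x - ?bs t x" for t x
    unfolding etat_def[abs_def] etax_def[abs_def] by (rule bform_diff)
  have dq: "dom ?q" unfolding qeq by (rule dom_diff[OF dN ds])
  have beq: "(\<integral>x. ?q t x \<partial>leb d) = (\<integral>x. ?bN t x \<partial>leb d)" if t: "t \<in> I" for t
    unfolding qeq using bs0[OF t] dom_integrable[OF dN t] dom_integrable[OF ds t] by simp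
  have heq: "?bh t x = ?bN t x - ?bu t x" for t x
  proof -
    have "bform ut ux U UX t x = bform hNt hNx U UX t x - bform ht hx U UX t x" for U UX
      unfolding ut_def ux_def by (rule bform_diff)
    then show ?thesis by simp
  qed
  have dg: "dom (\<lambda>t x. ?o t * gsq ux t x)" by (rule dom_mult[OF bdd_omega dom_gsq[OF bx]])
  note dus = dom_usq[OF bu]
  have g1: "dom (\<lambda>t x. (1 / 2) * usq u t x + (1 / 4) * (?o t * gsq ux t x))"
    by (intro dom_add dom_cmult dus dg)
  have g1i: "(\<integral>t. (\<integral>x. (1 / 2) * usq u t x + (1 / 4) * (?o t * gsq ux t x) \<partial>leb d) \<partial>N) = V / 2 + X / 4"
  proof -
    have "(\<integral>t. (\<integral>x. (1 / 2) * usq u t x + (1 / 4) * (?o t * gsq ux t x) \<partial>leb d) \<partial>N)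
        = (\<integral>t. (\<integral>x. usq u t x \<partial>leb d) / 2 + (\<integral>x. ?o t * gsq ux t x \<partial>leb d) / 4 \<partial>N)"
      by (rule Bochner_Integration.integral_cong[OF refl])
        (use dom_integrable[OF dus] dom_integrable[OF dg] in simp)
    then show ?thesis unfolding V_def X_def
      using dom_integrable_time[OF dus] dom_integrable_time[OF dg] by simp
  qed
  have doq: "dom (\<lambda>t x. ?o t * ?q t x)" by (rule dom_mult[OF bdd_omega dq])
  have om: "?o \<in> borel_measurable N" using dom_integrable_section[of "\<lambda>t x. ?o t * E x"]
  proof -
    have "dom (\<lambda>t x. E x)" unfolding dom_def by (auto intro!: exI[of _ 1] simp: case_prod_beta' gauss_env_pos less_imp_le)
    from dom_integrable_section[OF dom_mult[OF bdd_omega this], of "\<lambda>i\<in>{..<d}. 0"]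
    have "(\<lambda>t. ?o t * E (\<lambda>i\<in>{..<d}. 0) / E (\<lambda>i\<in>{..<d}. 0)) \<in> borel_measurable N"
      by (intro borel_measurable_divide borel_measurable_const borel_measurable_integrable) (auto simp: Rd_def)
    then show ?thesis using gauss_env_pos[of d "\<lambda>i\<in>{..<d}. 0"] by simp
  qed
  \<comment> \<open>The error form itself is dominated, being a difference of two dominated forms.
    Only its majorant containing \<open>zfun\<close> may lack integrability, so the comparison runs
    in [0, \<infinity>] and returns to the reals at the end.\<close>
  have Q: "\<bar>\<integral>t. (\<integral>x. ?o t * ?q t x \<partial>leb d) \<partial>N\<bar> \<le> V / 2 + X / 4 + Zr"
  proof -
    have zm: "(\<lambda>(t, x). ennreal (zfun w hNt hNx t x * \<rho> t x)) \<in> borel_measurable (N \<Otimes>\<^sub>M leb d)"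
      unfolding case_prod_beta'
      by (intro measurable_compose[OF _ measurable_ennreal] borel_measurable_times zfun_meas[OF w hN] dom_meas[OF dom_rw[OF wt_1]])
    have zs: "(\<lambda>x. ennreal (zfun w hNt hNx t x * \<rho> t x)) \<in> borel_measurable (leb d)" if "t \<in> I" for t
      using measurable_Pair2[OF zm, of t] that by simp
    have gs: "(\<lambda>x. ennreal ((1 / 2) * usq u t x + (1 / 4) * (?o t * gsq ux t x))) \<in> borel_measurable (leb d)" if "t \<in> I" for t
      by (intro measurable_compose[OF _ measurable_ennreal] borel_measurable_integrable dom_integrable[OF g1 that])
    have gnn: "0 \<le> (1 / 2) * usq u t x + (1 / 4) * (?o t * gsq ux t x)" if "t \<in> I" "x \<in> Rd d" for t x
      using usq_nonneg[OF that, of u] gsq_nonneg[OF that, of ux] omega_bounds[OF that(1)] by simp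
    have "ennreal \<bar>\<integral>t. (\<integral>x. ?o t * ?q t x \<partial>leb d) \<partial>N\<bar> \<le> (\<integral>\<^sup>+t. ennreal \<bar>\<integral>x. ?o t * ?q t x \<partial>leb d\<bar> \<partial>N)"
      using integral_norm_bound_ennreal[OF dom_integrable_time[OF doq]] by simp
    also have "\<dots> \<le> (\<integral>\<^sup>+t. (\<integral>\<^sup>+x. ennreal ((1 / 2) * usq u t x + (1 / 4) * (?o t * gsq ux t x)) \<partial>leb d)
        + (\<integral>\<^sup>+x. ennreal (zfun w hNt hNx t x * \<rho> t x) \<partial>leb d) \<partial>N)"
    proof (rule nn_integral_mono)
      fix t assume "t \<in> space N"
      then have t: "t \<in> I" by simp
      have "ennreal \<bar>\<integral>x. ?o t * ?q t x \<partial>leb d\<bar> \<le> (\<integral>\<^sup>+x. ennreal \<bar>?o t * ?q t x\<bar> \<partial>leb d)"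
        using integral_norm_bound_ennreal[OF dom_integrable[OF doq t]] by simp
      also have "\<dots> \<le> (\<integral>\<^sup>+x. ennreal ((1 / 2) * usq u t x + (1 / 4) * (?o t * gsq ux t x)) + ennreal (zfun w hNt hNx t x * \<rho> t x) \<partial>leb d)"
      proof (rule nn_integral_mono)
        fix x assume "x \<in> space (leb d)"
        then have x: "x \<in> Rd d" by simp
        have "\<bar>?o t * ?q t x\<bar> \<le> ((1 / 2) * usq u t x + (1 / 4) * (?o t * gsq ux t x)) + zfun w hNt hNx t x * \<rho> t x"
          using bform_eta_bound[OF t x, of w hNt hNx u ux] omega_bounds[OF t] by (simp add: abs_mult)
        then show "ennreal \<bar>?o t * ?q t x\<bar> \<le> ennreal ((1 / 2) * usq u t x + (1 / 4) * (?o t * gsq ux t x)) + ennreal (zfun w hNt hNx t x * \<rho> t x)"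
          using ennreal_leI ennreal_plus[OF gnn[OF t x] mult_nonneg_nonneg[OF zfun_nonneg less_imp_le[OF rho_pos[OF t x]]]]
          by metis
      qed
      also have "\<dots> = (\<integral>\<^sup>+x. ennreal ((1 / 2) * usq u t x + (1 / 4) * (?o t * gsq ux t x)) \<partial>leb d)
        + (\<integral>\<^sup>+x. ennreal (zfun w hNt hNx t x * \<rho> t x) \<partial>leb d)"
        by (rule nn_integral_add[OF gs[OF t] zs[OF t]])
      finally show "ennreal \<bar>\<integral>x. ?o t * ?q t x \<partial>leb d\<bar> \<le> (\<integral>\<^sup>+x. ennreal ((1 / 2) * usq u t x + (1 / 4) * (?o t * gsq ux t x)) \<partial>leb d)
        + (\<integral>\<^sup>+x. ennreal (zfun w hNt hNx t x * \<rho> t x) \<partial>leb d)" .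
    qed
    also have "\<dots> = (\<integral>\<^sup>+t. (\<integral>\<^sup>+x. ennreal ((1 / 2) * usq u t x + (1 / 4) * (?o t * gsq ux t x)) \<partial>leb d) \<partial>N)
        + (\<integral>\<^sup>+t. (\<integral>\<^sup>+x. ennreal (zfun w hNt hNx t x * \<rho> t x) \<partial>leb d) \<partial>N)"
    proof (rule nn_integral_add)
      have "(\<lambda>(t, x). ennreal ((1 / 2) * usq u t x + (1 / 4) * (?o t * gsq ux t x))) \<in> borel_measurable (N \<Otimes>\<^sub>M leb d)"
        unfolding case_prod_beta' by (intro measurable_compose[OF _ measurable_ennreal] dom_meas[OF g1])
      then show "(\<lambda>t. \<integral>\<^sup>+x. ennreal ((1 / 2) * usq u t x + (1 / 4) * (?o t * gsq ux t x)) \<partial>leb d) \<in> borel_measurable N"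
        by (rule L.borel_measurable_nn_integral)
      show "(\<lambda>t. \<integral>\<^sup>+x. ennreal (zfun w hNt hNx t x * \<rho> t x) \<partial>leb d) \<in> borel_measurable N"
        by (rule L.borel_measurable_nn_integral[OF zm])
    qed
    also have "\<dots> \<le> ennreal (V / 2 + X / 4) + ennreal Zr"
      using Z nn_integral_dom(3)[OF g1 gnn] unfolding g1i by (intro add_mono) auto
    also have "\<dots> = ennreal (V / 2 + X / 4 + Zr)"
      using nn_integral_dom(4)[OF g1 gnn] Zr unfolding g1i by (subst ennreal_plus) auto
    finally show ?thesis
      using nn_integral_dom(4)[OF g1 gnn] Zr unfolding g1i by (subst (asm) ennreal_le_iff) auto
  qed
  have e: "(\<integral>t. ?o t * ((\<integral>x. u t x * ut t x * \<rho> t x \<partial>leb d) + (\<Sum>i<d. \<integral>x. u t x * ux i t x * rj (\<lambda>_. 1) i t x \<partial>leb d)) \<partial>N)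
      \<le> V / (2 * (t1 - t0))"
    using energy_le[OF u] unfolding V_def usq_def .
  have bueq: "?o t * ((\<integral>x. u t x * ut t x * \<rho> t x \<partial>leb d) + (\<Sum>i<d. \<integral>x. u t x * ux i t x * rj (\<lambda>_. 1) i t x \<partial>leb d))
      = ?o t * (\<integral>x. ?bu t x \<partial>leb d) + (\<integral>x. ?o t * gsq ux t x \<partial>leb d)" if t: "t \<in> I" for t
  proof -
    have i1: "integrable (leb d) (\<lambda>x. u t x * ut t x * \<rho> t x)"
      by (rule dom_integrable[OF dom_mult[OF bdd_mult[OF bu but] dom_rw[OF wt_1]] t])
    have i2: "integrable (leb d) (\<lambda>x. u t x * ux i t x * rj (\<lambda>_. 1) i t x)" if "i < d" for i
      by (rule dom_integrable[OF dom_mult[OF bdd_mult[OF bu bx[OF that]] dom_rj[OF wt_1 that]] t])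
    have i3: "integrable (leb d) (gsq ux t)" by (rule dom_integrable[OF dom_gsq[OF bx] t])
    \<comment> \<open>The last sum of \<open>bform\<close>, with u in both arguments, is the
      gradient energy density; adding it back leaves the integrand of
      \<open>energy_le\<close>.\<close>
    have "?bu t x + gsq ux t x = u t x * ut t x * \<rho> t x + (\<Sum>i<d. u t x * ux i t x * rj (\<lambda>_. 1) i t x)" for x
    proof -
      have "gsq ux t x = (\<Sum>i<d. ux i t x * (ux i t x * \<rho> t x))"
        unfolding gsq_def sum_distrib_right by (simp add: power2_eq_square mult.assoc)
      then show ?thesis unfolding bform_def by (simp add: mult.assoc)
    qed
    then have "(\<integral>x. ?bu t x + gsq ux t x \<partial>leb d)
        = (\<integral>x. u t x * ut t x * \<rho> t x \<partial>leb d) + (\<Sum>i<d. \<integral>x. u t x * ux i t x * rj (\<lambda>_. 1) i t x \<partial>leb d)"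
    proof -
      have s2: "integrable (leb d) (\<lambda>x. \<Sum>i<d. u t x * ux i t x * rj (\<lambda>_. 1) i t x)"
        "(\<integral>x. (\<Sum>i<d. u t x * ux i t x * rj (\<lambda>_. 1) i t x) \<partial>leb d) = (\<Sum>i<d. \<integral>x. u t x * ux i t x * rj (\<lambda>_. 1) i t x \<partial>leb d)"
        by (rule Bochner_Integration.integrable_sum, simp add: i2)
           (rule Bochner_Integration.integral_sum, simp add: i2)
      assume "\<And>x. ?bu t x + gsq ux t x = u t x * ut t x * \<rho> t x + (\<Sum>i<d. u t x * ux i t x * rj (\<lambda>_. 1) i t x)"
      then show ?thesis unfolding s2(2)[symmetric]
        by (simp only: Bochner_Integration.integral_add[OF i1 s2(1)])
    qed
    moreover have "(\<integral>x. ?bu t x + gsq ux t x \<partial>leb d) = (\<integral>x. ?bu t x \<partial>leb d) + (\<integral>x. gsq ux t x \<partial>leb d)"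
      by (rule Bochner_Integration.integral_add[OF dom_integrable[OF du t] i3])
    ultimately have "(\<integral>x. u t x * ut t x * \<rho> t x \<partial>leb d) + (\<Sum>i<d. \<integral>x. u t x * ux i t x * rj (\<lambda>_. 1) i t x \<partial>leb d)
      = (\<integral>x. ?bu t x \<partial>leb d) + (\<integral>x. gsq ux t x \<partial>leb d)" by simp
    then show ?thesis by (simp only: distrib_left integral_mult_right_zero)
  qed
  have ti: "integrable N (\<lambda>t. ?o t * (\<integral>x. f t x \<partial>leb d))" if "dom f" for f
    using dom_integrable_time[OF dom_mult[OF bdd_omega that]] by simp
  have "(\<integral>t. ?o t * (\<integral>x. ?bu t x \<partial>leb d) \<partial>N) + X
      = (\<integral>t. ?o t * (\<integral>x. ?bu t x \<partial>leb d) + (\<integral>x. ?o t * gsq ux t x \<partial>leb d) \<partial>N)"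
    unfolding X_def by (rule Bochner_Integration.integral_add[OF ti[OF du] dom_integrable_time[OF dg], symmetric])
  also have "\<dots> \<le> V / (2 * (t1 - t0))"
    by (rule order_trans[OF _ e], rule eq_refl, rule Bochner_Integration.integral_cong) (auto simp: bueq)
  finally have au: "(\<integral>t. ?o t * (\<integral>x. ?bu t x \<partial>leb d) \<partial>N) + X \<le> V / (2 * (t1 - t0))" .
  have "(\<integral>t. ?o t * (\<integral>x. ?bh t x \<partial>leb d) \<partial>N)
      = (\<integral>t. ?o t * (\<integral>x. ?bN t x \<partial>leb d) - ?o t * (\<integral>x. ?bu t x \<partial>leb d) \<partial>N)"
    by (rule Bochner_Integration.integral_cong[OF refl])
      (use dom_integrable[OF dN] dom_integrable[OF du] in \<open>simp add: heq right_diff_distrib\<close>)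
  also have "\<dots> = (\<integral>t. ?o t * (\<integral>x. ?bN t x \<partial>leb d) \<partial>N) - (\<integral>t. ?o t * (\<integral>x. ?bu t x \<partial>leb d) \<partial>N)"
    by (rule Bochner_Integration.integral_diff[OF ti[OF dN] ti[OF du]])
  also have "(\<integral>t. ?o t * (\<integral>x. ?bN t x \<partial>leb d) \<partial>N) = (\<integral>t. (\<integral>x. ?o t * ?q t x \<partial>leb d) \<partial>N)"
    by (rule Bochner_Integration.integral_cong) (auto simp: beq)
  finally show ?thesis using Q au by linarith
qed

end

section \<open>Elementary inequalities behind the constant\<close>

lemma eroot_le_imp:
  assumes "eroot p Q \<le> ennreal e" "0 < p" "0 \<le> e"
  shows "Q \<le> ennreal (e ^ p)"
proof (cases Q)
  case (real q)
  then have "root p q \<le> e" using assms by (simp add: eroot_def)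
  then have "(root p q) ^ p \<le> e ^ p" using real assms by (intro power_mono) auto
  then show ?thesis using real assms by (simp add: ennreal_leI)
next
  case top
  then show ?thesis using assms by (simp add: eroot_def top_unique)
qed

lemma weighted_young: "0 < c \<Longrightarrow> a * b \<le> (1 / 2 :: real) * (c * a\<^sup>2 + b\<^sup>2 / c)"
proof -
  assume c: "0 < c"
  have "0 \<le> (c * a - b)\<^sup>2 / c" using c by simp
  also have "(c * a - b)\<^sup>2 / c = c * a\<^sup>2 + b\<^sup>2 / c - 2 * (a * b)"
    using c by (simp add: power2_eq_square field_simps)
  finally show ?thesis by simp
qed

text \<open>Origin of the constant 26. Absorbing X and inserting the bound on V leaves coefficients
  of which that of e^2 is the largest: 3 + 1 from V, using 2 / l \<le> 1 + 1 / l^2, and 4 + 4 from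
  the error term, using (1 + \<Lambda>)^2 \<le> 2 + 2 \<Lambda>^2. One further e^2 is added for the
  first term of the conclusion, giving 13, and the factor 2 / \<delta> doubles it.\<close>

lemma final_arith:
  fixes X V Dr Nn \<Lambda> l \<delta> c e :: real
  assumes "0 \<le> X" "0 \<le> V" "0 \<le> Dr" "0 < l" "0 < \<delta>" "\<delta> < 1" "0 \<le> c"
    and X: "X \<le> Nn\<^sup>2 + (V + X + c) / 4 + V / (2 * l) + V / 2 + X / 4 + (2 + (1 + \<Lambda>)\<^sup>2) * e\<^sup>2"
    and V: "V \<le> 2 * e\<^sup>2 + 2 * Dr"
  shows "2 * e\<^sup>2 + (2 / \<delta>) * X \<le> 26 / \<delta> * ((1 + l) / l * Dr + Nn\<^sup>2 + c + (1 + \<Lambda>\<^sup>2 + 1 / l\<^sup>2) * e\<^sup>2)"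
proof -
  define il where "il = 1 / l"
  have il: "0 < il" "(1 + l) / l = il + 1" "1 / l\<^sup>2 = il\<^sup>2" "V / (2 * l) = V * il / 2"
    using assms by (auto simp: il_def field_simps)
  let ?R = "(1 + l) / l * Dr + Nn\<^sup>2 + c + (1 + \<Lambda>\<^sup>2 + 1 / l\<^sup>2) * e\<^sup>2"
  \<comment> \<open>The two quarters of X on the right are moved to the left, at the price of a
    factor 2 for everything else.\<close>
  have lin1: "X \<le> n + (V + X + c) / 4 + y / 2 + V / 2 + X / 4 + z \<Longrightarrow> X \<le> 2 * n + c / 2 + (3 / 2 * V + y) + 2 * z"
    for n y z by (simp add: field_simps)
  have lin2: "X + q \<le> 13 * (m + Dr + n + c + q + j + k)"
    if "X \<le> 2 * n + c / 2 + p + 2 * (2 * q + r)" "p \<le> 3 * q + s + 3 * Dr + 2 * m" "s \<le> q + k" "r \<le> 2 * q + 2 * j"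
      "0 \<le> m" "0 \<le> q" "0 \<le> j" "0 \<le> k" "0 \<le> n" for n p q r s m j k
    using that assms(3,7) by argo
  have "X + e\<^sup>2 \<le> 13 * (il * Dr + Dr + Nn\<^sup>2 + c + e\<^sup>2 + \<Lambda>\<^sup>2 * e\<^sup>2 + il\<^sup>2 * e\<^sup>2)"
  proof (rule lin2)
    have "2 * e\<^sup>2 + (1 + \<Lambda>)\<^sup>2 * e\<^sup>2 = (2 + (1 + \<Lambda>)\<^sup>2) * e\<^sup>2" by (simp add: distrib_right)
    then show "X \<le> 2 * Nn\<^sup>2 + c / 2 + (3 / 2 * V + V * il) + 2 * (2 * e\<^sup>2 + (1 + \<Lambda>)\<^sup>2 * e\<^sup>2)"
      using lin1[OF X[unfolded il(4)]] by simp
    have "(3 / 2 * V + V * il) = V * (3 / 2 + il)" by (simp add: algebra_simps)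
    also have "\<dots> \<le> (2 * e\<^sup>2 + 2 * Dr) * (3 / 2 + il)" using V il by (intro mult_right_mono) auto
    also have "\<dots> = 3 * e\<^sup>2 + (2 * il) * e\<^sup>2 + 3 * Dr + 2 * (il * Dr)" by (simp add: algebra_simps)
    finally show "(3 / 2 * V + V * il) \<le> 3 * e\<^sup>2 + (2 * il) * e\<^sup>2 + 3 * Dr + 2 * (il * Dr)" .
    have "(2 * il) * e\<^sup>2 \<le> (1 + il\<^sup>2) * e\<^sup>2"
      using zero_le_power2[of "1 - il"] by (intro mult_right_mono) (simp_all add: power2_diff)
    then show "(2 * il) * e\<^sup>2 \<le> e\<^sup>2 + il\<^sup>2 * e\<^sup>2" by (simp add: distrib_right)
    have "(1 + \<Lambda>)\<^sup>2 * e\<^sup>2 \<le> (2 + 2 * \<Lambda>\<^sup>2) * e\<^sup>2"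
      using zero_le_power2[of "1 - \<Lambda>"] by (intro mult_right_mono) (simp_all add: power2_diff power2_sum)
    then show "(1 + \<Lambda>)\<^sup>2 * e\<^sup>2 \<le> 2 * e\<^sup>2 + 2 * (\<Lambda>\<^sup>2 * e\<^sup>2)" by (simp add: distrib_right)
  qed (use il assms in auto)
  also have "il * Dr + Dr + Nn\<^sup>2 + c + e\<^sup>2 + \<Lambda>\<^sup>2 * e\<^sup>2 + il\<^sup>2 * e\<^sup>2 = ?R"
    unfolding il by (simp add: algebra_simps)
  finally have "X + e\<^sup>2 \<le> 13 * ?R" .
  then have "(2 / \<delta>) * (X + e\<^sup>2) \<le> (2 / \<delta>) * (13 * ?R)"
    using assms by (intro mult_left_mono) auto
  moreover have "2 * e\<^sup>2 \<le> (2 / \<delta>) * e\<^sup>2" using assms by (intro mult_right_mono) (auto simp: field_simps)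
  ultimately show ?thesis by (simp add: distrib_left)
qed

context ou_window
begin

section \<open>Space-time integrals with values in [0, \<infinity>]\<close>

definition jm :: "tfun \<Rightarrow> bool" where
  "jm f \<longleftrightarrow> (\<lambda>p. f (fst p) (snd p)) \<in> borel_measurable (N \<Otimes>\<^sub>M leb d) \<and> (\<forall>t\<in>I. \<forall>x\<in>Rd d. 0 \<le> f t x)"

text \<open>For nonnegative integrands without an envelope bound, whose finiteness is to be derived
  from the hypotheses and cannot be presupposed.\<close>

definition II :: "tfun \<Rightarrow> ennreal" where
  "II f = (\<integral>\<^sup>+t. (\<integral>\<^sup>+x. ennreal (f t x * \<rho> t x) \<partial>leb d) \<partial>N)"

lemma jm_weight: "jm f \<Longrightarrow> (\<lambda>(t, x). ennreal (f t x * \<rho> t x)) \<in> borel_measurable (N \<Otimes>\<^sub>M leb d)"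
  unfolding case_prod_beta' jm_def
  by (intro measurable_compose[OF _ measurable_ennreal] borel_measurable_times dom_meas[OF dom_rw[OF wt_1]]) auto

lemma jm_inner: "jm f \<Longrightarrow> t \<in> I \<Longrightarrow> (\<lambda>x. ennreal (f t x * \<rho> t x)) \<in> borel_measurable (leb d)"
  using measurable_Pair2[OF jm_weight, of f t] by simp

lemma jm_outer: "jm f \<Longrightarrow> (\<lambda>t. \<integral>\<^sup>+x. ennreal (f t x * \<rho> t x) \<partial>leb d) \<in> borel_measurable N"
  by (rule L.borel_measurable_nn_integral[OF jm_weight])

lemma jm_add: "jm f \<Longrightarrow> jm g \<Longrightarrow> jm (\<lambda>t x. f t x + g t x)"
  by (auto simp: jm_def)

lemma jm_cmult: "jm f \<Longrightarrow> 0 \<le> c \<Longrightarrow> jm (\<lambda>t x. c * f t x)"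
  by (auto simp: jm_def)

lemma II_add:
  assumes "jm f" "jm g"
  shows "II (\<lambda>t x. f t x + g t x) = II f + II g"
proof -
  have "II (\<lambda>t x. f t x + g t x) = (\<integral>\<^sup>+t. (\<integral>\<^sup>+x. ennreal (f t x * \<rho> t x) \<partial>leb d) + (\<integral>\<^sup>+x. ennreal (g t x * \<rho> t x) \<partial>leb d) \<partial>N)"
    unfolding II_def
  proof (rule nn_integral_cong)
    fix t assume "t \<in> space N"
    then have t: "t \<in> I" by simp
    have "(\<integral>\<^sup>+x. ennreal ((f t x + g t x) * \<rho> t x) \<partial>leb d) = (\<integral>\<^sup>+x. ennreal (f t x * \<rho> t x) + ennreal (g t x * \<rho> t x) \<partial>leb d)"
      by (rule nn_integral_cong)
        (use assms t rho_pos[OF t] in \<open>simp add: jm_def distrib_right ennreal_plus less_imp_le\<close>)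
    also have "\<dots> = (\<integral>\<^sup>+x. ennreal (f t x * \<rho> t x) \<partial>leb d) + (\<integral>\<^sup>+x. ennreal (g t x * \<rho> t x) \<partial>leb d)"
      by (rule nn_integral_add[OF jm_inner[OF assms(1) t] jm_inner[OF assms(2) t]])
    finally show "(\<integral>\<^sup>+x. ennreal ((f t x + g t x) * \<rho> t x) \<partial>leb d) = \<dots>" .
  qed
  also have "\<dots> = II f + II g"
    unfolding II_def by (rule nn_integral_add[OF jm_outer[OF assms(1)] jm_outer[OF assms(2)]])
  finally show ?thesis .
qed

lemma II_cmult:
  assumes "jm f" "0 \<le> c"
  shows "II (\<lambda>t x. c * f t x) = ennreal c * II f"
proof -
  have "II (\<lambda>t x. c * f t x) = (\<integral>\<^sup>+t. ennreal c * (\<integral>\<^sup>+x. ennreal (f t x * \<rho> t x) \<partial>leb d) \<partial>N)"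
    unfolding II_def
  proof (rule nn_integral_cong)
    fix t assume "t \<in> space N"
    then have t: "t \<in> I" by simp
    have "(\<integral>\<^sup>+x. ennreal (c * f t x * \<rho> t x) \<partial>leb d) = (\<integral>\<^sup>+x. ennreal c * ennreal (f t x * \<rho> t x) \<partial>leb d)"
      by (simp add: ennreal_mult'[OF assms(2)] mult.assoc)
    then show "(\<integral>\<^sup>+x. ennreal (c * f t x * \<rho> t x) \<partial>leb d) = ennreal c * (\<integral>\<^sup>+x. ennreal (f t x * \<rho> t x) \<partial>leb d)"
      by (simp add: nn_integral_cmult[OF jm_inner[OF assms(1) t]])
  qed
  then show ?thesis unfolding II_def by (simp add: nn_integral_cmult[OF jm_outer[OF assms(1)]])
qed

lemma II_mono:
  assumes "\<And>t x. t \<in> I \<Longrightarrow> x \<in> Rd d \<Longrightarrow> f t x \<le> g t x"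
  shows "II f \<le> II g"
  unfolding II_def
  by (intro nn_integral_mono ennreal_leI mult_right_mono) (auto intro: assms less_imp_le[OF rho_pos])

lemma II_eq_rho:
  assumes "jm f"
  shows "(\<integral>\<^sup>+t. (\<integral>\<^sup>+x. ennreal (f t x) \<partial>rho d p0 T t) \<partial>N) = II f"
  unfolding II_def
proof (rule nn_integral_cong)
  fix t assume "t \<in> space N"
  then have t: "t \<in> I" by simp
  have "f t \<in> borel_measurable (leb d)"
    using assms section_meas[OF _ t, of f] by (simp add: jm_def case_prod_beta')
  then show "(\<integral>\<^sup>+x. ennreal (f t x) \<partial>rho d p0 T t) = (\<integral>\<^sup>+x. ennreal (f t x * \<rho> t x) \<partial>leb d)"
    using assms t by (intro nn_integral_rho) (auto simp: jm_def)
qed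

text \<open>The joint law of starting point and position has the probability measure
  \<open>p0\<close> as its first marginal, hence total mass 1, and passes it on to its second
  marginal.\<close>

lemma rho_mass: "t \<in> I \<Longrightarrow> (\<integral>\<^sup>+x. ennreal (\<rho> t x) \<partial>leb d) = 1"
proof -
  assume t: "t \<in> I"
  then have tau: "0 < T - t" using t1 by simp
  note m = ou_joint_marginals[OF p0 sets_p0 tau]
  have sJ: "sets (ou_joint d p0 (T - t)) = sets (p0 \<Otimes>\<^sub>M leb d)" by (simp add: ou_joint_def)
  have "prob_space (distr (ou_joint d p0 (T - t)) p0 fst)" unfolding m(1) by (rule p0)
  moreover have "fst \<in> measurable (ou_joint d p0 (T - t)) p0" "snd \<in> measurable (ou_joint d p0 (T - t)) (leb d)"
    unfolding measurable_cong_sets[OF sJ refl] by simp_all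
  ultimately have "prob_space (ou_joint d p0 (T - t))" "snd \<in> measurable (ou_joint d p0 (T - t)) (leb d)"
    by (auto dest: prob_space_distrD[rotated])
  then have "prob_space (density (leb d) (\<lambda>x. ennreal (ou_dens d p0 (T - t) x)))"
    unfolding m(2)[symmetric] by (intro prob_space.prob_space_distr)
  moreover have "(\<lambda>x. ennreal (ou_dens d p0 (T - t) x)) = (\<lambda>x. ennreal (\<rho> t x))"
    by (simp add: rho_dens_eq[symmetric] rho_dens_def)
  ultimately have "emeasure (density (leb d) (\<lambda>x. ennreal (\<rho> t x))) (Rd d) = 1"
    using prob_space.emeasure_space_1 by fastforce
  moreover have "Rd d \<in> sets (leb d)" using sets.top[of "leb d"] by simp
  ultimately have "(\<integral>\<^sup>+x. ennreal (\<rho> t x) * indicator (Rd d) x \<partial>leb d) = 1"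
    using rho_meas[OF t] by (subst (asm) emeasure_density) auto
  moreover have "(\<integral>\<^sup>+x. ennreal (\<rho> t x) * indicator (Rd d) x \<partial>leb d) = (\<integral>\<^sup>+x. ennreal (\<rho> t x) \<partial>leb d)"
    by (rule nn_integral_cong) simp
  ultimately show ?thesis by simp
qed

lemma jm_const: "0 \<le> c \<Longrightarrow> jm (\<lambda>t x. c)"
  by (simp add: jm_def)

lemma II_const: "0 \<le> c \<Longrightarrow> II (\<lambda>t x. c) = ennreal c"
proof -
  assume c: "0 \<le> c"
  have "II (\<lambda>t x. 1) = (\<integral>\<^sup>+t. 1 \<partial>N)"
    unfolding II_def by (rule nn_integral_cong) (simp add: rho_mass)
  then have "II (\<lambda>t x. 1) = 1" using N.emeasure_space_1 by simp
  then show ?thesis using II_cmult[OF jm_const[of 1] c] by simp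
qed

definition ssq :: "(nat \<Rightarrow> tfun) \<Rightarrow> tfun" where "ssq gx t x = (\<Sum>i<d. (gx i t x)\<^sup>2)"

lemma ssq_nonneg: "0 \<le> ssq gx t x"
  by (simp add: ssq_def sum_nonneg)

text \<open>Young's inequality with a tuned weight does the work of Cauchy-Schwarz for the fourth
  moments: with weight e^2 / L^2 the moment L^4 of the drift and the moment e^4 of the gradient each
  contribute L^2 e^2 / 2. With weight 1 / e^2 and total mass 1, the fourth moment of the gradient
  alone controls its second moment.\<close>

lemma II_zfun_le:
  assumes w: "wt w B" and h: "nice h ht hx" and e: "0 < e" and L: "1 \<le> L"
    and 1: "II (\<lambda>t x. (etat w ht t x)\<^sup>2) \<le> ennreal (e\<^sup>2)"
    and 2: "II (\<lambda>t x. (ssq (etax w hx) t x)\<^sup>2) \<le> ennreal (e ^ 4)"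
    and 3: "\<And>t. t \<in> I \<Longrightarrow> (\<integral>\<^sup>+x. ennreal ((sq d (drift t x))\<^sup>2 * \<rho> t x) \<partial>leb d) \<le> ennreal (L ^ 4)"
  shows "II (zfun w ht hx) \<le> ennreal ((2 + L\<^sup>2) * e\<^sup>2)"
    and "II (ssq (etax w hx)) \<le> ennreal (e\<^sup>2)"
proof -
  let ?S = "ssq (etax w hx)" and ?D = "\<lambda>t x. sq d (drift t x)"
  have L0: "0 < L" using L by simp
  have jS: "jm ?S"
    unfolding jm_def ssq_def
    by (auto intro!: borel_measurable_sum borel_measurable_power etax_meas[OF w h] sum_nonneg)
  have jS2: "jm (\<lambda>t x. (?S t x)\<^sup>2)" using jS unfolding jm_def by (auto intro!: borel_measurable_power)
  have jD2: "jm (\<lambda>t x. (?D t x)\<^sup>2)" using drift_meas[OF w h] unfolding jm_def by (auto intro!: borel_measurable_power)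
  have jE: "jm (\<lambda>t x. (etat w ht t x)\<^sup>2)" using etat_meas[OF w h] unfolding jm_def by (auto intro!: borel_measurable_power)
  have D: "II (\<lambda>t x. (?D t x)\<^sup>2) \<le> ennreal (L ^ 4)"
  proof -
    have "II (\<lambda>t x. (?D t x)\<^sup>2) \<le> (\<integral>\<^sup>+t. ennreal (L ^ 4) \<partial>N)"
      unfolding II_def by (intro nn_integral_mono 3) simp
    then show ?thesis using N.emeasure_space_1 by simp
  qed
  have Sle: "?S t x \<le> e\<^sup>2 / 2 + (1 / (2 * e\<^sup>2)) * (?S t x)\<^sup>2" for t x
    using weighted_young[of "1 / e\<^sup>2" "?S t x" 1] e by simp
  have DSle: "?D t x * ?S t x \<le> (e\<^sup>2 / (2 * L\<^sup>2)) * (?D t x)\<^sup>2 + (L\<^sup>2 / (2 * e\<^sup>2)) * (?S t x)\<^sup>2" for t x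
    using weighted_young[of "e\<^sup>2 / L\<^sup>2" "?D t x" "?S t x"] e L0 by (simp add: algebra_simps)
  have cS: "ennreal c * II (\<lambda>t x. (?S t x)\<^sup>2) \<le> ennreal (c * e ^ 4)" if "0 \<le> c" for c
    using mult_left_mono[OF 2, of "ennreal c"] that e by (simp add: ennreal_mult'[symmetric])
  have cD: "ennreal c * II (\<lambda>t x. (?D t x)\<^sup>2) \<le> ennreal (c * L ^ 4)" if "0 \<le> c" for c
    using mult_left_mono[OF D, of "ennreal c"] that L0 by (simp add: ennreal_mult'[symmetric])
  have c0: "0 \<le> e\<^sup>2 / 2" "0 \<le> 1 / (2 * e\<^sup>2)" "0 \<le> e\<^sup>2 / (2 * L\<^sup>2)" "0 \<le> L\<^sup>2 / (2 * e\<^sup>2)" by auto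
  have e4: "1 / (2 * e\<^sup>2) * e ^ 4 = e\<^sup>2 / 2" "e\<^sup>2 / (2 * L\<^sup>2) * L ^ 4 = L\<^sup>2 * e\<^sup>2 / 2" "L\<^sup>2 / (2 * e\<^sup>2) * e ^ 4 = L\<^sup>2 * e\<^sup>2 / 2"
    using e L0 by (auto simp: power4_eq_xxxx power2_eq_square)
  have IIS: "II ?S \<le> ennreal (e\<^sup>2)"
  proof -
    have "II ?S \<le> II (\<lambda>t x. e\<^sup>2 / 2 + (1 / (2 * e\<^sup>2)) * (?S t x)\<^sup>2)" by (rule II_mono) (rule Sle)
    also have "\<dots> = ennreal (e\<^sup>2 / 2) + ennreal (1 / (2 * e\<^sup>2)) * II (\<lambda>t x. (?S t x)\<^sup>2)"
      using II_add[OF jm_const[OF c0(1)] jm_cmult[OF jS2 c0(2)]] II_const[OF c0(1)] II_cmult[OF jS2 c0(2)] by simp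
    also have "\<dots> \<le> ennreal (e\<^sup>2 / 2) + ennreal (e\<^sup>2 / 2)"
      using cS[OF c0(2)] unfolding e4 by (rule add_left_mono)
    also have "\<dots> = ennreal (e\<^sup>2)" by (simp flip: ennreal_plus)
    finally show ?thesis .
  qed
  then show "II ?S \<le> ennreal (e\<^sup>2)" .
  have "II (zfun w ht hx) \<le> II (\<lambda>t x. ((etat w ht t x)\<^sup>2
      + ((e\<^sup>2 / (2 * L\<^sup>2)) * (?D t x)\<^sup>2 + (L\<^sup>2 / (2 * e\<^sup>2)) * (?S t x)\<^sup>2)) + ?S t x)"
    by (rule II_mono) (use DSle in \<open>simp add: zfun_def ssq_def\<close>)
  also have "\<dots> = (II (\<lambda>t x. (etat w ht t x)\<^sup>2)
      + (ennreal (e\<^sup>2 / (2 * L\<^sup>2)) * II (\<lambda>t x. (?D t x)\<^sup>2) + ennreal (L\<^sup>2 / (2 * e\<^sup>2)) * II (\<lambda>t x. (?S t x)\<^sup>2))) + II ?S"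
    using II_add[OF jm_add[OF jE jm_add[OF jm_cmult[OF jD2 c0(3)] jm_cmult[OF jS2 c0(4)]]] jS]
      II_add[OF jE jm_add[OF jm_cmult[OF jD2 c0(3)] jm_cmult[OF jS2 c0(4)]]]
      II_add[OF jm_cmult[OF jD2 c0(3)] jm_cmult[OF jS2 c0(4)]] II_cmult[OF jD2 c0(3)] II_cmult[OF jS2 c0(4)]
    by simp
  also have "\<dots> \<le> (ennreal (e\<^sup>2) + (ennreal (L\<^sup>2 * e\<^sup>2 / 2) + ennreal (L\<^sup>2 * e\<^sup>2 / 2))) + ennreal (e\<^sup>2)"
    using 1 IIS cS[OF c0(4)] cD[OF c0(3)] unfolding e4 by (intro add_mono)
  also have "\<dots> = ennreal ((2 + L\<^sup>2) * e\<^sup>2)"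
    by (simp add: algebra_simps flip: ennreal_plus)
  finally show "II (zfun w ht hx) \<le> ennreal ((2 + L\<^sup>2) * e\<^sup>2)" .
qed

end

lemma power2_diff_le: "(a - b)\<^sup>2 \<le> 2 * a\<^sup>2 + 2 * (b\<^sup>2 :: real)"
  using zero_le_power2[of "a + b"] by (simp add: power2_eq_square algebra_simps)

lemma ennreal_bound_eq:
  fixes a b D n c L l e :: real
  assumes "0 \<le> a" "0 \<le> b" "0 \<le> D" "0 \<le> n" "0 \<le> c" "0 \<le> L" "0 \<le> l" "0 \<le> e"
  shows "ennreal (a * (b * D + n + c + (1 + L + l) * e))
    = ennreal a * (ennreal b * ennreal D + ennreal n + ennreal c + (1 + ennreal L + ennreal l) * ennreal e)"
  using assms by (simp add: ennreal_mult)

context ou_window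
begin

section \<open>Moments extracted from the hypotheses\<close>

lemma LnormI_bound:
  assumes "LnormI p d p0 T t0 t1 f \<le> ennreal e" "0 < p" "0 \<le> e" "jm g"
    and "\<And>t x. t \<in> I \<Longrightarrow> x \<in> Rd d \<Longrightarrow> \<bar>f t x\<bar> ^ p = g t x"
  shows "II g \<le> ennreal (e ^ p)"
proof -
  have "II g = (\<integral>\<^sup>+t. (\<integral>\<^sup>+x. ennreal (g t x) \<partial>rho d p0 T t) \<partial>N)"
    by (rule II_eq_rho[OF assms(4), symmetric])
  also have "\<dots> = (\<integral>\<^sup>+t. (\<integral>\<^sup>+x. ennreal (\<bar>f t x\<bar> ^ p) \<partial>rho d p0 T t) \<partial>N)"
    by (intro nn_integral_cong) (simp add: assms(5) rho_eq)
  also have "\<dots> \<le> ennreal (e ^ p)"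
    by (rule eroot_le_imp[OF assms(1)[unfolded LnormI_def] assms(2,3)])
  finally show ?thesis .
qed

lemma grad_diff_hstar:
  assumes w: "wt w B" and h: "nice h ht hx" and t: "t \<in> I" and x: "x \<in> Rd d" and i: "i < d"
  shows "grad (\<lambda>y. h t y - hstar d p0 w T t y) x i = etax w hx i t x"
  unfolding grad_def etax_def hstar_eq
  by (rule pd_eqI, rule DERIV_diff[OF _ hs_DERIV_space[OF w t x i]]) (use h t x i in \<open>auto simp: nice_def\<close>)

lemma enorm_grad_sq:
  assumes w: "wt w B" and h: "nice h ht hx" and t: "t \<in> I" and x: "x \<in> Rd d"
  shows "(enorm d (grad (\<lambda>y. h t y - hstar d p0 w T t y) x))\<^sup>2 = ssq (etax w hx) t x"
  unfolding enorm_sq sq_def ssq_def by (rule sum.cong) (auto simp: grad_diff_hstar[OF w h t x])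

lemma jm_ssq_etax: "wt w B \<Longrightarrow> nice h ht hx \<Longrightarrow> jm (ssq (etax w hx))"
  unfolding jm_def ssq_def
  by (auto intro!: borel_measurable_sum borel_measurable_power etax_meas sum_nonneg)

lemma approx_err_bounds:
  assumes w: "wt w B" and h: "nice h ht hx" and e: "0 < e"
    and a: "approx_err d p0 w T t0 t1 h \<le> ennreal e"
  shows "II (\<lambda>t x. (h t x - hs w t x) ^ 4) \<le> ennreal (e ^ 4)"
    and "II (\<lambda>t x. (ssq (etax w hx) t x)\<^sup>2) \<le> ennreal (e ^ 4)"
    and "II (\<lambda>t x. (etat w ht t x)\<^sup>2) \<le> ennreal (e\<^sup>2)"
proof -
  let ?\<eta> = "\<lambda>t x. h t x - hstar d p0 w T t x"
  have "LnormI 4 d p0 T t0 t1 ?\<eta> \<le> approx_err d p0 w T t0 t1 h"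
    "LnormI 4 d p0 T t0 t1 (\<lambda>t x. enorm d (grad (?\<eta> t) x)) \<le> approx_err d p0 w T t0 t1 h"
    "LnormI 2 d p0 T t0 t1 (dt I ?\<eta>) \<le> approx_err d p0 w T t0 t1 h"
    unfolding approx_err_def Let_def by (auto intro: add_increasing add_increasing2)
  from this[THEN order_trans[OF _ a]]
  have L: "LnormI 4 d p0 T t0 t1 ?\<eta> \<le> ennreal e"
    "LnormI 4 d p0 T t0 t1 (\<lambda>t x. enorm d (grad (?\<eta> t) x)) \<le> ennreal e"
    "LnormI 2 d p0 T t0 t1 (dt I ?\<eta>) \<le> ennreal e" .
  have bh: "bdd h" using h by (simp add: nice_def)
  have j1: "jm (\<lambda>t x. (h t x - hs w t x) ^ 4)"
    unfolding jm_def by (auto intro!: borel_measurable_power borel_measurable_diff bdd_meas[OF bh] hs_meas0[OF w])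
  show "II (\<lambda>t x. (h t x - hs w t x) ^ 4) \<le> ennreal (e ^ 4)"
    by (rule LnormI_bound[OF L(1) _ _ j1]) (use e in \<open>auto simp: hstar_eq\<close>)
  have j2: "jm (\<lambda>t x. (ssq (etax w hx) t x)\<^sup>2)"
    using jm_ssq_etax[OF w h] unfolding jm_def by (auto intro!: borel_measurable_power)
  show "II (\<lambda>t x. (ssq (etax w hx) t x)\<^sup>2) \<le> ennreal (e ^ 4)"
  proof (rule LnormI_bound[OF L(2) _ _ j2])
    fix t x assume tx: "t \<in> I" "x \<in> Rd d"
    have "\<bar>enorm d (grad (?\<eta> t) x)\<bar> ^ 4 = ((enorm d (grad (?\<eta> t) x))\<^sup>2)\<^sup>2" by simp
    then show "\<bar>enorm d (grad (?\<eta> t) x)\<bar> ^ 4 = (ssq (etax w hx) t x)\<^sup>2"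
      unfolding enorm_grad_sq[OF w h tx] .
  qed (use e in auto)
  have j3: "jm (\<lambda>t x. (etat w ht t x)\<^sup>2)"
    using etat_meas[OF w h] unfolding jm_def by (auto intro!: borel_measurable_power)
  show "II (\<lambda>t x. (etat w ht t x)\<^sup>2) \<le> ennreal (e\<^sup>2)"
  proof (rule LnormI_bound[OF L(3) _ _ j3])
    fix t x assume tx: "t \<in> I" "x \<in> Rd d"
    have "dt I ?\<eta> t x = etat w ht t x"
      unfolding etat_def hstar_eq
      by (rule dt_eqI[OF t01 tx(1)], rule DERIV_diff[OF _ hs_DERIV_time[OF w tx]])
        (use h tx in \<open>auto simp: nice_def\<close>)
    then show "\<bar>dt I ?\<eta> t x\<bar>\<^sup>2 = (etat w ht t x)\<^sup>2" by simp
  qed (use e in auto)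
qed

lemma drift_bound:
  assumes "Lambda_star d p0 T t0 t1 = ennreal \<Lambda>" "0 \<le> \<Lambda>" and t: "t \<in> I"
  shows "(\<integral>\<^sup>+x. ennreal ((sq d (drift t x))\<^sup>2 * \<rho> t x) \<partial>leb d) \<le> ennreal (\<Lambda> ^ 4)"
proof -
  have "Lnorm 4 (rho d p0 T t) (\<lambda>x. enorm d (drift t x)) \<le> Lambda_star d p0 T t0 t1"
    unfolding Lambda_star_def drift_def
    by (rule SUP_upper2[OF t]) (auto intro: add_increasing add_increasing2)
  then have "(\<integral>\<^sup>+x. ennreal (\<bar>enorm d (drift t x)\<bar> ^ 4) \<partial>rho d p0 T t) \<le> ennreal (\<Lambda> ^ 4)"
    unfolding assms(1) Lnorm_def by (rule eroot_le_imp) (use assms in auto)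
  moreover have "\<bar>enorm d (drift t x)\<bar> ^ 4 = (sq d (drift t x))\<^sup>2" for x
  proof -
    have "\<bar>enorm d (drift t x)\<bar> ^ 4 = ((enorm d (drift t x))\<^sup>2)\<^sup>2" by simp
    then show ?thesis unfolding enorm_sq .
  qed
  moreover have "(\<integral>\<^sup>+x. ennreal ((sq d (drift t x))\<^sup>2) \<partial>rho d p0 T t) = (\<integral>\<^sup>+x. ennreal ((sq d (drift t x))\<^sup>2 * \<rho> t x) \<partial>leb d)"
  proof (rule nn_integral_rho[OF t])
    \<comment> \<open>The drift involves no approximant, but its measurability is stated jointly
      with that of the error terms; the zero function instantiates that statement.\<close>
    have "nice (\<lambda>t x. 0) (\<lambda>t x. 0) (\<lambda>i t x. 0)" unfolding nice_def by (auto intro: bdd_const)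
    from drift_meas[OF wt_1 this]
    have "(\<lambda>(t, x). sq d (drift t x)) \<in> borel_measurable (N \<Otimes>\<^sub>M leb d)" unfolding case_prod_beta' .
    from section_meas[OF this t]
    show "(\<lambda>x. (sq d (drift t x))\<^sup>2) \<in> borel_measurable (leb d)" by (intro borel_measurable_power) simp
  qed simp
  ultimately show ?thesis by simp
qed

text \<open>Stated for a single pair \<open>hN\<close>, h: the one test function used is their
  weighted difference, and the class \<Psi> acts only through the supremum in
  \<open>N_fun\<close>.\<close>

lemma main_estimate:
  assumes w: "wt w B" and hN12: "bounded_C12 d I b hN" and h12: "bounded_C12 d I b h"
    and V: "wdiff t0 t1 hN h \<in> V_space d p0 T t0 t1" and Psi: "wdiff t0 t1 hN h \<in> \<Psi>"
    and s0: "0 \<le> scl (wdiff t0 t1 hN h)" and sC: "scl (wdiff t0 t1 hN h) \<le> C0"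
    and e: "0 < eN" and ap: "approx_err d p0 w T t0 t1 hN \<le> ennreal eN"
    and \<delta>: "0 < \<delta>" "\<delta> < 1"
  shows "(\<integral>\<^sup>+t\<in>{t0 .. t1 - \<delta> * (t1 - t0)}.
               (\<integral>\<^sup>+x. ennreal ((enorm d (grad (\<lambda>y. h t y - hstar d p0 w T t y) x))\<^sup>2)
                  \<partial>rho d p0 T t) \<partial>N)
            \<le> ennreal (26 / \<delta>) *
               (ennreal ((1 + (t1 - t0)) / (t1 - t0)) * D_fun d p0 w T t0 t1 h
                + (N_fun d p0 T t0 t1 \<Psi> scl \<tau> h)\<^sup>2
                + ennreal (C0\<^sup>2 * \<tau>\<^sup>2)
                + (1 + (Lambda_star d p0 T t0 t1)\<^sup>2 + ennreal (1 / (t1 - t0)\<^sup>2)) * ennreal (eN\<^sup>2))"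
    (is "?L \<le> ?R")
proof (cases "D_fun d p0 w T t0 t1 h = \<infinity> \<or> N_fun d p0 T t0 t1 \<Psi> scl \<tau> h = \<infinity> \<or> Lambda_star d p0 T t0 t1 = \<infinity>")
  case True
  \<comment> \<open>All coefficients on the right are positive, so an infinite quantity makes the
    bound trivial. From here on the three quantities are real numbers.\<close>
  have "0 < (1 + (t1 - t0)) / (t1 - t0)" "0 < eN\<^sup>2" "0 < 26 / \<delta>" using t01 e \<delta> by auto
  then have "?R = \<infinity>"
    using True by (auto simp: ennreal_mult_eq_top_iff ennreal_eq_0_iff power2_eq_square not_le)
  then show ?thesis by simp
next
  case False
  let ?o = "omega t0 t1" and ?l = "t1 - t0"
  obtain Dr where Dr: "D_fun d p0 w T t0 t1 h = ennreal Dr" "0 \<le> Dr"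
    using False by (cases "D_fun d p0 w T t0 t1 h") auto
  obtain Nn where Nn: "N_fun d p0 T t0 t1 \<Psi> scl \<tau> h = ennreal Nn" "0 \<le> Nn"
    using False by (cases "N_fun d p0 T t0 t1 \<Psi> scl \<tau> h") auto
  obtain \<Lambda> where \<Lambda>: "Lambda_star d p0 T t0 t1 = ennreal \<Lambda>" "0 \<le> \<Lambda>"
    using False by (cases "Lambda_star d p0 T t0 t1") auto
  define hNt hNx ht hx where "hNt = dt I hN" and "hNx = (\<lambda>i t x. pd i (hN t) x)"
    and "ht = dt I h" and "hx = (\<lambda>i t x. pd i (h t) x)"
  have ncN: "nicec hN hNt hNx" and nch: "nicec h ht hx"
    unfolding hNt_def hNx_def ht_def hx_def
    using bounded_C12_nicec[OF hN12] bounded_C12_nicec[OF h12] by auto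
  have nN: "nice hN hNt hNx" and nh: "nice h ht hx" using ncN nch by (auto simp: nicec_def)
  define u ut ux where "u = (\<lambda>t x. hN t x - h t x)" and "ut = (\<lambda>t x. hNt t x - ht t x)"
    and "ux = (\<lambda>i t x. hNx i t x - hx i t x)"
  have ncu: "nicec u ut ux" unfolding u_def ut_def ux_def by (rule nicec_diff[OF ncN nch])
  have bu: "bdd u" and bx: "\<And>i. i < d \<Longrightarrow> bdd (ux i)" using ncu by (auto simp: nicec_def nice_def)
  have psi: "wdiff t0 t1 hN h = (\<lambda>t x. ?o t * u t x)" by (simp add: wdiff_def u_def)
  note V' = V[unfolded psi]
  define X where "X = (\<integral>t. (\<integral>x. ?o t * gsq ux t x \<partial>leb d) \<partial>N)"
  define Vv where "Vv = (\<integral>t. (\<integral>x. usq u t x \<partial>leb d) \<partial>N)"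
  define W where "W = (\<integral>t. (\<integral>x. (?o t * ?o t) * (usq u t x + gsq ux t x) \<partial>leb d) \<partial>N)"
  define A where "A = A_form d p0 T t0 t1 h (wdiff t0 t1 hN h)"
  have Aeq: "A = (\<integral>t. ?o t * (\<integral>x. bform ht hx u ux t x \<partial>leb d) \<partial>N)"
    unfolding A_def psi ht_def hx_def
    by (rule A_form_eq[OF ncu V']) (use nch in \<open>simp add: ht_def hx_def\<close>)
  note dU = dom_usq[OF bu] and dG = dom_gsq[of ux, OF bx]
  note dX = dom_mult[OF bdd_omega dG] and dW = dom_mult[OF bdd_mult[OF bdd_omega bdd_omega] dom_add[OF dU dG]]
  have nX: "0 \<le> ?o t * gsq ux t x" and nU: "0 \<le> usq u t x"
    and nW: "0 \<le> (?o t * ?o t) * (usq u t x + gsq ux t x)" if "t \<in> I" "x \<in> Rd d" for t x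
    using usq_nonneg[OF that] gsq_nonneg[OF that] omega_bounds[OF that(1)] by auto
  have X0: "0 \<le> X" unfolding X_def by (rule nn_integral_dom(4)[OF dX nX])
  have V0: "0 \<le> Vv" unfolding Vv_def by (rule nn_integral_dom(4)[OF dU nU])
  have W0: "0 \<le> W" unfolding W_def by (rule nn_integral_dom(4)[OF dW nW])
  have IX: "(\<integral>\<^sup>+t. (\<integral>\<^sup>+x. ennreal (?o t * gsq ux t x) \<partial>leb d) \<partial>N) = ennreal X"
    unfolding X_def by (rule nn_integral_dom(3)[OF dX nX])
  have IU: "(\<integral>\<^sup>+t. (\<integral>\<^sup>+x. ennreal (usq u t x) \<partial>leb d) \<partial>N) = ennreal Vv"
    unfolding Vv_def by (rule nn_integral_dom(3)[OF dU nU])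
  have IW: "(\<integral>\<^sup>+t. (\<integral>\<^sup>+x. ennreal ((?o t * ?o t) * (usq u t x + gsq ux t x)) \<partial>leb d) \<partial>N) = ennreal W"
    unfolding W_def by (rule nn_integral_dom(3)[OF dW nW])
  have XX: "II (\<lambda>t x. ?o t * ssq ux t x) = ennreal X"
    unfolding II_def IX[symmetric] ssq_def gsq_def by (simp only: mult.assoc)
  have VV: "II (\<lambda>t x. (u t x)\<^sup>2) = ennreal Vv"
    unfolding II_def IU[symmetric] usq_def ..
  \<comment> \<open>The norm of the test function carries the square of \<open>omega\<close>, the
    energy only its first power. As 0 \<le> \<open>omega\<close> \<le> 1, the square is the
    smaller.\<close>
  have WX: "W \<le> Vv + X"
  proof -
    have "W \<le> (\<integral>t. (\<integral>x. usq u t x + ?o t * gsq ux t x \<partial>leb d) \<partial>N)"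
      unfolding W_def
    proof (rule integral_mono[OF dom_integrable_time[OF dW] dom_integrable_time[OF dom_add[OF dU dX]]])
      fix t assume "t \<in> space N"
      then have t: "t \<in> I" by simp
      show "(\<integral>x. (?o t * ?o t) * (usq u t x + gsq ux t x) \<partial>leb d) \<le> (\<integral>x. usq u t x + ?o t * gsq ux t x \<partial>leb d)"
      proof (rule integral_mono[OF dom_integrable[OF dW t] dom_integrable[OF dom_add[OF dU dX] t]])
        fix x assume "x \<in> space (leb d)"
        then have x: "x \<in> Rd d" by simp
        have o: "0 \<le> ?o t" "?o t \<le> 1" using omega_bounds[OF t] by auto
        have "?o t * ?o t \<le> 1" using o by (simp add: mult_le_one)
        then have "(?o t * ?o t) * usq u t x \<le> 1 * usq u t x" by (rule mult_right_mono[OF _ nU[OF t x]])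
        moreover have "?o t * ?o t \<le> ?o t * 1" using o by (intro mult_left_mono) auto
        then have "(?o t * ?o t) * gsq ux t x \<le> ?o t * 1 * gsq ux t x" by (rule mult_right_mono[OF _ gsq_nonneg[OF t x]])
        ultimately show "(?o t * ?o t) * (usq u t x + gsq ux t x) \<le> usq u t x + ?o t * gsq ux t x"
          by (simp add: distrib_left)
      qed
    qed
    also have "\<dots> = (\<integral>t. (\<integral>x. usq u t x \<partial>leb d) + (\<integral>x. ?o t * gsq ux t x \<partial>leb d) \<partial>N)"
      by (rule Bochner_Integration.integral_cong[OF refl])
        (use dom_integrable[OF dU] dom_integrable[OF dX] in simp)
    also have "\<dots> = Vv + X" unfolding Vv_def X_def
      by (rule Bochner_Integration.integral_add[OF dom_integrable_time[OF dU] dom_integrable_time[OF dX]])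
    finally show ?thesis .
  qed
  \<comment> \<open>The supremum in \<open>N_fun\<close> leaves out the zero function, and a
    quotient by norm 0 is 0 by convention, so neither case bounds the form. In both cases, treated
    here and in \<open>X_zero2\<close>, X itself vanishes and the estimate for it is
    trivial.\<close>
  have X_zero: "X = 0" if "\<And>t x. t \<in> I \<Longrightarrow> x \<in> Rd d \<Longrightarrow> ?o t * u t x = 0"
  proof -
    have "?o t * gsq ux t x = 0" if t: "t \<in> I" and x: "x \<in> Rd d" for t x
    proof (cases "?o t = 0")
      case False
      have "ux i t x = 0" if i: "i < d" for i
      proof -
        have "u t (x(i := y)) = 0" for y
          using False \<open>\<And>t x. t \<in> I \<Longrightarrow> x \<in> Rd d \<Longrightarrow> ?o t * u t x = 0\<close>[OF t Rd_upd[OF x i, of y]] by simp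
        moreover have "((\<lambda>y. u t (x(i := y))) has_real_derivative ux i t x) (at (x i))"
          using ncu t x i by (auto simp: nicec_def nice_def)
        ultimately show ?thesis using DERIV_unique[OF _ DERIV_const] by simp
      qed
      then show ?thesis by (simp add: gsq_def)
    qed simp
    then have "X = (\<integral>t. (\<integral>x. 0 \<partial>leb d) \<partial>N)" unfolding X_def
      by (intro Bochner_Integration.integral_cong refl) auto
    then show ?thesis by simp
  qed
  have X_zero2: "X = 0" if "W = 0"
  proof -
    have "(\<integral>\<^sup>+t. (\<integral>\<^sup>+x. ennreal ((?o t * ?o t) * (usq u t x + gsq ux t x)) \<partial>leb d) \<partial>N) = 0"
      unfolding IW that by simp
    moreover have m: "(\<lambda>(t, x). ennreal ((?o t * ?o t) * (usq u t x + gsq ux t x))) \<in> borel_measurable (N \<Otimes>\<^sub>M leb d)"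
      unfolding case_prod_beta' by (intro measurable_compose[OF _ measurable_ennreal] dom_meas[OF dW])
    ultimately have "AE t in N. (\<integral>\<^sup>+x. ennreal ((?o t * ?o t) * (usq u t x + gsq ux t x)) \<partial>leb d) = 0"
      using nn_integral_0_iff_AE[OF L.borel_measurable_nn_integral[OF m]] by simp
    then have "AE t in N. (\<integral>\<^sup>+x. ennreal (?o t * gsq ux t x) \<partial>leb d) = 0"
      using AE_space
    proof eventually_elim
      case (elim t)
      then have t: "t \<in> I" by simp
      have "(\<lambda>x. ennreal ((?o t * ?o t) * (usq u t x + gsq ux t x))) \<in> borel_measurable (leb d)"
        using measurable_Pair2[OF m, of t] t by simp
      then have "AE x in leb d. ennreal ((?o t * ?o t) * (usq u t x + gsq ux t x)) = 0"
        using elim nn_integral_0_iff_AE by blast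
      then have "AE x in leb d. ennreal (?o t * gsq ux t x) = 0"
        using AE_space
      proof eventually_elim
        case (elim x)
        then have x: "x \<in> Rd d" by simp
        have "(?o t * ?o t) * (usq u t x + gsq ux t x) = 0"
          using elim(1) nW[OF t x] by (simp only: ennreal_eq_0_iff)
        then have "?o t = 0 \<or> usq u t x + gsq ux t x = 0" by auto
        then have "?o t = 0 \<or> gsq ux t x = 0"
          using add_nonneg_eq_0_iff[OF nU[OF t x] gsq_nonneg[OF t x, of ux]] by blast
        then show ?case by auto
      qed
      then have "(\<integral>\<^sup>+x. ennreal (?o t * gsq ux t x) \<partial>leb d) = (\<integral>\<^sup>+x. 0 \<partial>leb d)" by (rule nn_integral_cong_AE)
      then show ?case by simp
    qed
    then have "(\<integral>\<^sup>+t. (\<integral>\<^sup>+x. ennreal (?o t * gsq ux t x) \<partial>leb d) \<partial>N) = (\<integral>\<^sup>+t. 0 \<partial>N)" by (rule nn_integral_cong_AE)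
    then show ?thesis unfolding IX using X0 by simp
  qed
  have A_le: "A \<le> Nn\<^sup>2 + (Vv + X + C0\<^sup>2 * \<tau>\<^sup>2) / 4" if X: "0 < X"
  proof -
    let ?s = "scl (wdiff t0 t1 hN h)"
    let ?q = "W + \<tau>\<^sup>2 * ?s\<^sup>2"
    have "W \<noteq> 0" using X_zero2 X by auto
    then have q: "0 < ?q" using W0 by (simp add: add_pos_nonneg)
    have "\<exists>t\<in>I. \<exists>x\<in>Rd d. wdiff t0 t1 hN h t x \<noteq> 0" using X_zero X unfolding psi by fastforce
    then have "wdiff t0 t1 hN h \<in> {\<psi>\<in>\<Psi>. \<exists>t\<in>I. \<exists>x\<in>Rd d. \<psi> t x \<noteq> 0}" using Psi by blast
    from SUP_upper[OF this, of "\<lambda>\<psi>. ennreal (A_form d p0 T t0 t1 h \<psi> / sqrt (V_norm_sq d p0 T t0 t1 \<psi> + \<tau>\<^sup>2 * (scl \<psi>)\<^sup>2))"]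
    have "ennreal (A / sqrt (V_norm_sq d p0 T t0 t1 (wdiff t0 t1 hN h) + \<tau>\<^sup>2 * ?s\<^sup>2)) \<le> ennreal Nn"
      unfolding Nn(1)[symmetric] N_fun_def A_def .
    moreover have "V_norm_sq d p0 T t0 t1 (wdiff t0 t1 hN h) = W"
      unfolding psi W_def by (rule V_norm_sq_eq[OF ncu V'])
    ultimately have "A / sqrt ?q \<le> Nn" using Nn(2) by (simp add: ennreal_le_iff)
    then have "A \<le> Nn * sqrt ?q" using q by (simp add: divide_le_eq)
    also have "\<dots> \<le> Nn\<^sup>2 + (sqrt ?q)\<^sup>2 / 4"
      using young[of "sqrt ?q" Nn] by (simp add: mult.commute abs_le_iff)
    also have "(sqrt ?q)\<^sup>2 = ?q" using q by simp
    also have "?q \<le> Vv + X + C0\<^sup>2 * \<tau>\<^sup>2"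
    proof -
      have "?s\<^sup>2 \<le> C0\<^sup>2" using s0 sC by (intro power_mono)
      then have "\<tau>\<^sup>2 * ?s\<^sup>2 \<le> \<tau>\<^sup>2 * C0\<^sup>2" by (intro mult_left_mono) auto
      then show ?thesis using WX by (simp add: mult.commute)
    qed
    finally show ?thesis by simp
  qed
  note ab = approx_err_bounds[OF w nN e ap]
  \<comment> \<open>The moment bound is applied with 1 + \<Lambda> in place of \<Lambda>, because
    the weight in Young's inequality divides by it.\<close>
  have L1: "1 \<le> 1 + \<Lambda>" using \<Lambda> by simp
  have dr: "(\<integral>\<^sup>+x. ennreal ((sq d (drift t x))\<^sup>2 * \<rho> t x) \<partial>leb d) \<le> ennreal ((1 + \<Lambda>) ^ 4)" if "t \<in> I" for t
    by (rule order_trans[OF drift_bound[OF \<Lambda> that]]) (use \<Lambda> in \<open>auto intro!: ennreal_leI power_mono\<close>)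
  note zb = II_zfun_le[OF w nN e L1 ab(3) ab(2) dr]
  have key: "X \<le> A + Vv / (2 * ?l) + Vv / 2 + X / 4 + (2 + (1 + \<Lambda>)\<^sup>2) * eN\<^sup>2"
    unfolding Aeq X_def Vv_def u_def ux_def
    by (rule key_inequality[OF w nN nh]) (use zb(1) in \<open>simp_all add: II_def\<close>)
  have Xle: "X \<le> Nn\<^sup>2 + (Vv + X + C0\<^sup>2 * \<tau>\<^sup>2) / 4 + Vv / (2 * ?l) + Vv / 2 + X / 4 + (2 + (1 + \<Lambda>)\<^sup>2) * eN\<^sup>2"
  proof (cases "X = 0")
    case True
    then show ?thesis using V0 t01 by simp
  next
    case False
    then show ?thesis using key A_le X0 by linarith
  qed
  have jeta: "jm (\<lambda>t x. (hN t x - hs w t x) ^ 4)"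
  proof -
    have b: "bdd hN" using nN by (simp add: nice_def)
    show ?thesis unfolding jm_def
      by (intro conjI borel_measurable_power borel_measurable_diff bdd_meas[OF b] hs_meas0[OF w]) simp
  qed
  have jphi: "jm (\<lambda>t x. (h t x - hs w t x)\<^sup>2)"
  proof -
    have b: "bdd h" using nh by (simp add: nice_def)
    show ?thesis unfolding jm_def
      by (intro conjI borel_measurable_power borel_measurable_diff bdd_meas[OF b] hs_meas0[OF w]) simp
  qed
  have Dphi: "II (\<lambda>t x. (h t x - hs w t x)\<^sup>2) = ennreal Dr"
    unfolding Dr(1)[symmetric] D_fun_def hstar_eq by (rule II_eq_rho[OF jphi, symmetric])
  have Vle: "Vv \<le> 2 * eN\<^sup>2 + 2 * Dr"
  proof -
    have "(u t x)\<^sup>2 \<le> (eN\<^sup>2 + (1 / eN\<^sup>2) * (hN t x - hs w t x) ^ 4) + 2 * (h t x - hs w t x)\<^sup>2" for t x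
    proof -
      let ?a = "hN t x - hs w t x" and ?b = "h t x - hs w t x"
      have "u t x = ?a - ?b" by (simp add: u_def)
      then have "(u t x)\<^sup>2 \<le> 2 * ?a\<^sup>2 + 2 * ?b\<^sup>2"
        by (simp only: power2_diff_le)
      \<comment> \<open>This weight makes the fourth power and the constant contribute eN^2 each
        after integration, so that the L^4 bound acts as an L^2 bound.\<close>
      moreover have "2 * ?a\<^sup>2 \<le> eN\<^sup>2 + (1 / eN\<^sup>2) * ?a ^ 4"
        using weighted_young[of "1 / eN\<^sup>2" "?a\<^sup>2" 1] e by simp
      ultimately show ?thesis by simp
    qed
    then have "ennreal Vv \<le> II (\<lambda>t x. (eN\<^sup>2 + (1 / eN\<^sup>2) * (hN t x - hs w t x) ^ 4) + 2 * (h t x - hs w t x)\<^sup>2)"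
      unfolding VV[symmetric] by (intro II_mono)
    also have "\<dots> = (ennreal (eN\<^sup>2) + ennreal (1 / eN\<^sup>2) * II (\<lambda>t x. (hN t x - hs w t x) ^ 4)) + ennreal 2 * ennreal Dr"
      using II_add[OF jm_add[OF jm_const[of "eN\<^sup>2"] jm_cmult[OF jeta, of "1 / eN\<^sup>2"]] jm_cmult[OF jphi, of 2]]
        II_add[OF jm_const[of "eN\<^sup>2"] jm_cmult[OF jeta, of "1 / eN\<^sup>2"]] II_const[of "eN\<^sup>2"]
        II_cmult[OF jeta, of "1 / eN\<^sup>2"] II_cmult[OF jphi, of 2] Dphi by simp
    also have "\<dots> \<le> (ennreal (eN\<^sup>2) + ennreal (1 / eN\<^sup>2) * ennreal (eN ^ 4)) + ennreal 2 * ennreal Dr"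
      by (intro add_mono mult_left_mono ab(1)) auto
    also have "\<dots> = ennreal (eN\<^sup>2 + (1 / eN\<^sup>2) * eN ^ 4 + 2 * Dr)"
    proof -
      have n: "0 \<le> eN\<^sup>2" "0 \<le> 1 / eN\<^sup>2" "0 \<le> eN ^ 4" "0 \<le> (1 / eN\<^sup>2) * eN ^ 4" "0 \<le> 2 * Dr" "0 \<le> eN\<^sup>2 + (1 / eN\<^sup>2) * eN ^ 4"
        using Dr(2) by auto
      show ?thesis
        unfolding ennreal_plus[OF n(6) n(5)] ennreal_plus[OF n(1) n(4)] ennreal_mult[OF n(2) n(3)]
        using ennreal_mult[of 2 Dr] Dr(2) by simp
    qed
    finally have "Vv \<le> eN\<^sup>2 + (1 / eN\<^sup>2) * eN ^ 4 + 2 * Dr"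
      using e Dr(2) by (subst (asm) ennreal_le_iff) auto
    moreover have "(1 / eN\<^sup>2) * eN ^ 4 = eN\<^sup>2" using e by (simp add: power4_eq_xxxx power2_eq_square)
    ultimately show ?thesis by simp
  qed
  have jS: "jm (ssq (etax w hNx))" by (rule jm_ssq_etax[OF w nN])
  have jG: "jm (\<lambda>t x. ?o t * ssq ux t x)"
    unfolding jm_def ssq_def
    by (auto intro!: borel_measurable_times borel_measurable_sum borel_measurable_power bdd_meas[OF bdd_omega] bdd_meas[OF bx]
        mult_nonneg_nonneg sum_nonneg simp: omega_bounds)
  \<comment> \<open>Both factors 2 come from the square of a difference; 1 / \<delta> restores the
    weight \<open>omega\<close> that the energy carries.\<close>
  have "?L \<le> II (\<lambda>t x. 2 * ssq (etax w hNx) t x + (2 / \<delta>) * (?o t * ssq ux t x))"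
    unfolding II_def
  proof (rule nn_integral_mono)
    fix t assume "t \<in> space N"
    then have t: "t \<in> I" by simp
    show "(\<integral>\<^sup>+x. ennreal ((enorm d (grad (\<lambda>y. h t y - hstar d p0 w T t y) x))\<^sup>2) \<partial>rho d p0 T t)
        * indicator {t0..t1 - \<delta> * (t1 - t0)} t
      \<le> (\<integral>\<^sup>+x. ennreal ((2 * ssq (etax w hNx) t x + (2 / \<delta>) * (?o t * ssq ux t x)) * \<rho> t x) \<partial>leb d)"
    proof (cases "t \<in> {t0..t1 - \<delta> * (t1 - t0)}")
      case True
      have "(\<integral>\<^sup>+x. ennreal ((enorm d (grad (\<lambda>y. h t y - hstar d p0 w T t y) x))\<^sup>2) \<partial>rho d p0 T t)
          = (\<integral>\<^sup>+x. ennreal (ssq (etax w hx) t x) \<partial>rho d p0 T t)"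
        by (rule nn_integral_cong) (simp add: rho_eq enorm_grad_sq[OF w nh t])
      also have "\<dots> = (\<integral>\<^sup>+x. ennreal (ssq (etax w hx) t x * \<rho> t x) \<partial>leb d)"
        using jm_ssq_etax[OF w nh] t section_meas[of "ssq (etax w hx)" t]
        by (intro nn_integral_rho[OF t]) (auto simp: jm_def case_prod_beta')
      also have "\<dots> \<le> (\<integral>\<^sup>+x. ennreal ((2 * ssq (etax w hNx) t x + (2 / \<delta>) * (?o t * ssq ux t x)) * \<rho> t x) \<partial>leb d)"
      proof (intro nn_integral_mono ennreal_leI mult_right_mono)
        fix x assume "x \<in> space (leb d)"
        then show "0 \<le> \<rho> t x" using rho_pos[OF t] by (simp add: less_imp_le)
        have "ssq (etax w hx) t x \<le> (\<Sum>i<d. 2 * (etax w hNx i t x)\<^sup>2 + 2 * (ux i t x)\<^sup>2)"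
          unfolding ssq_def
        proof (rule sum_mono)
          fix i
          have "etax w hx i t x = etax w hNx i t x - ux i t x" by (simp add: etax_def ux_def)
          then show "(etax w hx i t x)\<^sup>2 \<le> 2 * (etax w hNx i t x)\<^sup>2 + 2 * (ux i t x)\<^sup>2"
            by (simp only: power2_diff_le)
        qed
        also have "\<dots> = 2 * ssq (etax w hNx) t x + 2 * (1 * ssq ux t x)"
          by (simp add: ssq_def sum.distrib sum_distrib_left)
        also have "\<dots> \<le> 2 * ssq (etax w hNx) t x + 2 * ((?o t / \<delta>) * ssq ux t x)"
        proof -
          have "\<delta> \<le> ?o t" using True t01 by (simp add: omega_def le_divide_eq)
          then have "1 \<le> ?o t / \<delta>" using \<delta> by (simp add: le_divide_eq)
          then have "1 * ssq ux t x \<le> (?o t / \<delta>) * ssq ux t x" by (rule mult_right_mono[OF _ ssq_nonneg])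
          then show ?thesis by linarith
        qed
        finally show "ssq (etax w hx) t x \<le> 2 * ssq (etax w hNx) t x + (2 / \<delta>) * (?o t * ssq ux t x)"
          by simp
      qed
      finally show ?thesis using True by simp
    qed simp
  qed
  also have "\<dots> = ennreal 2 * II (ssq (etax w hNx)) + ennreal (2 / \<delta>) * ennreal X"
    using II_add[OF jm_cmult[OF jS, of 2] jm_cmult[OF jG, of "2 / \<delta>"]] II_cmult[OF jS, of 2] II_cmult[OF jG, of "2 / \<delta>"] \<delta> XX
    by simp
  also have "\<dots> \<le> ennreal 2 * ennreal (eN\<^sup>2) + ennreal (2 / \<delta>) * ennreal X"
    by (rule add_right_mono[OF mult_left_mono[OF zb(2) zero_le]])
  also have "\<dots> = ennreal (2 * eN\<^sup>2 + (2 / \<delta>) * X)"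
  proof -
    have n: "0 \<le> eN\<^sup>2" "0 \<le> 2 * eN\<^sup>2" "0 \<le> 2 / \<delta>" "0 \<le> (2 / \<delta>) * X" using X0 \<delta> by auto
    show ?thesis
      unfolding ennreal_plus[OF n(2) n(4)] ennreal_mult[OF n(3) X0]
      using ennreal_mult[of 2 "eN\<^sup>2"] by simp
  qed
  also have "\<dots> \<le> ennreal (26 / \<delta> * ((1 + ?l) / ?l * Dr + Nn\<^sup>2 + C0\<^sup>2 * \<tau>\<^sup>2 + (1 + \<Lambda>\<^sup>2 + 1 / ?l\<^sup>2) * eN\<^sup>2))"
    by (intro ennreal_leI final_arith[OF X0 V0 Dr(2) _ \<delta> _ Xle Vle]) (use t01 in auto)
  also have "\<dots> = ?R"
  proof -
    have n: "0 \<le> 26 / \<delta>" "0 \<le> (1 + ?l) / ?l" "0 \<le> Nn\<^sup>2" "0 \<le> C0\<^sup>2 * \<tau>\<^sup>2" "0 \<le> \<Lambda>\<^sup>2" "0 \<le> 1 / ?l\<^sup>2" "0 \<le> eN\<^sup>2"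
      using \<delta> t01 by auto
    have "(ennreal Nn)\<^sup>2 = ennreal (Nn\<^sup>2)" "(ennreal \<Lambda>)\<^sup>2 = ennreal (\<Lambda>\<^sup>2)"
      using Nn \<Lambda> by (auto simp: ennreal_power)
    then show ?thesis
      unfolding Dr(1) Nn(1) \<Lambda>(1)
      by (simp only: ennreal_bound_eq[OF n(1,2) Dr(2) n(3-7)])
  qed
  finally show ?thesis .
qed

end

section \<open>The support of the initial law\<close>

lemma enorm_triangle: "enorm d (\<lambda>i. x i + y i) \<le> enorm d x + enorm d y"
  unfolding enorm_def by (rule L2_set_triangle_ineq)

lemma enorm_le_sum: "enorm d x \<le> (\<Sum>i<d. \<bar>x i\<bar>)"
  unfolding enorm_def by (rule L2_set_le_sum_abs)

lemma enorm_minus: "enorm d (\<lambda>i. x i - y i) = enorm d (\<lambda>i. y i - x i)"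
  by (simp add: enorm_def L2_set_def power2_commute)

lemma ball_sets: "{y \<in> Rd d. enorm d (\<lambda>i. y i - x i) < r} \<in> sets (leb d)"
proof -
  have "(\<lambda>y. enorm d (\<lambda>i. y i - x i)) \<in> borel_measurable (leb d)"
    unfolding enorm_def L2_set_def
    by (intro borel_measurable_sqrt measurable_compose[OF _ borel_measurable_sqrt] borel_measurable_sum borel_measurable_power borel_measurable_diff measurable_coord) auto
  from measurable_sets[OF this, of "{..<r}"] show ?thesis
    by (simp add: vimage_def Int_def conj_commute)
qed

text \<open>The complement of the support is covered by countably many null balls, those with
  rational centres and radii 1 / (k + 1). Each of its points has a null ball around it, and a ball
  of the countable family containing the point fits inside.\<close>

lemma AE_msupp:
  assumes p0: "prob_space p0" "sets p0 = sets (leb d)"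
  shows "AE x in p0. x \<in> msupp d p0"
proof -
  interpret prob_space p0 by fact
  have sp: "space p0 = Rd d" using sets_eq_imp_space_eq[OF p0(2)] by simp
  let ?b = "\<lambda>q r. {y \<in> Rd d. enorm d (\<lambda>i. y i - q i) < r}"
  let ?Q = "Pi\<^sub>E {..<d} (\<lambda>_. \<rat>) \<times> (UNIV :: nat set)"
  let ?r = "\<lambda>k. 1 / real (Suc k)"
  let ?Z = "{(q, k) \<in> ?Q. emeasure p0 (?b q (?r k)) = 0}"
  have "countable ?Q" by (intro countable_SIGMA countable_PiE) (auto simp: countable_rat)
  then have cZ: "countable ?Z" by (rule countable_subset[rotated]) auto
  have each: "AE y in p0. y \<notin> ?b (fst z) (?r (snd z))" if "z \<in> ?Z" for z
    using that ball_sets[of d "fst z" "?r (snd z)"] p0(2)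
    by (intro AE_not_in) (auto simp: null_sets_def case_prod_beta')
  have "AE y in p0. \<forall>z\<in>?Z. y \<notin> ?b (fst z) (?r (snd z))"
    unfolding AE_ball_countable[OF cZ] by (intro ballI each)
  then show ?thesis using AE_space
  proof eventually_elim
    case (elim y)
    then have y: "y \<in> Rd d" by (simp add: sp)
    show ?case
    proof (rule ccontr)
      assume "y \<notin> msupp d p0"
      then obtain r where r: "0 < r" "emeasure p0 (?b y r) = 0"
        using y by (auto simp: msupp_def zero_less_iff_neq_zero)
      obtain k where k: "?r k < r / 2" using nat_approx_posE[of "r / 2"] r by auto
      \<comment> \<open>The radius of the rational ball is below r / 2, so containing y it lies
        within distance r of y. Dividing by d + 1 keeps the sum of the d coordinate errors strictly
        below that radius.\<close>
      define \<epsilon> where "\<epsilon> = ?r k / real (Suc d)"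
      have \<epsilon>: "0 < \<epsilon>" by (simp add: \<epsilon>_def)
      have "\<forall>i. \<exists>q\<in>\<rat>. \<bar>q - y i\<bar> < \<epsilon>"
      proof
        fix i
        obtain q where "q \<in> \<rat>" "y i - \<epsilon> < q" "q < y i" using Rats_dense_in_real[of "y i - \<epsilon>" "y i"] \<epsilon> by auto
        then show "\<exists>q\<in>\<rat>. \<bar>q - y i\<bar> < \<epsilon>" by (intro bexI[of _ q]) auto
      qed
      then obtain q0 where q0: "\<And>i. q0 i \<in> \<rat>" "\<And>i. \<bar>q0 i - y i\<bar> < \<epsilon>" by metis
      define q where "q = restrict q0 {..<d}"
      have q: "q \<in> Pi\<^sub>E {..<d} (\<lambda>_. \<rat>)" using q0(1) by (auto simp: q_def)
      have "enorm d (\<lambda>i. y i - q i) \<le> (\<Sum>i<d. \<bar>y i - q i\<bar>)" by (rule enorm_le_sum)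
      also have "\<dots> \<le> (\<Sum>i<d. \<epsilon>)"
        using q0(2) by (intro sum_mono) (auto simp: q_def abs_minus_commute less_imp_le)
      also have "\<dots> = (real d / real (Suc d)) * ?r k" by (simp add: \<epsilon>_def)
      also have "\<dots> < 1 * ?r k" by (intro mult_strict_right_mono) auto
      finally have yq: "enorm d (\<lambda>i. y i - q i) < ?r k" by simp
      have "?b q (?r k) \<subseteq> ?b y r"
      proof
        fix z assume z: "z \<in> ?b q (?r k)"
        have "enorm d (\<lambda>i. z i - y i) \<le> enorm d (\<lambda>i. z i - q i) + enorm d (\<lambda>i. q i - y i)"
          using enorm_triangle[of d "\<lambda>i. z i - q i" "\<lambda>i. q i - y i"] by simp
        also have "\<dots> < ?r k + ?r k" using z yq enorm_minus[of d q y] by simp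
        finally show "z \<in> ?b y r" using z k by simp
      qed
      then have "emeasure p0 (?b q (?r k)) = 0"
        using emeasure_mono[of "?b q (?r k)" "?b y r" p0] r(2) ball_sets[of d y r] p0(2) by simp
      then have "(q, k) \<in> ?Z" using q by simp
      then have "y \<notin> ?b q (?r k)" using elim(1) by fastforce
      then show False using y yq by simp
    qed
  qed
qed

lemma setting_ou_window:
  assumes "setting d T p0 w Bbar s t0 t1"
  shows "ou_window d T t0 t1 p0" and "ou_window.wt d p0 w Bbar"
proof -
  have S: "1 \<le> d" "0 < t0" "t0 < t1" "t1 < T" "prob_space p0" "sets p0 = sets (leb d)"
    "\<forall>x\<in>msupp d p0. \<forall>i<d. \<bar>x i\<bar> \<le> 1" "w \<in> borel_measurable (leb d)"
    "\<forall>x\<in>msupp d p0. 0 < w x \<and> w x \<le> Bbar"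
    using assms unfolding setting_def by - (elim conjE, assumption)+
  have m: "AE a in p0. a \<in> msupp d p0" by (rule AE_msupp[OF S(5,6)])
  have "AE a in p0. \<forall>i<d. \<bar>a i\<bar> \<le> 1" using m by eventually_elim (use S(7) in blast)
  then show win: "ou_window d T t0 t1 p0" using S(1-6) by (intro ou_window.intro)
  have "AE a in p0. \<bar>w a\<bar> \<le> Bbar"
    using m
  proof eventually_elim
    case (elim a)
    then show ?case using S(9) by (metis abs_of_pos)
  qed
  then show "ou_window.wt d p0 w Bbar" using S(8) unfolding ou_window.wt_def[OF win] by blast
qed

section \<open>Bounded \<open>C\<^sup>1\<^sup>,\<^sup>2\<close> functions\<close>

text \<open>\<open>c2w\<close> carries the derivatives as explicit witnesses, which makes closure under composition provable
  without computing \<^const>\<open>dt\<close> and \<^const>\<open>pd\<close>.\<close>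

definition c2w :: "nat \<Rightarrow> real set \<Rightarrow> tfun \<Rightarrow> tfun \<Rightarrow> (nat \<Rightarrow> tfun) \<Rightarrow> (nat \<Rightarrow> nat \<Rightarrow> tfun) \<Rightarrow> bool" where
  "c2w d I v vt vx vxx \<longleftrightarrow>
     continuous_on (I \<times> Rd d) (\<lambda>p. v (fst p) (snd p)) \<and> continuous_on (I \<times> Rd d) (\<lambda>p. vt (fst p) (snd p)) \<and>
     (\<forall>i<d. continuous_on (I \<times> Rd d) (\<lambda>p. vx i (fst p) (snd p))) \<and>
     (\<forall>i<d. \<forall>j<d. continuous_on (I \<times> Rd d) (\<lambda>p. vxx i j (fst p) (snd p))) \<and>
     (\<forall>t\<in>I. \<forall>x\<in>Rd d. ((\<lambda>r. v r x) has_real_derivative vt t x) (at t within I)) \<and>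
     (\<forall>i<d. \<forall>t\<in>I. \<forall>x\<in>Rd d. ((\<lambda>y. v t (x(i := y))) has_real_derivative vx i t x) (at (x i))) \<and>
     (\<forall>i<d. \<forall>j<d. \<forall>t\<in>I. \<forall>x\<in>Rd d. ((\<lambda>y. vx j t (x(i := y))) has_real_derivative vxx i j t x) (at (x i))) \<and>
     (\<exists>M\<ge>0. \<forall>t\<in>I. \<forall>x\<in>Rd d. \<bar>v t x\<bar> \<le> M \<and> \<bar>vt t x\<bar> \<le> M \<and> (\<forall>i<d. \<bar>vx i t x\<bar> \<le> M \<and> (\<forall>j<d. \<bar>vxx i j t x\<bar> \<le> M)))"

lemma c2wD:
  assumes "c2w d I v vt vx vxx"
  shows "continuous_on (I \<times> Rd d) (\<lambda>p. v (fst p) (snd p))"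
    and "continuous_on (I \<times> Rd d) (\<lambda>p. vt (fst p) (snd p))"
    and "\<forall>i<d. continuous_on (I \<times> Rd d) (\<lambda>p. vx i (fst p) (snd p))"
    and "\<forall>i<d. \<forall>j<d. continuous_on (I \<times> Rd d) (\<lambda>p. vxx i j (fst p) (snd p))"
    and "\<forall>t\<in>I. \<forall>x\<in>Rd d. ((\<lambda>r. v r x) has_real_derivative vt t x) (at t within I)"
    and "\<forall>i<d. \<forall>t\<in>I. \<forall>x\<in>Rd d. ((\<lambda>y. v t (x(i := y))) has_real_derivative vx i t x) (at (x i))"
    and "\<forall>i<d. \<forall>j<d. \<forall>t\<in>I. \<forall>x\<in>Rd d. ((\<lambda>y. vx j t (x(i := y))) has_real_derivative vxx i j t x) (at (x i))"
    and "\<exists>M\<ge>0. \<forall>t\<in>I. \<forall>x\<in>Rd d. \<bar>v t x\<bar> \<le> M \<and> \<bar>vt t x\<bar> \<le> M \<and> (\<forall>i<d. \<bar>vx i t x\<bar> \<le> M \<and> (\<forall>j<d. \<bar>vxx i j t x\<bar> \<le> M))"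
  using assms unfolding c2w_def by - (elim conjE, assumption)+

definition c2b :: "nat \<Rightarrow> real set \<Rightarrow> tfun \<Rightarrow> bool" where
  "c2b d I v \<longleftrightarrow> (\<exists>vt vx vxx. c2w d I v vt vx vxx)"

lemma c2b_cong:
  assumes "c2b d I v" "\<And>t x. t \<in> I \<Longrightarrow> x \<in> Rd d \<Longrightarrow> u t x = v t x"
  shows "c2b d I u"
proof -
  obtain vt vx vxx where c: "c2w d I v vt vx vxx" using assms(1) by (auto simp: c2b_def)
  have 1: "continuous_on (I \<times> Rd d) (\<lambda>p. u (fst p) (snd p))"
    using c2wD(1)[OF c] by (subst continuous_on_cong[OF refl, where g="\<lambda>p. v (fst p) (snd p)"]) (auto simp: assms(2))
  have 2: "((\<lambda>r. u r x) has_real_derivative vt t x) (at t within I)" if "t \<in> I" "x \<in> Rd d" for t x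
  proof -
    have "((\<lambda>r. v r x) has_real_derivative vt t x) (at t within I)" using c2wD(5)[OF c] that by blast
    then show ?thesis by (rule has_field_derivative_transform_within[where d=1]) (use assms(2) that in auto)
  qed
  have 3: "((\<lambda>y. u t (x(i := y))) has_real_derivative vx i t x) (at (x i))" if "i < d" "t \<in> I" "x \<in> Rd d" for i t x
  proof -
    have "(\<lambda>y. u t (x(i := y))) = (\<lambda>y. v t (x(i := y)))" using assms(2) that by simp
    moreover have "((\<lambda>y. v t (x(i := y))) has_real_derivative vx i t x) (at (x i))"
      using c2wD(6)[OF c] that by blast
    ultimately show ?thesis by simp
  qed
  have 4: "\<exists>M\<ge>0. \<forall>t\<in>I. \<forall>x\<in>Rd d. \<bar>u t x\<bar> \<le> M \<and> \<bar>vt t x\<bar> \<le> M \<and> (\<forall>i<d. \<bar>vx i t x\<bar> \<le> M \<and> (\<forall>j<d. \<bar>vxx i j t x\<bar> \<le> M))"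
  proof -
    obtain M where M: "0 \<le> M" "\<forall>t\<in>I. \<forall>x\<in>Rd d. \<bar>v t x\<bar> \<le> M \<and> \<bar>vt t x\<bar> \<le> M \<and> (\<forall>i<d. \<bar>vx i t x\<bar> \<le> M \<and> (\<forall>j<d. \<bar>vxx i j t x\<bar> \<le> M))"
      using c2wD(8)[OF c] by blast
    show ?thesis
    proof (rule exI[of _ M], intro conjI M(1) ballI)
      fix t x assume "t \<in> I" "x \<in> Rd d"
      then show "\<bar>u t x\<bar> \<le> M" "\<bar>vt t x\<bar> \<le> M" "\<forall>i<d. \<bar>vx i t x\<bar> \<le> M \<and> (\<forall>j<d. \<bar>vxx i j t x\<bar> \<le> M)"
        using M(2) unfolding assms(2)[OF \<open>t \<in> I\<close> \<open>x \<in> Rd d\<close>] by blast+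
    qed
  qed
  have "c2w d I u vt vx vxx" 
    unfolding c2w_def using c2wD(2,3,4,7)[OF c]
    by (intro conjI 1 4 allI impI ballI 2 3) (assumption | blast)+
  then show ?thesis by (auto simp: c2b_def)
qed

lemma c2b_const: "c2b d I (\<lambda>t x. c)"
  unfolding c2b_def c2w_def
  by (rule exI[of _ "\<lambda>t x. 0"], rule exI[of _ "\<lambda>i t x. 0"], rule exI[of _ "\<lambda>i j t x. 0"])
     (auto intro!: exI[of _ "\<bar>c\<bar>"])

lemma c2b_add:
  assumes "c2b d I u" "c2b d I v" shows "c2b d I (\<lambda>t x. u t x + v t x)"
proof -
  obtain ut ux uxx vt vx vxx where c: "c2w d I u ut ux uxx" "c2w d I v vt vx vxx"
    using assms by (auto simp: c2b_def)
  obtain M N where M: "0 \<le> M" "\<forall>t\<in>I. \<forall>x\<in>Rd d. \<bar>u t x\<bar> \<le> M \<and> \<bar>ut t x\<bar> \<le> M \<and> (\<forall>i<d. \<bar>ux i t x\<bar> \<le> M \<and> (\<forall>j<d. \<bar>uxx i j t x\<bar> \<le> M))"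
    and N: "0 \<le> N" "\<forall>t\<in>I. \<forall>x\<in>Rd d. \<bar>v t x\<bar> \<le> N \<and> \<bar>vt t x\<bar> \<le> N \<and> (\<forall>i<d. \<bar>vx i t x\<bar> \<le> N \<and> (\<forall>j<d. \<bar>vxx i j t x\<bar> \<le> N))"
    using c2wD(8)[OF c(1)] c2wD(8)[OF c(2)] by blast
  have tri: "\<bar>a + b\<bar> \<le> M + N" if "\<bar>a\<bar> \<le> M" "\<bar>b\<bar> \<le> N" for a b :: real using that by linarith
  have "c2w d I (\<lambda>t x. u t x + v t x) (\<lambda>t x. ut t x + vt t x) (\<lambda>i t x. ux i t x + vx i t x) (\<lambda>i j t x. uxx i j t x + vxx i j t x)"
    unfolding c2w_def
  proof (intro conjI allI impI ballI exI[of _ "M + N"])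
    show "continuous_on (I \<times> Rd d) (\<lambda>p. u (fst p) (snd p) + v (fst p) (snd p))"
      by (rule continuous_on_add[OF c2wD(1)[OF c(1)] c2wD(1)[OF c(2)]])
    show "continuous_on (I \<times> Rd d) (\<lambda>p. ut (fst p) (snd p) + vt (fst p) (snd p))"
      by (rule continuous_on_add[OF c2wD(2)[OF c(1)] c2wD(2)[OF c(2)]])
    show "0 \<le> M + N" using M(1) N(1) by simp
    fix i assume i: "i < d"
    show "continuous_on (I \<times> Rd d) (\<lambda>p. ux i (fst p) (snd p) + vx i (fst p) (snd p))"
      by (rule continuous_on_add[OF c2wD(3)[OF c(1), rule_format, OF i] c2wD(3)[OF c(2), rule_format, OF i]])
    fix j assume j: "j < d"
    show "continuous_on (I \<times> Rd d) (\<lambda>p. uxx i j (fst p) (snd p) + vxx i j (fst p) (snd p))"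
      by (rule continuous_on_add[OF c2wD(4)[OF c(1), rule_format, OF i j] c2wD(4)[OF c(2), rule_format, OF i j]])
  next
    fix t x assume t: "t \<in> I" and x: "x \<in> Rd d"
    note m = M(2)[rule_format, OF t x] and n = N(2)[rule_format, OF t x]
    show "((\<lambda>r. u r x + v r x) has_real_derivative ut t x + vt t x) (at t within I)"
      by (rule DERIV_add[OF c2wD(5)[OF c(1), rule_format, OF t x] c2wD(5)[OF c(2), rule_format, OF t x]])
    show "\<bar>u t x + v t x\<bar> \<le> M + N" "\<bar>ut t x + vt t x\<bar> \<le> M + N" using m n by (blast intro: tri)+
    fix i assume i: "i < d"
    show "((\<lambda>y. u t (x(i := y)) + v t (x(i := y))) has_real_derivative ux i t x + vx i t x) (at (x i))"
      by (rule DERIV_add[OF c2wD(6)[OF c(1), rule_format, OF i t x] c2wD(6)[OF c(2), rule_format, OF i t x]])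
    show "\<bar>ux i t x + vx i t x\<bar> \<le> M + N" using m n i by (blast intro: tri)
    fix j assume j: "j < d"
    show "((\<lambda>y. ux j t (x(i := y)) + vx j t (x(i := y))) has_real_derivative uxx i j t x + vxx i j t x) (at (x i))"
      by (rule DERIV_add[OF c2wD(7)[OF c(1), rule_format, OF i j t x] c2wD(7)[OF c(2), rule_format, OF i j t x]])
    show "\<bar>uxx i j t x + vxx i j t x\<bar> \<le> M + N" using m n i j by (blast intro: tri)
  qed
  then show ?thesis by (auto simp: c2b_def)
qed

text \<open>The range of v lies in a compact interval, on which s and its derivatives are bounded by
  continuity. This admits unbounded outer functions such as \<open>cubed_relu\<close> or a linear
  map.\<close>

lemma c2b_compose:
  assumes "c2b d I v" and s: "\<And>y. (s has_real_derivative s' y) (at y)" "\<And>y. (s' has_real_derivative s'' y) (at y)"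
    and s'': "continuous_on UNIV s''"
  shows "c2b d I (\<lambda>t x. s (v t x))"
proof -
  obtain vt vx vxx where c: "c2w d I v vt vx vxx" using assms by (auto simp: c2b_def)
  have cs: "continuous_on UNIV s" "continuous_on UNIV s'"
    by (rule DERIV_continuous_on[where D=s'], use s(1) in simp, rule DERIV_continuous_on[where D=s''], use s(2) in simp)
  obtain M where M: "0 \<le> M" "\<forall>t\<in>I. \<forall>x\<in>Rd d. \<bar>v t x\<bar> \<le> M \<and> \<bar>vt t x\<bar> \<le> M \<and> (\<forall>i<d. \<bar>vx i t x\<bar> \<le> M \<and> (\<forall>j<d. \<bar>vxx i j t x\<bar> \<le> M))"
    using c2wD(8)[OF c] by blast
  have bd: "\<exists>B\<ge>0. \<forall>y\<in>{-M..M}. \<bar>f y\<bar> \<le> B" if "continuous_on UNIV f" for f :: "real \<Rightarrow> real"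
  proof -
    have "compact (f ` {-M..M})" by (intro compact_continuous_image continuous_on_subset[OF that]) auto
    then have "bounded (f ` {-M..M})" by (rule compact_imp_bounded)
    then obtain b where "0 < b" "\<forall>z\<in>f ` {-M..M}. norm z \<le> b" unfolding bounded_pos by blast
    then show ?thesis by (intro exI[of _ b]) auto
  qed
  obtain B0 B1 B2 where B: "0 \<le> B0" "\<forall>y\<in>{-M..M}. \<bar>s y\<bar> \<le> B0" "0 \<le> B1" "\<forall>y\<in>{-M..M}. \<bar>s' y\<bar> \<le> B1"
    "0 \<le> B2" "\<forall>y\<in>{-M..M}. \<bar>s'' y\<bar> \<le> B2"
    using bd[OF cs(1)] bd[OF cs(2)] bd[OF s''] by metis
  define K where "K = B0 + B1 * M + B2 * M * M"
  have K: "0 \<le> B1 * M" "0 \<le> B2 * M * M" using B M by auto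
  have vM: "v t x \<in> {-M..M}" if "t \<in> I" "x \<in> Rd d" for t x using M(2) that by (force simp: abs_le_iff)
  have cv: "continuous_on (I \<times> Rd d) (\<lambda>p. v (fst p) (snd p))" using c2wD(1)[OF c] by blast
  note cc = continuous_on_compose2[OF _ cv subset_UNIV]
  have dt: "((\<lambda>r. v r x) has_real_derivative vt t x) (at t within I)" if "t \<in> I" "x \<in> Rd d" for t x
    using c2wD(5)[OF c] that by blast
  have dx: "((\<lambda>y. v t (x(i := y))) has_real_derivative vx i t x) (at (x i))" if "i < d" "t \<in> I" "x \<in> Rd d" for i t x
    using c2wD(6)[OF c] that by blast
  have dxx: "((\<lambda>y. vx j t (x(i := y))) has_real_derivative vxx i j t x) (at (x i))" if "i < d" "j < d" "t \<in> I" "x \<in> Rd d" for i j t x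
    using c2wD(7)[OF c] that by blast
  have cvt: "continuous_on (I \<times> Rd d) (\<lambda>p. vt (fst p) (snd p))" using c2wD(2)[OF c] by blast
  have cvx: "continuous_on (I \<times> Rd d) (\<lambda>p. vx i (fst p) (snd p))" if "i < d" for i using c2wD(3)[OF c] that by blast
  have cvxx: "continuous_on (I \<times> Rd d) (\<lambda>p. vxx i j (fst p) (snd p))" if "i < d" "j < d" for i j using c2wD(4)[OF c] that by blast
  have "c2w d I (\<lambda>t x. s (v t x)) (\<lambda>t x. s' (v t x) * vt t x) (\<lambda>i t x. s' (v t x) * vx i t x)
      (\<lambda>i j t x. s'' (v t x) * vx i t x * vx j t x + s' (v t x) * vxx i j t x)"
    unfolding c2w_def
  proof (intro conjI allI impI ballI exI[of _ K])
    show "continuous_on (I \<times> Rd d) (\<lambda>p. s (v (fst p) (snd p)))" by (rule cc[OF cs(1)])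
    show "continuous_on (I \<times> Rd d) (\<lambda>p. s' (v (fst p) (snd p)) * vt (fst p) (snd p))"
      by (intro continuous_on_mult cc[OF cs(2)] cvt)
    show "continuous_on (I \<times> Rd d) (\<lambda>p. s' (v (fst p) (snd p)) * vx i (fst p) (snd p))" if "i < d" for i
      by (intro continuous_on_mult cc[OF cs(2)] cvx that)
    show "continuous_on (I \<times> Rd d) (\<lambda>p. s'' (v (fst p) (snd p)) * vx i (fst p) (snd p) * vx j (fst p) (snd p)
        + s' (v (fst p) (snd p)) * vxx i j (fst p) (snd p))" if "i < d" "j < d" for i j
      by (intro continuous_on_add continuous_on_mult cc[OF cs(2)] cc[OF s''] cvx cvxx that)
    show "((\<lambda>r. s (v r x)) has_real_derivative s' (v t x) * vt t x) (at t within I)" if "t \<in> I" "x \<in> Rd d" for t x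
      by (rule DERIV_chain2[where f=s, OF s(1) dt[OF that]])
    show "((\<lambda>y. s (v t (x(i := y)))) has_real_derivative s' (v t x) * vx i t x) (at (x i))"
      if "i < d" "t \<in> I" "x \<in> Rd d" for i t x
      using DERIV_chain2[where f=s, OF s(1) dx[OF that]] by simp
    show "((\<lambda>y. s' (v t (x(i := y))) * vx j t (x(i := y))) has_real_derivative
        s'' (v t x) * vx i t x * vx j t x + s' (v t x) * vxx i j t x) (at (x i))"
      if "i < d" "j < d" "t \<in> I" "x \<in> Rd d" for i j t x
      using DERIV_mult[OF DERIV_chain2[where f=s', OF s(2) dx[OF that(1,3,4)]] dxx[OF that]] by (simp add: mult_ac)
    show "0 \<le> K" using K B by (simp add: K_def)
    fix t x assume t: "t \<in> I" and x: "x \<in> Rd d"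
    note b = B(2,4,6)[rule_format, OF vM[OF t x]] and m = M(2)[rule_format, OF t x]
    show "\<bar>s (v t x)\<bar> \<le> K" using b(1) K by (simp add: K_def)
    have p1: "\<bar>s' (v t x) * a\<bar> \<le> B1 * M" if "\<bar>a\<bar> \<le> M" for a
      unfolding abs_mult using b(2) that B(3) by (intro mult_mono) auto
    show "\<bar>s' (v t x) * vt t x\<bar> \<le> K" using p1[of "vt t x"] m K B(1) by (simp add: K_def)
    fix i assume i: "i < d"
    show "\<bar>s' (v t x) * vx i t x\<bar> \<le> K" using p1[of "vx i t x"] m i K B(1) by (simp add: K_def)
    fix j assume j: "j < d"
    have "\<bar>s'' (v t x) * vx i t x\<bar> \<le> B2 * M"
      unfolding abs_mult using b(3) m i B(5) by (intro mult_mono) auto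
    then have "\<bar>s'' (v t x) * vx i t x * vx j t x\<bar> \<le> B2 * M * M"
      unfolding abs_mult[of _ "vx j t x"] using m j B(5) M(1) by (intro mult_mono) auto
    moreover have "\<bar>s' (v t x) * vxx i j t x\<bar> \<le> B1 * M" using p1[of "vxx i j t x"] m i j by simp
    ultimately show "\<bar>s'' (v t x) * vx i t x * vx j t x + s' (v t x) * vxx i j t x\<bar> \<le> K"
      using B(1) unfolding K_def by linarith
  qed
  then show ?thesis by (auto simp: c2b_def)
qed

lemma c2b_cmult: "c2b d I v \<Longrightarrow> c2b d I (\<lambda>t x. c * v t x)"
  by (rule c2b_compose[where s="\<lambda>y. c * y" and s'="\<lambda>_. c" and s''="\<lambda>_. 0"])
     (auto intro!: derivative_eq_intros)

lemma c2b_sum: "(\<And>i. i < n \<Longrightarrow> c2b d I (f i)) \<Longrightarrow> c2b d I (\<lambda>t x. \<Sum>i<n. f i t x)" for n :: nat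
  by (induction n) (auto intro: c2b_const c2b_add)

lemma c2b_time: "c2b d {t0..t1} (\<lambda>t x. t)"
  unfolding c2b_def c2w_def
  by (rule exI[of _ "\<lambda>t x. 1"], rule exI[of _ "\<lambda>i t x. 0"], rule exI[of _ "\<lambda>i j t x. 0"])
     (auto intro!: exI[of _ "\<bar>t0\<bar> + \<bar>t1\<bar> + 1"] continuous_intros)

text \<open>A bare coordinate is unbounded. The networks have bounded derivatives on all of space
  because they see the position only through bounded functions of single coordinates, the
  clips.\<close>

lemma c2b_coord:
  assumes j: "j < d" and s: "\<And>y. (s has_real_derivative s' y) (at y)" "\<And>y. (s' has_real_derivative s'' y) (at y)"
    and s'': "continuous_on UNIV s''"
    and b: "\<And>y. \<bar>s y\<bar> \<le> B0" "\<And>y. \<bar>s' y\<bar> \<le> B1" "\<And>y. \<bar>s'' y\<bar> \<le> B2"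
  shows "c2b d I (\<lambda>t x. s (x j))"
proof -
  have cs: "continuous_on UNIV s" "continuous_on UNIV s'"
    by (rule DERIV_continuous_on[where D=s'], use s(1) in simp, rule DERIV_continuous_on[where D=s''], use s(2) in simp)
  have cj: "continuous_on (I \<times> Rd d) (\<lambda>p. snd p j)"
    by (rule continuous_on_compose2[OF continuous_on_product_coordinates continuous_on_snd[OF continuous_on_id]]) auto
  note cc = continuous_on_compose2[OF _ cj subset_UNIV]
  have "c2w d I (\<lambda>t x. s (x j)) (\<lambda>t x. 0) (\<lambda>i t x. if i = j then s' (x j) else 0)
      (\<lambda>i k t x. if i = j \<and> k = j then s'' (x j) else 0)"
    unfolding c2w_def
  proof (intro conjI allI impI ballI exI[of _ "\<bar>B0\<bar> + \<bar>B1\<bar> + \<bar>B2\<bar>"])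
    show "continuous_on (I \<times> Rd d) (\<lambda>p. s (snd p j))" by (rule cc[OF cs(1)])
    show "continuous_on (I \<times> Rd d) (\<lambda>p. if i = j then s' (snd p j) else 0)" for i
      using cc[OF cs(2)] by (cases "i = j") simp_all
    show "continuous_on (I \<times> Rd d) (\<lambda>p. if i = j \<and> k = j then s'' (snd p j) else 0)" for i k
      using cc[OF s''] by (cases "i = j \<and> k = j") auto
    show "((\<lambda>y. s ((x(i := y)) j)) has_real_derivative (if i = j then s' (x j) else 0)) (at (x i))" for i and x :: pt
      using s(1) by (cases "i = j") simp_all
    show "((\<lambda>y. if k = j then s' ((x(i := y)) j) else 0) has_real_derivative
        (if i = j \<and> k = j then s'' (x j) else 0)) (at (x i))" for i k and x :: pt
      using s(2) by (cases "k = j"; cases "i = j") simp_all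
    show "\<bar>s (x j)\<bar> \<le> \<bar>B0\<bar> + \<bar>B1\<bar> + \<bar>B2\<bar>" for x :: pt using b(1)[of "x j"] by linarith
    show "\<bar>if i = j then s' (x j) else 0\<bar> \<le> \<bar>B0\<bar> + \<bar>B1\<bar> + \<bar>B2\<bar>" for i and x :: pt
      using b(2)[of "x j"] by (simp split: if_split) linarith
    show "\<bar>if i = j \<and> k = j then s'' (x j) else 0\<bar> \<le> \<bar>B0\<bar> + \<bar>B1\<bar> + \<bar>B2\<bar>" for i k and x :: pt
      using b(3)[of "x j"] by (simp split: if_split) linarith
  qed simp_all
  then show ?thesis by (auto simp: c2b_def)
qed

lemma c2b_bounded_C12:
  assumes c: "c2b d {t0..t1} v" and t: "t0 < t1" and b: "\<And>t x. t \<in> {t0..t1} \<Longrightarrow> x \<in> Rd d \<Longrightarrow> \<bar>v t x\<bar> \<le> b"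
  shows "bounded_C12 d {t0..t1} b v"
proof -
  let ?I = "{t0..t1}"
  obtain vt vx vxx where c: "c2w d ?I v vt vx vxx" using assms by (auto simp: c2b_def)
  obtain M where M: "0 \<le> M" "\<forall>t\<in>?I. \<forall>x\<in>Rd d. \<bar>v t x\<bar> \<le> M \<and> \<bar>vt t x\<bar> \<le> M \<and> (\<forall>i<d. \<bar>vx i t x\<bar> \<le> M \<and> (\<forall>j<d. \<bar>vxx i j t x\<bar> \<le> M))"
    using c2wD(8)[OF c] by blast
  have dt: "((\<lambda>r. v r x) has_real_derivative vt t x) (at t within ?I)" if "t \<in> ?I" "x \<in> Rd d" for t x
    using c2wD(5)[OF c] that by blast
  have dx: "((\<lambda>y. v t (x(i := y))) has_real_derivative vx i t x) (at (x i))" if "i < d" "t \<in> ?I" "x \<in> Rd d" for i t x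
    using c2wD(6)[OF c] that by blast
  have dtv: "dt ?I v t x = vt t x" if "t \<in> ?I" "x \<in> Rd d" for t x
    by (rule dt_eqI[where f=v and x=x, OF t that(1) dt[OF that]])
  have pdv: "pd i (v t) x = vx i t x" if "i < d" "t \<in> ?I" "x \<in> Rd d" for i t x
    by (rule pd_eqI[where f="v t", OF dx[OF that]])
  have dxx: "((\<lambda>y. pd j (v t) (x(i := y))) has_real_derivative vxx i j t x) (at (x i))"
    if "i < d" "j < d" "t \<in> ?I" "x \<in> Rd d" for i j t x
  proof -
    have "(\<lambda>y. pd j (v t) (x(i := y))) = (\<lambda>y. vx j t (x(i := y)))" using pdv that by simp
    moreover have "((\<lambda>y. vx j t (x(i := y))) has_real_derivative vxx i j t x) (at (x i))"
      using c2wD(7)[OF c] that by blast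
    ultimately show ?thesis by simp
  qed
  have pdd: "pd i (pd j (v t)) x = vxx i j t x" if "i < d" "j < d" "t \<in> ?I" "x \<in> Rd d" for i j t x
    by (rule pd_eqI[where f="pd j (v t)", OF dxx[OF that]])
  have cg: "continuous_on (?I \<times> Rd d) (\<lambda>(t, x). f t x)"
    if "continuous_on (?I \<times> Rd d) (\<lambda>p. g (fst p) (snd p))" "\<And>t x. t \<in> ?I \<Longrightarrow> x \<in> Rd d \<Longrightarrow> f t x = g t x" for f g :: tfun
    using that(1) by (subst continuous_on_cong[OF refl, where g="\<lambda>p. g (fst p) (snd p)"]) (auto simp: that(2))
  have C1: "continuous_on (?I \<times> Rd d) (\<lambda>(t, x). v t x)"
    by (rule cg[OF _ refl]) (use c2wD(1)[OF c] in blast)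
  have C2: "continuous_on (?I \<times> Rd d) (\<lambda>(t, x). dt ?I v t x)"
    by (rule cg[OF _ dtv]) (use c2wD(2)[OF c] in blast)
  have C3: "continuous_on (?I \<times> Rd d) (\<lambda>(t, x). pd i (v t) x)" if "i < d" for i
    by (rule cg[OF _ pdv[OF that]]) (use c2wD(3)[OF c] that in blast)
  have C4: "continuous_on (?I \<times> Rd d) (\<lambda>(t, x). pd i (pd j (v t)) x)" if "i < d" "j < d" for i j
    by (rule cg[OF _ pdd[OF that]]) (use c2wD(4)[OF c] that in blast)
  have D1: "(\<lambda>r. v r x) differentiable (at t within ?I)" if "t \<in> ?I" "x \<in> Rd d" for t x
    using dt[OF that] by (auto simp: real_differentiable_def)
  have D2: "pd_exists i (v t) x" if "i < d" "t \<in> ?I" "x \<in> Rd d" for i t x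
    using dx[OF that] by (auto simp: pd_exists_def real_differentiable_def)
  have D3: "pd_exists i (pd j (v t)) x" if "i < d" "j < d" "t \<in> ?I" "x \<in> Rd d" for i j t x
    using dxx[OF that] by (auto simp: pd_exists_def real_differentiable_def)
  have g: "enorm d (grad (v t) x) \<le> real d * M" if "t \<in> ?I" "x \<in> Rd d" for t x
  proof -
    have "enorm d (grad (v t) x) \<le> (\<Sum>i<d. \<bar>grad (v t) x i\<bar>)" by (rule enorm_le_sum)
    also have "\<dots> \<le> (\<Sum>i<d. M)" using M(2) that by (intro sum_mono) (auto simp: grad_def pdv)
    finally show ?thesis by simp
  qed
  show ?thesis
    unfolding bounded_C12_def C12_def
    by (intro conjI ballI allI impI exI[of _ M] exI[of _ "real d * M"] C1 C2 C3 C4 D1 D2 D3 b g)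
       (use M(2) in \<open>auto simp: dtv pdd\<close>)
qed

section \<open>Network classes\<close>

text \<open>The exponents 3 and 2 give the first two derivatives of the cubed ReLU, the second of
  them still continuous. At the kink the difference quotient is at most a positive power of
  |h|.\<close>

lemma relu_power_DERIV:
  "((\<lambda>u. (max u 0) ^ (k + 2)) has_real_derivative real (k + 2) * (max u 0) ^ (k + 1)) (at (u :: real))"
proof (cases u "0 :: real" rule: linorder_cases)
  case less
  have "((\<lambda>_. 0) has_real_derivative 0) (at u)" by simp
  then have "((\<lambda>u. (max u 0) ^ (k + 2)) has_real_derivative 0) (at u)"
    by (rule DERIV_cong_ev[THEN iffD1, rotated -1])
       (use less eventually_nhds_in_open[of "{..<0}" u] in \<open>auto simp: max_def elim: eventually_mono\<close>)
  then show ?thesis using less by (simp add: max_def)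
next
  case equal
  have l: "((\<lambda>h :: real. \<bar>h\<bar> ^ (k + 1)) \<longlongrightarrow> 0) (at 0)"
    by (rule tendsto_eq_intros refl | simp)+
  have "((\<lambda>h :: real. (max (0 + h) 0) ^ (k + 2) / h) \<longlongrightarrow> 0) (at 0)"
  proof (rule Lim_null_comparison[OF always_eventually l], rule allI)
    fix h :: real
    show "norm ((max (0 + h) 0) ^ (k + 2) / h) \<le> \<bar>h\<bar> ^ (k + 1)"
    proof (cases "h \<le> 0")
      case True
      then have "max (0 + h) 0 = 0" by simp
      then have "norm ((max (0 + h) 0) ^ (k + 2) / h) = 0" by simp
      also have "\<dots> \<le> \<bar>h\<bar> ^ (k + 1)" by (intro zero_le_power abs_ge_zero)
      finally show ?thesis .
    next
      case False
      then show ?thesis by (simp add: max_def)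
    qed
  qed
  then show ?thesis using equal by (simp add: DERIV_def)
next
  case greater
  have "((\<lambda>u. u ^ (k + 2)) has_real_derivative real (k + 2) * (max u 0) ^ (k + 1)) (at u)"
    by (rule derivative_eq_intros refl | use greater in \<open>simp add: max_def\<close>)+
  then show ?thesis
    by (rule DERIV_cong_ev[THEN iffD1, rotated -1])
       (use greater eventually_nhds_in_open[of "{0<..}" u] in \<open>auto simp: max_def elim: eventually_mono\<close>)
qed

lemma c2b_cubed_relu:
  assumes "c2b d I v"
  shows "c2b d I (\<lambda>t x. cubed_relu (v t x))"
proof (rule c2b_compose[where s=cubed_relu and s'="\<lambda>u. 3 * (max u 0)\<^sup>2" and s''="\<lambda>u. 6 * max u 0", OF assms])
  fix y :: real
  show "(cubed_relu has_real_derivative 3 * (max y 0)\<^sup>2) (at y)"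
    using relu_power_DERIV[of 1 y] by (simp add: cubed_relu_def[abs_def] numeral_eq_Suc)
  show "((\<lambda>u. 3 * (max u 0)\<^sup>2) has_real_derivative 6 * max y 0) (at y)"
    using DERIV_cmult[OF relu_power_DERIV[of 0 y], of 3] by (simp add: numeral_eq_Suc mult.assoc)
  show "continuous_on UNIV (\<lambda>u :: real. 6 * max u 0)" by (intro continuous_intros)
qed

lemma smooth_realD:
  assumes "smooth_real f"
  shows "(f has_real_derivative deriv f y) (at y)"
    and "(deriv f has_real_derivative deriv (deriv f) y) (at y)"
    and "continuous_on UNIV (deriv (deriv f))"
proof -
  have d: "(deriv ^^ n) f differentiable (at x)" for n x using assms by (simp add: smooth_real_def)
  show "(f has_real_derivative deriv f y) (at y)"
    using d[of 0 y] by (simp add: DERIV_deriv_iff_real_differentiable)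
  show "(deriv f has_real_derivative deriv (deriv f) y) (at y)"
    using d[of 1 y] by (simp add: DERIV_deriv_iff_real_differentiable)
  have "deriv (deriv f) differentiable (at x)" for x using d[of 2 x] by (simp add: numeral_2_eq_2)
  then show "continuous_on UNIV (deriv (deriv f))"
    by (intro continuous_at_imp_continuous_on ballI differentiable_imp_continuous_within)
qed

lemma c2b_layer:
  assumes \<kappa>: "is_clip d R \<kappa>" and n: "n 0 = d + 1"
  shows "i < n j \<Longrightarrow> c2b d {t0..t1} (\<lambda>t x. layer (\<lambda>_. cubed_relu) n A b j (net_input t (clip d \<kappa> x)) i)"
proof (induction j arbitrary: i)
  case 0
  show ?case
  proof (cases i)
    case 0
    then show ?thesis using c2b_time by (simp add: net_input_def)
  next
    case (Suc k)
    then have k: "k < d" using 0 n by simp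
    then have s: "smooth_real (\<kappa> k)" "\<forall>u. \<bar>\<kappa> k u\<bar> \<le> R" "\<forall>u. \<bar>deriv (\<kappa> k) u\<bar> \<le> 1" "\<exists>M. \<forall>u. \<bar>deriv (deriv (\<kappa> k)) u\<bar> \<le> M"
      using \<kappa> by (auto simp: is_clip_def)
    then obtain M where M: "\<forall>u. \<bar>deriv (deriv (\<kappa> k)) u\<bar> \<le> M" by blast
    have "c2b d {t0..t1} (\<lambda>t x. \<kappa> k (x k))"
      by (rule c2b_coord[OF k smooth_realD[OF s(1)]]) (use s M in auto)
    then show ?thesis using k Suc by (simp add: net_input_def clip_def)
  qed
next
  case (Suc j)
  show ?case by (simp, intro c2b_cubed_relu c2b_add c2b_sum c2b_cmult c2b_const Suc.IH)
qed

lemma c2b_net: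
  assumes \<kappa>: "is_clip d R \<kappa>" and \<Theta>: "is_Theta B \<Theta>" and g: "g \<in> NN_cubed d t0 t1 R W L Lam P0 Aa"
  shows "c2b d {t0..t1} (clipped d \<kappa> (\<lambda>t x. \<Theta> (g t x)))"
proof -
  obtain n A b where n: "n 0 = d + 1"
    and ge: "g = (\<lambda>t x. net_out (\<lambda>_. cubed_relu) n A b L (net_input t x))"
    using g unfolding NN_cubed_def NN_def by blast
  have c: "c2b d {t0..t1} (\<lambda>t x. net_out (\<lambda>_. cubed_relu) n A b L (net_input t (clip d \<kappa> x)))"
    unfolding net_out_def
    by (intro c2b_add c2b_sum c2b_cmult c2b_const)
       (rule c2b_layer[where n=n and \<kappa>=\<kappa> and d=d and R=R, OF \<kappa> n])
  have "smooth_real \<Theta>" using \<Theta> by (simp add: is_Theta_def)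
  from c2b_compose[OF c smooth_realD[OF this]] show ?thesis
    unfolding clipped_def ge .
qed

lemma Theta_bound: "is_Theta B \<Theta> \<Longrightarrow> \<bar>\<Theta> u\<bar> \<le> 3 * B" "is_Theta B \<Theta> \<Longrightarrow> 0 \<le> B"
proof -
  assume "is_Theta B \<Theta>"
  then have "\<Theta> u \<in> {- 2 * B .. 3 * B}" unfolding is_Theta_def by blast
  then show "\<bar>\<Theta> u\<bar> \<le> 3 * B" "0 \<le> B" by auto
qed

section \<open>Two networks in parallel\<close>

lemma sum_lessThan_add:
  fixes f :: "nat \<Rightarrow> real"
  shows "(\<Sum>k<a + b. f k) = (\<Sum>k<a. f k) + (\<Sum>k<b. f (a + k))"
  by (induction b) (simp_all add: add.assoc)

text \<open>Two networks of the same depth run side by side on the same input; a final hidden layer of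
  width two applies \<open>\<Theta>\<close> to each of the two outputs, and the output layer subtracts.\<close>

lemma NN_parallel:
  assumes g: "g \<in> NN_cubed d t0 t1 R W L Lam P0 Aa" and g': "g' \<in> NN_cubed d t0 t1 R W L Lam P0 Aa"
    and \<Theta>: "is_Theta B \<Theta>" and Lam: "1 \<le> Lam" and W: "1 \<le> W"
  shows "(\<lambda>t x. \<Theta> (g t x) - \<Theta> (g' t x))
    \<in> NN_cubed_last d t0 t1 R \<Theta> (2 * W) (L + 1) Lam (2 * P0 + 2) (max Aa (3 * B))"
proof -
  let ?c = "\<lambda>_. cubed_relu" and ?act = "\<lambda>j. if j = L + 1 then \<Theta> else cubed_relu"
  obtain n A b where n0: "n 0 = d + 1" and nL: "n (L + 1) = 1" and nW: "\<forall>j\<in>{1..L}. 1 \<le> n j \<and> n j \<le> W"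
    and par: "\<forall>j\<le>L. \<forall>i<n (j + 1). \<bar>b j i\<bar> \<le> Lam \<and> (\<forall>k<n j. \<bar>A j i k\<bar> \<le> Lam)"
    and cnt: "card {(j, i, k). j \<le> L \<and> i < n (j + 1) \<and> k < n j \<and> A j i k \<noteq> 0}
          + card {(j, i). j \<le> L \<and> i < n (j + 1) \<and> b j i \<noteq> 0} \<le> P0"
    and lay: "\<forall>t\<in>{t0..t1}. \<forall>x\<in>Rd d. (\<forall>i<d. \<bar>x i\<bar> \<le> R) \<longrightarrow>
           (\<forall>j\<in>{1..L}. \<forall>i<n j. \<bar>layer ?c n A b j (net_input t x) i\<bar> \<le> Aa)"
    and ge: "g = (\<lambda>t x. net_out ?c n A b L (net_input t x))"
    using g unfolding NN_cubed_def NN_def mem_Collect_eq by - (elim exE conjE, rule that, assumption+)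
  obtain n' A' b' where n0': "n' 0 = d + 1" and nL': "n' (L + 1) = 1" and nW': "\<forall>j\<in>{1..L}. 1 \<le> n' j \<and> n' j \<le> W"
    and par': "\<forall>j\<le>L. \<forall>i<n' (j + 1). \<bar>b' j i\<bar> \<le> Lam \<and> (\<forall>k<n' j. \<bar>A' j i k\<bar> \<le> Lam)"
    and cnt': "card {(j, i, k). j \<le> L \<and> i < n' (j + 1) \<and> k < n' j \<and> A' j i k \<noteq> 0}
          + card {(j, i). j \<le> L \<and> i < n' (j + 1) \<and> b' j i \<noteq> 0} \<le> P0"
    and lay': "\<forall>t\<in>{t0..t1}. \<forall>x\<in>Rd d. (\<forall>i<d. \<bar>x i\<bar> \<le> R) \<longrightarrow>
           (\<forall>j\<in>{1..L}. \<forall>i<n' j. \<bar>layer ?c n' A' b' j (net_input t x) i\<bar> \<le> Aa)"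
    and ge': "g' = (\<lambda>t x. net_out ?c n' A' b' L (net_input t x))"
    using g' unfolding NN_cubed_def NN_def mem_Collect_eq by - (elim exE conjE, rule that, assumption+)
  \<comment> \<open>The input layer is shared, so its width stays d + 1. Layer L + 1, where each
    network has its single output, is now a hidden layer of width 2, followed by one new
    output.\<close>
  define m where "m j = (if j = 0 then d + 1 else if j \<le> L + 1 then n j + n' j else 1)" for j
  \<comment> \<open>Block diagonal between hidden layers, but stacked at the first layer, where both
    networks read the same input. The new output row is 1, -1.\<close>
  define AA where "AA j i k = (if j = L + 1 then (if k = 0 then 1 else - 1)
      else if i < n (j + 1) then (if j = 0 \<or> k < n j then A j i k else 0)
      else (if j = 0 then A' j (i - n (j + 1)) k else if k < n j then 0 else A' j (i - n (j + 1)) (k - n j)))" for j i k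
  define bb where "bb j i = (if j = L + 1 then 0 else if i < n (j + 1) then b j i else b' j (i - n (j + 1)))" for j i
  let ?l = "layer ?act m AA bb" and ?l1 = "layer ?c n A b" and ?l2 = "layer ?c n' A' b'"
  define P where "P j z i = (\<Sum>k<m j. AA j i k * ?l j z k) + bb j i" for j z i
  define P1 where "P1 j z i = (\<Sum>k<n j. A j i k * ?l1 j z k) + b j i" for j z i
  define P2 where "P2 j z i = (\<Sum>k<n' j. A' j i k * ?l2 j z k) + b' j i" for j z i
  have pre: "P j z i = (if i < n (j + 1) then P1 j z i else P2 j z (i - n (j + 1)))"
    if j: "j \<le> L" and IH: "j = 0 \<or> (\<forall>i. ?l j z i = (if i < n j then ?l1 j z i else ?l2 j z (i - n j)))"
    for j z i
  proof (cases "j = 0")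
    case True
    then show ?thesis by (simp add: P_def P1_def P2_def m_def AA_def bb_def n0 n0')
  next
    case False
    then have l: "?l j z k = (if k < n j then ?l1 j z k else ?l2 j z (k - n j))" for k using IH by blast
    have "P j z i = (\<Sum>k<n j. AA j i k * ?l j z k) + (\<Sum>k<n' j. AA j i (n j + k) * ?l j z (n j + k)) + bb j i"
      using False j by (simp add: P_def m_def sum_lessThan_add)
    moreover have "(\<Sum>k<n j. AA j i k * ?l j z k) = (\<Sum>k<n j. AA j i k * ?l1 j z k)"
      by (rule sum.cong[OF refl], subst l) simp
    moreover have "(\<Sum>k<n' j. AA j i (n j + k) * ?l j z (n j + k)) = (\<Sum>k<n' j. AA j i (n j + k) * ?l2 j z k)"
      by (rule sum.cong[OF refl], subst l) simp
    ultimately show ?thesis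
      unfolding P1_def P2_def using False j by (simp add: AA_def bb_def)
  qed
  have lS: "?l (Suc j) z i = ?act (Suc j) (P j z i)" "?l1 (Suc j) z i = cubed_relu (P1 j z i)"
    "?l2 (Suc j) z i = cubed_relu (P2 j z i)" for j z i
    by (simp_all add: P_def P1_def P2_def)
  \<comment> \<open>Stated from layer 1 on: at layer 0 the values are the common input and not two
    blocks.\<close>
  have hid: "\<forall>i. ?l (Suc j) z i = (if i < n (Suc j) then ?l1 (Suc j) z i else ?l2 (Suc j) z (i - n (Suc j)))"
    if "Suc j \<le> L" for j z
    using that
  proof (induction j)
    case 0
    show ?case
    proof
      fix i
      show "?l (Suc 0) z i = (if i < n (Suc 0) then ?l1 (Suc 0) z i else ?l2 (Suc 0) z (i - n (Suc 0)))"
        unfolding lS using pre[of 0 z i] 0 by simp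
    qed
  next
    case (Suc j)
    show ?case
    proof
      fix i
      show "?l (Suc (Suc j)) z i = (if i < n (Suc (Suc j)) then ?l1 (Suc (Suc j)) z i else ?l2 (Suc (Suc j)) z (i - n (Suc (Suc j))))"
        unfolding lS(1)[of "Suc j"] lS(2)[of "Suc j"] lS(3)[of "Suc j"]
        using pre[of "Suc j" z i] Suc by simp
    qed
  qed
  have preL: "P L z i = (if i < n (L + 1) then P1 L z i else P2 L z (i - n (L + 1)))" for z i
  proof (rule pre[OF order_refl])
    show "L = 0 \<or> (\<forall>i. ?l L z i = (if i < n L then ?l1 L z i else ?l2 L z (i - n L)))"
      using hid[of "L - 1" z] by (cases L) auto
  qed
  have top: "?l (L + 1) z 0 = \<Theta> (P1 L z 0)" "?l (L + 1) z 1 = \<Theta> (P2 L z 0)" for z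
    using lS(1)[of L z 0] lS(1)[of L z 1] preL[of z 0] preL[of z 1] nL by simp_all
  have m2: "m (L + 1) = 2" using nL nL' by (simp add: m_def)
  have out: "net_out ?act m AA bb (L + 1) z = \<Theta> (P1 L z 0) - \<Theta> (P2 L z 0)" for z
    unfolding net_out_def m2 using top[of z] by (simp add: numeral_2_eq_2 AA_def bb_def)
  have gP: "g t x = P1 L (net_input t x) 0" "g' t x = P2 L (net_input t x) 0" for t x
    by (simp_all add: ge ge' net_out_def P1_def P2_def)
  let ?S = "{(j, i, k). j \<le> L \<and> i < n (j + 1) \<and> k < n j \<and> A j i k \<noteq> 0}"
  let ?S' = "{(j, i, k). j \<le> L \<and> i < n' (j + 1) \<and> k < n' j \<and> A' j i k \<noteq> 0}"
  let ?T = "{(j, i). j \<le> L \<and> i < n (j + 1) \<and> b j i \<noteq> 0}"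
  let ?T' = "{(j, i). j \<le> L \<and> i < n' (j + 1) \<and> b' j i \<noteq> 0}"
  let ?f = "\<lambda>(j, i, k). (j, i + n (j + 1), if j = 0 then k else k + n j)"
  let ?h = "\<lambda>(j, i). (j, i + n (j + 1))"
  have fin: "finite {(j, i, k). j \<le> L \<and> i < n (j + 1) \<and> k < n j \<and> A j i k \<noteq> 0}" for n :: "nat \<Rightarrow> nat" and A :: "nat \<Rightarrow> nat \<Rightarrow> nat \<Rightarrow> real"
    by (rule finite_subset[of _ "SIGMA j:{..L}. {..<n (j + 1)} \<times> {..<n j}"]) auto
  have finT: "finite {(j, i). j \<le> L \<and> i < n (j + 1) \<and> b j i \<noteq> 0}" for n :: "nat \<Rightarrow> nat" and b :: "nat \<Rightarrow> nat \<Rightarrow> real"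
    by (rule finite_subset[of _ "SIGMA j:{..L}. {..<n (j + 1)}"]) auto
  \<comment> \<open>A nonzero weight belongs to the first network, is a shifted weight of the
    second, or is one of the two output weights; the latter are the 2 in the budget 2 * P0 + 2. The
    shift leaves the input index alone at the first layer.\<close>
  have c1: "card {(j, i, k). j \<le> L + 1 \<and> i < m (j + 1) \<and> k < m j \<and> AA j i k \<noteq> 0} \<le> card ?S + card ?S' + 2"
  proof -
    have "{(j, i, k). j \<le> L + 1 \<and> i < m (j + 1) \<and> k < m j \<and> AA j i k \<noteq> 0}
        \<subseteq> (?S \<union> ?f ` ?S') \<union> {(L + 1, 0, 0), (L + 1, 0, 1)}"
    proof (rule subsetI, rule ccontr)
      fix p assume p: "p \<in> {(j, i, k). j \<le> L + 1 \<and> i < m (j + 1) \<and> k < m j \<and> AA j i k \<noteq> 0}"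
        and np: "p \<notin> (?S \<union> ?f ` ?S') \<union> {(L + 1, 0, 0), (L + 1, 0, 1)}"
      obtain j i k where pe: "p = (j, i, k)" by (cases p)
      have a: "j \<le> L + 1" "i < m (j + 1)" "k < m j" "AA j i k \<noteq> 0" using p pe by auto
      have no: "(j, i, k) \<notin> {(L + 1, 0, 0), (L + 1, 0, 1)}" "(j, i, k) \<notin> ?f ` ?S'" using np pe by blast+
      have "j \<noteq> L + 1"
      proof
        assume j: "j = L + 1"
        then have "i = 0" "k < 2" using a(2,3) m2 by (auto simp: m_def)
        then show False using no(1) j by (auto simp: less_2_cases_iff)
      qed
      then have j: "j \<le> L" using a(1) by simp
      have i: "i < n (j + 1) + n' (j + 1)" using a(2) j by (simp add: m_def)
      have "i < n (j + 1)"
      proof (rule ccontr)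
        assume ni: "\<not> i < n (j + 1)"
        show False
        proof (cases "j = 0")
          case True
          have "(j, i - n (j + 1), k) \<in> ?S'"
            using a(3,4) ni i j True n0' by (auto simp: AA_def m_def)
          moreover have "(j, i, k) = ?f (j, i - n (j + 1), k)" using ni True by simp
          ultimately show False using no(2) by blast
        next
          case False
          then have kn: "\<not> k < n j" "A' j (i - n (j + 1)) (k - n j) \<noteq> 0"
            using a(4) ni j by (auto simp: AA_def split: if_splits)
          moreover have "k < n j + n' j" using a(3) j False by (simp add: m_def)
          ultimately have "(j, i - n (j + 1), k - n j) \<in> ?S'" using ni i j by auto
          moreover have "(j, i, k) = ?f (j, i - n (j + 1), k - n j)" using ni False kn by simp
          ultimately show False using no(2) by blast
        qed
      qed
      then have "j \<le> L \<and> i < n (j + 1) \<and> k < n j \<and> A j i k \<noteq> 0"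
        using a(3,4) j n0 by (auto simp: AA_def m_def split: if_splits)
      then show False using np pe by simp
    qed
    then have "card {(j, i, k). j \<le> L + 1 \<and> i < m (j + 1) \<and> k < m j \<and> AA j i k \<noteq> 0}
        \<le> card ((?S \<union> ?f ` ?S') \<union> {(L + 1, 0, 0), (L + 1, 0, 1)})"
      by (intro card_mono finite_UnI finite_imageI fin) auto
    also have "\<dots> \<le> card (?S \<union> ?f ` ?S') + card {(L + 1, 0 :: nat, 0 :: nat), (L + 1, 0, 1)}" by (rule card_Un_le)
    also have "\<dots> \<le> (card ?S + card (?f ` ?S')) + 2" by (intro add_mono card_Un_le) simp
    also have "\<dots> \<le> (card ?S + card ?S') + 2" using card_image_le[OF fin[of n' A'], of ?f] by simp
    finally show ?thesis .
  qed
  have c2: "card {(j, i). j \<le> L + 1 \<and> i < m (j + 1) \<and> bb j i \<noteq> 0} \<le> card ?T + card ?T'"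
  proof -
    have "{(j, i). j \<le> L + 1 \<and> i < m (j + 1) \<and> bb j i \<noteq> 0} \<subseteq> ?T \<union> ?h ` ?T'"
    proof (rule subsetI, rule ccontr)
      fix p assume p: "p \<in> {(j, i). j \<le> L + 1 \<and> i < m (j + 1) \<and> bb j i \<noteq> 0}" and np: "p \<notin> ?T \<union> ?h ` ?T'"
      obtain j i where pe: "p = (j, i)" by (cases p)
      have a: "j \<le> L + 1" "i < m (j + 1)" "bb j i \<noteq> 0" using p pe by auto
      have no: "(j, i) \<notin> ?h ` ?T'" using np pe by blast
      have j: "j \<le> L" using a(1,3) by (auto simp: bb_def le_Suc_eq)
      have i: "i < n (j + 1) + n' (j + 1)" using a(2) j by (simp add: m_def)
      have "i < n (j + 1)"
      proof (rule ccontr)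
        assume ni: "\<not> i < n (j + 1)"
        then have "(j, i - n (j + 1)) \<in> ?T'" using a(3) i j by (auto simp: bb_def)
        moreover have "(j, i) = ?h (j, i - n (j + 1))" using ni by simp
        ultimately show False using no by blast
      qed
      then have "j \<le> L \<and> i < n (j + 1) \<and> b j i \<noteq> 0" using a(3) j by (auto simp: bb_def)
      then show False using np pe by simp
    qed
    then have "card {(j, i). j \<le> L + 1 \<and> i < m (j + 1) \<and> bb j i \<noteq> 0} \<le> card (?T \<union> ?h ` ?T')"
      by (intro card_mono finite_UnI finite_imageI finT)
    also have "\<dots> \<le> card ?T + card (?h ` ?T')" by (rule card_Un_le)
    also have "\<dots> \<le> card ?T + card ?T'" using card_image_le[OF finT[of n' b'], of ?h] by simp
    finally show ?thesis .
  qed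
  show ?thesis
    unfolding NN_cubed_last_def NN_def mem_Collect_eq
  proof (rule exI[of _ m], rule exI[of _ AA], rule exI[of _ bb], intro conjI)
    show "m 0 = d + 1" "m (L + 1 + 1) = 1" by (simp_all add: m_def)
    show "\<forall>j\<in>{1..L + 1}. 1 \<le> m j \<and> m j \<le> 2 * W"
    proof
      fix j assume j: "j \<in> {1..L + 1}"
      show "1 \<le> m j \<and> m j \<le> 2 * W"
      proof (cases "j = L + 1")
        case True then show ?thesis using m2 W by simp
      next
        case False
        then have "j \<in> {1..L}" using j by auto
        then have "1 \<le> n j \<and> n j \<le> W" "1 \<le> n' j \<and> n' j \<le> W" using nW nW' by auto
        then show ?thesis using j by (auto simp: m_def)
      qed
    qed
    show "\<forall>j\<le>L + 1. \<forall>i<m (j + 1). \<bar>bb j i\<bar> \<le> Lam \<and> (\<forall>k<m j. \<bar>AA j i k\<bar> \<le> Lam)"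
    proof (intro allI impI)
      fix j i assume j: "j \<le> L + 1" and i: "i < m (j + 1)"
      show "\<bar>bb j i\<bar> \<le> Lam \<and> (\<forall>k<m j. \<bar>AA j i k\<bar> \<le> Lam)"
      proof (cases "j = L + 1")
        \<comment> \<open>The output weights 1 and -1 fit the parameter bound because it is at least
          1.\<close>
        case True then show ?thesis using Lam by (simp add: bb_def AA_def)
      next
        case False
        then have j: "j \<le> L" using j by simp
        have i: "i < n (j + 1) + n' (j + 1)" using i j by (simp add: m_def)
        show ?thesis
        proof (cases "i < n (j + 1)")
          case True
          then have p: "\<bar>b j i\<bar> \<le> Lam" "\<forall>k<n j. \<bar>A j i k\<bar> \<le> Lam" using par j by auto
          then show ?thesis using True j Lam n0 by (auto simp: bb_def AA_def m_def)
        next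
          case False
          then have "i - n (j + 1) < n' (j + 1)" using i by simp
          then have p: "\<bar>b' j (i - n (j + 1))\<bar> \<le> Lam" "\<forall>k<n' j. \<bar>A' j (i - n (j + 1)) k\<bar> \<le> Lam" using par' j by auto
          then show ?thesis using False j Lam n0' by (auto simp: bb_def AA_def m_def)
        qed
      qed
    qed
    show "card {(j, i, k). j \<le> L + 1 \<and> i < m (j + 1) \<and> k < m j \<and> AA j i k \<noteq> 0}
        + card {(j, i). j \<le> L + 1 \<and> i < m (j + 1) \<and> bb j i \<noteq> 0} \<le> 2 * P0 + 2"
      using c1 c2 cnt cnt' by linarith
    show "\<forall>t\<in>{t0..t1}. \<forall>x\<in>Rd d. (\<forall>i<d. \<bar>x i\<bar> \<le> R) \<longrightarrow>
           (\<forall>j\<in>{1..L + 1}. \<forall>i<m j. \<bar>?l j (net_input t x) i\<bar> \<le> max Aa (3 * B))"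
    proof (intro ballI impI allI)
      fix t x j i assume t: "t \<in> {t0..t1}" and x: "x \<in> Rd d" "\<forall>i<d. \<bar>x i\<bar> \<le> R" and j: "j \<in> {1..L + 1}" and i: "i < m j"
      show "\<bar>?l j (net_input t x) i\<bar> \<le> max Aa (3 * B)"
      proof (cases "j = L + 1")
        \<comment> \<open>The new hidden layer consists of values of \<Theta>, which accounts for 3
          * B in the activation budget.\<close>
        case True
        then show ?thesis using lS(1)[of L] Theta_bound(1)[OF \<Theta>] by (simp add: le_max_iff_disj)
      next
        case False
        then have jL: "j \<in> {1..L}" using j by auto
        then obtain j' where j': "j = Suc j'" "Suc j' \<le> L" by (cases j) auto
        have i: "i < n j + n' j" using i jL by (auto simp: m_def)
        have l: "?l j (net_input t x) i
            = (if i < n j then ?l1 j (net_input t x) i else ?l2 j (net_input t x) (i - n j))"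
          unfolding j'(1) by (rule hid[OF j'(2), THEN spec])
        have "\<bar>?l j (net_input t x) i\<bar> \<le> Aa"
        proof (cases "i < n j")
          case True
          show ?thesis
            unfolding l if_P[OF True]
            by (rule lay[THEN bspec, OF t, THEN bspec, OF x(1), THEN mp, OF x(2), THEN bspec, OF jL, THEN spec, THEN mp, OF True])
        next
          case False
          then have i': "i - n j < n' j" using i by simp
          show ?thesis
            unfolding l if_not_P[OF False]
            by (rule lay'[THEN bspec, OF t, THEN bspec, OF x(1), THEN mp, OF x(2), THEN bspec, OF jL, THEN spec, THEN mp, OF i'])
        qed
        then show ?thesis by simp
      qed
    qed
    show "(\<lambda>t x. \<Theta> (g t x) - \<Theta> (g' t x)) = (\<lambda>t x. net_out ?act m AA bb (L + 1) (net_input t x))"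
      unfolding out gP ..
  qed
qed

section \<open>Regularity and cone representation for the concrete class\<close>

lemma H_net_props:
  assumes \<kappa>: "is_clip d R \<kappa>" and \<Theta>: "is_Theta Bbar \<Theta>" and t: "t0 < t1"
    and h: "h \<in> H_net d T Bbar t0 t1 R \<Theta> \<kappa> Ct W L Lam P0 Aa"
  shows "bounded_C12 d {t0..t1} (3 * Bbar) h" and "c2b d {t0..t1} h"
proof -
  obtain g where g: "g \<in> NN_cubed d t0 t1 R W L Lam P0 Aa" "agree d t0 t1 h (clipped d \<kappa> (\<lambda>t x. \<Theta> (g t x)))"
    using h unfolding H_net_def by blast
  show c: "c2b d {t0..t1} h"
    by (rule c2b_cong[OF c2b_net[OF \<kappa> \<Theta> g(1)]]) (use g(2) in \<open>auto simp: agree_def\<close>)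
  show "bounded_C12 d {t0..t1} (3 * Bbar) h"
    by (rule c2b_bounded_C12[OF c t]) (use g(2) Theta_bound(1)[OF \<Theta>] in \<open>auto simp: agree_def clipped_def\<close>)
qed

text \<open>The parallel network represents the difference with coefficient 1, hence scale at most
  1. By the triangle inequality its values, gradient and time derivative are at most 6 Bbar, 2 G and
  2 G_t, which are the first three summands of \<Gamma>. On the window it coincides with h - h', so
  its derivatives are read off from those of h and h'.\<close>

lemma H_net_wdiff:
  assumes \<kappa>: "is_clip d R \<kappa>" and \<Theta>: "is_Theta Bbar \<Theta>" and t: "t0 < t1" and Lam: "1 \<le> Lam" and W: "1 \<le> W"
    and h: "h \<in> H_net d T Bbar t0 t1 R \<Theta> \<kappa> Ct W L Lam P0 Aa"
    and h': "h' \<in> H_net d T Bbar t0 t1 R \<Theta> \<kappa> Ct W L Lam P0 Aa"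
  shows "cone_rep d T Bbar t0 t1 R \<Theta> \<kappa> Ct W L Lam P0 Aa 1 (wdiff t0 t1 h h')"
proof -
  let ?I = "{t0..t1}"
  obtain g where g: "g \<in> NN_cubed d t0 t1 R W L Lam P0 Aa" "agree d t0 t1 h (clipped d \<kappa> (\<lambda>t x. \<Theta> (g t x)))"
    and hb: "\<forall>t\<in>?I. \<forall>x\<in>Rd d. enorm d (grad (h t) x) \<le> G_bd d T Bbar t1 \<and> \<bar>dt ?I h t x\<bar> \<le> Gt_bd d T Bbar t1 R Ct"
    using h unfolding H_net_def by blast
  obtain g' where g': "g' \<in> NN_cubed d t0 t1 R W L Lam P0 Aa" "agree d t0 t1 h' (clipped d \<kappa> (\<lambda>t x. \<Theta> (g' t x)))"
    and hb': "\<forall>t\<in>?I. \<forall>x\<in>Rd d. enorm d (grad (h' t) x) \<le> G_bd d T Bbar t1 \<and> \<bar>dt ?I h' t x\<bar> \<le> Gt_bd d T Bbar t1 R Ct"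
    using h' unfolding H_net_def by blast
  define \<phi> where "\<phi> = (\<lambda>t x. \<Theta> (g t x) - \<Theta> (g' t x))"
  have eq: "clipped d \<kappa> \<phi> t x = h t x - h' t x" if "t \<in> ?I" "x \<in> Rd d" for t x
    using g(2) g'(2) that by (auto simp: agree_def clipped_def \<phi>_def)
  obtain vt vx vxx where c: "c2w d ?I h vt vx vxx" using H_net_props(2)[OF \<kappa> \<Theta> t h] by (auto simp: c2b_def)
  obtain vt' vx' vxx' where c': "c2w d ?I h' vt' vx' vxx'" using H_net_props(2)[OF \<kappa> \<Theta> t h'] by (auto simp: c2b_def)
  have B: "0 \<le> Bbar" by (rule Theta_bound(2)[OF \<Theta>])
  show ?thesis
    unfolding cone_rep_def
  proof (rule bexI[of _ \<phi>], intro conjI ballI)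
    show "\<phi> \<in> NN_cubed_last d t0 t1 R \<Theta> (2 * W) (L + 1) Lam (2 * P0 + 2) (max Aa (3 * Bbar))"
      unfolding \<phi>_def by (rule NN_parallel[OF g(1) g'(1) \<Theta> Lam W])
    show "agree d t0 t1 (wdiff t0 t1 h h') (\<lambda>t x. 1 * omega t0 t1 t * clipped d \<kappa> \<phi> t x)"
      by (auto simp: agree_def wdiff_def eq)
    fix s x assume s: "s \<in> ?I" and x: "x \<in> Rd d"
    have d1: "((\<lambda>r. h r x) has_real_derivative vt s x) (at s within ?I)" "((\<lambda>r. h' r x) has_real_derivative vt' s x) (at s within ?I)"
      using c2wD(5)[OF c] c2wD(5)[OF c'] s x by blast+
    have "((\<lambda>r. clipped d \<kappa> \<phi> r x) has_real_derivative vt s x - vt' s x) (at s within ?I)"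
      by (rule has_field_derivative_transform_within[OF DERIV_diff[OF d1], where d=1]) (use s x eq in auto)
    then have "dt ?I (clipped d \<kappa> \<phi>) s x = vt s x - vt' s x"
      by (rule dt_eqI[where f="clipped d \<kappa> \<phi>" and x=x, OF t s])
    moreover have "dt ?I h s x = vt s x" "dt ?I h' s x = vt' s x"
      using dt_eqI[where f=h and x=x, OF t s d1(1)] dt_eqI[where f=h' and x=x, OF t s d1(2)] by auto
    ultimately have D: "\<bar>dt ?I (clipped d \<kappa> \<phi>) s x\<bar> \<le> 2 * Gt_bd d T Bbar t1 R Ct"
      using hb[rule_format, OF s x] hb'[rule_format, OF s x] by linarith
    have gd: "grad (clipped d \<kappa> \<phi> s) x i = grad (h s) x i + - grad (h' s) x i" if i: "i < d" for i
    proof -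
      have dx: "((\<lambda>y. h s (x(i := y))) has_real_derivative vx i s x) (at (x i))"
        "((\<lambda>y. h' s (x(i := y))) has_real_derivative vx' i s x) (at (x i))"
        using c2wD(6)[OF c] c2wD(6)[OF c'] s x i by blast+
      have "(\<lambda>y. clipped d \<kappa> \<phi> s (x(i := y))) = (\<lambda>y. h s (x(i := y)) - h' s (x(i := y)))"
        using eq s x i by simp
      then have "((\<lambda>y. clipped d \<kappa> \<phi> s (x(i := y))) has_real_derivative vx i s x - vx' i s x) (at (x i))"
        using DERIV_diff[OF dx] by simp
      from pd_eqI[where f="clipped d \<kappa> \<phi> s", OF this] pd_eqI[where f="h s", OF dx(1)] pd_eqI[where f="h' s", OF dx(2)]
      show ?thesis by (simp add: grad_def)
    qed
    have "enorm d (grad (clipped d \<kappa> \<phi> s) x) = enorm d (\<lambda>i. grad (h s) x i + - grad (h' s) x i)"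
      unfolding enorm_def by (rule L2_set_cong) (auto simp: gd)
    also have "\<dots> \<le> enorm d (grad (h s) x) + enorm d (\<lambda>i. - grad (h' s) x i)" by (rule enorm_triangle)
    also have "enorm d (\<lambda>i. - grad (h' s) x i) = enorm d (grad (h' s) x)" by (simp add: enorm_def L2_set_def)
    finally have G: "enorm d (grad (clipped d \<kappa> \<phi> s) x) \<le> 2 * G_bd d T Bbar t1"
      using hb[rule_format, OF s x] hb'[rule_format, OF s x] by linarith
    have "\<bar>clipped d \<kappa> \<phi> s x\<bar> \<le> 6 * Bbar"
      using Theta_bound(1)[OF \<Theta>, of "g s (clip d \<kappa> x)"] Theta_bound(1)[OF \<Theta>, of "g' s (clip d \<kappa> x)"]
      unfolding clipped_def \<phi>_def by linarith
    moreover have "0 \<le> 6 * Bbar / (t1 - t0)" using B t by simp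
    ultimately show "\<bar>clipped d \<kappa> \<phi> s x\<bar> + enorm d (grad (clipped d \<kappa> \<phi> s) x) + \<bar>dt ?I (clipped d \<kappa> \<phi>) s x\<bar>
        \<le> Gamma_bd d T Bbar t0 t1 R Ct"
      using D G unfolding Gamma_bd_def by linarith
  qed
qed

theorem theorem4p1:
  shows "\<exists>C::real. C > 0 \<and>
    (\<forall>(d::nat) (T::real) (p0::pt measure) (w::pt \<Rightarrow> real) (Bbar::real) (s::ereal) (t0::real) (t1::real).
      setting d T p0 w Bbar s t0 t1 \<longrightarrow>
      (\<forall>(H::tfun set) (\<Psi>::tfun set) (scl::tfun \<Rightarrow> real) (C0::real) (hN::tfun) (eN::real).
         scaled_class d p0 T t0 t1 \<Psi> scl \<longrightarrow>
         (\<forall>h\<in>H. \<forall>h'\<in>H. wdiff t0 t1 h h' \<in> \<Psi>) \<longrightarrow>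
         (\<forall>h\<in>H. bounded_C12 d {t0..t1} (3 * Bbar) h) \<longrightarrow>
         (\<forall>h\<in>H. \<forall>h'\<in>H. scl (wdiff t0 t1 h h') \<le> C0) \<longrightarrow>
         hN \<in> H \<longrightarrow> 0 < eN \<longrightarrow> approx_err d p0 w T t0 t1 hN \<le> ennreal eN \<longrightarrow>
         (\<forall>h\<in>H. \<forall>\<tau>\<ge>0. \<forall>\<delta>. 0 < \<delta> \<longrightarrow> \<delta> < 1 \<longrightarrow>
            (\<integral>\<^sup>+t\<in>{t0 .. t1 - \<delta> * (t1 - t0)}.
               (\<integral>\<^sup>+x. ennreal ((enorm d (grad (\<lambda>y. h t y - hstar d p0 w T t y) x))\<^sup>2)
                  \<partial>rho d p0 T t) \<partial>nu t0 t1)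
            \<le> ennreal (C / \<delta>) *
               (ennreal ((1 + (t1 - t0)) / (t1 - t0)) * D_fun d p0 w T t0 t1 h
                + (N_fun d p0 T t0 t1 \<Psi> scl \<tau> h)\<^sup>2
                + ennreal (C0\<^sup>2 * \<tau>\<^sup>2)
                + (1 + (Lambda_star d p0 T t0 t1)\<^sup>2 + ennreal (1 / (t1 - t0)\<^sup>2)) * ennreal (eN\<^sup>2))))
      \<and>
      (\<forall>(R::real) (\<Theta>::real \<Rightarrow> real) (\<kappa>::nat \<Rightarrow> real \<Rightarrow> real) (Ct::real) (N::nat) (K::nat)
         (c1::real) (c2::real) (W::nat) (L::nat) (Lam::real) (P0::nat) (Aa::real).
         R > 1 \<longrightarrow> is_Theta Bbar \<Theta> \<longrightarrow> is_clip d R \<kappa> \<longrightarrow> Ct > 0 \<longrightarrow>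
         N \<ge> 1 \<longrightarrow> K \<ge> 1 \<longrightarrow> c1 > 0 \<longrightarrow>
         c1 * (real K * real N ^ d) \<le> real W \<longrightarrow> real W \<le> c2 * (real K * real N ^ d) \<longrightarrow>
         W \<ge> d + 1 \<longrightarrow> Lam \<ge> 1 \<longrightarrow> Aa \<ge> 1 \<longrightarrow>
         (\<forall>h\<in>H_net d T Bbar t0 t1 R \<Theta> \<kappa> Ct W L Lam P0 Aa.
            bounded_C12 d {t0..t1} (3 * Bbar) h) \<and>
         (\<forall>h\<in>H_net d T Bbar t0 t1 R \<Theta> \<kappa> Ct W L Lam P0 Aa.
          \<forall>h'\<in>H_net d T Bbar t0 t1 R \<Theta> \<kappa> Ct W L Lam P0 Aa.
            wdiff t0 t1 h h' \<in> Psi_net d T Bbar t0 t1 R \<Theta> \<kappa> Ct W L Lam P0 Aa \<and>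
            cone_scale d T Bbar t0 t1 R \<Theta> \<kappa> Ct W L Lam P0 Aa (wdiff t0 t1 h h') \<le> 1)))"
\<comment> \<open>The constant of \<open>final_arith\<close>, fixed before the dimension and all
  other data are introduced.\<close>
proof (intro exI[of _ 26] conjI allI impI)
  show "(0 :: real) < 26" by simp
next
  fix d T p0 w Bbar s t0 t1
  assume S: "setting d T p0 w Bbar s t0 t1"
  note win = setting_ou_window(1)[OF S] and wt = setting_ou_window(2)[OF S]
  {
    fix H \<Psi> scl C0 hN eN
    assume sc: "scaled_class d p0 T t0 t1 \<Psi> scl"
      and cl: "\<forall>h\<in>H. \<forall>h'\<in>H. wdiff t0 t1 h h' \<in> \<Psi>"
      and b: "\<forall>h\<in>H. bounded_C12 d {t0..t1} (3 * Bbar) h"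
      and C0: "\<forall>h\<in>H. \<forall>h'\<in>H. scl (wdiff t0 t1 h h') \<le> C0"
      and hN: "hN \<in> H" and e: "0 < eN" "approx_err d p0 w T t0 t1 hN \<le> ennreal eN"
    have V: "\<psi> \<in> V_space d p0 T t0 t1" "0 \<le> scl \<psi>" if "\<psi> \<in> \<Psi>" for \<psi>
      using sc that unfolding scaled_class_def by auto
    show "\<forall>h\<in>H. \<forall>\<tau>\<ge>0. \<forall>\<delta>. 0 < \<delta> \<longrightarrow> \<delta> < 1 \<longrightarrow>
            (\<integral>\<^sup>+t\<in>{t0 .. t1 - \<delta> * (t1 - t0)}.
               (\<integral>\<^sup>+x. ennreal ((enorm d (grad (\<lambda>y. h t y - hstar d p0 w T t y) x))\<^sup>2)
                  \<partial>rho d p0 T t) \<partial>nu t0 t1)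
            \<le> ennreal (26 / \<delta>) *
               (ennreal ((1 + (t1 - t0)) / (t1 - t0)) * D_fun d p0 w T t0 t1 h
                + (N_fun d p0 T t0 t1 \<Psi> scl \<tau> h)\<^sup>2
                + ennreal (C0\<^sup>2 * \<tau>\<^sup>2)
                + (1 + (Lambda_star d p0 T t0 t1)\<^sup>2 + ennreal (1 / (t1 - t0)\<^sup>2)) * ennreal (eN\<^sup>2))"
    proof (intro ballI allI impI)
      fix h and \<tau> \<delta> :: real
      assume h: "h \<in> H" and \<delta>: "0 < \<delta>" "\<delta> < 1"
      have \<psi>: "wdiff t0 t1 hN h \<in> \<Psi>" using cl hN h by blast
      show "(\<integral>\<^sup>+t\<in>{t0 .. t1 - \<delta> * (t1 - t0)}.
               (\<integral>\<^sup>+x. ennreal ((enorm d (grad (\<lambda>y. h t y - hstar d p0 w T t y) x))\<^sup>2)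
                  \<partial>rho d p0 T t) \<partial>nu t0 t1)
            \<le> ennreal (26 / \<delta>) *
               (ennreal ((1 + (t1 - t0)) / (t1 - t0)) * D_fun d p0 w T t0 t1 h
                + (N_fun d p0 T t0 t1 \<Psi> scl \<tau> h)\<^sup>2
                + ennreal (C0\<^sup>2 * \<tau>\<^sup>2)
                + (1 + (Lambda_star d p0 T t0 t1)\<^sup>2 + ennreal (1 / (t1 - t0)\<^sup>2)) * ennreal (eN\<^sup>2))"
        by (rule ou_window.main_estimate[where scl=scl and ?C0.0=C0, OF win wt bspec[OF b hN] bspec[OF b h]
              V(1)[OF \<psi>] \<psi> V(2)[OF \<psi>] bspec[OF bspec[OF C0 hN] h] e \<delta>])
    qed
  next
    have t: "t0 < t1" using ou_window.t01[OF win] by simp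
    fix R :: real and \<Theta> \<kappa> and Ct :: real and N K :: nat and c1 c2 :: real and W L P0 :: nat and Lam Aa :: real
    assume \<Theta>: "is_Theta Bbar \<Theta>" and \<kappa>: "is_clip d R \<kappa>" and W: "d + 1 \<le> W" and Lam: "1 \<le> Lam"
    let ?H = "H_net d T Bbar t0 t1 R \<Theta> \<kappa> Ct W L Lam P0 Aa"
    show "\<forall>h\<in>?H. bounded_C12 d {t0..t1} (3 * Bbar) h"
      using H_net_props(1)[OF \<kappa> \<Theta> t] by blast
    show "\<forall>h\<in>?H. \<forall>h'\<in>?H. wdiff t0 t1 h h' \<in> Psi_net d T Bbar t0 t1 R \<Theta> \<kappa> Ct W L Lam P0 Aa \<and>
        cone_scale d T Bbar t0 t1 R \<Theta> \<kappa> Ct W L Lam P0 Aa (wdiff t0 t1 h h') \<le> 1"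
    proof (intro ballI conjI)
      fix h h' assume "h \<in> ?H" "h' \<in> ?H"
      then have c: "cone_rep d T Bbar t0 t1 R \<Theta> \<kappa> Ct W L Lam P0 Aa 1 (wdiff t0 t1 h h')"
        using W by (intro H_net_wdiff[OF \<kappa> \<Theta> t Lam]) auto
      then show "wdiff t0 t1 h h' \<in> Psi_net d T Bbar t0 t1 R \<Theta> \<kappa> Ct W L Lam P0 Aa"
        unfolding Psi_net_def by blast
      show "cone_scale d T Bbar t0 t1 R \<Theta> \<kappa> Ct W L Lam P0 Aa (wdiff t0 t1 h h') \<le> 1"
        unfolding cone_scale_def
      proof (rule cInf_lower)
        show "1 \<in> {\<bar>c\<bar> |c. cone_rep d T Bbar t0 t1 R \<Theta> \<kappa> Ct W L Lam P0 Aa c (wdiff t0 t1 h h')}"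
          using c by (auto intro!: exI[of _ 1])
      qed (auto intro!: bdd_belowI[of _ 0])
    qed
  }
qed

end
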